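(* Let $p$ be a prime, let $\mathcal U$ be a sufficiently saturated model of $\mathrm{DCF}_p$ (differentially closed fields of characteristic $p$ with one derivation $\partial$), and let $k\geqslant 1$ be an integer. Then the set $\{a\in\mathcal U\setminus\{0\}:\partial(a)=a^{p^k+1}\}$ is strongly minimal and strictly disintegrated; in particular it is geometrically trivial. Moreover, if $1\leqslant k<l$, then the set of non-zero solutions of $\partial(T)=T^{p^k+1}$ is orthogonal to the set of non-zero solutions of $\partial(T)=T^{p^l+1}$.
   Context: $\mathrm{DCF}_p$ is the model companion of the theory of differential fields of characteristic $p$ (fields with one derivation), in the language of differential rings; it is stable. A definable set $V$ is strictly disintegrated if its induced structure is that of a pure set, i.e., any two tuples of the same length consisting of pairwise distinct elements of $V$ have the same type over the parameters defining $V$. Orthogonality of the two sets refers to orthogonality of the (stationary) complete types over $\mathbb F_p$ isolated by them. *)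

theory Defs
  imports
    "HOL-Algebra.Ring"
    "HOL-Computational_Algebra.Primes"
    "HOL-Library.Infinite_Typeclass"
begin

unbundle cardinal_syntax

section \<open>Differential rings and fields\<close>

record 'u diff_ring = "'u ring" + der :: "'u \<Rightarrow> 'u"

locale differential_ring = cring R for R :: "'u diff_ring" (structure) +
  assumes der_closed: "x \<in> carrier R \<Longrightarrow> der R x \<in> carrier R"
    and der_add: "\<lbrakk>x \<in> carrier R; y \<in> carrier R\<rbrakk> \<Longrightarrow> der R (x \<oplus> y) = der R x \<oplus> der R y"
    and der_mult: "\<lbrakk>x \<in> carrier R; y \<in> carrier R\<rbrakk> \<Longrightarrow>
      der R (x \<otimes> y) = der R x \<otimes> y \<oplus> x \<otimes> der R y"

text \<open>For prime \<open>p\<close>, the equation \<open>p \<cdot> 1 = 0\<close> says that the field has characteristic \<open>p\<close>.\<close>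

definition differential_field :: "nat \<Rightarrow> 'u diff_ring \<Rightarrow> bool" where
  "differential_field p R \<longleftrightarrow>
     differential_ring R \<and> field R \<and> add_pow R p \<one>\<^bsub>R\<^esub> = \<zero>\<^bsub>R\<^esub>"

text \<open>In positive characteristic this is the prime subfield.\<close>

definition prime_subfield :: "'u diff_ring \<Rightarrow> 'u set" where
  "prime_subfield R = range (\<lambda>n::nat. add_pow R n \<one>\<^bsub>R\<^esub>)"

definition diff_embedding :: "('u \<Rightarrow> 'v) \<Rightarrow> 'u diff_ring \<Rightarrow> 'v diff_ring \<Rightarrow> bool" where
  "diff_embedding h M N \<longleftrightarrow>
     h \<in> ring_hom M N \<and> inj_on h (carrier M) \<and> (\<forall>x\<in>carrier M. h (der M x) = der N (h x))"

section \<open>First-order logic in the language of differential rings\<close>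

datatype tm = Var nat | Zero | One | Add tm tm | Neg tm | Mult tm tm | Der tm

datatype fm = FEq tm tm | FNot fm | FAnd fm fm | FEx nat fm

primrec eval :: "'u diff_ring \<Rightarrow> (nat \<Rightarrow> 'u) \<Rightarrow> tm \<Rightarrow> 'u" where
  "eval R e (Var i) = e i"
| "eval R e Zero = \<zero>\<^bsub>R\<^esub>"
| "eval R e One = \<one>\<^bsub>R\<^esub>"
| "eval R e (Add s t) = eval R e s \<oplus>\<^bsub>R\<^esub> eval R e t"
| "eval R e (Neg t) = \<ominus>\<^bsub>R\<^esub> eval R e t"
| "eval R e (Mult s t) = eval R e s \<otimes>\<^bsub>R\<^esub> eval R e t"
| "eval R e (Der t) = der R (eval R e t)"

primrec sat :: "'u diff_ring \<Rightarrow> (nat \<Rightarrow> 'u) \<Rightarrow> fm \<Rightarrow> bool" where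
  "sat R e (FEq s t) \<longleftrightarrow> eval R e s = eval R e t"
| "sat R e (FNot \<phi>) \<longleftrightarrow> \<not> sat R e \<phi>"
| "sat R e (FAnd \<phi> \<psi>) \<longleftrightarrow> sat R e \<phi> \<and> sat R e \<psi>"
| "sat R e (FEx i \<phi>) \<longleftrightarrow> (\<exists>x\<in>carrier R. sat R (e(i := x)) \<phi>)"

text \<open>Variable \<open>i\<close> is assigned the \<open>i\<close>-th list entry. Variables beyond the end of the list get
  the value \<open>0\<close>, which is named by a constant of the language, so no new relations become
  definable by this convention.\<close>

definition holds :: "'u diff_ring \<Rightarrow> fm \<Rightarrow> 'u list \<Rightarrow> bool" where
  "holds R \<phi> xs \<longleftrightarrow> sat R (\<lambda>i. if i < length xs then xs ! i else \<zero>\<^bsub>R\<^esub>) \<phi>"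

text \<open>A theory is a set of formulas, each read as its universal closure. Structures are
  differential rings throughout: every structure of the language that embeds in a differential
  field is one, so this is no restriction for the models of a model companion of differential
  fields.\<close>

definition is_model :: "'u diff_ring \<Rightarrow> fm set \<Rightarrow> bool" where
  "is_model M T \<longleftrightarrow>
     differential_ring M \<and> (\<forall>\<phi>\<in>T. \<forall>xs. set xs \<subseteq> carrier M \<longrightarrow> holds M \<phi> xs)"

definition elementary_embedding :: "('u \<Rightarrow> 'v) \<Rightarrow> 'u diff_ring \<Rightarrow> 'v diff_ring \<Rightarrow> bool" where
  "elementary_embedding h M N \<longleftrightarrow>
     diff_embedding h M N \<and>
     (\<forall>\<phi> xs. set xs \<subseteq> carrier M \<longrightarrow> (holds M \<phi> xs \<longleftrightarrow> holds N \<phi> (map h xs)))"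

text \<open>\<open>T\<close> is the model companion of the theory whose models are the structures in \<open>K\<close>. The
  structures range over all carriers inside the infinite type \<open>'u\<close>. As the language is countable,
  by the Loewenheim-Skolem theorem the notion does not depend on the choice of \<open>'u\<close>.\<close>

definition model_companion :: "fm set \<Rightarrow> ('u::infinite diff_ring \<Rightarrow> bool) \<Rightarrow> bool" where
  "model_companion T K \<longleftrightarrow>
     (\<forall>M::'u diff_ring. is_model M T \<longrightarrow> (\<exists>N h. K N \<and> diff_embedding h M N)) \<and>
     (\<forall>M::'u diff_ring. K M \<longrightarrow> (\<exists>N::'u diff_ring. \<exists>h. is_model N T \<and> diff_embedding h M N)) \<and>
     (\<forall>(M::'u diff_ring) (N::'u diff_ring) h. is_model M T \<longrightarrow> is_model N T \<longrightarrow>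
        diff_embedding h M N \<longrightarrow> elementary_embedding h M N)"

section \<open>Definable sets and types\<close>

text \<open>A pair \<open>(\<phi>, cs)\<close> stands for the formula \<open>\<phi>(x, cs)\<close> in the single variable \<open>x\<close> (variable
  number 0) with parameters \<open>cs\<close>.\<close>

type_synonym 'u pfm = "fm \<times> 'u list"

definition pfms :: "'u set \<Rightarrow> 'u pfm set" where
  "pfms A = {f. set (snd f) \<subseteq> A}"

definition sols :: "'u diff_ring \<Rightarrow> 'u pfm \<Rightarrow> 'u set" where
  "sols U f = {x \<in> carrier U. holds U (fst f) (x # snd f)}"

definition definable_over :: "'u diff_ring \<Rightarrow> 'u set \<Rightarrow> 'u set \<Rightarrow> bool" where
  "definable_over U A V \<longleftrightarrow> (\<exists>f\<in>pfms A. V = sols U f)"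

definition acl :: "'u diff_ring \<Rightarrow> 'u set \<Rightarrow> 'u set" where
  "acl U A = {x. \<exists>F. definable_over U A F \<and> finite F \<and> x \<in> F}"

definition same_type :: "'u diff_ring \<Rightarrow> 'u set \<Rightarrow> 'u list \<Rightarrow> 'u list \<Rightarrow> bool" where
  "same_type U A xs ys \<longleftrightarrow> length xs = length ys \<and>
     (\<forall>\<phi> cs. set cs \<subseteq> A \<longrightarrow> (holds U \<phi> (xs @ cs) \<longleftrightarrow> holds U \<phi> (ys @ cs)))"

definition tp :: "'u diff_ring \<Rightarrow> 'u set \<Rightarrow> 'u \<Rightarrow> 'u pfm set" where
  "tp U A a = {f \<in> pfms A. a \<in> sols U f}"

text \<open>Complete 1-types, as maximal sets of formulas over \<open>A\<close> that are finitely satisfiable in \<open>U\<close>;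
  they need not be realised in \<open>U\<close>.\<close>

definition complete_types :: "'u diff_ring \<Rightarrow> 'u set \<Rightarrow> 'u pfm set set" where
  "complete_types U A = {q. q \<subseteq> pfms A \<and>
     (\<forall>F\<subseteq>q. finite F \<longrightarrow> (\<exists>x\<in>carrier U. \<forall>f\<in>F. x \<in> sols U f)) \<and>
     (\<forall>(\<phi>, cs)\<in>pfms A. (\<phi>, cs) \<in> q \<or> (FNot \<phi>, cs) \<in> q)}"

text \<open>Sufficiently saturated means \<open>\<kappa>\<close>-saturated for an uncountable cardinal \<open>\<kappa>\<close>; the small
  parameter sets are then those of cardinality less than \<open>\<kappa>\<close>.\<close>

definition sufficiently_saturated :: "'k rel \<Rightarrow> 'u diff_ring \<Rightarrow> bool" where
  "sufficiently_saturated \<kappa> U \<longleftrightarrow> Card_order \<kappa> \<and> natLeq <o \<kappa> \<and>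
     (\<forall>A\<subseteq>carrier U. |A| <o \<kappa> \<longrightarrow>
       (\<forall>q\<in>complete_types U A. \<exists>x\<in>carrier U. \<forall>f\<in>q. x \<in> sols U f))"

section \<open>Strong minimality and the induced geometry\<close>

text \<open>Minimality is required in every elementary extension; by the Loewenheim-Skolem theorem it
  is enough to let the extension range over structures on the same type.\<close>

definition strongly_minimal :: "'u diff_ring \<Rightarrow> 'u set \<Rightarrow> 'u set \<Rightarrow> bool" where
  "strongly_minimal U A V \<longleftrightarrow> (\<exists>\<phi> cs. set cs \<subseteq> A \<and> V = sols U (\<phi>, cs) \<and>
     (\<forall>(N::'u diff_ring) h. differential_ring N \<longrightarrow> elementary_embedding h U N \<longrightarrow>
        infinite (sols N (\<phi>, map h cs)) \<and>
        (\<forall>f\<in>pfms (carrier N).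
           finite (sols N (\<phi>, map h cs) \<inter> sols N f) \<or> finite (sols N (\<phi>, map h cs) - sols N f))))"

definition strictly_disintegrated :: "'u diff_ring \<Rightarrow> 'u set \<Rightarrow> 'u set \<Rightarrow> bool" where
  "strictly_disintegrated U A V \<longleftrightarrow> definable_over U A V \<and>
     (\<forall>xs ys. set xs \<subseteq> V \<longrightarrow> set ys \<subseteq> V \<longrightarrow> distinct xs \<longrightarrow> distinct ys \<longrightarrow>
        length xs = length ys \<longrightarrow> same_type U A xs ys)"

definition geometrically_trivial :: "'u diff_ring \<Rightarrow> 'u set \<Rightarrow> 'u set \<Rightarrow> bool" where
  "geometrically_trivial U A V \<longleftrightarrow> definable_over U A V \<and>
     (\<forall>B\<subseteq>V. B \<noteq> {} \<longrightarrow> acl U (A \<union> B) \<inter> V = (\<Union>b\<in>B. acl U (A \<union> {b}) \<inter> V))"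

section \<open>Forking and orthogonality\<close>

text \<open>\<open>\<phi>(x, b)\<close> divides over \<open>A\<close> if there are realisations \<open>b\<^sub>0, b\<^sub>1, \<dots>\<close> of \<open>tp(b/A)\<close> such that the
  family of the \<open>\<phi>(x, b\<^sub>i)\<close> is \<open>k\<close>-inconsistent for some \<open>k\<close>. For small \<open>A\<close> it does not matter that
  the realisations are taken in \<open>U\<close>, as \<open>U\<close> is \<open>\<kappa>\<close>-saturated for an uncountable \<open>\<kappa>\<close>.\<close>

definition divides_over :: "'u diff_ring \<Rightarrow> 'u set \<Rightarrow> 'u pfm \<Rightarrow> bool" where
  "divides_over U A f \<longleftrightarrow> (\<exists>(k::nat) (bs :: nat \<Rightarrow> 'u list).
     (\<forall>i. set (bs i) \<subseteq> carrier U \<and> same_type U A (bs i) (snd f)) \<and>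
     (\<forall>I. finite I \<and> card I = k \<longrightarrow> (\<Inter>i\<in>I. sols U (fst f, bs i)) = {}))"

text \<open>A type forks over \<open>A\<close> if it implies a finite disjunction of formulas dividing over \<open>A\<close>; by
  compactness a finite part of the type then already does.\<close>

definition forks_over :: "'u diff_ring \<Rightarrow> 'u set \<Rightarrow> 'u pfm set \<Rightarrow> bool" where
  "forks_over U A q \<longleftrightarrow> (\<exists>F D. F \<subseteq> q \<and> finite F \<and> finite D \<and>
     (\<forall>d\<in>D. d \<in> pfms (carrier U) \<and> divides_over U A d) \<and>
     (\<forall>x\<in>carrier U. (\<forall>f\<in>F. x \<in> sols U f) \<longrightarrow> (\<exists>d\<in>D. x \<in> sols U d)))"

definition nonforking_extension ::
  "'u diff_ring \<Rightarrow> 'u set \<Rightarrow> 'u pfm set \<Rightarrow> 'u set \<Rightarrow> 'u pfm set \<Rightarrow> bool" where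
  "nonforking_extension U A q B r \<longleftrightarrow>
     r \<in> complete_types U B \<and> q \<subseteq> r \<and> \<not> forks_over U A r"

definition stationary :: "'k rel \<Rightarrow> 'u diff_ring \<Rightarrow> 'u set \<Rightarrow> 'u pfm set \<Rightarrow> bool" where
  "stationary \<kappa> U A q \<longleftrightarrow>
     (\<forall>B. A \<subseteq> B \<and> B \<subseteq> carrier U \<and> |B| <o \<kappa> \<longrightarrow> (\<exists>!r. nonforking_extension U A q B r))"

definition independent_over :: "'u diff_ring \<Rightarrow> 'u set \<Rightarrow> 'u \<Rightarrow> 'u \<Rightarrow> bool" where
  "independent_over U C a b \<longleftrightarrow> \<not> forks_over U C (tp U (insert b C) a)"

definition orthogonal_types ::
  "'k rel \<Rightarrow> 'u diff_ring \<Rightarrow> 'u set \<Rightarrow> 'u pfm set \<Rightarrow> 'u pfm set \<Rightarrow> bool" where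
  "orthogonal_types \<kappa> U A q r \<longleftrightarrow>
     (\<forall>C a b. A \<subseteq> C \<and> C \<subseteq> carrier U \<and> |C| <o \<kappa> \<and> a \<in> carrier U \<and> b \<in> carrier U \<and>
        nonforking_extension U A q C (tp U C a) \<and> nonforking_extension U A r C (tp U C b)
        \<longrightarrow> independent_over U C a b)"

definition isolates_type :: "'u diff_ring \<Rightarrow> 'u set \<Rightarrow> 'u set \<Rightarrow> 'u pfm set \<Rightarrow> bool" where
  "isolates_type U A V q \<longleftrightarrow>
     q \<in> complete_types U A \<and> (\<exists>f\<in>q. V = sols U f) \<and> (\<forall>f\<in>q. V \<subseteq> sols U f)"

definition orthogonal_sets ::
  "'k rel \<Rightarrow> 'u diff_ring \<Rightarrow> 'u set \<Rightarrow> 'u set \<Rightarrow> 'u set \<Rightarrow> bool" where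
  "orthogonal_sets \<kappa> U A V W \<longleftrightarrow>
     (\<exists>q r. isolates_type U A V q \<and> isolates_type U A W r \<and>
        stationary \<kappa> U A q \<and> stationary \<kappa> U A r \<and> orthogonal_types \<kappa> U A q r)"

section \<open>The equation\<close>

definition nonzero_solutions :: "nat \<Rightarrow> nat \<Rightarrow> 'u diff_ring \<Rightarrow> 'u set" where
  "nonzero_solutions p k U =
     {a \<in> carrier U - {\<zero>\<^bsub>U\<^esub>}. der U a = a [^]\<^bsub>U\<^esub> (p ^ k + 1)}"

end

theory Submission
  imports Defs "HOL-Algebra.Embedded_Algebras" "HOL-Decision_Procs.Commutative_Ring"
begin

text \<open>Put \<open>q = p\<^sup>k\<close>. A solution \<open>v\<close> of \<open>D v = v\<^bsup>q+1\<^esup>\<close> is an eigenvector of the derivation whose eigenvalue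
  \<open>v\<^sup>q\<close> is constant. Eigenvectors with distinct constant eigenvalues are linearly independent over the
  constants, so over a differential field \<open>K\<close> whose constants are \<open>p\<close>-th powers in \<open>K\<close> a solution \<open>v\<close> is
  transcendental as soon as \<open>v\<^sup>q\<close> avoids an additive monoid \<open>S\<close> that contains all constant eigenvalues of
  \<open>D\<close> on the compositum of \<open>K\<close> and the constants; then \<open>K(v)\<close> inherits this with \<open>S + \<nat> v\<^sup>q\<close> in place
  of \<open>S\<close>. Starting from the prime field, \<open>S\<close> is the span of the \<open>q\<close>-th powers of the solutions
  adjoined so far, and such a combination is \<open>v\<^sup>q\<close> only if \<open>v\<close> is one of them. If \<open>K\<close> is
  algebraically closed in the model-theoretic sense, the finitely many eigenvalues occurring in a
  finite-dimensional space show that \<open>S = K\<close> will do.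

  An isomorphism between two such fields is elementary by model completeness, because
  two models can be amalgamated over a separable embedding: the tensor product acts faithfully on
  semilinear maps, so it is reduced and maps to a differential field. Hence tuples of distinct solutions have
  the same type, solutions outside \<open>acl C\<close> have the same type over \<open>C\<close>, and the statements follow.
  For orthogonality, a relation \<open>a\<^bsup>p^k\<^esup> = s + n b\<^bsup>p^l\<^esup>\<close> with \<open>k < l\<close> makes \<open>a\<close> the sum of an algebraic
  element and a constant, so that \<open>D a\<close>, and with it \<open>a\<close>, is algebraic.\<close>

section \<open>Derivations on reduced rings\<close>

text \<open>The model companion is given only through embeddings, without axioms. So what is known
  of \<open>U\<close> must come from explicit extensions built on the same type \<open>'u\<close>
  and pulled back by model completeness. This is why tensor products and polynomial rings appear as
  rings of operators on functions: no quotient is formed until a prime differential ideal is divided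
  out, and finite lists suffice to code the result. The obstacle peculiar to characteristic
  \<open>p\<close> is that an isomorphism of differential subfields need not be elementary: a
  constant of the subfield has a \<open>p\<close>-th root in \<open>U\<close>, and if the root lies
  outside the subfield, the isomorphism does not control its derivative. Hence the subfields in use
  are \<open>good\<close>, which makes \<open>U\<close> separable over them. Adjoining a solution
  must preserve this, and the condition on eigenvalues serves that end as well as transcendence. The
  exponent enters through \<open>k \<ge> 1\<close>, which makes \<open>v^(p^k)\<close> a
  \<open>p\<close>-th power.\<close>

text \<open>The identities between ring terms below are checked by reflection: the normal forms of both sides agree.\<close>

lemma ring_norm_1:
  "norm (polex.Sub (polex.Mul (polex.Sub (polex.Mul (polex.Var 0) (polex.Var 1)) (polex.Mul (polex.Var 2) (polex.Var 3))) (polex.Mul (polex.Var 4) (polex.Var 4))) (polex.Mul (polex.Sub (polex.Mul (polex.Var 5) (polex.Var 4)) (polex.Mul (polex.Var 6) (polex.Var 7))) (polex.Mul (polex.Var 1) (polex.Var 1)))) =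
    norm (polex.Sub (polex.Mul (polex.Mul (polex.Var 4) (polex.Var 1)) (polex.Sub (polex.Add (polex.Mul (polex.Var 0) (polex.Var 4)) (polex.Mul (polex.Var 2) (polex.Var 7))) (polex.Add (polex.Mul (polex.Var 5) (polex.Var 1)) (polex.Mul (polex.Var 6) (polex.Var 3))))) (polex.Mul (polex.Add (polex.Mul (polex.Var 7) (polex.Var 1)) (polex.Mul (polex.Var 3) (polex.Var 4))) (polex.Sub (polex.Mul (polex.Var 2) (polex.Var 4)) (polex.Mul (polex.Var 6) (polex.Var 1)))))"
  by code_simp

lemma ring_norm_2:
  "norm (polex.Sub (polex.Mul (polex.Add (polex.Mul (polex.Var 0) (polex.Var 1)) (polex.Mul (polex.Var 2) (polex.Var 3))) (polex.Mul (polex.Var 4) (polex.Var 5))) (polex.Mul (polex.Add (polex.Mul (polex.Var 6) (polex.Var 5)) (polex.Mul (polex.Var 7) (polex.Var 4))) (polex.Mul (polex.Var 3) (polex.Var 1)))) =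
    norm (polex.Add (polex.Mul (polex.Mul (polex.Var 5) (polex.Var 1)) (polex.Sub (polex.Mul (polex.Var 0) (polex.Var 4)) (polex.Mul (polex.Var 6) (polex.Var 3)))) (polex.Mul (polex.Mul (polex.Var 4) (polex.Var 3)) (polex.Sub (polex.Mul (polex.Var 2) (polex.Var 5)) (polex.Mul (polex.Var 7) (polex.Var 1)))))"
  by code_simp

lemma ring_norm_3:
  "norm (polex.Sub (polex.Mul (polex.Mul (polex.Var 0) (polex.Var 1)) (polex.Mul (polex.Var 2) (polex.Var 3))) (polex.Mul (polex.Mul (polex.Var 4) (polex.Var 5)) (polex.Mul (polex.Var 6) (polex.Var 7)))) =
    norm (polex.Add (polex.Mul (polex.Mul (polex.Var 1) (polex.Var 3)) (polex.Sub (polex.Mul (polex.Var 0) (polex.Var 2)) (polex.Mul (polex.Var 4) (polex.Var 6)))) (polex.Mul (polex.Mul (polex.Var 4) (polex.Var 6)) (polex.Sub (polex.Mul (polex.Var 1) (polex.Var 3)) (polex.Mul (polex.Var 5) (polex.Var 7)))))"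
  by code_simp

lemma ring_norm_4:
  "norm (polex.Add (polex.Mul (polex.Add (polex.Mul (polex.Var 0) (polex.Var 1)) (polex.Mul (polex.Var 2) (polex.Var 3))) (polex.Var 4)) (polex.Mul (polex.Var 5) (polex.Mul (polex.Var 3) (polex.Var 1)))) =
    norm (polex.Add (polex.Mul (polex.Var 0) (polex.Mul (polex.Var 1) (polex.Var 4))) (polex.Mul (polex.Add (polex.Mul (polex.Var 2) (polex.Var 4)) (polex.Mul (polex.Var 5) (polex.Var 1))) (polex.Var 3)))"
  by code_simp

lemma ring_norm_5:
  "norm (polex.Mul (polex.Mul (polex.Add (polex.Mul (polex.Var 0) (polex.Var 1)) (polex.Mul (polex.Var 2) (polex.Var 3))) (polex.Var 4)) (polex.Mul (polex.Mul (polex.Var 3) (polex.Var 5)) (polex.Mul (polex.Var 1) (polex.Var 5)))) =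
    norm (polex.Mul (polex.Add (polex.Mul (polex.Mul (polex.Var 0) (polex.Var 4)) (polex.Mul (polex.Var 1) (polex.Var 5))) (polex.Mul (polex.Mul (polex.Var 2) (polex.Var 4)) (polex.Mul (polex.Var 3) (polex.Var 5)))) (polex.Mul (polex.Mul (polex.Var 3) (polex.Var 1)) (polex.Var 5)))"
  by code_simp

lemma ring_norm_6:
  "norm (polex.Mul (polex.Sub (polex.Mul (polex.Add (polex.Mul (polex.Var 0) (polex.Var 1)) (polex.Mul (polex.Var 2) (polex.Var 3))) (polex.Mul (polex.Var 4) (polex.Var 5))) (polex.Mul (polex.Mul (polex.Var 2) (polex.Var 1)) (polex.Add (polex.Mul (polex.Var 6) (polex.Var 5)) (polex.Mul (polex.Var 4) (polex.Var 7))))) (polex.Mul (polex.Mul (polex.Mul (polex.Var 4) (polex.Var 4)) (polex.Var 5)) (polex.Mul (polex.Var 4) (polex.Mul (polex.Var 5) (polex.Var 5))))) =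
    norm (polex.Mul (polex.Add (polex.Mul (polex.Mul (polex.Sub (polex.Mul (polex.Var 0) (polex.Var 4)) (polex.Mul (polex.Var 2) (polex.Var 6))) (polex.Var 1)) (polex.Mul (polex.Var 4) (polex.Mul (polex.Var 5) (polex.Var 5)))) (polex.Mul (polex.Mul (polex.Var 2) (polex.Sub (polex.Mul (polex.Var 3) (polex.Var 5)) (polex.Mul (polex.Var 1) (polex.Var 7)))) (polex.Mul (polex.Mul (polex.Var 4) (polex.Var 4)) (polex.Var 5)))) (polex.Mul (polex.Mul (polex.Var 4) (polex.Var 5)) (polex.Mul (polex.Var 4) (polex.Var 5))))"
  by code_simp

lemma ring_norm_7:
  "norm (polex.Mul (polex.Sub (polex.Mul (polex.Add (polex.Add (polex.Mul (polex.Var 0) (polex.Var 1)) (polex.Mul (polex.Var 2) (polex.Var 3))) (polex.Add (polex.Mul (polex.Var 4) (polex.Var 5)) (polex.Mul (polex.Var 6) (polex.Var 7)))) (polex.Mul (polex.Var 5) (polex.Var 1))) (polex.Mul (polex.Add (polex.Mul (polex.Var 2) (polex.Var 1)) (polex.Mul (polex.Var 6) (polex.Var 5))) (polex.Add (polex.Mul (polex.Var 7) (polex.Var 1)) (polex.Mul (polex.Var 5) (polex.Var 3))))) (polex.Mul (polex.Mul (polex.Var 5) (polex.Var 5)) (polex.Mul (polex.Var 1) (polex.Var 1)))) =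
    norm (polex.Mul (polex.Add (polex.Mul (polex.Sub (polex.Mul (polex.Var 0) (polex.Var 5)) (polex.Mul (polex.Var 2) (polex.Var 7))) (polex.Mul (polex.Var 1) (polex.Var 1))) (polex.Mul (polex.Sub (polex.Mul (polex.Var 4) (polex.Var 1)) (polex.Mul (polex.Var 6) (polex.Var 3))) (polex.Mul (polex.Var 5) (polex.Var 5)))) (polex.Mul (polex.Mul (polex.Var 5) (polex.Var 1)) (polex.Mul (polex.Var 5) (polex.Var 1))))"
  by code_simp

lemma ring_norm_8:
  "norm (polex.Mul (polex.Var 0) (polex.Sub (polex.Mul (polex.Var 1) (polex.Var 2)) (polex.Mul (polex.Var 3) (polex.Var 4)))) =
    norm (polex.Add (polex.Mul (polex.Var 2) (polex.Sub (polex.Mul (polex.Var 1) (polex.Var 0)) (polex.Mul (polex.Var 5) (polex.Var 4)))) (polex.Mul (polex.Var 4) (polex.Sub (polex.Mul (polex.Var 5) (polex.Var 2)) (polex.Mul (polex.Var 3) (polex.Var 0)))))"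
  by code_simp

lemma ring_norm_9:
  "norm (polex.Sub (polex.Add (polex.Mul (polex.Var 0) (polex.Var 1)) (polex.Mul (polex.Var 2) (polex.Var 3))) (polex.Add (polex.Mul (polex.Var 0) (polex.Var 1)) (polex.Mul (polex.Var 2) (polex.Var 4)))) =
    norm (polex.Mul (polex.Var 2) (polex.Sub (polex.Var 3) (polex.Var 4)))"
  by code_simp

lemma ring_norm_10:
  "norm (polex.Sub (polex.Add (polex.Mul (polex.Var 0) (polex.Var 1)) (polex.Mul (polex.Var 2) (polex.Var 3))) (polex.Mul (polex.Var 2) (polex.Var 4))) =
    norm (polex.Add (polex.Add (polex.Mul (polex.Var 0) (polex.Var 1)) (polex.Mul (polex.Var 2) (polex.Var 5))) (polex.Mul (polex.Var 2) (polex.Sub (polex.Var 3) (polex.Add (polex.Var 5) (polex.Var 4)))))"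
  by code_simp

lemma ring_norm_11:
  "norm (polex.Sub (polex.Sub (polex.Var 0) (polex.Mul (polex.Var 1) (polex.Var 2))) (polex.Sub (polex.Var 0) (polex.Mul (polex.Var 3) (polex.Var 2)))) =
    norm (polex.Mul (polex.Sub (polex.Var 3) (polex.Var 1)) (polex.Var 2))"
  by code_simp

lemma ring_norm_12:
  "norm (polex.Mul (polex.Add (polex.Add (polex.Var 0) (polex.Mul (polex.Var 1) (polex.Var 2))) (polex.Mul (polex.Mul (polex.Var 2) (polex.Var 2)) (polex.Var 3))) (polex.Add (polex.Var 4) (polex.Var 2))) =
    norm (polex.Add (polex.Add (polex.Mul (polex.Var 0) (polex.Var 4)) (polex.Mul (polex.Add (polex.Mul (polex.Var 1) (polex.Var 4)) (polex.Var 0)) (polex.Var 2))) (polex.Mul (polex.Mul (polex.Var 2) (polex.Var 2)) (polex.Add (polex.Var 1) (polex.Mul (polex.Var 3) (polex.Add (polex.Var 4) (polex.Var 2))))))"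
  by code_simp

lemma ring_norm_13:
  "norm (polex.Add (polex.Add (polex.Add (polex.Var 0) (polex.Mul (polex.Var 1) (polex.Var 2))) (polex.Mul (polex.Mul (polex.Var 2) (polex.Var 2)) (polex.Var 3))) (polex.Mul (polex.Var 4) (polex.Add (polex.Add (polex.Var 5) (polex.Mul (polex.Var 6) (polex.Var 2))) (polex.Mul (polex.Mul (polex.Var 2) (polex.Var 2)) (polex.Var 7))))) =
    norm (polex.Add (polex.Add (polex.Add (polex.Var 0) (polex.Mul (polex.Var 4) (polex.Var 5))) (polex.Mul (polex.Add (polex.Var 1) (polex.Mul (polex.Var 4) (polex.Var 6))) (polex.Var 2))) (polex.Mul (polex.Mul (polex.Var 2) (polex.Var 2)) (polex.Add (polex.Var 3) (polex.Mul (polex.Var 4) (polex.Var 7)))))"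
  by code_simp

lemma ring_norm_14:
  "norm (polex.Mul (polex.Var 0) (polex.Add (polex.Mul (polex.Var 1) (polex.Var 2)) (polex.Mul (polex.Mul (polex.Var 2) (polex.Var 2)) (polex.Var 3)))) =
    norm (polex.Sub (polex.Mul (polex.Mul (polex.Var 0) (polex.Var 1)) (polex.Var 2)) (polex.Mul (polex.Var 2) (polex.Mul (polex.Var 2) (polex.Neg (polex.Mul (polex.Var 0) (polex.Var 3))))))"
  by code_simp

lemma ring_norm_15:
  "norm (polex.Var 0) =
    norm (polex.Add (polex.Var 1) (polex.Sub (polex.Var 0) (polex.Var 1)))"
  by code_simp

lemma ring_norm_16:
  "norm (polex.Sub (polex.Add (polex.Mul (polex.Var 0) (polex.Var 1)) (polex.Mul (polex.Var 2) (polex.Var 3))) (polex.Mul (polex.Var 4) (polex.Mul (polex.Var 2) (polex.Var 5)))) =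
    norm (polex.Add (polex.Add (polex.Mul (polex.Var 0) (polex.Var 1)) (polex.Mul (polex.Mul (polex.Var 6) (polex.Var 2)) (polex.Var 5))) (polex.Mul (polex.Var 2) (polex.Sub (polex.Var 3) (polex.Mul (polex.Add (polex.Var 4) (polex.Var 6)) (polex.Var 5)))))"
  by code_simp

lemma ring_norm_17:
  "norm (polex.Mul (polex.Var 0) (polex.Add (polex.Mul (polex.Var 1) (polex.Var 0)) (polex.Mul (polex.Var 2) (polex.Var 3)))) =
    norm (polex.Add (polex.Mul (polex.Var 1) (polex.Mul (polex.Var 0) (polex.Var 0))) (polex.Mul (polex.Mul (polex.Var 0) (polex.Var 2)) (polex.Var 3)))"
  by code_simp

lemma ring_norm_18:
  "norm (polex.Mul (polex.Sub (polex.Var 0) (polex.Mul (polex.Sub (polex.Var 1) (polex.Var 2)) (polex.Var 3))) (polex.Var 4)) =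
    norm (polex.Add (polex.Add (polex.Mul (polex.Var 0) (polex.Var 4)) (polex.Mul (polex.Var 3) (polex.Mul (polex.Var 2) (polex.Var 4)))) (polex.Mul (polex.Neg (polex.Var 1)) (polex.Mul (polex.Var 3) (polex.Var 4))))"
  by code_simp

lemma ring_norm_19:
  "norm (polex.Mul (polex.Add (polex.Mul (polex.Var 0) (polex.Var 1)) (polex.Mul (polex.Var 2) (polex.Var 3))) (polex.Mul (polex.Var 4) (polex.Var 5))) =
    norm (polex.Add (polex.Mul (polex.Mul (polex.Var 0) (polex.Mul (polex.Var 1) (polex.Var 4))) (polex.Var 5)) (polex.Mul (polex.Mul (polex.Var 2) (polex.Mul (polex.Var 3) (polex.Var 5))) (polex.Var 4)))"
  by code_simp

lemma ring_norm_20: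
  "norm (polex.Mul (polex.Mul (polex.Mul (polex.Var 0) (polex.Var 1)) (polex.Mul (polex.Var 2) (polex.Var 3))) (polex.Mul (polex.Var 4) (polex.Var 5))) =
    norm (polex.Mul (polex.Mul (polex.Var 0) (polex.Mul (polex.Var 1) (polex.Var 4))) (polex.Mul (polex.Var 2) (polex.Mul (polex.Var 3) (polex.Var 5))))"
  by code_simp

lemma ring_norm_21:
  "norm (polex.Mul (polex.Var 0) (polex.Mul (polex.Var 1) (polex.Var 1))) =
    norm (polex.Sub (polex.Mul (polex.Add (polex.Mul (polex.Var 0) (polex.Var 1)) (polex.Mul (polex.Var 2) (polex.Var 3))) (polex.Var 1)) (polex.Mul (polex.Mul (polex.Var 2) (polex.Var 1)) (polex.Var 3)))"
  by code_simp

lemma ring_norm_22: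
  "norm (polex.Add (polex.Mul (polex.Mul (polex.Var 0) (polex.Var 1)) (polex.Var 2)) (polex.Mul (polex.Var 1) (polex.Mul (polex.Var 3) (polex.Var 2)))) =
    norm (polex.Mul (polex.Add (polex.Var 0) (polex.Var 3)) (polex.Mul (polex.Var 1) (polex.Var 2)))"
  by code_simp

lemma ring_norm_23:
  "norm (polex.Add (polex.Sub (polex.Mul (polex.Var 0) (polex.Var 1)) (polex.Var 2)) (polex.Add (polex.Mul (polex.Mul (polex.Var 0) (polex.Var 3)) (polex.Var 4)) (polex.Add (polex.Mul (polex.Mul (polex.Var 3) (polex.Var 1)) (polex.Var 5)) (polex.Mul (polex.Sub (polex.Mul (polex.Var 3) (polex.Var 3)) (polex.Var 3)) (polex.Mul (polex.Var 5) (polex.Var 4)))))) =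
    norm (polex.Sub (polex.Mul (polex.Add (polex.Mul (polex.Var 3) (polex.Var 5)) (polex.Var 0)) (polex.Add (polex.Mul (polex.Var 3) (polex.Var 4)) (polex.Var 1))) (polex.Add (polex.Mul (polex.Var 3) (polex.Mul (polex.Var 5) (polex.Var 4))) (polex.Var 2)))"
  by code_simp

section \<open>Identities and the Frobenius map in commutative rings\<close>

lemma (in ring) eq_of_minus:
  assumes "a \<ominus> b = \<zero>" "a \<in> carrier R" "b \<in> carrier R"
  shows "a = b"
  using assms by (simp add: r_right_minus_eq)
context cring
begin

text \<open>Read \<open>a\<close>, \<open>b\<close>, \<open>a'\<close>, \<open>b'\<close> as the
  derivatives of \<open>x\<close>, \<open>s\<close>, \<open>x'\<close>, \<open>s'\<close>. The
  right-hand side combines \<open>x' s - x s'\<close> with its own derivative, so the quotient rule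
  respects equality of fractions modulo a differential ideal. The next two identities do the same
  for sums and products.\<close>

lemma frac_der_identity:
  assumes "x \<in> carrier R" "s \<in> carrier R" "x' \<in> carrier R" "s' \<in> carrier R"
    "a \<in> carrier R" "b \<in> carrier R" "a' \<in> carrier R" "b' \<in> carrier R"
  shows "(a' \<otimes> s' \<ominus> x' \<otimes> b') \<otimes> (s \<otimes> s) \<ominus> (a \<otimes> s \<ominus> x \<otimes> b) \<otimes> (s' \<otimes> s')
      = (s \<otimes> s') \<otimes> ((a' \<otimes> s \<oplus> x' \<otimes> b) \<ominus> (a \<otimes> s' \<oplus> x \<otimes> b'))
        \<ominus> (b \<otimes> s' \<oplus> b' \<otimes> s) \<otimes> (x' \<otimes> s \<ominus> x \<otimes> s')"
  by (use in_carrier_Cons in_carrier_Nil norm_eq[OF _ ring_norm_1, of "[a', s', x', b', s, a, x, b]"] assms in simp)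
lemma frac_add_identity:
  assumes "x \<in> carrier R" "s \<in> carrier R" "x' \<in> carrier R" "s' \<in> carrier R"
    "y \<in> carrier R" "t \<in> carrier R" "y' \<in> carrier R" "t' \<in> carrier R"
  shows "(x' \<otimes> t' \<oplus> y' \<otimes> s') \<otimes> (s \<otimes> t) \<ominus> (x \<otimes> t \<oplus> y \<otimes> s) \<otimes> (s' \<otimes> t')
     = (t \<otimes> t') \<otimes> (x' \<otimes> s \<ominus> x \<otimes> s') \<oplus> (s \<otimes> s') \<otimes> (y' \<otimes> t \<ominus> y \<otimes> t')"
  by (use in_carrier_Cons in_carrier_Nil norm_eq[OF _ ring_norm_2, of "[x', t', y', s', s, t, x, y]"] assms in simp)
lemma frac_mult_identity:
  assumes "x \<in> carrier R" "s \<in> carrier R" "x' \<in> carrier R" "s' \<in> carrier R"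
    "y \<in> carrier R" "t \<in> carrier R" "y' \<in> carrier R" "t' \<in> carrier R"
  shows "(x' \<otimes> y') \<otimes> (s \<otimes> t) \<ominus> (x \<otimes> y) \<otimes> (s' \<otimes> t')
     = (y' \<otimes> t) \<otimes> (x' \<otimes> s \<ominus> x \<otimes> s') \<oplus> (x \<otimes> s') \<otimes> (y' \<otimes> t \<ominus> y \<otimes> t')"
  by (use in_carrier_Cons in_carrier_Nil norm_eq[OF _ ring_norm_3, of "[x', y', s, t, x, y, s', t']"] assms in simp)

lemma add_pow_nat_mult:
  assumes "x \<in> carrier R"
  shows "[(n::nat)] \<cdot> x = ([n] \<cdot> \<one>) \<otimes> x"
  using add_pow_ldistr[of \<one> x n] assms by simp

lemma binomial_theorem:
  assumes x: "x \<in> carrier R" and y: "y \<in> carrier R"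
  shows "(x \<oplus> y) [^] (n::nat) = (\<Oplus>k\<in>{..n}. [(n choose k)] \<cdot> (x [^] k \<otimes> y [^] (n - k)))"
proof (induction n)
  case 0
  then show ?case using x y by simp
next
  case (Suc n)
  let ?A = "\<Oplus>k\<in>{..n}. [(n choose k)] \<cdot> (x [^] k \<otimes> y [^] (n - k))"
  have A: "?A \<in> carrier R" using x y by (intro finsum_closed) auto
  have Ax: "?A \<otimes> x = (\<Oplus>k\<in>{..n}. [(n choose k)] \<cdot> (x [^] (Suc k) \<otimes> y [^] (n - k)))"
  proof -
    have "?A \<otimes> x = (\<Oplus>k\<in>{..n}. ([(n choose k)] \<cdot> (x [^] k \<otimes> y [^] (n - k))) \<otimes> x)"
      using x y by (intro finsum_ldistr) auto
    also have "\<dots> = (\<Oplus>k\<in>{..n}. [(n choose k)] \<cdot> (x [^] (Suc k) \<otimes> y [^] (n - k)))"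
      using x y by (intro finsum_cong') (auto simp: add_pow_ldistr add_pow_rdistr m_ac)
    finally show ?thesis .
  qed
  have Ay: "?A \<otimes> y = (\<Oplus>k\<in>{..Suc n}. [(n choose k)] \<cdot> (x [^] k \<otimes> y [^] (Suc n - k)))"
  proof -
    have "?A \<otimes> y = (\<Oplus>k\<in>{..n}. ([(n choose k)] \<cdot> (x [^] k \<otimes> y [^] (n - k))) \<otimes> y)"
      using x y by (intro finsum_ldistr) auto
    also have "\<dots> = (\<Oplus>k\<in>{..n}. [(n choose k)] \<cdot> (x [^] k \<otimes> y [^] (Suc n - k)))"
      using x y by (intro finsum_cong') (auto simp: add_pow_ldistr add_pow_rdistr m_ac Suc_diff_le)
    also have "\<dots> = (\<Oplus>k\<in>{..Suc n}. [(n choose k)] \<cdot> (x [^] k \<otimes> y [^] (Suc n - k)))"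
      using x y by (subst finsum_Suc) (auto simp: binomial_eq_0)
    finally show ?thesis .
  qed
  have "(\<Oplus>k\<in>{..Suc n}. [(Suc n choose k)] \<cdot> (x [^] k \<otimes> y [^] (Suc n - k)))
      = (\<Oplus>k\<in>{..n}. [(Suc n choose Suc k)] \<cdot> (x [^] Suc k \<otimes> y [^] (n - k))) \<oplus> y [^] Suc n"
    using x y by (subst finsum_Suc2) auto
  also have "(\<Oplus>k\<in>{..n}. [(Suc n choose Suc k)] \<cdot> (x [^] Suc k \<otimes> y [^] (n - k)))
     = (\<Oplus>k\<in>{..n}. [(n choose k)] \<cdot> (x [^] Suc k \<otimes> y [^] (n - k)) \<oplus> [(n choose Suc k)] \<cdot> (x [^] Suc k \<otimes> y [^] (n - k)))"
    using x y by (intro finsum_cong') (auto simp del: nat_pow_Suc simp add: add.nat_pow_mult)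
  also have "\<dots> = ?A \<otimes> x \<oplus> (\<Oplus>k\<in>{..n}. [(n choose Suc k)] \<cdot> (x [^] Suc k \<otimes> y [^] (n - k)))"
    unfolding Ax using x y by (intro finsum_addf) auto
  also have "\<dots> \<oplus> y [^] Suc n = ?A \<otimes> x \<oplus> ((\<Oplus>k\<in>{..n}. [(n choose Suc k)] \<cdot> (x [^] Suc k \<otimes> y [^] (n - k))) \<oplus> y [^] Suc n)"
    using x y A by (intro a_assoc) auto
  also have "(\<Oplus>k\<in>{..n}. [(n choose Suc k)] \<cdot> (x [^] Suc k \<otimes> y [^] (n - k))) \<oplus> y [^] Suc n = ?A \<otimes> y"
    unfolding Ay using x y by (subst finsum_Suc2) auto
  also have "?A \<otimes> x \<oplus> ?A \<otimes> y = (x \<oplus> y) [^] Suc n"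
    using x y A Suc by (simp add: r_distr)
  finally show ?case by simp
qed

text \<open>Stated for commutative rings and not only for fields, since it is applied to operator
  rings in order to prove that they are reduced.\<close>

lemma freshmans_dream:
  assumes p: "prime (p::nat)" and ch: "[p] \<cdot> \<one> = \<zero>" and x: "x \<in> carrier R" and y: "y \<in> carrier R"
  shows "(x \<oplus> y) [^] p = x [^] p \<oplus> y [^] p"
proof -
  obtain n where n: "p = Suc n" "n > 0" using p prime_gt_1_nat[of p] by (cases p) auto
  have van: "[(p choose k)] \<cdot> (x [^] k \<otimes> y [^] (p - k)) = \<zero>" if "0 < k" "k < p" for k
  proof -
    have "p dvd p choose k" using dvd_choose_prime[of k p] p that by auto
    then obtain m where "p choose k = p * m" by (elim dvdE)
    then have "[(p choose k)] \<cdot> (x [^] k \<otimes> y [^] (p - k)) = [m] \<cdot> ([p] \<cdot> (x [^] k \<otimes> y [^] (p - k)))"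
      using x y by (simp add: add.nat_pow_pow mult.commute)
    also have "[p] \<cdot> (x [^] k \<otimes> y [^] (p - k)) = \<zero>"
      using x y ch by (subst add_pow_nat_mult) auto
    finally show ?thesis by simp
  qed
  have "(x \<oplus> y) [^] p = (\<Oplus>k\<in>{..p}. [(p choose k)] \<cdot> (x [^] k \<otimes> y [^] (p - k)))"
    by (rule binomial_theorem[OF x y])
  also have "\<dots> = [(p choose p)] \<cdot> (x [^] p \<otimes> y [^] (p - p)) \<oplus> (\<Oplus>k\<in>{..n}. [(p choose k)] \<cdot> (x [^] k \<otimes> y [^] (p - k)))"
    unfolding n(1) using x y by (subst finsum_Suc) auto
  also have "(\<Oplus>k\<in>{..n}. [(p choose k)] \<cdot> (x [^] k \<otimes> y [^] (p - k))) = (\<Oplus>k\<in>{..n}. if k = 0 then y [^] p else \<zero>)"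
    using x y van n(1) by (intro finsum_cong') auto
  also have "\<dots> = y [^] p"
    using add.finprod_singleton[of 0 "{..n}" "\<lambda>_. y [^] p"] y by (simp add: eq_commute)
  finally show ?thesis using x y by simp
qed

lemma freshmans_dream_pow:
  assumes p: "prime (p::nat)" and ch: "[p] \<cdot> \<one> = \<zero>" and x: "x \<in> carrier R" and y: "y \<in> carrier R"
  shows "(x \<oplus> y) [^] (p ^ k) = x [^] (p ^ k) \<oplus> y [^] (p ^ k)"
proof (induction k)
  case (Suc k)
  then have "(x \<oplus> y) [^] (p ^ Suc k) = (x [^] (p ^ k) \<oplus> y [^] (p ^ k)) [^] p"
    using x y by (metis a_closed nat_pow_pow power_Suc2)
  then show ?case using x y freshmans_dream[OF p ch] by (simp add: nat_pow_pow mult.commute)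
qed (use x y in simp)

end

section \<open>Radical and prime differential ideals\<close>

locale derivation_ring = cring +
  fixes d :: "'a \<Rightarrow> 'a"
  assumes d_closed [simp, intro]: "x \<in> carrier R \<Longrightarrow> d x \<in> carrier R"
    and d_add: "\<lbrakk>x \<in> carrier R; y \<in> carrier R\<rbrakk> \<Longrightarrow> d (x \<oplus> y) = d x \<oplus> d y"
    and d_mult: "\<lbrakk>x \<in> carrier R; y \<in> carrier R\<rbrakk> \<Longrightarrow> d (x \<otimes> y) = d x \<otimes> y \<oplus> x \<otimes> d y"
begin

lemma d_zero [simp]: "d \<zero> = \<zero>"
  using d_add[of \<zero> \<zero>] by (simp add: local.add.r_cancel_one')

lemma d_one [simp]: "d \<one> = \<zero>"
  using d_mult[of \<one> \<one>] by (simp add: local.add.r_cancel_one')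

lemma d_minus: "x \<in> carrier R \<Longrightarrow> d (\<ominus> x) = \<ominus> d x"
  using d_add[of x "\<ominus> x"] by (metis a_inv_closed d_closed d_zero minus_equality r_neg a_comm)

lemma d_diff: "\<lbrakk>x \<in> carrier R; y \<in> carrier R\<rbrakk> \<Longrightarrow> d (x \<ominus> y) = d x \<ominus> d y"
  by (simp add: a_minus_def d_add d_minus)

text \<open>Only squares are tested for radicality; for differential ideals this suffices below.\<close>

definition rdi :: "'a set \<Rightarrow> bool" where
  "rdi J \<longleftrightarrow> J \<subseteq> carrier R \<and> \<zero> \<in> J \<and> (\<forall>a\<in>J. \<forall>b\<in>J. a \<oplus> b \<in> J) \<and>
     (\<forall>a\<in>J. \<forall>x\<in>carrier R. x \<otimes> a \<in> J) \<and> (\<forall>a\<in>J. d a \<in> J) \<and>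
     (\<forall>x\<in>carrier R. x \<otimes> x \<in> J \<longrightarrow> x \<in> J)"

lemma rdiD:
  assumes "rdi J"
  shows rdi_sub: "a \<in> J \<Longrightarrow> a \<in> carrier R"
    and rdi_zero: "\<zero> \<in> J"
    and rdi_add: "\<lbrakk>a \<in> J; b \<in> J\<rbrakk> \<Longrightarrow> a \<oplus> b \<in> J"
    and rdi_mult: "\<lbrakk>b \<in> J; a \<in> carrier R\<rbrakk> \<Longrightarrow> a \<otimes> b \<in> J"
    and rdi_der: "a \<in> J \<Longrightarrow> d a \<in> J"
    and rdi_sqrt: "\<lbrakk>a \<otimes> a \<in> J; a \<in> carrier R\<rbrakk> \<Longrightarrow> a \<in> J"
  using assms unfolding rdi_def by blast+

text \<open>For closure under \<open>d\<close>, note that the square of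
  \<open>a \<otimes> d x\<close> equals \<open>(a \<otimes> d x) \<otimes> d (a \<otimes> x)\<close>
  minus \<open>(d a \<otimes> d x) \<otimes> (a \<otimes> x)\<close>. Both terms lie in
  \<open>J\<close>, and closure of \<open>J\<close> under square roots gives
  \<open>a \<otimes> d x\<close> itself.\<close>

lemma rdi_colon:
  assumes J: "rdi J" and a: "a \<in> carrier R"
  shows "rdi {x \<in> carrier R. a \<otimes> x \<in> J}"
proof -
  note mult = rdi_mult[OF J] and sq = rdi_sqrt[OF J] and add = rdi_add[OF J]
  have der: "a \<otimes> d x \<in> J" if x: "x \<in> carrier R" and ax: "a \<otimes> x \<in> J" for x
  proof -
    have "d (a \<otimes> x) \<in> J" by (rule rdi_der[OF J ax])
    then have "d a \<otimes> x \<oplus> a \<otimes> d x \<in> J" using a x by (simp add: d_mult)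
    then have 1: "(a \<otimes> d x) \<otimes> (d a \<otimes> x \<oplus> a \<otimes> d x) \<in> J" by (rule mult) (use a x in auto)
    have 2: "(\<ominus> (d a \<otimes> d x)) \<otimes> (a \<otimes> x) \<in> J" by (rule mult[OF ax]) (use a x in auto)
    have "(a \<otimes> d x) \<otimes> (d a \<otimes> x \<oplus> a \<otimes> d x) \<oplus> (\<ominus> (d a \<otimes> d x)) \<otimes> (a \<otimes> x) = (a \<otimes> d x) \<otimes> (a \<otimes> d x)"
      using a x d_closed[OF a] d_closed[OF x] by algebra
    with add[OF 1 2] show ?thesis using sq[of "a \<otimes> d x"] a x by simp
  qed
  have rad: "a \<otimes> x \<in> J" if x: "x \<in> carrier R" and axx: "a \<otimes> (x \<otimes> x) \<in> J" for x
  proof -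
    have "a \<otimes> (a \<otimes> (x \<otimes> x)) \<in> J" by (rule mult[OF axx a])
    moreover have "a \<otimes> (a \<otimes> (x \<otimes> x)) = (a \<otimes> x) \<otimes> (a \<otimes> x)" using a x by algebra
    ultimately show ?thesis using sq[of "a \<otimes> x"] a x by simp
  qed
  have 1: "a \<otimes> (x \<oplus> y) \<in> J" if "x \<in> carrier R" "y \<in> carrier R" "a \<otimes> x \<in> J" "a \<otimes> y \<in> J" for x y
    using add[OF that(3,4)] that a by (simp only: r_distr)
  have 2: "a \<otimes> (x \<otimes> y) \<in> J" if "x \<in> carrier R" "y \<in> carrier R" "a \<otimes> y \<in> J" for x y
    using mult[OF that(3,1)] that a by (simp only: m_lcomm)
  have 3: "a \<otimes> \<zero> \<in> J" using rdi_zero[OF J] a by (simp only: r_null)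
  have mem: "y \<in> {x \<in> carrier R. a \<otimes> x \<in> J} \<longleftrightarrow> y \<in> carrier R \<and> a \<otimes> y \<in> J" for y by blast
  show ?thesis unfolding rdi_def mem
  proof (intro conjI ballI impI; (unfold mem)?; (elim conjE)?)
    show "d b \<in> carrier R" if "b \<in> carrier R" for b using that by (rule d_closed)
    show "a \<otimes> y \<in> J" if "y \<in> carrier R" "a \<otimes> (y \<otimes> y) \<in> J" for y using that by (rule rad)
  qed (rule 1 2 3 der a_closed m_closed zero_closed subsetI; (unfold mem)?; (elim conjE)?; assumption)+
qed

text \<open>Take \<open>P\<close> maximal among the ideals avoiding \<open>s\<close>. Colon ideals
  replace the usual products of ideals: if \<open>a \<otimes> s\<close> were in \<open>P\<close>
  with \<open>a\<close> outside, the colon by \<open>s\<close> would be strictly larger than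
  \<open>P\<close>, hence contain \<open>s\<close>, and \<open>s \<otimes> s\<close> would be in
  \<open>P\<close>. So for \<open>x\<close> outside \<open>P\<close> the colon by \<open>x\<close>
  avoids \<open>s\<close> and equals \<open>P\<close> by maximality, which is primality.\<close>

lemma exists_prime_rdi:
  assumes J0: "rdi J0" and s: "s \<in> carrier R" "s \<notin> J0"
  shows "\<exists>P. rdi P \<and> s \<notin> P \<and> (\<forall>x\<in>carrier R. \<forall>y\<in>carrier R. x \<otimes> y \<in> P \<longrightarrow> x \<in> P \<or> y \<in> P)"
proof -
  let ?A = "{J. rdi J \<and> s \<notin> J}"
  have "\<exists>M\<in>?A. \<forall>X\<in>?A. M \<subseteq> X \<longrightarrow> X = M"
  proof (rule subset_Zorn_nonempty)
    show "?A \<noteq> {}" using J0 s by auto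
    fix \<C> assume ne: "\<C> \<noteq> {}" and ch: "subset.chain ?A \<C>"
    then have sub: "\<And>X. X \<in> \<C> \<Longrightarrow> rdi X \<and> s \<notin> X"
      and tot: "\<And>X Y. X \<in> \<C> \<Longrightarrow> Y \<in> \<C> \<Longrightarrow> X \<subseteq> Y \<or> Y \<subseteq> X"
      by (auto simp: subset.chain_def)
    have "a \<oplus> b \<in> \<Union>\<C>" if ab: "a \<in> X" "b \<in> Y" "X \<in> \<C>" "Y \<in> \<C>" for a b X Y
      using tot[OF ab(3,4)]
    proof
      assume "X \<subseteq> Y"
      then have "a \<oplus> b \<in> Y" using ab sub rdi_add[of Y a b] by auto
      then show ?thesis using ab by auto
    next
      assume "Y \<subseteq> X"
      then have "a \<oplus> b \<in> X" using ab sub rdi_add[of X a b] by auto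
      then show ?thesis using ab by auto
    qed
    moreover have "a \<otimes> b \<in> \<Union>\<C>" if "b \<in> X" "X \<in> \<C>" "a \<in> carrier R" for a b X
      using rdi_mult[of X b a] sub[of X] that by auto
    moreover have "d a \<in> \<Union>\<C>" if "a \<in> X" "X \<in> \<C>" for a X
      using rdi_der[of X a] sub[of X] that by auto
    moreover have "a \<in> \<Union>\<C>" if "a \<otimes> a \<in> X" "X \<in> \<C>" "a \<in> carrier R" for a X
      using rdi_sqrt[of X a] sub[of X] that by auto
    moreover have "\<Union>\<C> \<subseteq> carrier R" using sub rdi_sub by (meson Union_least subsetI)
    moreover have "\<zero> \<in> \<Union>\<C>" using ne sub rdi_zero by (metis UnionI equals0I)
    ultimately have "rdi (\<Union>\<C>)" unfolding rdi_def by (simp only: Union_iff Ball_def) meson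
    then show "\<Union>\<C> \<in> ?A" using sub by auto
  qed
  then obtain P where P: "rdi P" "s \<notin> P" and max: "\<And>X. rdi X \<Longrightarrow> s \<notin> X \<Longrightarrow> P \<subseteq> X \<Longrightarrow> X = P" by blast
  have sub: "P \<subseteq> {x \<in> carrier R. a \<otimes> x \<in> P}" if "a \<in> carrier R" for a
    using rdi_sub[OF P(1)] rdi_mult[OF P(1)] that by blast
  have key: "a \<otimes> s \<notin> P" if a: "a \<in> carrier R" "a \<notin> P" for a
  proof
    assume "a \<otimes> s \<in> P"
    then have "a \<in> {x \<in> carrier R. s \<otimes> x \<in> P}" using a s by (simp add: m_comm)
    then have "{x \<in> carrier R. s \<otimes> x \<in> P} \<noteq> P" using a by blast
    then have "s \<in> {x \<in> carrier R. s \<otimes> x \<in> P}"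
      using max[OF rdi_colon[OF P(1) s(1)] _ sub[OF s(1)]] by blast
    then show False using P(2) s rdi_sqrt[OF P(1)] by blast
  qed
  have "y \<in> P" if "x \<in> carrier R" "y \<in> carrier R" "x \<otimes> y \<in> P" "x \<notin> P" for x y
  proof -
    have "{z \<in> carrier R. x \<otimes> z \<in> P} = P"
      using max[OF rdi_colon[OF P(1) that(1)] _ sub[OF that(1)]] key[OF that(1,4)] by blast
    then show ?thesis using that by blast
  qed
  then show ?thesis using P by blast
qed

end

text \<open>Lets every set whose elements are named by finite lists over \<open>'u\<close> be copied
  into \<open>'u\<close>. The fold alone separates only lists of equal length, so the length is
  coded as well.\<close>

lemma exists_inj_lists:
  "\<exists>e :: 'u::infinite list \<Rightarrow> 'u. inj e"
proof -
  have inf: "infinite (UNIV :: 'u set)" by (rule infinite_UNIV)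
  have "|UNIV \<times> UNIV :: ('u \<times> 'u) set| \<le>o |UNIV :: 'u set|"
    by (rule ordIso_imp_ordLeq[OF card_of_Times_same_infinite[OF inf]])
  then have "\<exists>pr :: 'u \<times> 'u \<Rightarrow> 'u. inj_on pr (UNIV \<times> UNIV) \<and> pr ` (UNIV \<times> UNIV) \<le> UNIV"
    by (rule iffD2[OF card_of_ordLeq])
  then obtain pr :: "'u \<times> 'u \<Rightarrow> 'u" where pr: "inj pr"
    by (elim exE conjE) (simp only: UNIV_Times_UNIV)
  obtain j :: "nat \<Rightarrow> 'u" where j: "inj j" using iffD1[OF infinite_iff_countable_subset inf] by (elim exE conjE)
  define e where "e = (\<lambda>xs. foldr (\<lambda>x y. pr (x, y)) xs (j 0))"
  have "xs = ys" if "length xs = length ys" "e xs = e ys" for xs ys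
    using that by (induction rule: list_induct2) (auto simp: e_def dest: injD[OF pr])
  then have "inj (\<lambda>xs. pr (j (length xs), e xs))"
    by (auto intro!: injI dest!: injD[OF pr] injD[OF j])
  then show ?thesis by blast
qed

text \<open>Quotients must live on \<open>'u\<close>, while \<open>'a\<close> may be a type of
  functions. A class is coded by the names, under \<open>g\<close>, of the two coordinates of a
  chosen representative.\<close>

lemma exists_quotient_code:
  fixes g :: "'u::infinite list \<Rightarrow> 'a"
  assumes r: "equiv S r" and g: "S \<subseteq> A \<times> A" "A \<subseteq> range g"
  shows "\<exists>\<iota> :: 'a \<times> 'a \<Rightarrow> 'u. \<forall>x\<in>S. \<forall>y\<in>S. \<iota> x = \<iota> y \<longleftrightarrow> (x, y) \<in> r"
proof -
  obtain e :: "'u list \<Rightarrow> 'u" where e: "inj e" using exists_inj_lists by blast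
  define gi where "gi = inv_into UNIV g"
  have gi: "gi x = gi y \<longleftrightarrow> x = y" if "x \<in> A" "y \<in> A" for x y
    using that g(2) unfolding gi_def by (metis f_inv_into_f subsetD)
  define c where "c = (\<lambda>q. let x = (SOME x. x \<in> q) in e [e (gi (fst x)), e (gi (snd x))])"
  have c: "q = q'" if q: "q \<in> S // r" "q' \<in> S // r" "c q = c q'" for q q'
  proof -
    let ?x = "SOME x. x \<in> q" and ?y = "SOME x. x \<in> q'"
    have x: "?x \<in> q" "?y \<in> q'"
      using in_quotient_imp_non_empty[OF r q(1)] in_quotient_imp_non_empty[OF r q(2)]
      by (simp_all add: some_in_eq)
    moreover have "?x \<in> S" "?y \<in> S" using x q in_quotient_imp_subset[OF r] by blast+
    moreover from this have "fst ?x \<in> A" "snd ?x \<in> A" "fst ?y \<in> A" "snd ?y \<in> A" using g(1) by auto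
    ultimately have "?x = ?y"
      using q(3) unfolding c_def Let_def by (auto dest!: injD[OF e] simp: prod_eq_iff gi)
    then have "?x \<in> q \<inter> q'" using x by simp
    then show ?thesis using quotient_disj[OF r q(1,2)] by blast
  qed
  show ?thesis
  proof (intro exI[of _ "\<lambda>x. c (r `` {x})"] ballI)
    fix x y assume xy: "x \<in> S" "y \<in> S"
    have "c (r `` {x}) = c (r `` {y}) \<longleftrightarrow> r `` {x} = r `` {y}"
      using c quotientI[OF xy(1)] quotientI[OF xy(2)] by metis
    then show "c (r `` {x}) = c (r `` {y}) \<longleftrightarrow> (x, y) \<in> r"
      using eq_equiv_class_iff[OF r xy] by simp
  qed
qed

text \<open>The field of fractions of the domain \<open>R/P\<close> in one step: fractions with
  denominator outside \<open>P\<close> are identified when their cross difference lies in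
  \<open>P\<close>. The elements are the codes \<open>\<iota> (x, s)\<close>, so the carrier sits in
  \<open>'u\<close>.\<close>

locale diff_fractions = derivation_ring R d for R (structure) and d +
  fixes P :: "'a set" and \<iota> :: "'a \<times> 'a \<Rightarrow> 'u"
  assumes rdi: "rdi P"
    and prime: "\<lbrakk>x \<in> carrier R; y \<in> carrier R; x \<otimes> y \<in> P\<rbrakk> \<Longrightarrow> x \<in> P \<or> y \<in> P"
    and one_P: "\<one> \<notin> P"
    and iota: "\<lbrakk>x \<in> carrier R; s \<in> carrier R - P; y \<in> carrier R; t \<in> carrier R - P\<rbrakk> \<Longrightarrow>
      \<iota> (x, s) = \<iota> (y, t) \<longleftrightarrow> x \<otimes> t \<ominus> y \<otimes> s \<in> P"
begin

definition S where "S = carrier R \<times> (carrier R - P)"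
definition rep where "rep = inv_into S \<iota>"

definition frac :: "'u diff_ring" where
  "frac = \<lparr>carrier = \<iota> ` S,
     monoid.mult = (\<lambda>a b. \<iota> (fst (rep a) \<otimes> fst (rep b), snd (rep a) \<otimes> snd (rep b))),
     one = \<iota> (\<one>, \<one>), zero = \<iota> (\<zero>, \<one>),
     add = (\<lambda>a b. \<iota> (fst (rep a) \<otimes> snd (rep b) \<oplus> fst (rep b) \<otimes> snd (rep a), snd (rep a) \<otimes> snd (rep b))),
     der = (\<lambda>a. \<iota> (d (fst (rep a)) \<otimes> snd (rep a) \<ominus> fst (rep a) \<otimes> d (snd (rep a)), snd (rep a) \<otimes> snd (rep a)))\<rparr>"

lemmas P_sub = rdi_sub[OF rdi] and P_add = rdi_add[OF rdi] and P_zero [simp] = rdi_zero[OF rdi]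
  and P_der = rdi_der[OF rdi]

lemma P_mult: "\<lbrakk>x \<in> carrier R; y \<in> P\<rbrakk> \<Longrightarrow> x \<otimes> y \<in> P"
  using rdi_mult[OF rdi] by simp

lemma P_minus: "\<lbrakk>x \<in> P; y \<in> P\<rbrakk> \<Longrightarrow> x \<ominus> y \<in> P"
  using P_add[of x "(\<ominus> \<one>) \<otimes> y"] P_mult[of "\<ominus> \<one>" y] P_sub by (simp add: a_minus_def l_minus)
lemma not_P_mult: "\<lbrakk>s \<in> carrier R - P; t \<in> carrier R - P\<rbrakk> \<Longrightarrow> s \<otimes> t \<in> carrier R - P"
  using prime by auto

lemma rep_cases:
  assumes "x \<in> carrier R" "s \<in> carrier R - P"
  obtains x' s' where "rep (\<iota> (x, s)) = (x', s')" "x' \<in> carrier R" "s' \<in> carrier R - P"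
    "x' \<otimes> s \<ominus> x \<otimes> s' \<in> P"
proof -
  have xs: "(x, s) \<in> S" using assms by (simp add: S_def)
  then have "rep (\<iota> (x, s)) \<in> S" unfolding rep_def by (meson image_eqI inv_into_into)
  then obtain x' s' where r: "rep (\<iota> (x, s)) = (x', s')" "x' \<in> carrier R" "s' \<in> carrier R - P"
    by (cases "rep (\<iota> (x, s))") (auto simp: S_def)
  moreover have "\<iota> (rep (\<iota> (x, s))) = \<iota> (x, s)" using xs unfolding rep_def
    by (meson f_inv_into_f image_eqI)
  ultimately show ?thesis using iota[of x' s' x s] assms that by simp
qed

lemma frac_simps [simp]:
  "carrier frac = \<iota> ` S" "\<one>\<^bsub>frac\<^esub> = \<iota> (\<one>, \<one>)" "\<zero>\<^bsub>frac\<^esub> = \<iota> (\<zero>, \<one>)"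
  by (simp_all add: frac_def)

lemma frac_mult:
  assumes x: "x \<in> carrier R" "s \<in> carrier R - P" and y: "y \<in> carrier R" "t \<in> carrier R - P"
  shows "\<iota> (x, s) \<otimes>\<^bsub>frac\<^esub> \<iota> (y, t) = \<iota> (x \<otimes> y, s \<otimes> t)"
proof -
  obtain x' s' where r: "rep (\<iota> (x, s)) = (x', s')" "x' \<in> carrier R" "s' \<in> carrier R - P"
    "x' \<otimes> s \<ominus> x \<otimes> s' \<in> P" using rep_cases[OF x] .
  obtain y' t' where q: "rep (\<iota> (y, t)) = (y', t')" "y' \<in> carrier R" "t' \<in> carrier R - P"
    "y' \<otimes> t \<ominus> y \<otimes> t' \<in> P" using rep_cases[OF y] .
  have c: "s \<in> carrier R" "t \<in> carrier R" "s' \<in> carrier R" "t' \<in> carrier R" using x y r q by auto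
  have "(x' \<otimes> y') \<otimes> (s \<otimes> t) \<ominus> (x \<otimes> y) \<otimes> (s' \<otimes> t')
     = (y' \<otimes> t) \<otimes> (x' \<otimes> s \<ominus> x \<otimes> s') \<oplus> (x \<otimes> s') \<otimes> (y' \<otimes> t \<ominus> y \<otimes> t')"
    using x(1) y(1) r(2) q(2) c by (intro frac_mult_identity)
  also have "\<dots> \<in> P" by (rule P_add[OF P_mult[OF _ r(4)] P_mult[OF _ q(4)]]) (use x(1) y(1) r(2) q(2) c in auto)
  finally have "\<iota> (x' \<otimes> y', s' \<otimes> t') = \<iota> (x \<otimes> y, s \<otimes> t)"
    using x y r q not_P_mult[OF x(2) y(2)] not_P_mult[OF r(3) q(3)] by (subst iota) auto
  then show ?thesis using r q by (simp add: frac_def)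
qed

lemma frac_add:
  assumes x: "x \<in> carrier R" "s \<in> carrier R - P" and y: "y \<in> carrier R" "t \<in> carrier R - P"
  shows "\<iota> (x, s) \<oplus>\<^bsub>frac\<^esub> \<iota> (y, t) = \<iota> (x \<otimes> t \<oplus> y \<otimes> s, s \<otimes> t)"
proof -
  obtain x' s' where r: "rep (\<iota> (x, s)) = (x', s')" "x' \<in> carrier R" "s' \<in> carrier R - P"
    "x' \<otimes> s \<ominus> x \<otimes> s' \<in> P" using rep_cases[OF x] .
  obtain y' t' where q: "rep (\<iota> (y, t)) = (y', t')" "y' \<in> carrier R" "t' \<in> carrier R - P"
    "y' \<otimes> t \<ominus> y \<otimes> t' \<in> P" using rep_cases[OF y] .
  have c: "s \<in> carrier R" "t \<in> carrier R" "s' \<in> carrier R" "t' \<in> carrier R" using x y r q by auto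
  have "(x' \<otimes> t' \<oplus> y' \<otimes> s') \<otimes> (s \<otimes> t) \<ominus> (x \<otimes> t \<oplus> y \<otimes> s) \<otimes> (s' \<otimes> t')
     = (t \<otimes> t') \<otimes> (x' \<otimes> s \<ominus> x \<otimes> s') \<oplus> (s \<otimes> s') \<otimes> (y' \<otimes> t \<ominus> y \<otimes> t')"
    using x(1) y(1) r(2) q(2) c by (intro frac_add_identity)
  also have "\<dots> \<in> P" by (rule P_add[OF P_mult[OF _ r(4)] P_mult[OF _ q(4)]]) (use x(1) y(1) r(2) q(2) c in auto)
  finally have "\<iota> (x' \<otimes> t' \<oplus> y' \<otimes> s', s' \<otimes> t') = \<iota> (x \<otimes> t \<oplus> y \<otimes> s, s \<otimes> t)"
    using x y r q not_P_mult[OF x(2) y(2)] not_P_mult[OF r(3) q(3)] by (subst iota) auto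
  then show ?thesis using r q by (simp add: frac_def)
qed

lemma frac_der:
  assumes x: "x \<in> carrier R" "s \<in> carrier R - P"
  shows "der frac (\<iota> (x, s)) = \<iota> (d x \<otimes> s \<ominus> x \<otimes> d s, s \<otimes> s)"
proof -
  obtain x' s' where r: "rep (\<iota> (x, s)) = (x', s')" "x' \<in> carrier R" "s' \<in> carrier R - P"
    "x' \<otimes> s \<ominus> x \<otimes> s' \<in> P" using rep_cases[OF x] .
  have c: "s \<in> carrier R" "s' \<in> carrier R" using x r by auto
  have dz: "(d x' \<otimes> s \<oplus> x' \<otimes> d s) \<ominus> (d x \<otimes> s' \<oplus> x \<otimes> d s') \<in> P"
    using P_der[OF r(4)] x(1) r(2) c by (simp add: d_diff d_mult)
  have "(d x' \<otimes> s' \<ominus> x' \<otimes> d s') \<otimes> (s \<otimes> s) \<ominus> (d x \<otimes> s \<ominus> x \<otimes> d s) \<otimes> (s' \<otimes> s')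
      = (s \<otimes> s') \<otimes> ((d x' \<otimes> s \<oplus> x' \<otimes> d s) \<ominus> (d x \<otimes> s' \<oplus> x \<otimes> d s'))
        \<ominus> (d s \<otimes> s' \<oplus> d s' \<otimes> s) \<otimes> (x' \<otimes> s \<ominus> x \<otimes> s')"
    using x(1) r(2) c d_closed[OF x(1)] d_closed[OF r(2)] d_closed[OF c(1)] d_closed[OF c(2)] by (intro frac_der_identity)
  also have "\<dots> \<in> P" by (rule P_minus[OF P_mult[OF _ dz] P_mult[OF _ r(4)]]) (use x(1) r(2) c in auto)
  finally have "\<iota> (d x' \<otimes> s' \<ominus> x' \<otimes> d s', s' \<otimes> s') = \<iota> (d x \<otimes> s \<ominus> x \<otimes> d s, s \<otimes> s)"
    using x r not_P_mult[OF x(2) x(2)] not_P_mult[OF r(3) r(3)] by (subst iota) auto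
  then show ?thesis using r by (simp add: frac_def)
qed

lemma frac_eqI:
  assumes "x \<otimes> t = y \<otimes> s" "x \<in> carrier R" "s \<in> carrier R - P" "y \<in> carrier R" "t \<in> carrier R - P"
  shows "\<iota> (x, s) = \<iota> (y, t)"
proof -
  have "x \<otimes> t \<ominus> y \<otimes> s = \<zero>" using assms by (simp add: r_right_minus_eq)
  then show ?thesis unfolding iota[OF assms(2-5)] by (simp only: P_zero)
qed

lemma in_frac: "\<lbrakk>x \<in> carrier R; s \<in> carrier R - P\<rbrakk> \<Longrightarrow> \<iota> (x, s) \<in> carrier frac"
  by (auto simp: S_def)

lemma frac_cases:
  assumes "a \<in> carrier frac"
  obtains x s where "a = \<iota> (x, s)" "x \<in> carrier R" "s \<in> carrier R - P"
  using assms by (auto simp: S_def)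

lemma one_S: "\<one> \<in> carrier R - P" using one_P by simp

lemma frac_cring: "cring frac"
proof (rule cringI[OF abelian_groupI comm_monoidI])
  fix a b assume a: "a \<in> carrier frac" and b: "b \<in> carrier frac"
  obtain x s where 1: "a = \<iota> (x, s)" "x \<in> carrier R" "s \<in> carrier R - P" using a by (rule frac_cases)
  obtain y t where 2: "b = \<iota> (y, t)" "y \<in> carrier R" "t \<in> carrier R - P" using b by (rule frac_cases)
  have c: "s \<in> carrier R" "t \<in> carrier R" using 1 2 by auto
  note st = not_P_mult[OF 1(3) 2(3)] not_P_mult[OF 2(3) 1(3)]
  show "a \<oplus>\<^bsub>frac\<^esub> b \<in> carrier frac" using 1 2 c st by (simp only: frac_add in_frac m_closed a_closed)
  show "a \<otimes>\<^bsub>frac\<^esub> b \<in> carrier frac" using 1 2 c st by (simp only: frac_mult in_frac m_closed a_closed)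
  show "a \<oplus>\<^bsub>frac\<^esub> b = b \<oplus>\<^bsub>frac\<^esub> a"
    unfolding 1 2 frac_add[OF 1(2,3) 2(2,3)] frac_add[OF 2(2,3) 1(2,3)]
    using 1(2) 2(2) c st by (intro frac_eqI) (simp_all add: a_comm m_comm)
  show "a \<otimes>\<^bsub>frac\<^esub> b = b \<otimes>\<^bsub>frac\<^esub> a"
    unfolding 1 2 frac_mult[OF 1(2,3) 2(2,3)] frac_mult[OF 2(2,3) 1(2,3)]
    using 1(2) 2(2) c st by (intro frac_eqI) (simp_all add: m_comm)
  fix e assume e: "e \<in> carrier frac"
  obtain z u where 3: "e = \<iota> (z, u)" "z \<in> carrier R" "u \<in> carrier R - P" using e by (rule frac_cases)
  have c': "u \<in> carrier R" using 3 by auto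
  note st' = not_P_mult[OF 1(3) 3(3)] not_P_mult[OF 2(3) 3(3)]
  note st2 = not_P_mult[OF st(1) 3(3)] not_P_mult[OF 1(3) st'(2)] not_P_mult[OF st'(1) st'(2)]
  show "(a \<oplus>\<^bsub>frac\<^esub> b) \<oplus>\<^bsub>frac\<^esub> e = a \<oplus>\<^bsub>frac\<^esub> (b \<oplus>\<^bsub>frac\<^esub> e)"
  proof -
    have l: "(a \<oplus>\<^bsub>frac\<^esub> b) \<oplus>\<^bsub>frac\<^esub> e = \<iota> ((x \<otimes> t \<oplus> y \<otimes> s) \<otimes> u \<oplus> z \<otimes> (s \<otimes> t), (s \<otimes> t) \<otimes> u)"
      using 1 2 3 c st by (simp only: frac_add m_closed a_closed)
    have r: "a \<oplus>\<^bsub>frac\<^esub> (b \<oplus>\<^bsub>frac\<^esub> e) = \<iota> (x \<otimes> (t \<otimes> u) \<oplus> (y \<otimes> u \<oplus> z \<otimes> t) \<otimes> s, s \<otimes> (t \<otimes> u))"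
      using 1 2 3 c c' st' by (simp only: frac_add m_closed a_closed)
    have "(x \<otimes> t \<oplus> y \<otimes> s) \<otimes> u \<oplus> z \<otimes> (s \<otimes> t) = x \<otimes> (t \<otimes> u) \<oplus> (y \<otimes> u \<oplus> z \<otimes> t) \<otimes> s"
      by (use in_carrier_Cons in_carrier_Nil norm_eq[OF _ ring_norm_4, of "[x, t, y, s, u, z]"] 1(2) 2(2) 3(2) c c' in simp)
    moreover have "(s \<otimes> t) \<otimes> u = s \<otimes> (t \<otimes> u)" using c c' by (simp add: m_assoc)
    ultimately show ?thesis unfolding l r by simp
  qed
  show "(a \<otimes>\<^bsub>frac\<^esub> b) \<otimes>\<^bsub>frac\<^esub> e = a \<otimes>\<^bsub>frac\<^esub> (b \<otimes>\<^bsub>frac\<^esub> e)"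
    using 1 2 3 c c' st st' by (simp only: frac_mult m_closed a_closed m_assoc)
  show "(a \<oplus>\<^bsub>frac\<^esub> b) \<otimes>\<^bsub>frac\<^esub> e = a \<otimes>\<^bsub>frac\<^esub> e \<oplus>\<^bsub>frac\<^esub> b \<otimes>\<^bsub>frac\<^esub> e"
  proof -
    have l: "(a \<oplus>\<^bsub>frac\<^esub> b) \<otimes>\<^bsub>frac\<^esub> e = \<iota> ((x \<otimes> t \<oplus> y \<otimes> s) \<otimes> z, (s \<otimes> t) \<otimes> u)"
      using 1 2 3 c st by (simp only: frac_add frac_mult m_closed a_closed)
    have r: "a \<otimes>\<^bsub>frac\<^esub> e \<oplus>\<^bsub>frac\<^esub> b \<otimes>\<^bsub>frac\<^esub> e = \<iota> ((x \<otimes> z) \<otimes> (t \<otimes> u) \<oplus> (y \<otimes> z) \<otimes> (s \<otimes> u), (s \<otimes> u) \<otimes> (t \<otimes> u))"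
      using 1 2 3 c c' st' by (simp only: frac_add frac_mult m_closed a_closed)
    have "((x \<otimes> t \<oplus> y \<otimes> s) \<otimes> z) \<otimes> ((s \<otimes> u) \<otimes> (t \<otimes> u)) = ((x \<otimes> z) \<otimes> (t \<otimes> u) \<oplus> (y \<otimes> z) \<otimes> (s \<otimes> u)) \<otimes> ((s \<otimes> t) \<otimes> u)"
      by (use in_carrier_Cons in_carrier_Nil norm_eq[OF _ ring_norm_5, of "[x, t, y, s, z, u]"] 1(2) 2(2) 3(2) c c' in simp)
    then show ?thesis unfolding l r using 1(2) 2(2) 3(2) c c' st2 by (intro frac_eqI) auto
  qed
next
  show "\<zero>\<^bsub>frac\<^esub> \<in> carrier frac" "\<one>\<^bsub>frac\<^esub> \<in> carrier frac"
    using in_frac[OF zero_closed one_S] in_frac[OF one_closed one_S] by auto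
next
  fix a assume a: "a \<in> carrier frac"
  obtain x s where 1: "a = \<iota> (x, s)" "x \<in> carrier R" "s \<in> carrier R - P" using a by (rule frac_cases)
  have c: "s \<in> carrier R" using 1 by auto
  show "\<zero>\<^bsub>frac\<^esub> \<oplus>\<^bsub>frac\<^esub> a = a" using 1 c frac_add[OF zero_closed one_S 1(2,3)] by simp
  show "\<one>\<^bsub>frac\<^esub> \<otimes>\<^bsub>frac\<^esub> a = a" using 1 c frac_mult[OF one_closed one_S 1(2,3)] by simp
  have "\<iota> (\<ominus> x, s) \<oplus>\<^bsub>frac\<^esub> a = \<iota> ((\<ominus> x) \<otimes> s \<oplus> x \<otimes> s, s \<otimes> s)"
    using 1 frac_add[of "\<ominus> x" s x s] by simp
  also have "\<dots> = \<iota> (\<zero>, \<one>)"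
    using 1 c one_S not_P_mult[OF 1(3) 1(3)] by (intro frac_eqI) (auto simp: l_minus l_neg)
  finally show "\<exists>y\<in>carrier frac. y \<oplus>\<^bsub>frac\<^esub> a = \<zero>\<^bsub>frac\<^esub>"
    using in_frac[of "\<ominus> x" s] 1 by auto
qed

lemma frac_field: "field frac"
proof -
  interpret F: cring frac by (rule frac_cring)
  have nz: "\<iota> (x, s) = \<iota> (\<zero>, \<one>) \<longleftrightarrow> x \<in> P" if "x \<in> carrier R" "s \<in> carrier R - P" for x s
    using that one_S by (subst iota) (auto simp: a_minus_def)
  show ?thesis
  proof (rule F.cring_fieldI2)
    show "\<zero>\<^bsub>frac\<^esub> \<noteq> \<one>\<^bsub>frac\<^esub>" using nz[OF one_closed one_S] one_P by auto
    fix a assume a: "a \<in> carrier frac" "a \<noteq> \<zero>\<^bsub>frac\<^esub>"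
    obtain x s where 1: "a = \<iota> (x, s)" "x \<in> carrier R" "s \<in> carrier R - P" using a(1) by (rule frac_cases)
    have x: "x \<in> carrier R - P" using a 1 nz by auto
    have "a \<otimes>\<^bsub>frac\<^esub> \<iota> (s, x) = \<iota> (x \<otimes> s, s \<otimes> x)" using 1 x frac_mult[of x s s x] by simp
    also have "\<dots> = \<iota> (\<one>, \<one>)"
      using 1 x one_S not_P_mult[OF 1(3) x] by (intro frac_eqI) (auto simp: m_comm)
    finally show "\<exists>b\<in>carrier frac. a \<otimes>\<^bsub>frac\<^esub> b = \<one>\<^bsub>frac\<^esub>"
      using in_frac[of s x] 1 x by auto
  qed
qed

text \<open>Here \<open>a\<close>, \<open>b\<close>, \<open>a'\<close>, \<open>b'\<close> stand for
  the derivatives of \<open>x\<close>, \<open>s\<close>, \<open>y\<close>, \<open>t\<close>. The two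
  sides of the product rule are computed with different denominators, one of degree 2 and one of
  degree 3 in each of \<open>s\<close> and \<open>t\<close>, so they agree only after cross
  multiplication.\<close>

lemma frac_der_mult_identity:
  assumes "x \<in> carrier R" "s \<in> carrier R" "y \<in> carrier R" "t \<in> carrier R"
    "a \<in> carrier R" "b \<in> carrier R" "a' \<in> carrier R" "b' \<in> carrier R"
  shows "((a \<otimes> y \<oplus> x \<otimes> a') \<otimes> (s \<otimes> t) \<ominus> (x \<otimes> y) \<otimes> (b \<otimes> t \<oplus> s \<otimes> b')) \<otimes> (((s \<otimes> s) \<otimes> t) \<otimes> (s \<otimes> (t \<otimes> t)))
    = (((a \<otimes> s \<ominus> x \<otimes> b) \<otimes> y) \<otimes> (s \<otimes> (t \<otimes> t)) \<oplus> (x \<otimes> (a' \<otimes> t \<ominus> y \<otimes> b')) \<otimes> ((s \<otimes> s) \<otimes> t)) \<otimes> ((s \<otimes> t) \<otimes> (s \<otimes> t))"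
  by (use in_carrier_Cons in_carrier_Nil norm_eq[OF _ ring_norm_6, of "[a, y, x, a', s, t, b, b']"] assms in simp)

lemma frac_der_add_identity:
  assumes "x \<in> carrier R" "s \<in> carrier R" "y \<in> carrier R" "t \<in> carrier R"
    "a \<in> carrier R" "b \<in> carrier R" "a' \<in> carrier R" "b' \<in> carrier R"
  shows "(((a \<otimes> t \<oplus> x \<otimes> b') \<oplus> (a' \<otimes> s \<oplus> y \<otimes> b)) \<otimes> (s \<otimes> t) \<ominus> (x \<otimes> t \<oplus> y \<otimes> s) \<otimes> (b \<otimes> t \<oplus> s \<otimes> b')) \<otimes> ((s \<otimes> s) \<otimes> (t \<otimes> t))
    = ((a \<otimes> s \<ominus> x \<otimes> b) \<otimes> (t \<otimes> t) \<oplus> (a' \<otimes> t \<ominus> y \<otimes> b') \<otimes> (s \<otimes> s)) \<otimes> ((s \<otimes> t) \<otimes> (s \<otimes> t))"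
  by (use in_carrier_Cons in_carrier_Nil norm_eq[OF _ ring_norm_7, of "[a, t, x, b', a', s, y, b]"] assms in simp)

lemma frac_differential_ring: "differential_ring frac"
proof (intro differential_ring.intro frac_cring differential_ring_axioms.intro)
  fix a assume a: "a \<in> carrier frac"
  obtain x s where 1: "a = \<iota> (x, s)" "x \<in> carrier R" "s \<in> carrier R - P" using a by (rule frac_cases)
  have c: "s \<in> carrier R" using 1 by auto
  note ss = not_P_mult[OF 1(3) 1(3)]
  show "der frac a \<in> carrier frac"
    unfolding 1 frac_der[OF 1(2,3)] using 1 c ss by (intro in_frac) auto
  fix b assume b: "b \<in> carrier frac"
  obtain y t where 2: "b = \<iota> (y, t)" "y \<in> carrier R" "t \<in> carrier R - P" using b by (rule frac_cases)
  have c': "t \<in> carrier R" using 2 by auto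
  note st = not_P_mult[OF 1(3) 2(3)] not_P_mult[OF 2(3) 2(3)]
  have st': "(s \<otimes> s) \<otimes> t \<in> carrier R - P" "s \<otimes> (t \<otimes> t) \<in> carrier R - P"
    using not_P_mult 1 2 ss st by blast+
  have A: "d x \<otimes> s \<ominus> x \<otimes> d s \<in> carrier R" "d y \<otimes> t \<ominus> y \<otimes> d t \<in> carrier R" using 1 2 c c' by auto
  show "der frac (a \<oplus>\<^bsub>frac\<^esub> b) = der frac a \<oplus>\<^bsub>frac\<^esub> der frac b"
  proof -
    have l: "der frac (a \<oplus>\<^bsub>frac\<^esub> b) = \<iota> (((d x \<otimes> t \<oplus> x \<otimes> d t) \<oplus> (d y \<otimes> s \<oplus> y \<otimes> d s)) \<otimes> (s \<otimes> t) \<ominus> (x \<otimes> t \<oplus> y \<otimes> s) \<otimes> (d s \<otimes> t \<oplus> s \<otimes> d t), (s \<otimes> t) \<otimes> (s \<otimes> t))"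
      using 1 2 c c' st by (simp only: frac_add frac_der m_closed a_closed d_mult d_add)
    have r: "der frac a \<oplus>\<^bsub>frac\<^esub> der frac b = \<iota> ((d x \<otimes> s \<ominus> x \<otimes> d s) \<otimes> (t \<otimes> t) \<oplus> (d y \<otimes> t \<ominus> y \<otimes> d t) \<otimes> (s \<otimes> s), (s \<otimes> s) \<otimes> (t \<otimes> t))"
      using 1 2 c c' st ss A by (simp only: frac_add frac_der)
    show ?thesis unfolding l r using 1(2) 2(2) c c' not_P_mult[OF ss st(2)] not_P_mult[OF st(1) st(1)]
      by (intro frac_eqI frac_der_add_identity) auto
  qed
  show "der frac (a \<otimes>\<^bsub>frac\<^esub> b) = der frac a \<otimes>\<^bsub>frac\<^esub> b \<oplus>\<^bsub>frac\<^esub> a \<otimes>\<^bsub>frac\<^esub> der frac b"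
  proof -
    have l: "der frac (a \<otimes>\<^bsub>frac\<^esub> b) = \<iota> ((d x \<otimes> y \<oplus> x \<otimes> d y) \<otimes> (s \<otimes> t) \<ominus> (x \<otimes> y) \<otimes> (d s \<otimes> t \<oplus> s \<otimes> d t), (s \<otimes> t) \<otimes> (s \<otimes> t))"
      using 1 2 c c' st by (simp only: frac_mult frac_der m_closed a_closed d_mult d_add)
    have r: "der frac a \<otimes>\<^bsub>frac\<^esub> b \<oplus>\<^bsub>frac\<^esub> a \<otimes>\<^bsub>frac\<^esub> der frac b
       = \<iota> (((d x \<otimes> s \<ominus> x \<otimes> d s) \<otimes> y) \<otimes> (s \<otimes> (t \<otimes> t)) \<oplus> (x \<otimes> (d y \<otimes> t \<ominus> y \<otimes> d t)) \<otimes> ((s \<otimes> s) \<otimes> t), ((s \<otimes> s) \<otimes> t) \<otimes> (s \<otimes> (t \<otimes> t)))"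
      using 1 2 c c' st st' ss A by (simp only: frac_mult frac_add frac_der m_closed)
    show ?thesis unfolding l r using 1(2) 2(2) c c' not_P_mult[OF st'] not_P_mult[OF st(1) st(1)]
      by (intro frac_eqI frac_der_mult_identity) auto
  qed
qed

lemma iota_hom: "(\<lambda>x. \<iota> (x, \<one>)) \<in> ring_hom R frac"
proof (rule ring_hom_memI)
  fix x y assume "x \<in> carrier R" "y \<in> carrier R"
  then show "\<iota> (x \<otimes> y, \<one>) = \<iota> (x, \<one>) \<otimes>\<^bsub>frac\<^esub> \<iota> (y, \<one>)" "\<iota> (x \<oplus> y, \<one>) = \<iota> (x, \<one>) \<oplus>\<^bsub>frac\<^esub> \<iota> (y, \<one>)"
    using one_S by (simp_all add: frac_mult frac_add)
next
  show "\<iota> (x, \<one>) \<in> carrier frac" if "x \<in> carrier R" for x by (rule in_frac[OF that one_S])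
qed simp

lemma iota_der: "x \<in> carrier R \<Longrightarrow> der frac (\<iota> (x, \<one>)) = \<iota> (d x, \<one>)"
  using one_S by (simp add: frac_der a_minus_def)

end

text \<open>The differential field is placed on any infinite type over which all elements of the ring
  are coded by finite lists.\<close>

theorem (in derivation_ring) exists_differential_field_hom:
  fixes g :: "'u::infinite list \<Rightarrow> 'a"
  assumes red: "\<And>x. \<lbrakk>x \<in> carrier R; x \<otimes> x = \<zero>\<rbrakk> \<Longrightarrow> x = \<zero>"
    and s: "s \<in> carrier R" "s \<noteq> \<zero>"
    and ch: "[(p::nat)] \<cdot> \<one> = \<zero>"
    and g: "carrier R \<subseteq> range g"
  shows "\<exists>(L :: 'u diff_ring) h. differential_field p L \<and> h \<in> ring_hom R L \<and>
    (\<forall>x\<in>carrier R. h (d x) = der L (h x)) \<and> h s \<noteq> \<zero>\<^bsub>L\<^esub>"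
proof -
  \<comment> \<open>For the zero ideal, closure under square roots is reducedness.\<close>
  have "rdi {\<zero>}" unfolding rdi_def
  proof (intro conjI ballI impI)
    show "x \<in> {\<zero>}" if "x \<in> carrier R" "x \<otimes> x \<in> {\<zero>}" for x using that red by blast
  qed simp_all
  from exists_prime_rdi[OF this s(1)] s(2) obtain P where P: "rdi P" "s \<notin> P"
    and prime: "\<And>x y. \<lbrakk>x \<in> carrier R; y \<in> carrier R; x \<otimes> y \<in> P\<rbrakk> \<Longrightarrow> x \<in> P \<or> y \<in> P"
    by auto
  have one: "\<one> \<notin> P" using P s rdi_mult[OF P(1), of \<one> s] by auto
  note Padd = rdi_add[OF P(1)] and Pmult = rdi_mult[OF P(1)] and Psub = rdi_sub[OF P(1)]
  define S where "S = carrier R \<times> (carrier R - P)"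
  define r where "r = {((x, s), (y, t)) |x s y t. (x, s) \<in> S \<and> (y, t) \<in> S \<and> x \<otimes> t \<ominus> y \<otimes> s \<in> P}"
  have "equiv S r"
  proof (rule equivI)
    show "r \<subseteq> S \<times> S" by (auto simp: r_def)
    show "refl_on S r" using rdi_zero[OF P(1)] by (auto simp: refl_on_def r_def S_def a_minus_def r_neg)
    show "sym r"
    proof (rule symI)
      fix a b assume "(a, b) \<in> r"
      then obtain x s y t where 1: "a = (x, s)" "b = (y, t)" "(x, s) \<in> S" "(y, t) \<in> S" "x \<otimes> t \<ominus> y \<otimes> s \<in> P"
        by (auto simp: r_def)
      have c: "x \<in> carrier R" "s \<in> carrier R" "y \<in> carrier R" "t \<in> carrier R" using 1 by (auto simp: S_def)
      have "y \<otimes> s \<ominus> x \<otimes> t = (\<ominus> \<one>) \<otimes> (x \<otimes> t \<ominus> y \<otimes> s)" using c by algebra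
      then show "(b, a) \<in> r" using 1 c Pmult by (auto simp: r_def)
    qed
    show "trans r"
    proof (rule transI)
      fix a b e assume "(a, b) \<in> r" "(b, e) \<in> r"
      then obtain x s y t z u where 1: "a = (x, s)" "b = (y, t)" "e = (z, u)" "(x, s) \<in> S" "(y, t) \<in> S" "(z, u) \<in> S"
        "x \<otimes> t \<ominus> y \<otimes> s \<in> P" "y \<otimes> u \<ominus> z \<otimes> t \<in> P"
        by (auto simp: r_def)
      have c: "x \<in> carrier R" "s \<in> carrier R" "y \<in> carrier R" "t \<in> carrier R" "z \<in> carrier R" "u \<in> carrier R" "t \<notin> P"
        using 1 by (auto simp: S_def)
      \<comment> \<open>Transitivity becomes visible after multiplying by \<open>t\<close>, which
        lies outside the prime ideal and can be cancelled.\<close>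
      have "t \<otimes> (x \<otimes> u \<ominus> z \<otimes> s) = u \<otimes> (x \<otimes> t \<ominus> y \<otimes> s) \<oplus> s \<otimes> (y \<otimes> u \<ominus> z \<otimes> t)"
        by (use in_carrier_Cons in_carrier_Nil norm_eq[OF _ ring_norm_8, of "[t, x, u, z, s, y]"] c(1-6) in simp)
      also have "\<dots> \<in> P" by (rule Padd[OF Pmult[OF 1(7)] Pmult[OF 1(8)]]) (use c in auto)
      finally have "x \<otimes> u \<ominus> z \<otimes> s \<in> P" using prime[of t "x \<otimes> u \<ominus> z \<otimes> s"] c by simp
      then show "(a, e) \<in> r" using 1 by (auto simp: r_def)
    qed
  qed
  moreover have "S \<subseteq> carrier R \<times> carrier R" by (auto simp: S_def)
  ultimately obtain \<iota> :: "'a \<times> 'a \<Rightarrow> 'u" where \<iota>: "\<forall>x\<in>S. \<forall>y\<in>S. \<iota> x = \<iota> y \<longleftrightarrow> (x, y) \<in> r"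
    using exists_quotient_code[of S r "carrier R" g] g by (elim exE meta_impE) auto
  have \<iota>': "(\<iota> (x, s) = \<iota> (y, t)) = (x \<otimes> t \<ominus> y \<otimes> s \<in> P)"
    if "x \<in> carrier R" "s \<in> carrier R - P" "y \<in> carrier R" "t \<in> carrier R - P" for x s y t
    using \<iota>[rule_format, of "(x, s)" "(y, t)"] that by (simp add: S_def r_def)
  interpret F: diff_fractions R d P \<iota>
    by unfold_locales (fact P(1) prime one | rule \<iota>'; assumption)+
  interpret F': differential_ring F.frac by (rule F.frac_differential_ring)
  have hom: "(\<lambda>x. \<iota> (x, \<one>)) \<in> ring_hom R F.frac" by (rule F.iota_hom)
  have pow: "\<iota> ([n] \<cdot> \<one>, \<one>) = [n] \<cdot>\<^bsub>F.frac\<^esub> \<one>\<^bsub>F.frac\<^esub>" for n :: nat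
    by (induction n) (use ring_hom_add[OF hom] ring_hom_one[OF hom] in \<open>auto simp del: F.frac_simps simp: F.frac_simps(3)\<close>)
  have "differential_field p F.frac"
    unfolding differential_field_def using F.frac_differential_ring F.frac_field pow[of p] ch by simp
  moreover have "\<iota> (s, \<one>) \<noteq> \<zero>\<^bsub>F.frac\<^esub>"
    using F.iota[of s \<one> \<zero> \<one>] s P F.one_S by (auto simp: a_minus_def)
  ultimately show ?thesis using hom F.iota_der by (intro exI[of _ F.frac] exI[of _ "\<lambda>x. \<iota> (x, \<one>)"]) auto
qed

section \<open>Rings of commuting operators\<close>

text \<open>A commuting family \<open>G\<close> of additive operators on a group \<open>\<Lambda>\<close> of functions spans a commutative
  ring; commutators with a fixed additive operator \<open>nab\<close> then form a derivation of this ring.\<close>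

locale op_ring = abelian_group F for F (structure) +
  fixes \<Lambda> :: "('i \<Rightarrow> 'a) set" and G :: "(('i \<Rightarrow> 'a) \<Rightarrow> 'i \<Rightarrow> 'a) set"
    and nab :: "('i \<Rightarrow> 'a) \<Rightarrow> 'i \<Rightarrow> 'a"
  assumes \<Lambda>_carrier: "\<xi> \<in> \<Lambda> \<Longrightarrow> \<xi> i \<in> carrier F"
    and \<Lambda>_zero: "(\<lambda>_. \<zero>) \<in> \<Lambda>"
    and \<Lambda>_add: "\<lbrakk>\<xi> \<in> \<Lambda>; \<mu> \<in> \<Lambda>\<rbrakk> \<Longrightarrow> (\<lambda>i. \<xi> i \<oplus> \<mu> i) \<in> \<Lambda>"
    and G_outside: "\<lbrakk>g \<in> G; \<xi> \<notin> \<Lambda>\<rbrakk> \<Longrightarrow> g \<xi> = (\<lambda>_. \<zero>)"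
    and G_closed: "\<lbrakk>g \<in> G; \<xi> \<in> \<Lambda>\<rbrakk> \<Longrightarrow> g \<xi> \<in> \<Lambda>"
    and G_add: "\<lbrakk>g \<in> G; \<xi> \<in> \<Lambda>; \<mu> \<in> \<Lambda>\<rbrakk> \<Longrightarrow> g (\<lambda>i. \<xi> i \<oplus> \<mu> i) = (\<lambda>i. g \<xi> i \<oplus> g \<mu> i)"
    and G_comm: "\<lbrakk>g \<in> G; h \<in> G; \<xi> \<in> \<Lambda>\<rbrakk> \<Longrightarrow> g (h \<xi>) = h (g \<xi>)"
    and G_comp: "\<lbrakk>g \<in> G; h \<in> G\<rbrakk> \<Longrightarrow> g \<circ> h \<in> G"
    and G_one: "(\<lambda>\<xi>. if \<xi> \<in> \<Lambda> then \<xi> else (\<lambda>_. \<zero>)) \<in> G"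
    and G_minus: "g \<in> G \<Longrightarrow> (\<lambda>\<xi> i. \<ominus> g \<xi> i) \<in> G"
    and nab_closed: "\<xi> \<in> \<Lambda> \<Longrightarrow> nab \<xi> \<in> \<Lambda>"
    and nab_add: "\<lbrakk>\<xi> \<in> \<Lambda>; \<mu> \<in> \<Lambda>\<rbrakk> \<Longrightarrow> nab (\<lambda>i. \<xi> i \<oplus> \<mu> i) = (\<lambda>i. nab \<xi> i \<oplus> nab \<mu> i)"
    and nab_comm: "g \<in> G \<Longrightarrow> \<exists>h\<in>G. \<exists>h'\<in>G. \<forall>\<xi>\<in>\<Lambda>. nab (g \<xi>) = (\<lambda>i. (h \<xi> i \<oplus> h' \<xi> i) \<oplus> g (nab \<xi>) i)"
begin

text \<open>As \<open>G\<close> is closed under composition and negation, its additive span is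
  already a ring. Adding one generator at a time gives the induction by which most properties of the
  ring are proved.\<close>

inductive_set ops :: "(('i \<Rightarrow> 'a) \<Rightarrow> 'i \<Rightarrow> 'a) set" where
  ops_zero: "(\<lambda>_ _. \<zero>) \<in> ops"
| ops_add_gen: "\<lbrakk>g \<in> G; r \<in> ops\<rbrakk> \<Longrightarrow> (\<lambda>\<xi> i. g \<xi> i \<oplus> r \<xi> i) \<in> ops"

lemma ops_basic:
  assumes "r \<in> ops"
  shows "\<xi> \<notin> \<Lambda> \<Longrightarrow> r \<xi> = (\<lambda>_. \<zero>)"
    and "\<xi> \<in> \<Lambda> \<Longrightarrow> r \<xi> \<in> \<Lambda>"
    and "\<lbrakk>\<xi> \<in> \<Lambda>; \<mu> \<in> \<Lambda>\<rbrakk> \<Longrightarrow> r (\<lambda>i. \<xi> i \<oplus> \<mu> i) = (\<lambda>i. r \<xi> i \<oplus> r \<mu> i)"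
proof -
  have "(\<xi> \<notin> \<Lambda> \<longrightarrow> r \<xi> = (\<lambda>_. \<zero>)) \<and> (\<xi> \<in> \<Lambda> \<longrightarrow> r \<xi> \<in> \<Lambda>) \<and>
     (\<xi> \<in> \<Lambda> \<longrightarrow> \<mu> \<in> \<Lambda> \<longrightarrow> r \<mu> \<in> \<Lambda> \<and> r (\<lambda>i. \<xi> i \<oplus> \<mu> i) = (\<lambda>i. r \<xi> i \<oplus> r \<mu> i))" for \<xi> \<mu>
    using assms
  proof induction
    case ops_zero
    then show ?case using \<Lambda>_zero by simp
  next
    case (ops_add_gen g r)
    then show ?case
      by (auto simp: G_outside G_closed G_add \<Lambda>_add \<Lambda>_carrier[OF G_closed] \<Lambda>_carrier[of "r _"] a_ac fun_eq_iff)
  qed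
  then show "\<xi> \<notin> \<Lambda> \<Longrightarrow> r \<xi> = (\<lambda>_. \<zero>)" "\<xi> \<in> \<Lambda> \<Longrightarrow> r \<xi> \<in> \<Lambda>"
     "\<lbrakk>\<xi> \<in> \<Lambda>; \<mu> \<in> \<Lambda>\<rbrakk> \<Longrightarrow> r (\<lambda>i. \<xi> i \<oplus> \<mu> i) = (\<lambda>i. r \<xi> i \<oplus> r \<mu> i)" for \<xi> \<mu> by blast+
qed

lemmas ops_outside = ops_basic(1) and ops_closed = ops_basic(2) and ops_additive = ops_basic(3)

lemma ops_carrier [simp]: "r \<in> ops \<Longrightarrow> r \<xi> i \<in> carrier F"
  using ops_outside[of r \<xi>] ops_closed[of r \<xi>] \<Lambda>_carrier by (cases "\<xi> \<in> \<Lambda>") auto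

lemma G_carrier [simp]: "g \<in> G \<Longrightarrow> g \<xi> i \<in> carrier F"
  using G_outside[of g \<xi>] G_closed[of g \<xi>] \<Lambda>_carrier by (cases "\<xi> \<in> \<Lambda>") auto

lemma idem_zero: "\<lbrakk>a \<in> carrier F; a = a \<oplus> a\<rbrakk> \<Longrightarrow> a = \<zero>"
  using add.r_cancel_one'[of a a] by simp

lemma ops_null: "r \<in> ops \<Longrightarrow> r (\<lambda>_. \<zero>) = (\<lambda>_. \<zero>)"
proof -
  assume r: "r \<in> ops"
  have "r (\<lambda>_. \<zero>) i = r (\<lambda>_. \<zero>) i \<oplus> r (\<lambda>_. \<zero>) i" for i
    using fun_cong[OF ops_additive[OF r \<Lambda>_zero \<Lambda>_zero], of i] by simp
  then have "r (\<lambda>_. \<zero>) i = \<zero>" for i using idem_zero[OF ops_carrier[OF r]] by blast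
  then show ?thesis by (rule ext)
qed

lemma gen_ops: "g \<in> G \<Longrightarrow> g \<in> ops"
  using ops_add_gen[of g, OF _ ops_zero] by simp

lemma ops_add: "\<lbrakk>r \<in> ops; s \<in> ops\<rbrakk> \<Longrightarrow> (\<lambda>\<xi> i. r \<xi> i \<oplus> s \<xi> i) \<in> ops"
proof (induction rule: ops.induct)
  case (ops_add_gen g r)
  have "(\<lambda>\<xi> i. g \<xi> i \<oplus> (r \<xi> i \<oplus> s \<xi> i)) \<in> ops"
    by (rule ops.ops_add_gen[OF ops_add_gen.hyps(1) ops_add_gen.IH[OF ops_add_gen.prems]])
  then show ?case using ops_add_gen by (simp add: a_assoc)
qed simp

lemma ops_minus: "r \<in> ops \<Longrightarrow> (\<lambda>\<xi> i. \<ominus> r \<xi> i) \<in> ops"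
proof (induction rule: ops.induct)
  case ops_zero
  have 0: "\<ominus> \<zero> = \<zero>" by (rule minus_equality) simp_all
  show ?case unfolding 0 by (rule ops.ops_zero)
next
  case (ops_add_gen g r)
  then have "(\<lambda>\<xi> i. \<ominus> g \<xi> i \<oplus> \<ominus> r \<xi> i) \<in> ops" by (intro ops.ops_add_gen G_minus)
  then show ?case using ops_add_gen by (simp add: minus_add)
qed

lemma gen_comp_ops: "\<lbrakk>r \<in> ops; g \<in> G\<rbrakk> \<Longrightarrow> g \<circ> r \<in> ops"
proof (induction rule: ops.induct)
  case ops_zero
  then show ?case using ops.ops_zero ops_null[OF gen_ops] by (simp add: comp_def)
next
  case (ops_add_gen h r)
  have "g (\<lambda>i. h \<xi> i \<oplus> r \<xi> i) = (\<lambda>i. g (h \<xi>) i \<oplus> g (r \<xi>) i)" for \<xi>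
  proof (cases "\<xi> \<in> \<Lambda>")
    case True
    then show ?thesis using G_add[OF ops_add_gen(4) G_closed ops_closed] ops_add_gen by simp
  next
    case False
    then show ?thesis using G_outside ops_outside ops_add_gen ops_null[OF gen_ops] by simp
  qed
  moreover have "(\<lambda>\<xi> i. (g \<circ> h) \<xi> i \<oplus> (g \<circ> r) \<xi> i) \<in> ops"
    by (rule ops.ops_add_gen[OF G_comp[OF ops_add_gen.prems ops_add_gen.hyps(1)] ops_add_gen.IH[OF ops_add_gen.prems]])
  ultimately show ?case by (simp add: comp_def)
qed

lemma ops_comp: "\<lbrakk>r \<in> ops; s \<in> ops\<rbrakk> \<Longrightarrow> r \<circ> s \<in> ops"
proof (induction rule: ops.induct)
  case ops_zero
  then show ?case using ops.ops_zero by (simp add: comp_def)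
next
  case (ops_add_gen g r)
  have "(\<lambda>\<xi> i. (g \<circ> s) \<xi> i \<oplus> (r \<circ> s) \<xi> i) \<in> ops"
    by (rule ops_add[OF gen_comp_ops[OF ops_add_gen.prems ops_add_gen.hyps(1)] ops_add_gen.IH[OF ops_add_gen.prems]])
  then show ?case by (simp add: comp_def)
qed

lemma gen_commute: "\<lbrakk>r \<in> ops; g \<in> G; \<xi> \<in> \<Lambda>\<rbrakk> \<Longrightarrow> g (r \<xi>) = r (g \<xi>)"
proof (induction rule: ops.induct)
  case ops_zero
  then show ?case using ops_null[OF gen_ops] by simp
next
  case (ops_add_gen h r)
  then show ?case using G_add[OF ops_add_gen(4) G_closed ops_closed] G_comm by simp
qed

lemma ops_commute:
  assumes "r \<in> ops" "s \<in> ops"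
  shows "r \<circ> s = s \<circ> r"
proof -
  have "r (s \<xi>) = s (r \<xi>)" if "\<xi> \<in> \<Lambda>" for \<xi>
    using assms(1)
  proof (induction rule: ops.induct)
    case ops_zero
    then show ?case using ops_null assms(2) by simp
  next
    case (ops_add_gen g r)
    then show ?case
      using ops_additive[OF assms(2) G_closed[OF ops_add_gen(1) that] ops_closed[OF ops_add_gen(2) that]]
        gen_commute[OF assms(2) ops_add_gen(1) that] by simp
  qed
  moreover have "r (s \<xi>) = s (r \<xi>)" if "\<xi> \<notin> \<Lambda>" for \<xi>
    using that assms by (simp add: ops_outside ops_null)
  ultimately show ?thesis by (auto simp: fun_eq_iff comp_def)
qed

definition one_op where "one_op = (\<lambda>\<xi>. if \<xi> \<in> \<Lambda> then \<xi> else (\<lambda>_. \<zero>))"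

definition OR :: "(('i \<Rightarrow> 'a) \<Rightarrow> 'i \<Rightarrow> 'a) ring" where
  "OR = \<lparr>carrier = ops, monoid.mult = (\<circ>), one = one_op, zero = (\<lambda>_ _. \<zero>),
     add = (\<lambda>r s \<xi> i. r \<xi> i \<oplus> s \<xi> i)\<rparr>"

lemma OR_simps [simp]:
  "carrier OR = ops" "r \<otimes>\<^bsub>OR\<^esub> s = r \<circ> s" "\<one>\<^bsub>OR\<^esub> = one_op" "\<zero>\<^bsub>OR\<^esub> = (\<lambda>_ _. \<zero>)"
  "r \<oplus>\<^bsub>OR\<^esub> s = (\<lambda>\<xi> i. r \<xi> i \<oplus> s \<xi> i)"
  by (simp_all add: OR_def)

lemma OR_cring: "cring OR"
proof (rule cringI[OF abelian_groupI comm_monoidI])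
  fix r s assume r: "r \<in> carrier OR" and s: "s \<in> carrier OR"
  show "r \<oplus>\<^bsub>OR\<^esub> s \<in> carrier OR" "r \<otimes>\<^bsub>OR\<^esub> s \<in> carrier OR" using r s by (auto simp: ops_add ops_comp)
  show "r \<oplus>\<^bsub>OR\<^esub> s = s \<oplus>\<^bsub>OR\<^esub> r" using r s by (simp add: a_comm)
  show "r \<otimes>\<^bsub>OR\<^esub> s = s \<otimes>\<^bsub>OR\<^esub> r" using r s ops_commute by simp
  fix t assume t: "t \<in> carrier OR"
  show "r \<oplus>\<^bsub>OR\<^esub> s \<oplus>\<^bsub>OR\<^esub> t = r \<oplus>\<^bsub>OR\<^esub> (s \<oplus>\<^bsub>OR\<^esub> t)" using r s t by (simp add: a_assoc)
  show "r \<otimes>\<^bsub>OR\<^esub> s \<otimes>\<^bsub>OR\<^esub> t = r \<otimes>\<^bsub>OR\<^esub> (s \<otimes>\<^bsub>OR\<^esub> t)" by (simp add: comp_assoc)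
  show "(r \<oplus>\<^bsub>OR\<^esub> s) \<otimes>\<^bsub>OR\<^esub> t = r \<otimes>\<^bsub>OR\<^esub> t \<oplus>\<^bsub>OR\<^esub> s \<otimes>\<^bsub>OR\<^esub> t" by (simp add: comp_def)
next
  show "\<zero>\<^bsub>OR\<^esub> \<in> carrier OR" "\<one>\<^bsub>OR\<^esub> \<in> carrier OR"
    using ops_zero gen_ops[OF G_one] by (simp_all add: one_op_def)
next
  fix r assume r: "r \<in> carrier OR"
  show "\<zero>\<^bsub>OR\<^esub> \<oplus>\<^bsub>OR\<^esub> r = r" using r by simp
  have "one_op (r \<xi>) = r \<xi>" for \<xi>
    using r ops_closed[of r \<xi>] ops_outside[of r \<xi>] by (cases "\<xi> \<in> \<Lambda>") (auto simp: one_op_def)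
  then show "\<one>\<^bsub>OR\<^esub> \<otimes>\<^bsub>OR\<^esub> r = r" by (simp add: comp_def)
  show "\<exists>s\<in>carrier OR. s \<oplus>\<^bsub>OR\<^esub> r = \<zero>\<^bsub>OR\<^esub>"
    using r ops_minus[of r] by (intro bexI[of _ "\<lambda>\<xi> i. \<ominus> r \<xi> i"]) (auto simp: l_neg)
qed

definition dO :: "(('i \<Rightarrow> 'a) \<Rightarrow> 'i \<Rightarrow> 'a) \<Rightarrow> ('i \<Rightarrow> 'a) \<Rightarrow> 'i \<Rightarrow> 'a" where
  "dO r = (\<lambda>\<xi> i. if \<xi> \<in> \<Lambda> then nab (r \<xi>) i \<ominus> r (nab \<xi>) i else \<zero>)"

lemma nab_carrier [simp]: "\<xi> \<in> \<Lambda> \<Longrightarrow> nab \<xi> i \<in> carrier F"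
  using \<Lambda>_carrier[OF nab_closed] .

lemma dO_gen:
  assumes "g \<in> G" "h \<in> ops" "\<And>\<xi>. \<xi> \<in> \<Lambda> \<Longrightarrow> nab (g \<xi>) = (\<lambda>i. h \<xi> i \<oplus> g (nab \<xi>) i)"
  shows "dO g = h"
proof -
  have "x \<oplus> y \<ominus> y = x" if "x \<in> carrier F" "y \<in> carrier F" for x y
    using that by (simp add: a_minus_def a_assoc r_neg)
  then have "dO g \<xi> = h \<xi>" for \<xi> using assms by (auto simp: dO_def ops_outside)
  then show ?thesis by blast
qed

lemma nab_zero: "nab (\<lambda>_. \<zero>) = (\<lambda>_. \<zero>)"
proof -
  have "nab (\<lambda>_. \<zero>) i = nab (\<lambda>_. \<zero>) i \<oplus> nab (\<lambda>_. \<zero>) i" for i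
    using fun_cong[OF nab_add[OF \<Lambda>_zero \<Lambda>_zero], of i] by simp
  then have "nab (\<lambda>_. \<zero>) i = \<zero>" for i using idem_zero[OF nab_carrier[OF \<Lambda>_zero]] by blast
  then show ?thesis by (rule ext)
qed

lemma dO_add:
  assumes r: "r \<in> ops" and s: "s \<in> ops"
  shows "dO (\<lambda>\<xi> i. r \<xi> i \<oplus> s \<xi> i) = (\<lambda>\<xi> i. dO r \<xi> i \<oplus> dO s \<xi> i)"
proof -
  have eq: "(a \<oplus> b) \<ominus> (a' \<oplus> b') = (a \<ominus> a') \<oplus> (b \<ominus> b')"
    if "a \<in> carrier F" "b \<in> carrier F" "a' \<in> carrier F" "b' \<in> carrier F" for a b a' b'
    using that by (simp add: a_minus_def minus_add a_ac)
  have "dO (\<lambda>\<xi> i. r \<xi> i \<oplus> s \<xi> i) \<xi> i = dO r \<xi> i \<oplus> dO s \<xi> i" for \<xi> i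
  proof (cases "\<xi> \<in> \<Lambda>")
    case True
    note rs = ops_closed[OF r True] ops_closed[OF s True]
    show ?thesis using True r s rs by (simp add: dO_def nab_add eq)
  qed (simp add: dO_def)
  then show ?thesis by blast
qed

lemma dO_closed: "r \<in> ops \<Longrightarrow> dO r \<in> ops"
proof (induction rule: ops.induct)
  case ops_zero
  have "dO (\<lambda>_ _. \<zero>) = (\<lambda>_ _. \<zero>)" by (auto simp: dO_def nab_zero a_minus_def fun_eq_iff)
  then show ?case using ops.ops_zero by simp
next
  case (ops_add_gen g r)
  obtain h h' where h: "h \<in> G" "h' \<in> G"
    "\<And>\<xi>. \<xi> \<in> \<Lambda> \<Longrightarrow> nab (g \<xi>) = (\<lambda>i. (h \<xi> i \<oplus> h' \<xi> i) \<oplus> g (nab \<xi>) i)"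
    using nab_comm[OF ops_add_gen(1)] by blast
  have hh: "(\<lambda>\<xi> i. h \<xi> i \<oplus> h' \<xi> i) \<in> ops" by (rule ops_add[OF gen_ops[OF h(1)] gen_ops[OF h(2)]])
  have "dO g = (\<lambda>\<xi> i. h \<xi> i \<oplus> h' \<xi> i)" by (rule dO_gen[OF ops_add_gen(1) hh h(3)])
  then show ?case
    using dO_add[OF gen_ops[OF ops_add_gen(1)] ops_add_gen(2)] ops_add[OF hh ops_add_gen(3)] by simp
qed

text \<open>The commutator identity \<open>[nab, r s] = [nab, r] s + r [nab, s]\<close>. As
  \<open>nab\<close> need not belong to the ring, \<open>r (nab (s \<xi>))\<close> is inserted by
  hand, and additivity of \<open>r\<close> splits it.\<close>

lemma dO_comp:
  assumes r: "r \<in> ops" and s: "s \<in> ops"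
  shows "dO (r \<circ> s) = (\<lambda>\<xi> i. (dO r \<circ> s) \<xi> i \<oplus> (r \<circ> dO s) \<xi> i)"
proof -
  have "dO (r \<circ> s) \<xi> i = dO r (s \<xi>) i \<oplus> r (dO s \<xi>) i" for \<xi> i
  proof (cases "\<xi> \<in> \<Lambda>")
    case True
    note sl = ops_closed[OF s True] and nl = nab_closed[OF True]
    note nsl = nab_closed[OF sl] and snl = ops_closed[OF s nl]
    have "dO s \<xi> \<in> \<Lambda>" by (rule ops_closed[OF dO_closed[OF s] True])
    have "nab (s \<xi>) = (\<lambda>i. dO s \<xi> i \<oplus> s (nab \<xi>) i)"
      using True s sl snl by (simp add: dO_def a_minus_def a_assoc l_neg fun_eq_iff)
    then have "r (nab (s \<xi>)) = (\<lambda>i. r (dO s \<xi>) i \<oplus> r (s (nab \<xi>)) i)"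
      using ops_additive[OF r \<open>dO s \<xi> \<in> \<Lambda>\<close> snl] by simp
    then have *: "r (nab (s \<xi>)) i = r (dO s \<xi>) i \<oplus> r (s (nab \<xi>)) i" by simp
    have eq: "(a \<ominus> (b \<oplus> e)) \<oplus> b = a \<ominus> e"
      if "a \<in> carrier F" "b \<in> carrier F" "e \<in> carrier F" for a b e
      using that by (simp add: a_minus_def minus_add a_ac l_neg r_neg r_neg1 r_neg2)
    have "dO (r \<circ> s) \<xi> i = nab (r (s \<xi>)) i \<ominus> r (s (nab \<xi>)) i" using True by (simp add: dO_def)
    also have "\<dots> = (nab (r (s \<xi>)) i \<ominus> r (nab (s \<xi>)) i) \<oplus> r (dO s \<xi>) i"
      unfolding * using eq r ops_closed[OF r sl] by simp
    also have "\<dots> = dO r (s \<xi>) i \<oplus> r (dO s \<xi>) i" using sl by (simp add: dO_def)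
    finally show ?thesis .
  next
    case False
    have "dO r (\<lambda>_. \<zero>) = (\<lambda>_. \<zero>)" "r (\<lambda>_. \<zero>) = (\<lambda>_. \<zero>)"
      using ops_null[OF dO_closed[OF r]] ops_null[OF r] by auto
    then show ?thesis using False ops_outside[OF s False] ops_outside[OF dO_closed[OF s] False] by (simp add: dO_def)
  qed
  then show ?thesis by (auto simp: comp_def)
qed

lemma OR_derivation: "derivation_ring OR dO"
  using OR_cring dO_closed dO_add dO_comp
  by (simp add: derivation_ring_def derivation_ring_axioms_def)

lemma OR_char: "[(n::nat)] \<cdot>\<^bsub>OR\<^esub> r = (\<lambda>\<xi> i. [n] \<cdot> r \<xi> i)"
proof -
  interpret OR: cring OR by (rule OR_cring)
  show ?thesis by (induction n) (simp_all add: )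
qed

text \<open>An element of \<open>ops\<close> is a finite sum of generators, so a list of codes of
  generators names it. This supplies the coding hypothesis of
  \<open>exists_differential_field_hom\<close>.\<close>

lemma ops_coded:
  fixes \<gamma> :: "'u::infinite list \<Rightarrow> ('i \<Rightarrow> 'a) \<Rightarrow> 'i \<Rightarrow> 'a"
  assumes "G \<subseteq> range \<gamma>"
  shows "\<exists>g :: 'u list \<Rightarrow> ('i \<Rightarrow> 'a) \<Rightarrow> 'i \<Rightarrow> 'a. carrier OR \<subseteq> range g"
proof -
  obtain e :: "'u list \<Rightarrow> 'u" where e: "inj e" using exists_inj_lists by blast
  define g where "g = (\<lambda>xs. foldr (\<lambda>x r \<xi> i. \<gamma> (inv_into UNIV e x) \<xi> i \<oplus> r \<xi> i) xs (\<lambda>_ _. \<zero>))"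
  have "r \<in> range g" if "r \<in> ops" for r
    using that
  proof (induction rule: ops.induct)
    case ops_zero
    have "g [] = (\<lambda>_ _. \<zero>)" by (simp add: g_def)
    then show ?case by (metis rangeI)
  next
    case (ops_add_gen h r)
    obtain xs where xs: "r = g xs" using ops_add_gen by blast
    obtain ys where ys: "h = \<gamma> ys" using ops_add_gen assms by blast
    have "g (e ys # xs) = (\<lambda>\<xi> i. h \<xi> i \<oplus> r \<xi> i)"
      using xs ys e by (simp add: g_def)
    then show ?case by (metis rangeI)
  qed
  then show ?thesis by auto
qed

end

section \<open>Amalgamation of differential fields\<close>

lemma (in ring) span_cons_iff:
  "v \<in> Span K (u # us) \<longleftrightarrow> (\<exists>k\<in>K. \<exists>w\<in>Span K us. v = k \<otimes> u \<oplus> w)"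
  by (simp add: line_extension_mem_iff)

lemma (in ring) span_nil [simp]: "Span K [] = {\<zero>}"
  by simp

lemma (in field) nat_pow_nonzero:
  "\<lbrakk>x \<in> carrier R; x \<noteq> \<zero>\<rbrakk> \<Longrightarrow> x [^] (n::nat) \<noteq> \<zero>"
  by (induction n) (auto simp: integral_iff)

lemma (in field) inv_nonzero:
  assumes "x \<in> carrier R" "x \<noteq> \<zero>"
  shows "inv x \<in> carrier R" "x \<otimes> inv x = \<one>" "inv x \<otimes> x = \<one>" "inv x \<noteq> \<zero>"
proof -
  have x: "x \<in> Units R" using assms by (simp add: field_Units)
  show "inv x \<in> carrier R" "x \<otimes> inv x = \<one>" "inv x \<otimes> x = \<one>" using x by auto
  then show "inv x \<noteq> \<zero>" using assms by (metis r_null one_not_zero)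
qed

section \<open>Differential fields of characteristic p\<close>

locale dfield =
  fixes p :: nat and U :: "'u diff_ring" (structure)
  assumes prime_p: "prime p" and diff_field: "differential_field p U"

sublocale dfield \<subseteq> field U
  using diff_field by (simp add: differential_field_def)

sublocale dfield \<subseteq> differential_ring U
  using diff_field by (simp add: differential_field_def)

sublocale dfield \<subseteq> derivation_ring U "der U"
  by unfold_locales (auto intro: der_closed der_add der_mult)

context dfield
begin

lemma char_p: "[p] \<cdot> \<one> = \<zero>"
  using diff_field by (simp add: differential_field_def)

lemma p_gt: "p > 1" "p > 0" "p \<noteq> 0"
  using prime_gt_1_nat[OF prime_p] by auto

lemma frob_add: "\<lbrakk>x \<in> carrier U; y \<in> carrier U\<rbrakk> \<Longrightarrow> (x \<oplus> y) [^] p = x [^] p \<oplus> y [^] p"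
  by (rule freshmans_dream[OF prime_p char_p])

lemma frob_zero: "\<zero> [^] p = \<zero>"
  using p_gt by (simp add: nat_pow_zero)

lemma frob_eq_zero: "x \<in> carrier U \<Longrightarrow> x [^] p = \<zero> \<longleftrightarrow> x = \<zero>"
  using nat_pow_nonzero frob_zero by auto

lemma frob_mult: "\<lbrakk>x \<in> carrier U; y \<in> carrier U\<rbrakk> \<Longrightarrow> (x \<otimes> y) [^] p = x [^] p \<otimes> y [^] p"
  by (rule nat_pow_distrib)

lemma frob_minus: "x \<in> carrier U \<Longrightarrow> (\<ominus> x) [^] p = \<ominus> (x [^] p)"
  using frob_add[of x "\<ominus> x"] frob_zero by (simp add: r_neg) (metis a_comm a_inv_closed minus_equality nat_pow_closed)

lemma frob_diff: "\<lbrakk>x \<in> carrier U; y \<in> carrier U\<rbrakk> \<Longrightarrow> (x \<ominus> y) [^] p = x [^] p \<ominus> y [^] p"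
  by (simp add: a_minus_def frob_add frob_minus)

lemma frob_inj: "\<lbrakk>x \<in> carrier U; y \<in> carrier U; x [^] p = y [^] p\<rbrakk> \<Longrightarrow> x = y"
  using frob_diff[of x y] frob_eq_zero[of "x \<ominus> y"] by simp

end

section \<open>Tensor products as operators on semilinear maps\<close>

definition diff_hom_on :: "'u set \<Rightarrow> 'u diff_ring \<Rightarrow> 'v diff_ring \<Rightarrow> ('u \<Rightarrow> 'v) \<Rightarrow> bool" where
  "diff_hom_on K U M \<sigma> \<longleftrightarrow> (\<forall>x\<in>K. \<sigma> x \<in> carrier M) \<and> \<sigma> \<one>\<^bsub>U\<^esub> = \<one>\<^bsub>M\<^esub> \<and>
     (\<forall>x\<in>K. \<forall>y\<in>K. \<sigma> (x \<oplus>\<^bsub>U\<^esub> y) = \<sigma> x \<oplus>\<^bsub>M\<^esub> \<sigma> y) \<and>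
     (\<forall>x\<in>K. \<forall>y\<in>K. \<sigma> (x \<otimes>\<^bsub>U\<^esub> y) = \<sigma> x \<otimes>\<^bsub>M\<^esub> \<sigma> y) \<and> (\<forall>x\<in>K. \<sigma> (der U x) = der M (\<sigma> x))"

lemma diff_hom_onD:
  assumes "diff_hom_on K U M \<sigma>"
  shows "x \<in> K \<Longrightarrow> \<sigma> x \<in> carrier M" "\<sigma> \<one>\<^bsub>U\<^esub> = \<one>\<^bsub>M\<^esub>"
    "\<lbrakk>x \<in> K; y \<in> K\<rbrakk> \<Longrightarrow> \<sigma> (x \<oplus>\<^bsub>U\<^esub> y) = \<sigma> x \<oplus>\<^bsub>M\<^esub> \<sigma> y"
    "\<lbrakk>x \<in> K; y \<in> K\<rbrakk> \<Longrightarrow> \<sigma> (x \<otimes>\<^bsub>U\<^esub> y) = \<sigma> x \<otimes>\<^bsub>M\<^esub> \<sigma> y"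
    "x \<in> K \<Longrightarrow> \<sigma> (der U x) = der M (\<sigma> x)"
  using assms unfolding diff_hom_on_def by blast+

text \<open>The data of the tensor product of \<open>U\<close> and \<open>M\<close> over
  \<open>K\<close>, where \<open>K\<close> acts on \<open>M\<close> through \<open>\<sigma>\<close>.
  The ring is realised by operators, so that two sums of tensors are equal as soon as they act
  alike.\<close>

locale tensor = dfield p U + M: dfield p M
  for p and U :: "'u diff_ring" (structure) and M :: "'u diff_ring" +
  fixes K :: "'u set" and \<sigma> :: "'u \<Rightarrow> 'u"
  assumes K: "subfield K U"
    and K_der: "k \<in> K \<Longrightarrow> der U k \<in> K"
    and \<sigma>: "diff_hom_on K U M \<sigma>"
begin

lemmas \<sigma>_closed [simp] = diff_hom_onD(1)[OF \<sigma>] and \<sigma>_one = diff_hom_onD(2)[OF \<sigma>]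
  and \<sigma>_add = diff_hom_onD(3)[OF \<sigma>] and \<sigma>_mult = diff_hom_onD(4)[OF \<sigma>] and \<sigma>_der = diff_hom_onD(5)[OF \<sigma>]

lemma K_closed [simp]: "k \<in> K \<Longrightarrow> k \<in> carrier U" using subfieldE(3)[OF K] by blast
lemma K_zero [simp]: "\<zero> \<in> K" and K_one [simp]: "\<one> \<in> K"
  and K_add: "\<lbrakk>a \<in> K; b \<in> K\<rbrakk> \<Longrightarrow> a \<oplus> b \<in> K" and K_mult: "\<lbrakk>a \<in> K; b \<in> K\<rbrakk> \<Longrightarrow> a \<otimes> b \<in> K"
  and K_minus: "a \<in> K \<Longrightarrow> \<ominus> a \<in> K"
  using subringE[OF subfieldE(1)[OF K]] by auto

lemma \<sigma>_zero: "\<sigma> \<zero> = \<zero>\<^bsub>M\<^esub>"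
  using \<sigma>_add[of \<zero> \<zero>] M.add.r_cancel_one'[of "\<sigma> \<zero>" "\<sigma> \<zero>"] by simp

text \<open>The \<open>\<sigma>\<close>-semilinear maps from \<open>U\<close> to \<open>M\<close>,
  that is, the \<open>M\<close>-dual of the tensor product. The value zero off the carrier turns
  equality of maps into equality of functions.\<close>

definition \<Lambda> :: "('u \<Rightarrow> 'u) set" where
  "\<Lambda> = {l. (\<forall>x. x \<notin> carrier U \<longrightarrow> l x = \<zero>\<^bsub>M\<^esub>) \<and> (\<forall>x. l x \<in> carrier M) \<and>
     (\<forall>x\<in>carrier U. \<forall>y\<in>carrier U. l (x \<oplus> y) = l x \<oplus>\<^bsub>M\<^esub> l y) \<and>
     (\<forall>k\<in>K. \<forall>x\<in>carrier U. l (k \<otimes> x) = \<sigma> k \<otimes>\<^bsub>M\<^esub> l x)}"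

lemma \<Lambda>I:
  assumes "\<And>x. x \<notin> carrier U \<Longrightarrow> l x = \<zero>\<^bsub>M\<^esub>" "\<And>x. x \<in> carrier U \<Longrightarrow> l x \<in> carrier M"
    "\<And>x y. \<lbrakk>x \<in> carrier U; y \<in> carrier U\<rbrakk> \<Longrightarrow> l (x \<oplus> y) = l x \<oplus>\<^bsub>M\<^esub> l y"
    "\<And>k x. \<lbrakk>k \<in> K; x \<in> carrier U\<rbrakk> \<Longrightarrow> l (k \<otimes> x) = \<sigma> k \<otimes>\<^bsub>M\<^esub> l x"
  shows "l \<in> \<Lambda>"
  using assms unfolding \<Lambda>_def by (auto, metis M.zero_closed)

lemma \<Lambda>D:
  assumes "l \<in> \<Lambda>"
  shows "x \<notin> carrier U \<Longrightarrow> l x = \<zero>\<^bsub>M\<^esub>" "l x \<in> carrier M"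
    "\<lbrakk>x \<in> carrier U; y \<in> carrier U\<rbrakk> \<Longrightarrow> l (x \<oplus> y) = l x \<oplus>\<^bsub>M\<^esub> l y"
    "\<lbrakk>k \<in> K; x \<in> carrier U\<rbrakk> \<Longrightarrow> l (k \<otimes> x) = \<sigma> k \<otimes>\<^bsub>M\<^esub> l x"
  using assms unfolding \<Lambda>_def by blast+

lemma \<Lambda>_null: "l \<in> \<Lambda> \<Longrightarrow> l \<zero> = \<zero>\<^bsub>M\<^esub>"
  using \<Lambda>D(3)[of l \<zero> \<zero>] \<Lambda>D(2)[of l \<zero>] M.add.r_cancel_one'[of "l \<zero>" "l \<zero>"] by simp

text \<open>The tensor of \<open>f\<close> in \<open>M\<close> and \<open>u\<close> in
  \<open>U\<close>: \<open>u\<close> multiplies the argument and \<open>f\<close> the value.\<close>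

definition gen :: "'u \<Rightarrow> 'u \<Rightarrow> ('u \<Rightarrow> 'u) \<Rightarrow> 'u \<Rightarrow> 'u" where
  "gen f u = (\<lambda>l x. if l \<in> \<Lambda> \<and> x \<in> carrier U then f \<otimes>\<^bsub>M\<^esub> l (u \<otimes> x) else \<zero>\<^bsub>M\<^esub>)"

definition G where "G = {gen f u | f u. f \<in> carrier M \<and> u \<in> carrier U}"

text \<open>The derivation induced on the dual, \<open>D \<circ> l - l \<circ> D\<close>. It
  preserves semilinearity because \<open>\<sigma>\<close> commutes with the derivations, and its
  commutator with the tensor of \<open>f\<close> and \<open>u\<close> is the product rule for
  tensors.\<close>

definition nab :: "('u \<Rightarrow> 'u) \<Rightarrow> 'u \<Rightarrow> 'u" where
  "nab l = (\<lambda>x. if x \<in> carrier U then der M (l x) \<ominus>\<^bsub>M\<^esub> l (der U x) else \<zero>\<^bsub>M\<^esub>)"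

lemma gen_closed:
  assumes f: "f \<in> carrier M" and u: "u \<in> carrier U" and l: "l \<in> \<Lambda>"
  shows "gen f u l \<in> \<Lambda>"
proof (rule \<Lambda>I)
  fix k x assume kx: "k \<in> K" "x \<in> carrier U"
  then have "u \<otimes> (k \<otimes> x) = k \<otimes> (u \<otimes> x)" using u by (simp add: m_lcomm)
  then have "l (u \<otimes> (k \<otimes> x)) = \<sigma> k \<otimes>\<^bsub>M\<^esub> l (u \<otimes> x)" using \<Lambda>D(4)[OF l kx(1)] u kx by simp
  then show "gen f u l (k \<otimes> x) = \<sigma> k \<otimes>\<^bsub>M\<^esub> gen f u l x"
    using kx u f l \<Lambda>D(2)[OF l] by (simp add: gen_def M.m_lcomm)
next
  fix x y assume xy: "x \<in> carrier U" "y \<in> carrier U"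
  then show "gen f u l (x \<oplus> y) = gen f u l x \<oplus>\<^bsub>M\<^esub> gen f u l y"
    using u f l \<Lambda>D(2,3)[OF l] by (simp add: gen_def r_distr M.r_distr)
qed (use f \<Lambda>D(2)[OF l] in \<open>auto simp: gen_def\<close>)

lemma gen_comp:
  assumes f: "f \<in> carrier M" "g \<in> carrier M" and u: "u \<in> carrier U" "v \<in> carrier U"
  shows "gen f u (gen g v l) = gen (f \<otimes>\<^bsub>M\<^esub> g) (u \<otimes> v) l"
proof (cases "l \<in> \<Lambda>")
  case True
  have "v \<otimes> (u \<otimes> x) = (u \<otimes> v) \<otimes> x" if "x \<in> carrier U" for x using that u by (simp add: m_ac)
  then show ?thesis
    using True gen_closed[OF f(2) u(2) True] f u \<Lambda>D(2)[OF True] by (auto simp: gen_def fun_eq_iff M.m_assoc)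
next
  case False
  then show ?thesis using f by (auto simp: gen_def fun_eq_iff)
qed

lemma gen_cases:
  assumes "g \<in> G" obtains f u where "g = gen f u" "f \<in> carrier M" "u \<in> carrier U"
  using assms unfolding G_def by blast

lemma gen_in: "\<lbrakk>f \<in> carrier M; u \<in> carrier U\<rbrakk> \<Longrightarrow> gen f u \<in> G"
  unfolding G_def by blast

lemma \<Lambda>_add: "\<lbrakk>l \<in> \<Lambda>; m \<in> \<Lambda>\<rbrakk> \<Longrightarrow> (\<lambda>i. l i \<oplus>\<^bsub>M\<^esub> m i) \<in> \<Lambda>"
  by (rule \<Lambda>I) (simp_all add: \<Lambda>D M.a_ac M.r_distr)

lemma nab_closed:
  assumes l: "l \<in> \<Lambda>" shows "nab l \<in> \<Lambda>"
proof (rule \<Lambda>I)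
  fix x y assume xy: "x \<in> carrier U" "y \<in> carrier U"
  have eq: "(a \<oplus>\<^bsub>M\<^esub> b) \<ominus>\<^bsub>M\<^esub> (a' \<oplus>\<^bsub>M\<^esub> b') = (a \<ominus>\<^bsub>M\<^esub> a') \<oplus>\<^bsub>M\<^esub> (b \<ominus>\<^bsub>M\<^esub> b')"
    if "a \<in> carrier M" "b \<in> carrier M" "a' \<in> carrier M" "b' \<in> carrier M" for a b a' b'
    using that by (simp add: a_minus_def M.minus_add M.a_ac)
  show "nab l (x \<oplus> y) = nab l x \<oplus>\<^bsub>M\<^esub> nab l y"
    using xy \<Lambda>D(2,3)[OF l] by (simp add: nab_def d_add M.d_add eq)
next
  fix k x assume kx: "k \<in> K" "x \<in> carrier U"
  have eq: "(a \<otimes>\<^bsub>M\<^esub> b \<oplus>\<^bsub>M\<^esub> s \<otimes>\<^bsub>M\<^esub> c) \<ominus>\<^bsub>M\<^esub> (a \<otimes>\<^bsub>M\<^esub> b \<oplus>\<^bsub>M\<^esub> s \<otimes>\<^bsub>M\<^esub> e) = s \<otimes>\<^bsub>M\<^esub> (c \<ominus>\<^bsub>M\<^esub> e)"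
    if "a \<in> carrier M" "b \<in> carrier M" "s \<in> carrier M" "c \<in> carrier M" "e \<in> carrier M" for a b s c e
    by (use M.in_carrier_Cons M.in_carrier_Nil M.norm_eq[OF _ ring_norm_9, of "[a, b, s, c, e]"] that in simp)
  show "nab l (k \<otimes> x) = \<sigma> k \<otimes>\<^bsub>M\<^esub> nab l x"
    using kx K_der[OF kx(1)] \<Lambda>D(2)[OF l]
    by (simp add: nab_def d_mult M.d_mult \<Lambda>D(3,4)[OF l] \<sigma>_der eq)
qed (use \<Lambda>D(2)[OF l] in \<open>auto simp: nab_def\<close>)

lemma nab_gen:
  assumes f: "f \<in> carrier M" and u: "u \<in> carrier U" and l: "l \<in> \<Lambda>"
  shows "nab (gen f u l) = (\<lambda>i. (gen (der M f) u l i \<oplus>\<^bsub>M\<^esub> gen f (der U u) l i) \<oplus>\<^bsub>M\<^esub> gen f u (nab l) i)"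
proof (rule ext)
  fix x
  note lD = \<Lambda>D(2,3)[OF l] and nl = nab_closed[OF l]
  show "nab (gen f u l) x = (gen (der M f) u l x \<oplus>\<^bsub>M\<^esub> gen f (der U u) l x) \<oplus>\<^bsub>M\<^esub> gen f u (nab l) x"
  proof (cases "x \<in> carrier U")
    case x: True
    have eq: "(a \<otimes>\<^bsub>M\<^esub> b \<oplus>\<^bsub>M\<^esub> f \<otimes>\<^bsub>M\<^esub> c) \<ominus>\<^bsub>M\<^esub> f \<otimes>\<^bsub>M\<^esub> e = (a \<otimes>\<^bsub>M\<^esub> b \<oplus>\<^bsub>M\<^esub> f \<otimes>\<^bsub>M\<^esub> s) \<oplus>\<^bsub>M\<^esub> f \<otimes>\<^bsub>M\<^esub> (c \<ominus>\<^bsub>M\<^esub> (s \<oplus>\<^bsub>M\<^esub> e))"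
      if "a \<in> carrier M" "b \<in> carrier M" "f \<in> carrier M" "c \<in> carrier M" "e \<in> carrier M" "s \<in> carrier M" for a b c e s f
      by (use M.in_carrier_Cons M.in_carrier_Nil M.norm_eq[OF _ ring_norm_10, of "[a, b, f, c, e, s]"] that in simp)
    have 1: "gen f u l x = f \<otimes>\<^bsub>M\<^esub> l (u \<otimes> x)" "gen f u l (der U x) = f \<otimes>\<^bsub>M\<^esub> l (u \<otimes> der U x)"
      "gen (der M f) u l x = der M f \<otimes>\<^bsub>M\<^esub> l (u \<otimes> x)" "gen f (der U u) l x = f \<otimes>\<^bsub>M\<^esub> l (der U u \<otimes> x)"
      using x l by (simp_all add: gen_def)
    have 2: "gen f u (nab l) x = f \<otimes>\<^bsub>M\<^esub> (der M (l (u \<otimes> x)) \<ominus>\<^bsub>M\<^esub> l (der U u \<otimes> x \<oplus> u \<otimes> der U x))"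
      using x u nl by (simp add: gen_def nab_def d_mult)
    have 3: "l (der U u \<otimes> x \<oplus> u \<otimes> der U x) = l (der U u \<otimes> x) \<oplus>\<^bsub>M\<^esub> l (u \<otimes> der U x)"
      using x u by (intro lD(2)) auto
    have "nab (gen f u l) x = (der M f \<otimes>\<^bsub>M\<^esub> l (u \<otimes> x) \<oplus>\<^bsub>M\<^esub> f \<otimes>\<^bsub>M\<^esub> der M (l (u \<otimes> x))) \<ominus>\<^bsub>M\<^esub> f \<otimes>\<^bsub>M\<^esub> l (u \<otimes> der U x)"
      using x f lD(1) by (simp add: nab_def 1 M.d_mult)
    also have "\<dots> = (gen (der M f) u l x \<oplus>\<^bsub>M\<^esub> gen f (der U u) l x) \<oplus>\<^bsub>M\<^esub> gen f u (nab l) x"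
      unfolding 1 2 3 using f lD(1) by (intro eq) auto
    finally show ?thesis .
  qed (simp add: nab_def gen_def)
qed

lemma gen_add_left:
  assumes "f \<in> carrier M" "g \<in> carrier M" "u \<in> carrier U"
  shows "gen (f \<oplus>\<^bsub>M\<^esub> g) u = (\<lambda>l x. gen f u l x \<oplus>\<^bsub>M\<^esub> gen g u l x)"
  using assms \<Lambda>D(2) by (auto simp: gen_def fun_eq_iff M.l_distr)

lemma gen_add_right:
  assumes "f \<in> carrier M" "u \<in> carrier U" "v \<in> carrier U"
  shows "gen f (u \<oplus> v) = (\<lambda>l x. gen f u l x \<oplus>\<^bsub>M\<^esub> gen f v l x)"
proof (intro ext)
  fix l x
  show "gen f (u \<oplus> v) l x = gen f u l x \<oplus>\<^bsub>M\<^esub> gen f v l x"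
  proof (cases "l \<in> \<Lambda> \<and> x \<in> carrier U")
    case True
    then have l: "l \<in> \<Lambda>" and x: "x \<in> carrier U" by auto
    show ?thesis using assms x l \<Lambda>D(2)[OF l] by (simp add: gen_def l_distr \<Lambda>D(3)[OF l] M.r_distr)
  qed (use assms in \<open>auto simp: gen_def\<close>)
qed

lemma gen_K:
  assumes "f \<in> carrier M" "k \<in> K" "u \<in> carrier U"
  shows "gen f (k \<otimes> u) = gen (f \<otimes>\<^bsub>M\<^esub> \<sigma> k) u"
proof (intro ext)
  fix l x
  show "gen f (k \<otimes> u) l x = gen (f \<otimes>\<^bsub>M\<^esub> \<sigma> k) u l x"
  proof (cases "l \<in> \<Lambda> \<and> x \<in> carrier U")
    case True
    then have l: "l \<in> \<Lambda>" and x: "x \<in> carrier U" by auto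
    show ?thesis using assms x l \<Lambda>D(2)[OF l] by (simp add: gen_def m_assoc \<Lambda>D(4)[OF l] M.m_assoc)
  qed (use assms in \<open>auto simp: gen_def\<close>)
qed

lemma gen_zero_left: "u \<in> carrier U \<Longrightarrow> gen \<zero>\<^bsub>M\<^esub> u = (\<lambda>_ _. \<zero>\<^bsub>M\<^esub>)"
  using \<Lambda>D(2) by (auto simp: gen_def fun_eq_iff)

lemma gen_zero_right: "f \<in> carrier M \<Longrightarrow> gen f \<zero> = (\<lambda>_ _. \<zero>\<^bsub>M\<^esub>)"
  by (auto simp: gen_def fun_eq_iff \<Lambda>_null[THEN arg_cong[of _ _ "(\<otimes>\<^bsub>M\<^esub>) f"]])

lemma gen_one: "gen \<one>\<^bsub>M\<^esub> \<one> = (\<lambda>l. if l \<in> \<Lambda> then l else (\<lambda>_. \<zero>\<^bsub>M\<^esub>))"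
  using \<Lambda>D(1,2) by (auto simp: gen_def fun_eq_iff)

lemma gen_minus:
  assumes "f \<in> carrier M" "u \<in> carrier U"
  shows "gen (\<ominus>\<^bsub>M\<^esub> f) u = (\<lambda>l x. \<ominus>\<^bsub>M\<^esub> gen f u l x)"
  using assms \<Lambda>D(2) by (auto simp: gen_def fun_eq_iff M.l_minus)

lemma gen_commute:
  assumes "f \<in> carrier M" "g \<in> carrier M" "u \<in> carrier U" "v \<in> carrier U"
  shows "gen f u (gen g v l) = gen g v (gen f u l)"
  using assms by (simp add: gen_comp M.m_comm m_comm)

end

context tensor
begin

lemma gen_additive:
  assumes f: "f \<in> carrier M" and u: "u \<in> carrier U" and l: "l \<in> \<Lambda>" "m \<in> \<Lambda>"
  shows "gen f u (\<lambda>i. l i \<oplus>\<^bsub>M\<^esub> m i) = (\<lambda>i. gen f u l i \<oplus>\<^bsub>M\<^esub> gen f u m i)"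
  using f u l \<Lambda>_add[OF l] \<Lambda>D(2)[OF l(1)] \<Lambda>D(2)[OF l(2)] by (simp add: gen_def fun_eq_iff M.r_distr)

lemma gen_outside: "l \<notin> \<Lambda> \<Longrightarrow> gen f u l = (\<lambda>_. \<zero>\<^bsub>M\<^esub>)"
  by (simp add: gen_def)

lemma gen_o:
  assumes "f \<in> carrier M" "g \<in> carrier M" "u \<in> carrier U" "v \<in> carrier U"
  shows "gen f u \<circ> gen g v = gen (f \<otimes>\<^bsub>M\<^esub> g) (u \<otimes> v)"
  by (rule ext) (simp add: gen_comp[OF assms])

lemma nab_additive:
  assumes l: "l \<in> \<Lambda>" "m \<in> \<Lambda>"
  shows "nab (\<lambda>i. l i \<oplus>\<^bsub>M\<^esub> m i) = (\<lambda>i. nab l i \<oplus>\<^bsub>M\<^esub> nab m i)"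
proof -
  have eq: "(a \<oplus>\<^bsub>M\<^esub> b) \<ominus>\<^bsub>M\<^esub> (a' \<oplus>\<^bsub>M\<^esub> b') = (a \<ominus>\<^bsub>M\<^esub> a') \<oplus>\<^bsub>M\<^esub> (b \<ominus>\<^bsub>M\<^esub> b')"
    if "a \<in> carrier M" "b \<in> carrier M" "a' \<in> carrier M" "b' \<in> carrier M" for a b a' b'
    using that by (simp add: a_minus_def M.minus_add M.a_ac)
  show ?thesis using \<Lambda>D(2)[OF l(1)] \<Lambda>D(2)[OF l(2)] by (auto simp: nab_def fun_eq_iff M.d_add eq)
qed

lemma G_all: "(\<forall>g\<in>G. Q g) \<longleftrightarrow> (\<forall>f\<in>carrier M. \<forall>u\<in>carrier U. Q (gen f u))"
  unfolding G_def by blast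

lemma op_ring_M: "op_ring M \<Lambda> G nab"
proof (rule op_ring.intro[OF M.is_abelian_group])
  have "\<forall>g\<in>G. \<forall>l. (l \<notin> \<Lambda> \<longrightarrow> g l = (\<lambda>_. \<zero>\<^bsub>M\<^esub>)) \<and> (l \<in> \<Lambda> \<longrightarrow> g l \<in> \<Lambda>)"
    unfolding G_all by (simp add: gen_outside gen_closed)
  moreover have "\<forall>g\<in>G. \<forall>l\<in>\<Lambda>. \<forall>m\<in>\<Lambda>. g (\<lambda>i. l i \<oplus>\<^bsub>M\<^esub> m i) = (\<lambda>i. g l i \<oplus>\<^bsub>M\<^esub> g m i)"
    unfolding G_all by (simp add: gen_additive)
  moreover have "\<forall>g\<in>G. \<forall>h\<in>G. (\<forall>l\<in>\<Lambda>. g (h l) = h (g l)) \<and> g \<circ> h \<in> G"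
    unfolding G_all by (simp add: gen_comp gen_o gen_in M.m_comm m_comm)
  moreover have "\<forall>g\<in>G. (\<lambda>l i. \<ominus>\<^bsub>M\<^esub> g l i) \<in> G"
    unfolding G_all by (simp add: gen_minus[symmetric] gen_in)
  moreover have "\<forall>g\<in>G. \<exists>h\<in>G. \<exists>h'\<in>G. \<forall>l\<in>\<Lambda>. nab (g l) = (\<lambda>i. (h l i \<oplus>\<^bsub>M\<^esub> h' l i) \<oplus>\<^bsub>M\<^esub> g (nab l) i)"
    unfolding G_all
  proof (intro ballI)
    fix f u assume "f \<in> carrier M" "u \<in> carrier U"
    then show "\<exists>h\<in>G. \<exists>h'\<in>G. \<forall>l\<in>\<Lambda>. nab (gen f u l) = (\<lambda>i. (h l i \<oplus>\<^bsub>M\<^esub> h' l i) \<oplus>\<^bsub>M\<^esub> gen f u (nab l) i)"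
      using nab_gen[of f u] gen_in[of "der M f" u] gen_in[of f "der U u"]
      by (intro bexI[of _ "gen (der M f) u"] bexI[of _ "gen f (der U u)"]) auto
  qed
  moreover have "(\<lambda>l. if l \<in> \<Lambda> then l else (\<lambda>_. \<zero>\<^bsub>M\<^esub>)) \<in> G"
    using gen_in[of "\<one>\<^bsub>M\<^esub>" \<one>] gen_one by simp
  moreover have "(\<lambda>_. \<zero>\<^bsub>M\<^esub>) \<in> \<Lambda>" by (rule \<Lambda>I) auto
  moreover have "\<forall>l\<in>\<Lambda>. \<forall>i. l i \<in> carrier M" by (auto simp: \<Lambda>_def)
  moreover have "\<forall>l\<in>\<Lambda>. \<forall>m\<in>\<Lambda>. (\<lambda>i. l i \<oplus>\<^bsub>M\<^esub> m i) \<in> \<Lambda>" by (simp add: \<Lambda>_add)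
  moreover have "\<forall>l\<in>\<Lambda>. nab l \<in> \<Lambda>" by (simp add: nab_closed)
  moreover have "\<forall>l\<in>\<Lambda>. \<forall>m\<in>\<Lambda>. nab (\<lambda>i. l i \<oplus>\<^bsub>M\<^esub> m i) = (\<lambda>i. nab l i \<oplus>\<^bsub>M\<^esub> nab m i)"
    by (simp add: nab_additive)
  ultimately show "op_ring_axioms M \<Lambda> G nab" unfolding op_ring_axioms_def by (intro conjI) (simp_all only: Ball_def simp_thms, simp_all)
qed

end

sublocale tensor \<subseteq> OP: op_ring M \<Lambda> G nab
  by (rule op_ring_M)

context tensor
begin

lemma gen_ops [simp]: "\<lbrakk>f \<in> carrier M; u \<in> carrier U\<rbrakk> \<Longrightarrow> gen f u \<in> OP.ops"
  by (rule OP.gen_ops[OF gen_in])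

lemma dO_gen:
  assumes "f \<in> carrier M" "u \<in> carrier U"
  shows "OP.dO (gen f u) = gen (der M f) u \<oplus>\<^bsub>OP.OR\<^esub> gen f (der U u)"
  using assms OP.ops_add[OF gen_ops[of "der M f" u] gen_ops[of f "der U u"]]
  by (auto intro!: OP.dO_gen gen_in simp: nab_gen)

text \<open>A subspace that is maximal among those avoiding \<open>u\<close> is a hyperplane complementary to \<open>u\<close>.\<close>

lemma exists_functional:
  assumes us: "set us \<subseteq> carrier U" and u: "u \<in> carrier U" "u \<notin> Span K us"
  shows "\<exists>l\<in>\<Lambda>. (\<forall>x\<in>Span K us. l x = \<zero>\<^bsub>M\<^esub>) \<and> l u = \<one>\<^bsub>M\<^esub>"
proof -
  define sp where "sp = (\<lambda>W. W \<subseteq> carrier U \<and> \<zero> \<in> W \<and> (\<forall>a\<in>W. \<forall>b\<in>W. a \<oplus> b \<in> W) \<and> (\<forall>k\<in>K. \<forall>a\<in>W. k \<otimes> a \<in> W))"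
  let ?A = "{W. sp W \<and> Span K us \<subseteq> W \<and> u \<notin> W}"
  have "\<exists>W\<in>?A. \<forall>X\<in>?A. W \<subseteq> X \<longrightarrow> X = W"
  proof (rule subset_Zorn_nonempty)
    show "?A \<noteq> {}"
      using u Span_subgroup_props[OF K us] Span_smult_closed[OF K us] by (auto simp: sp_def intro!: exI[of _ "Span K us"] simp del: Span.simps)
    fix \<C> assume ne: "\<C> \<noteq> {}" and ch: "subset.chain ?A \<C>"
    have sub: "sp X" "Span K us \<subseteq> X" "u \<notin> X" if "X \<in> \<C>" for X
      using ch that by (auto simp: subset.chain_def)
    have tot: "X \<subseteq> Y \<or> Y \<subseteq> X" if "X \<in> \<C>" "Y \<in> \<C>" for X Y
      using ch that by (auto simp: subset.chain_def)
    have "a \<oplus> b \<in> \<Union>\<C>" if ab: "a \<in> X" "b \<in> Y" "X \<in> \<C>" "Y \<in> \<C>" for a b X Y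
      using tot[OF ab(3,4)]
    proof
      assume "X \<subseteq> Y"
      then have "a \<oplus> b \<in> Y" using ab sub(1)[of Y] by (auto simp: sp_def)
      then show ?thesis using ab by auto
    next
      assume "Y \<subseteq> X"
      then have "a \<oplus> b \<in> X" using ab sub(1)[of X] by (auto simp: sp_def)
      then show ?thesis using ab by auto
    qed
    moreover obtain X0 where "X0 \<in> \<C>" using ne by blast
    moreover have "k \<otimes> a \<in> \<Union>\<C>" if "a \<in> X" "X \<in> \<C>" "k \<in> K" for k a X
      using sub(1)[of X] that by (intro UnionI[of X]) (auto simp: sp_def)
    moreover have "\<Union>\<C> \<subseteq> carrier U" using sub(1) unfolding sp_def by (meson Union_least)
    moreover have "\<zero> \<in> \<Union>\<C>" using sub(1) \<open>X0 \<in> \<C>\<close> by (auto simp: sp_def)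
    ultimately have "sp (\<Union>\<C>)" unfolding sp_def by (simp only: Union_iff Ball_def) meson
    then show "\<Union>\<C> \<in> ?A" using sub(2,3) \<open>X0 \<in> \<C>\<close> by auto
  qed
  then obtain W where W: "sp W" "Span K us \<subseteq> W" "u \<notin> W"
    and max: "\<And>X. sp X \<Longrightarrow> Span K us \<subseteq> X \<Longrightarrow> u \<notin> X \<Longrightarrow> W \<subseteq> X \<Longrightarrow> X = W"
    by (elim bexE) auto
  have Wc: "a \<in> carrier U" if "a \<in> W" for a using W(1) that by (auto simp: sp_def)
  have Wz: "\<zero> \<in> W" using W(1) by (auto simp: sp_def)
  have Wa: "a \<oplus> b \<in> W" if "a \<in> W" "b \<in> W" for a b using W(1) that by (auto simp: sp_def)
  have Ws: "k \<otimes> a \<in> W" if "k \<in> K" "a \<in> W" for k a using W(1) that by (auto simp: sp_def)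
  have Wm: "a \<ominus> b \<in> W" if "a \<in> W" "b \<in> W" for a b
    using Wa[OF that(1) Ws[OF K_minus[OF K_one] that(2)]] Wc that by (simp add: a_minus_def l_minus)
  have Wu: "k = \<zero>" if "k \<in> K" "k \<otimes> u \<in> W" for k
  proof (rule ccontr)
    assume "k \<noteq> \<zero>"
    then have k: "inv k \<in> K" "inv k \<otimes> k = \<one>" using subfield_m_inv[OF K, of k] that by auto
    have "inv k \<otimes> (k \<otimes> u) = (inv k \<otimes> k) \<otimes> u"
      by (rule m_assoc[symmetric]) (use k that u in auto)
    then have "u \<in> W" using Ws[OF k(1) that(2)] k(2) u by simp
    then show False using W by simp
  qed
  have ex: "\<exists>k\<in>K. x \<ominus> k \<otimes> u \<in> W" if x: "x \<in> carrier U" for x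
  proof (cases "x \<in> W")
    case True
    then show ?thesis using u x by (intro bexI[of _ \<zero>]) (auto simp: a_minus_def)
  next
    case False
    \<comment> \<open>\<open>X\<close> is spanned by \<open>W\<close> and \<open>x\<close>. By
      maximality of \<open>W\<close> it contains \<open>u\<close>, and solving for \<open>x\<close>
      yields the coordinate of \<open>x\<close> along \<open>u\<close>.\<close>
    define X where "X = {k \<otimes> x \<oplus> w | k w. k \<in> K \<and> w \<in> W}"
    have XI: "k \<otimes> x \<oplus> w \<in> X" if "k \<in> K" "w \<in> W" for k w using that by (auto simp: X_def)
    have "sp X" unfolding sp_def
    proof (intro conjI ballI)
      show "X \<subseteq> carrier U" using x Wc by (auto simp: X_def)
      show "\<zero> \<in> X" using XI[OF K_zero Wz] x by simp
      fix a assume "a \<in> X"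
      then obtain k w where 1: "a = k \<otimes> x \<oplus> w" "k \<in> K" "w \<in> W" by (auto simp: X_def)
      show "k' \<otimes> a \<in> X" if "k' \<in> K" for k'
      proof -
        have "k' \<otimes> a = (k' \<otimes> k) \<otimes> x \<oplus> k' \<otimes> w" using 1 x that Wc by (simp add: r_distr m_assoc)
        then show ?thesis using XI[OF K_mult[OF that 1(2)] Ws[OF that 1(3)]] by simp
      qed
      fix b assume "b \<in> X"
      then obtain k' w' where 2: "b = k' \<otimes> x \<oplus> w'" "k' \<in> K" "w' \<in> W" by (auto simp: X_def)
      have "a \<oplus> b = (k \<oplus> k') \<otimes> x \<oplus> (w \<oplus> w')" using 1 2 x Wc by (simp add: l_distr a_ac)
      then show "a \<oplus> b \<in> X" using XI[OF K_add[OF 1(2) 2(2)] Wa[OF 1(3) 2(3)]] by simp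
    qed
    have "W \<subseteq> X"
    proof
      fix w assume w: "w \<in> W"
      then show "w \<in> X" using XI[OF K_zero w] Wc x by simp
    qed
    moreover have "x \<in> X" using XI[OF K_one Wz] x by simp
    ultimately have "u \<in> X" using max[OF \<open>sp X\<close>] W(2) False by blast
    then obtain k w where 1: "u = k \<otimes> x \<oplus> w" "k \<in> K" "w \<in> W" by (auto simp: X_def)
    have "k \<noteq> \<zero>" using 1 x Wc[of w] W(3) by auto
    then have k: "inv k \<in> K" "inv k \<otimes> k = \<one>" using subfield_m_inv[OF K, of k] 1 by auto
    have kc: "inv k \<in> carrier U" "k \<in> carrier U" "w \<in> carrier U" using k(1) 1 Wc by auto
    have "inv k \<otimes> u = (inv k \<otimes> k) \<otimes> x \<oplus> inv k \<otimes> w"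
      unfolding 1(1) using x kc by (simp only: r_distr m_assoc m_closed)
    then have 2: "inv k \<otimes> u = x \<oplus> inv k \<otimes> w" using x k by simp
    have "x \<ominus> inv k \<otimes> u = \<ominus> (inv k \<otimes> w)" unfolding 2 using x kc
      by (simp add: a_minus_def minus_add a_assoc[symmetric] r_neg)
    also have "\<dots> = (\<ominus> (inv k)) \<otimes> w" using kc by (simp add: l_minus)
    also have "\<dots> \<in> W" using Ws[OF K_minus[OF k(1)] 1(3)] .
    finally show ?thesis using k by blast
  qed
  have uniq: "k = k'" if "k \<in> K" "k' \<in> K" "x \<in> carrier U" "x \<ominus> k \<otimes> u \<in> W" "x \<ominus> k' \<otimes> u \<in> W" for k k' x
  proof -
    have kc: "k \<in> carrier U" "k' \<in> carrier U" using that by auto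
    have "(x \<ominus> k' \<otimes> u) \<ominus> (x \<ominus> k \<otimes> u) = (k \<ominus> k') \<otimes> u"
      by (use in_carrier_Cons in_carrier_Nil norm_eq[OF _ ring_norm_11, of "[x, k', u, k]"] that(3) kc u(1) in simp)
    then have "(k \<ominus> k') \<otimes> u \<in> W" using Wm[OF that(5,4)] by simp
    then have "k \<ominus> k' = \<zero>" using Wu[of "k \<ominus> k'"] that K_add K_minus by (simp add: a_minus_def)
    then show ?thesis using that by simp
  qed
  \<comment> \<open>\<open>c x\<close> is the coordinate of \<open>x\<close> along \<open>u\<close>
    modulo \<open>W\<close>; followed by \<open>\<sigma>\<close> it is the functional
    sought.\<close>
  define c where "c = (\<lambda>x. THE k. k \<in> K \<and> x \<ominus> k \<otimes> u \<in> W)"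
  have c: "c x = k" if "k \<in> K" "x \<in> carrier U" "x \<ominus> k \<otimes> u \<in> W" for x k
    unfolding c_def using that uniq by (intro the_equality) auto
  have c': "c x \<in> K" "x \<ominus> c x \<otimes> u \<in> W" if x: "x \<in> carrier U" for x
    using ex[OF x] c[OF _ x] by auto
  define l where "l = (\<lambda>x. if x \<in> carrier U then \<sigma> (c x) else \<zero>\<^bsub>M\<^esub>)"
  have "l \<in> \<Lambda>"
  proof (rule \<Lambda>I)
    fix x y assume x: "x \<in> carrier U" and y: "y \<in> carrier U"
    have "x \<oplus> y \<ominus> (c x \<oplus> c y) \<otimes> u = (x \<ominus> c x \<otimes> u) \<oplus> (y \<ominus> c y \<otimes> u)"
      using x y c' u by (simp add: a_minus_def l_distr minus_add a_ac)
    then have "c (x \<oplus> y) = c x \<oplus> c y" using Wa c' x y K_add by (intro c) auto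
    then show "l (x \<oplus> y) = l x \<oplus>\<^bsub>M\<^esub> l y" using x y c' \<sigma>_add by (simp add: l_def)
  next
    fix k x assume k: "k \<in> K" and x: "x \<in> carrier U"
    have "k \<otimes> x \<ominus> (k \<otimes> c x) \<otimes> u = k \<otimes> (x \<ominus> c x \<otimes> u)"
      using x k c' u by (simp add: a_minus_def r_distr r_minus m_assoc)
    then have "c (k \<otimes> x) = k \<otimes> c x" using Ws c' x k K_mult by (intro c) auto
    then show "l (k \<otimes> x) = \<sigma> k \<otimes>\<^bsub>M\<^esub> l x" using x k c' \<sigma>_mult by (simp add: l_def)
  qed (use c' in \<open>auto simp: l_def\<close>)
  moreover have "l x = \<zero>\<^bsub>M\<^esub>" if "x \<in> Span K us" for x
  proof -
    have x: "x \<in> W" "x \<in> carrier U" using that W Wc by auto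
    then have "c x = \<zero>" using u by (intro c) (auto simp: a_minus_def)
    then show ?thesis using x \<sigma>_zero by (simp add: l_def)
  qed
  moreover have "c u = \<one>" using u Wz by (intro c) (auto simp: a_minus_def r_neg)
  then have "l u = \<one>\<^bsub>M\<^esub>" using u \<sigma>_one by (simp add: l_def)
  ultimately show ?thesis by blast
qed

end

context abelian_monoid
begin

lemma finsum_lessThan_Suc:
  assumes "\<And>i. f i \<in> carrier G"
  shows "(\<Oplus>i\<in>{..<Suc n}. f i) = (\<Oplus>i\<in>{..<n}. f i) \<oplus> f n"
  using assms by (simp add: lessThan_Suc finsum_insert Pi_def a_comm)

end

lemma (in dfield) char_p_mult: "x \<in> carrier U \<Longrightarrow> [p] \<cdot> x = \<zero>"
  using char_p by (subst add_pow_nat_mult) auto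

sublocale tensor \<subseteq> R: derivation_ring OP.OR OP.dO
  by (rule OP.OR_derivation)

context tensor
begin

declare OP.OR_simps [simp del]

lemma gen_car [simp]: "\<lbrakk>f \<in> carrier M; u \<in> carrier U\<rbrakk> \<Longrightarrow> gen f u \<in> carrier OP.OR"
  by (simp add: OP.OR_simps)

lemma R_add_left:
  "\<lbrakk>f \<in> carrier M; g \<in> carrier M; u \<in> carrier U\<rbrakk> \<Longrightarrow> gen (f \<oplus>\<^bsub>M\<^esub> g) u = gen f u \<oplus>\<^bsub>OP.OR\<^esub> gen g u"
  by (simp add: OP.OR_simps gen_add_left)

lemma R_add_right:
  "\<lbrakk>f \<in> carrier M; u \<in> carrier U; v \<in> carrier U\<rbrakk> \<Longrightarrow> gen f (u \<oplus> v) = gen f u \<oplus>\<^bsub>OP.OR\<^esub> gen f v"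
  by (simp add: OP.OR_simps gen_add_right)

lemma R_mult:
  "\<lbrakk>f \<in> carrier M; g \<in> carrier M; u \<in> carrier U; v \<in> carrier U\<rbrakk> \<Longrightarrow>
    gen f u \<otimes>\<^bsub>OP.OR\<^esub> gen g v = gen (f \<otimes>\<^bsub>M\<^esub> g) (u \<otimes> v)"
  by (simp add: OP.OR_simps gen_o)

lemma R_one: "\<one>\<^bsub>OP.OR\<^esub> = gen \<one>\<^bsub>M\<^esub> \<one>"
  by (simp add: OP.OR_simps gen_one OP.one_op_def)

lemma R_zero_left: "u \<in> carrier U \<Longrightarrow> gen \<zero>\<^bsub>M\<^esub> u = \<zero>\<^bsub>OP.OR\<^esub>"
  by (simp add: OP.OR_simps gen_zero_left)

lemma R_zero_right: "f \<in> carrier M \<Longrightarrow> gen f \<zero> = \<zero>\<^bsub>OP.OR\<^esub>"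
  by (simp add: OP.OR_simps gen_zero_right)

lemma R_pow:
  "\<lbrakk>f \<in> carrier M; u \<in> carrier U\<rbrakk> \<Longrightarrow> gen f u [^]\<^bsub>OP.OR\<^esub> (n::nat) = gen (f [^]\<^bsub>M\<^esub> n) (u [^] n)"
  by (induction n) (simp_all add: R_one R_mult)

lemma R_char: "[p] \<cdot>\<^bsub>OP.OR\<^esub> \<one>\<^bsub>OP.OR\<^esub> = \<zero>\<^bsub>OP.OR\<^esub>"
proof -
  note c = OP.ops_carrier[OF gen_ops[OF M.one_closed one_closed]]
  have "[p] \<cdot>\<^bsub>OP.OR\<^esub> \<one>\<^bsub>OP.OR\<^esub> = (\<lambda>\<xi> i. [p] \<cdot>\<^bsub>M\<^esub> (\<one>\<^bsub>OP.OR\<^esub> \<xi> i))" by (rule OP.OR_char)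
  also have "\<dots> = (\<lambda>_ _. \<zero>\<^bsub>M\<^esub>)"
    unfolding R_one M.char_p_mult[OF c] ..
  finally show ?thesis by (simp add: OP.OR_simps)
qed

lemmas R_frob = R.freshmans_dream[OF prime_p R_char]

lemma R_one_not_zero: "\<one>\<^bsub>OP.OR\<^esub> \<noteq> \<zero>\<^bsub>OP.OR\<^esub>"
proof
  assume eq: "\<one>\<^bsub>OP.OR\<^esub> = \<zero>\<^bsub>OP.OR\<^esub>"
  obtain l where l: "l \<in> \<Lambda>" "l \<one> = \<one>\<^bsub>M\<^esub>" using exists_functional[of "[]" \<one>] by auto
  have "\<one>\<^bsub>OP.OR\<^esub> l \<one> = \<one>\<^bsub>M\<^esub>" using l by (simp add: OP.OR_simps OP.one_op_def)
  then show False using eq by (simp add: OP.OR_simps)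
qed

text \<open>Finite sums of tensors are kept as lists because reducedness is proved by induction on
  the number of terms.\<close>

primrec opl :: "('u \<times> 'u) list \<Rightarrow> ('u \<Rightarrow> 'u) \<Rightarrow> 'u \<Rightarrow> 'u" where
  "opl [] = \<zero>\<^bsub>OP.OR\<^esub>"
| "opl (fu # xs) = gen (fst fu) (snd fu) \<oplus>\<^bsub>OP.OR\<^esub> opl xs"

lemma opl_car: "set xs \<subseteq> carrier M \<times> carrier U \<Longrightarrow> opl xs \<in> carrier OP.OR"
  by (induction xs) auto

lemma ops_opl: "r \<in> OP.ops \<Longrightarrow> \<exists>xs. set xs \<subseteq> carrier M \<times> carrier U \<and> r = opl xs"
proof (induction rule: OP.ops.induct)
  case ops_zero
  then show ?case by (intro exI[of _ "[]"]) (simp add: OP.OR_simps)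
next
  case (ops_add_gen g r)
  obtain f u where fu: "g = gen f u" "f \<in> carrier M" "u \<in> carrier U" using ops_add_gen(1) by (rule gen_cases)
  obtain xs where "set xs \<subseteq> carrier M \<times> carrier U" "r = opl xs" using ops_add_gen by blast
  then show ?case using fu by (intro exI[of _ "(f, u) # xs"]) (simp add: OP.OR_simps)
qed

definition frob where "frob fu = (fst fu [^]\<^bsub>M\<^esub> p, snd fu [^] p)"

lemma frob_pair: "frob (f, u) = (f [^]\<^bsub>M\<^esub> p, u [^] p)"
  by (simp add: frob_def)

lemma frob_carrier: "set xs \<subseteq> carrier M \<times> carrier U \<Longrightarrow> set (map frob xs) \<subseteq> carrier M \<times> carrier U"
  by (induction xs) (auto simp: frob_def)

lemma opl_frob: "set xs \<subseteq> carrier M \<times> carrier U \<Longrightarrow> opl xs [^]\<^bsub>OP.OR\<^esub> p = opl (map frob xs)"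
proof (induction xs)
  case Nil
  then show ?case using p_gt by (simp add: R.nat_pow_zero)
next
  case (Cons fu xs)
  then show ?case using opl_car[of xs] by (auto simp: frob_def R_frob R_pow)
qed

text \<open>If \<open>v\<close> is a combination of the right factors of \<open>ys\<close>, its
  coefficients move across the tensor sign and are added to the left factors, so the list does not
  grow. The second equation records that the same redistribution is compatible with
  \<open>p\<close>-th powers, as the induction in \<open>opl_reduced\<close> requires.\<close>

lemma opl_absorb:
  assumes "v \<in> Span K (map snd ys)" "f \<in> carrier M" "set ys \<subseteq> carrier M \<times> carrier U"
  shows "\<exists>ys'. length ys' = length ys \<and> set ys' \<subseteq> carrier M \<times> carrier U \<and>
    gen f v \<oplus>\<^bsub>OP.OR\<^esub> opl ys = opl ys' \<and>
    gen (f [^]\<^bsub>M\<^esub> p) (v [^] p) \<oplus>\<^bsub>OP.OR\<^esub> opl (map frob ys) = opl (map frob ys')"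
  using assms(1,3)
proof (induction ys arbitrary: v)
  case Nil
  then have v: "v = \<zero>" by simp
  show ?case unfolding v
    using assms(2) by (intro exI[of _ "[]"]) (auto simp: R_zero_right frob_zero)
next
  case (Cons gw zs)
  obtain g w where gw: "gw = (g, w)" by (cases gw)
  have c: "g \<in> carrier M" "w \<in> carrier U" "set zs \<subseteq> carrier M \<times> carrier U" using Cons(3) gw by auto
  have "v \<in> Span K (w # map snd zs)" using Cons(2) gw by simp
  then obtain k v' where k: "k \<in> K" "v' \<in> Span K (map snd zs)" "v = k \<otimes> w \<oplus> v'" unfolding span_cons_iff by blast
  have v': "v' \<in> carrier U"
  proof -
    have "set (map snd zs) \<subseteq> carrier U" using c(3) by auto
    then show ?thesis using k(2) Span_in_carrier[OF subfieldE(3)[OF K]] by blast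
  qed
  obtain zs' where zs': "length zs' = length zs" "set zs' \<subseteq> carrier M \<times> carrier U"
    "gen f v' \<oplus>\<^bsub>OP.OR\<^esub> opl zs = opl zs'"
    "gen (f [^]\<^bsub>M\<^esub> p) (v' [^] p) \<oplus>\<^bsub>OP.OR\<^esub> opl (map frob zs) = opl (map frob zs')"
    using Cons.IH[OF k(2) c(3)] by blast
  have kp: "k [^] p \<in> K" and \<sigma>p: "\<sigma> (k [^] p) = \<sigma> k [^]\<^bsub>M\<^esub> p"
  proof -
    have "k [^] n \<in> K \<and> \<sigma> (k [^] n) = \<sigma> k [^]\<^bsub>M\<^esub> n" for n :: nat
      by (induction n) (use k(1) K_mult \<sigma>_mult \<sigma>_one in auto)
    then show "k [^] p \<in> K" "\<sigma> (k [^] p) = \<sigma> k [^]\<^bsub>M\<^esub> p" by auto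
  qed
  let ?ys = "(f \<otimes>\<^bsub>M\<^esub> \<sigma> k \<oplus>\<^bsub>M\<^esub> g, w) # zs'"
  have 1: "gen f v = gen (f \<otimes>\<^bsub>M\<^esub> \<sigma> k) w \<oplus>\<^bsub>OP.OR\<^esub> gen f v'"
    unfolding k(3) using k(1) c v' assms(2) by (simp add: R_add_right gen_K)
  have 2: "gen (f [^]\<^bsub>M\<^esub> p) (v [^] p) = gen ((f \<otimes>\<^bsub>M\<^esub> \<sigma> k) [^]\<^bsub>M\<^esub> p) (w [^] p) \<oplus>\<^bsub>OP.OR\<^esub> gen (f [^]\<^bsub>M\<^esub> p) (v' [^] p)"
    unfolding k(3) using k(1) c v' assms(2) kp
    by (simp add: R_add_right gen_K frob_add frob_mult M.frob_mult \<sigma>p[symmetric])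
  have o: "opl zs \<in> carrier OP.OR" "opl (map frob zs) \<in> carrier OP.OR"
    using opl_car[OF c(3)] opl_car[OF frob_carrier[OF c(3)]] by auto
  have "gen f v \<oplus>\<^bsub>OP.OR\<^esub> opl (gw # zs) = opl ?ys"
    unfolding gw 1 using assms(2) k(1) c v' o(1) zs'(3)[symmetric] by (simp add: R_add_left R.a_ac)
  moreover have "gen (f [^]\<^bsub>M\<^esub> p) (v [^] p) \<oplus>\<^bsub>OP.OR\<^esub> opl (map frob (gw # zs)) = opl (map frob ?ys)"
    unfolding gw 2 using assms(2) k(1) c v' o(2) zs'(4)[symmetric]
    by (simp add: frob_pair R_add_left R.a_ac M.frob_add)
  moreover have "length ?ys = length (gw # zs)" "set ?ys \<subseteq> carrier M \<times> carrier U"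
    using zs' assms(2) k(1) c by auto
  ultimately show ?case by blast
qed

lemma opl_eval:
  assumes "l \<in> \<Lambda>" "set xs \<subseteq> carrier M \<times> carrier U" "\<forall>x\<in>snd ` set xs. l x = \<zero>\<^bsub>M\<^esub>"
  shows "opl xs l \<one> = \<zero>\<^bsub>M\<^esub>"
  using assms(2,3)
proof (induction xs)
  case (Cons fu xs)
  then have "opl xs l \<one> = \<zero>\<^bsub>M\<^esub>" by auto
  then show ?case using Cons assms(1) by (auto simp: OP.OR_simps gen_def)
qed (simp add: OP.OR_simps)

text \<open>Separability of \<open>U\<close> over \<open>K\<close> in the form of MacLane's
  criterion: linear independence over \<open>K\<close> survives the passage to \<open>p\<close>-th
  powers.\<close>

definition sep where
  "sep \<longleftrightarrow> (\<forall>us u. set us \<subseteq> carrier U \<longrightarrow> u \<in> carrier U \<longrightarrow>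
     u [^] p \<in> Span K (map (\<lambda>x. x [^] p) us) \<longrightarrow> u \<in> Span K us)"

text \<open>Induction on the number of tensors. If the right factor \<open>u\<close> of the first
  one depends on the others, it is absorbed and the list becomes shorter. Otherwise
  \<open>u^p\<close> is independent of their \<open>p\<close>-th powers by \<open>sep\<close>; a
  functional that is 1 at \<open>u^p\<close> and 0 at these reads off \<open>f^p\<close>, so
  \<open>f\<close> vanishes.\<close>

lemma opl_reduced:
  assumes sep: sep
  shows "\<lbrakk>set xs \<subseteq> carrier M \<times> carrier U; opl (map frob xs) = \<zero>\<^bsub>OP.OR\<^esub>\<rbrakk> \<Longrightarrow> opl xs = \<zero>\<^bsub>OP.OR\<^esub>"
proof (induction xs rule: length_induct)
  case (1 xs)
  show ?case
  proof (cases xs)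
    case (Cons fu ys)
    obtain f u where fu: "fu = (f, u)" by (cases fu)
    have c: "f \<in> carrier M" "u \<in> carrier U" "set ys \<subseteq> carrier M \<times> carrier U" using 1(2) Cons fu by auto
    have IH: "opl zs = \<zero>\<^bsub>OP.OR\<^esub>"
      if "length zs = length ys" "set zs \<subseteq> carrier M \<times> carrier U" "opl (map frob zs) = \<zero>\<^bsub>OP.OR\<^esub>" for zs
      using 1(1) that Cons by auto
    show ?thesis
    proof (cases "u \<in> Span K (map snd ys)")
      case True
      obtain zs where zs: "length zs = length ys" "set zs \<subseteq> carrier M \<times> carrier U"
        "gen f u \<oplus>\<^bsub>OP.OR\<^esub> opl ys = opl zs"
        "gen (f [^]\<^bsub>M\<^esub> p) (u [^] p) \<oplus>\<^bsub>OP.OR\<^esub> opl (map frob ys) = opl (map frob zs)"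
        using opl_absorb[OF True c(1,3)] by blast
      have "opl (map frob zs) = \<zero>\<^bsub>OP.OR\<^esub>" using 1(3) zs(4) Cons fu by (simp add: frob_pair)
      then show ?thesis using IH[OF zs(1,2)] zs(3) Cons fu by simp
    next
      case False
      let ?us = "map (\<lambda>x. x [^] p) (map snd ys)"
      have us: "set (map snd ys) \<subseteq> carrier U" "set ?us \<subseteq> carrier U" using c(3) by auto
      have "u [^] p \<notin> Span K ?us" using False sep us(1) c(2) unfolding sep_def by blast
      then obtain l where l: "l \<in> \<Lambda>" "\<And>x. x \<in> Span K ?us \<Longrightarrow> l x = \<zero>\<^bsub>M\<^esub>" "l (u [^] p) = \<one>\<^bsub>M\<^esub>"
        using exists_functional[OF us(2), of "u [^] p"] c(2) by blast
      have lz: "opl (map frob ys) l \<one> = \<zero>\<^bsub>M\<^esub>"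
      proof (rule opl_eval[OF l(1)])
        show "set (map frob ys) \<subseteq> carrier M \<times> carrier U" by (rule frob_carrier[OF c(3)])
        have "snd ` set (map frob ys) = set ?us" by (auto simp: frob_def image_image)
        then show "\<forall>x\<in>snd ` set (map frob ys). l x = \<zero>\<^bsub>M\<^esub>" using l(2) Span_base_incl[OF K us(2)] by blast
      qed
      have "(gen (f [^]\<^bsub>M\<^esub> p) (u [^] p) \<oplus>\<^bsub>OP.OR\<^esub> opl (map frob ys)) l \<one> = \<zero>\<^bsub>M\<^esub>"
        using 1(3) Cons fu by (simp add: frob_pair) (simp add: OP.OR_simps)
      then have "f [^]\<^bsub>M\<^esub> p = \<zero>\<^bsub>M\<^esub>" using l lz c by (simp add: OP.OR_simps gen_def)
      then have f: "f = \<zero>\<^bsub>M\<^esub>" using M.frob_eq_zero c by simp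
      have o: "opl ys \<in> carrier OP.OR" "opl (map frob ys) \<in> carrier OP.OR"
        using opl_car[OF c(3)] opl_car[OF frob_carrier[OF c(3)]] by auto
      have "opl (map frob ys) = \<zero>\<^bsub>OP.OR\<^esub>"
        using 1(3) Cons fu f c o by (simp add: frob_pair M.frob_zero R_zero_left)
      then show ?thesis using IH[of ys] c(3) Cons fu f c o by (simp add: R_zero_left)
    qed
  qed simp
qed

end

text \<open>\<open>U \<otimes> M\<close> over \<open>K\<close>, in its action on the \<open>\<sigma>\<close>-semilinear maps from \<open>U\<close> to \<open>M\<close>, is reduced, and so
  maps to a differential field.\<close>

theorem exists_amalgam:
  fixes U :: "'u::infinite diff_ring" (structure) and M :: "'u diff_ring"
  assumes T: "tensor p U M K \<sigma>" and sep: "tensor.sep p U K"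
  shows "\<exists>(L::'u diff_ring) i j. differential_field p L \<and> diff_embedding i U L \<and> diff_embedding j M L \<and>
    (\<forall>k\<in>K. i k = j (\<sigma> k))"
proof -
  interpret tensor p U M K \<sigma> by (rule T)
  have red: "r = \<zero>\<^bsub>OP.OR\<^esub>" if r: "r \<in> carrier OP.OR" "r \<otimes>\<^bsub>OP.OR\<^esub> r = \<zero>\<^bsub>OP.OR\<^esub>" for r
  proof -
    obtain xs where xs: "set xs \<subseteq> carrier M \<times> carrier U" "r = opl xs"
      using ops_opl[of r] r(1) unfolding OP.OR_simps(1) by blast
    \<comment> \<open>Since \<open>p\<close> is at least 2, \<open>r^p\<close> is a multiple of the
      square of \<open>r\<close>.\<close>
    obtain n where n: "p = Suc (Suc n)" using p_gt(1) by (cases p rule: nat.exhaust; cases "p - 1") auto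
    have "r [^]\<^bsub>OP.OR\<^esub> p = r [^]\<^bsub>OP.OR\<^esub> n \<otimes>\<^bsub>OP.OR\<^esub> (r \<otimes>\<^bsub>OP.OR\<^esub> r)"
      unfolding n using r(1) by (simp add: R.m_assoc)
    also have "\<dots> = \<zero>\<^bsub>OP.OR\<^esub>" using r by simp
    finally have "opl (map frob xs) = \<zero>\<^bsub>OP.OR\<^esub>" using opl_frob[OF xs(1)] xs(2) by simp
    then show ?thesis using opl_reduced[OF sep xs(1)] xs(2) by simp
  qed
  have "G \<subseteq> range (\<lambda>xs. gen (xs ! 0) (xs ! 1))"
  proof
    fix g assume "g \<in> G"
    then obtain f u where fu: "g = gen f u" by (rule gen_cases)
    show "g \<in> range (\<lambda>xs. gen (xs ! 0) (xs ! 1))" unfolding fu by (rule range_eqI[of _ _ "[f, u]"]) simp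
  qed
  then obtain g :: "'u list \<Rightarrow> ('u \<Rightarrow> 'u) \<Rightarrow> 'u \<Rightarrow> 'u" where g: "carrier OP.OR \<subseteq> range g"
    using OP.ops_coded[of "\<lambda>xs. gen (xs ! 0) (xs ! 1)"] by blast
  have "\<exists>(L::'u diff_ring) h. differential_field p L \<and> h \<in> ring_hom OP.OR L \<and>
    (\<forall>x\<in>carrier OP.OR. h (OP.dO x) = der L (h x)) \<and> h \<one>\<^bsub>OP.OR\<^esub> \<noteq> \<zero>\<^bsub>L\<^esub>"
    by (rule R.exists_differential_field_hom[OF _ R.one_closed R_one_not_zero R_char g]) (rule red)
  then obtain L :: "'u diff_ring" and h where L: "differential_field p L" and h: "h \<in> ring_hom OP.OR L"
    and hd: "\<And>x. x \<in> carrier OP.OR \<Longrightarrow> h (OP.dO x) = der L (h x)"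
    by (elim exE conjE) simp
  interpret L: dfield p L using L prime_p by (simp add: dfield_def)
  have i: "(\<lambda>u. h (gen \<one>\<^bsub>M\<^esub> u)) \<in> ring_hom U L"
  proof (rule ring_hom_memI)
    show "h (gen \<one>\<^bsub>M\<^esub> (x \<otimes> y)) = h (gen \<one>\<^bsub>M\<^esub> x) \<otimes>\<^bsub>L\<^esub> h (gen \<one>\<^bsub>M\<^esub> y)" if "x \<in> carrier U" "y \<in> carrier U" for x y
      using ring_hom_mult[OF h, of "gen \<one>\<^bsub>M\<^esub> x" "gen \<one>\<^bsub>M\<^esub> y"] that by (simp add: R_mult)
    show "h (gen \<one>\<^bsub>M\<^esub> (x \<oplus> y)) = h (gen \<one>\<^bsub>M\<^esub> x) \<oplus>\<^bsub>L\<^esub> h (gen \<one>\<^bsub>M\<^esub> y)" if "x \<in> carrier U" "y \<in> carrier U" for x y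
      using ring_hom_add[OF h, of "gen \<one>\<^bsub>M\<^esub> x" "gen \<one>\<^bsub>M\<^esub> y"] that by (simp add: R_add_right)
    show "h (gen \<one>\<^bsub>M\<^esub> \<one>) = \<one>\<^bsub>L\<^esub>" using ring_hom_one[OF h] by (simp add: R_one)
    show "h (gen \<one>\<^bsub>M\<^esub> x) \<in> carrier L" if "x \<in> carrier U" for x
      using ring_hom_closed[OF h gen_car[OF M.one_closed that]] .
  qed
  have j: "(\<lambda>f. h (gen f \<one>)) \<in> ring_hom M L"
  proof (rule ring_hom_memI)
    show "h (gen (x \<otimes>\<^bsub>M\<^esub> y) \<one>) = h (gen x \<one>) \<otimes>\<^bsub>L\<^esub> h (gen y \<one>)" if "x \<in> carrier M" "y \<in> carrier M" for x y
      using ring_hom_mult[OF h, of "gen x \<one>" "gen y \<one>"] that by (simp add: R_mult)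
    show "h (gen (x \<oplus>\<^bsub>M\<^esub> y) \<one>) = h (gen x \<one>) \<oplus>\<^bsub>L\<^esub> h (gen y \<one>)" if "x \<in> carrier M" "y \<in> carrier M" for x y
      using ring_hom_add[OF h, of "gen x \<one>" "gen y \<one>"] that by (simp add: R_add_left)
    show "h (gen \<one>\<^bsub>M\<^esub> \<one>) = \<one>\<^bsub>L\<^esub>" using ring_hom_one[OF h] by (simp add: R_one)
    show "h (gen x \<one>) \<in> carrier L" if "x \<in> carrier M" for x
      using ring_hom_closed[OF h gen_car[OF that one_closed]] .
  qed
  have "h (gen \<one>\<^bsub>M\<^esub> (der U u)) = der L (h (gen \<one>\<^bsub>M\<^esub> u))" if u: "u \<in> carrier U" for u
    using hd[of "gen \<one>\<^bsub>M\<^esub> u"] u by (simp add: dO_gen R_zero_left)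
  then have "diff_embedding (\<lambda>u. h (gen \<one>\<^bsub>M\<^esub> u)) U L"
    using non_trivial_field_hom_is_inj[OF i field_axioms L.field_axioms] i by (simp add: diff_embedding_def)
  moreover have "h (gen (der M f) \<one>) = der L (h (gen f \<one>))" if f: "f \<in> carrier M" for f
    using hd[of "gen f \<one>"] f by (simp add: dO_gen R_zero_right)
  then have "diff_embedding (\<lambda>f. h (gen f \<one>)) M L"
    using non_trivial_field_hom_is_inj[OF j M.field_axioms L.field_axioms] j by (simp add: diff_embedding_def)
  moreover have "gen \<one>\<^bsub>M\<^esub> k = gen (\<sigma> k) \<one>" if "k \<in> K" for k
    using gen_K[of "\<one>\<^bsub>M\<^esub>" k \<one>] that by simp
  ultimately show ?thesis using L
    by (intro exI[of _ L] exI[of _ "\<lambda>u. h (gen \<one>\<^bsub>M\<^esub> u)"] exI[of _ "\<lambda>f. h (gen f \<one>)"]) simp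
qed

section \<open>Taylor expansion of polynomials\<close>

lemma (in cring) taylor_pow:
  assumes "y \<in> carrier R" "z \<in> carrier R"
  shows "\<exists>s\<in>carrier R. (y \<oplus> z) [^] (n::nat) = y [^] n \<oplus> ([n] \<cdot> (y [^] (n - 1))) \<otimes> z \<oplus> (z \<otimes> z) \<otimes> s"
proof (induction n)
  case 0
  then show ?case using assms by (intro bexI[of _ \<zero>]) auto
next
  case (Suc n)
  then obtain s where s: "s \<in> carrier R"
    "(y \<oplus> z) [^] n = y [^] n \<oplus> ([n] \<cdot> (y [^] (n - 1))) \<otimes> z \<oplus> (z \<otimes> z) \<otimes> s" by blast
  define a where "a = y [^] n"
  define b where "b = [n] \<cdot> (y [^] (n - 1))"
  have ab: "a \<in> carrier R" "b \<in> carrier R" using assms by (auto simp: a_def b_def)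
  have bby: "b \<otimes> y = [n] \<cdot> a"
  proof (cases n)
    case (Suc m)
    then show ?thesis using assms by (simp add: a_def b_def add_pow_ldistr l_distr)
  qed (use assms in \<open>auto simp: a_def b_def\<close>)
  have "(y \<oplus> z) [^] Suc n = (a \<oplus> b \<otimes> z \<oplus> (z \<otimes> z) \<otimes> s) \<otimes> (y \<oplus> z)"
    using s(2) by (simp add: a_def b_def)
  also have "\<dots> = a \<otimes> y \<oplus> (b \<otimes> y \<oplus> a) \<otimes> z \<oplus> (z \<otimes> z) \<otimes> (b \<oplus> s \<otimes> (y \<oplus> z))"
    by (use in_carrier_Cons in_carrier_Nil norm_eq[OF _ ring_norm_12, of "[a, b, z, s, y]"] ab s(1) assms in simp)
  also have "b \<otimes> y \<oplus> a = [Suc n] \<cdot> a" using bby ab by simp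
  finally have "(y \<oplus> z) [^] Suc n = y [^] Suc n \<oplus> ([Suc n] \<cdot> (y [^] (Suc n - 1))) \<otimes> z \<oplus> (z \<otimes> z) \<otimes> (b \<oplus> s \<otimes> (y \<oplus> z))"
    by (simp add: a_def)
  then show ?case using ab s(1) assms by (intro bexI[of _ "b \<oplus> s \<otimes> (y \<oplus> z)"]) auto
qed

text \<open>The remainder is kept as an unspecified multiple of the square of \<open>z\<close>,
  which is all that a nilpotent \<open>z\<close> requires. In the derivative the term
  \<open>i = 0\<close> carries the factor 0, so its truncated exponent does no harm.\<close>

lemma (in cring) taylor:
  assumes y: "y \<in> carrier R" and z: "z \<in> carrier R" and f: "\<And>i. f i \<in> carrier R"
  shows "\<exists>s\<in>carrier R. (\<Oplus>i\<in>{..<n::nat}. f i \<otimes> (y \<oplus> z) [^] i) =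
    (\<Oplus>i\<in>{..<n}. f i \<otimes> y [^] i) \<oplus> (\<Oplus>i\<in>{..<n}. [i] \<cdot> (f i \<otimes> y [^] (i - 1))) \<otimes> z \<oplus> (z \<otimes> z) \<otimes> s"
proof (induction n)
  case 0
  then show ?case using assms by (intro bexI[of _ \<zero>]) auto
next
  case (Suc n)
  then obtain s where s: "s \<in> carrier R" "(\<Oplus>i\<in>{..<n}. f i \<otimes> (y \<oplus> z) [^] i) =
    (\<Oplus>i\<in>{..<n}. f i \<otimes> y [^] i) \<oplus> (\<Oplus>i\<in>{..<n}. [i] \<cdot> (f i \<otimes> y [^] (i - 1))) \<otimes> z \<oplus> (z \<otimes> z) \<otimes> s" by blast
  obtain t where t: "t \<in> carrier R" "(y \<oplus> z) [^] n = y [^] n \<oplus> ([n] \<cdot> (y [^] (n - 1))) \<otimes> z \<oplus> (z \<otimes> z) \<otimes> t"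
    using taylor_pow[OF y z] by blast
  define A B where "A = (\<Oplus>i\<in>{..<n}. f i \<otimes> y [^] i)" and "B = (\<Oplus>i\<in>{..<n}. [i] \<cdot> (f i \<otimes> y [^] (i - 1)))"
  define a b where "a = y [^] n" and "b = [n] \<cdot> (y [^] (n - 1))"
  have c: "A \<in> carrier R" "B \<in> carrier R" "a \<in> carrier R" "b \<in> carrier R"
    unfolding A_def B_def a_def b_def using y f by (auto intro!: finsum_closed)
  have fb: "[n] \<cdot> (f n \<otimes> y [^] (n - 1)) = f n \<otimes> b" using y f by (simp add: b_def add_pow_rdistr)
  have "(\<Oplus>i\<in>{..<Suc n}. f i \<otimes> (y \<oplus> z) [^] i) = (A \<oplus> B \<otimes> z \<oplus> (z \<otimes> z) \<otimes> s) \<oplus> f n \<otimes> (a \<oplus> b \<otimes> z \<oplus> (z \<otimes> z) \<otimes> t)"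
    using s(2) t(2) y z f by (simp add: finsum_lessThan_Suc A_def B_def a_def b_def)
  also have "\<dots> = (A \<oplus> f n \<otimes> a) \<oplus> (B \<oplus> f n \<otimes> b) \<otimes> z \<oplus> (z \<otimes> z) \<otimes> (s \<oplus> f n \<otimes> t)"
  proof -
    define g where "g = f n"
    have g: "g \<in> carrier R" using f by (simp add: g_def)
    show ?thesis unfolding g_def[symmetric]
      by (use in_carrier_Cons in_carrier_Nil norm_eq[OF _ ring_norm_13, of "[A, B, z, s, g, a, b, t]"] c s(1) t(1) g z in simp)
  qed
  finally have "(\<Oplus>i\<in>{..<Suc n}. f i \<otimes> (y \<oplus> z) [^] i) = (\<Oplus>i\<in>{..<Suc n}. f i \<otimes> y [^] i) \<oplus>
     (\<Oplus>i\<in>{..<Suc n}. [i] \<cdot> (f i \<otimes> y [^] (i - 1))) \<otimes> z \<oplus> (z \<otimes> z) \<otimes> (s \<oplus> f n \<otimes> t)"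
    using y f fb by (simp add: finsum_lessThan_Suc A_def B_def a_def)
  then show ?case using s(1) t(1) f by (intro bexI[of _ "s \<oplus> f n \<otimes> t"]) auto
qed

section \<open>Adjoining a solution\<close>

lemma (in cring) square_multiple_identity:
  assumes "i \<in> carrier R" "E \<in> carrier R" "z \<in> carrier R" "s \<in> carrier R"
  shows "i \<otimes> (E \<otimes> z \<oplus> (z \<otimes> z) \<otimes> s) = (i \<otimes> E) \<otimes> z \<ominus> z \<otimes> (z \<otimes> (\<ominus> (i \<otimes> s)))"
  by (use in_carrier_Cons in_carrier_Nil norm_eq[OF _ ring_norm_14, of "[i, E, z, s]"] assms in simp)

context dfield
begin

text \<open>Moves an inverse into a \<open>p\<close>-th power, which is constant. Thus every
  fraction can be given a constant denominator, and denominators interfere neither with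
  differentiation nor with spans over the constants.\<close>

lemma inv_pow_p:
  assumes "x \<in> carrier U" "x \<noteq> \<zero>"
  shows "inv x = x [^] (p - 1) \<otimes> (inv x) [^] p"
proof -
  have p: "p = Suc (p - 1)" using p_gt by simp
  have ix: "inv x \<in> carrier U" "x \<otimes> inv x = \<one>" using inv_nonzero[OF assms] by auto
  have "x [^] n \<otimes> (inv x) [^] n = \<one>" for n :: nat
    using assms ix by (simp add: nat_pow_distrib[symmetric])
  moreover have "(inv x) [^] p = (inv x) [^] (p - 1) \<otimes> inv x" by (subst p) simp
  ultimately show ?thesis using assms ix by (simp add: m_assoc[symmetric])
qed

lemma nat_cancel:
  assumes "0 < d" "d < p" "x \<in> carrier U" "[d] \<cdot> x = \<zero>"
  shows "x = \<zero>"
proof -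
  have "coprime d p" using assms(1,2) prime_p by (metis coprime_commute nat_dvd_not_less prime_imp_coprime)
  then obtain a b where ab: "a * d = b * p + 1"
    using bezout_nat[of d p] assms(1) by (metis coprime_iff_gcd_eq_1 mult.commute gcd.commute not_gr_zero)
  have "[(a * d)] \<cdot> x = [a] \<cdot> ([d] \<cdot> x)" using assms(3) by (simp add: add.nat_pow_pow mult.commute)
  also have "\<dots> = \<zero>" using assms(4) by simp
  finally have "[(b * p + 1)] \<cdot> x = \<zero>" using ab by simp
  moreover have "[(b * p + 1)] \<cdot> x = [b] \<cdot> ([p] \<cdot> x) \<oplus> x"
    using assms(3) by (simp add: add.nat_pow_pow mult.commute)
  ultimately show ?thesis using assms(3) char_p_mult by simp
qed

definition Frob where "Frob = (\<lambda>x. x [^] p) ` carrier U"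

lemma der_pow_p: "x \<in> carrier U \<Longrightarrow> der U (x [^] p) = \<zero>"
proof -
  assume x: "x \<in> carrier U"
  have "der U (x [^] n) = [n] \<cdot> (x [^] (n - 1) \<otimes> der U x)" for n :: nat
  proof (induction n)
    case (Suc n)
    have "x [^] n \<otimes> der U x = (if n = 0 then \<one> else x [^] (n - 1) \<otimes> x) \<otimes> der U x"
      using x by (cases n) auto
    then have "[n] \<cdot> (x [^] (n - 1) \<otimes> der U x) \<otimes> x = [n] \<cdot> (x [^] n \<otimes> der U x)"
      using x by (cases "n = 0") (auto simp: add_pow_ldistr add_pow_rdistr m_ac)
    then show ?case using x Suc by (simp add: d_mult)
  qed simp
  then show ?thesis using char_p_mult x by simp
qed

lemma Frob_subfield: "subfield Frob U"
proof (rule subfieldI')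
  show "subring Frob U"
  proof (rule subringI)
    show "Frob \<subseteq> carrier U" by (auto simp: Frob_def)
    show "\<one> \<in> Frob" unfolding Frob_def by (rule image_eqI[of _ _ \<one>]) simp_all
    show "\<ominus> h \<in> Frob" if "h \<in> Frob" for h
      using that by (auto simp: Frob_def frob_minus[symmetric])
    show "h1 \<otimes> h2 \<in> Frob" if "h1 \<in> Frob" "h2 \<in> Frob" for h1 h2
      using that by (auto simp: Frob_def frob_mult[symmetric])
    show "h1 \<oplus> h2 \<in> Frob" if "h1 \<in> Frob" "h2 \<in> Frob" for h1 h2
      using that by (auto simp: Frob_def frob_add[symmetric])
  qed
  show "inv k \<in> Frob" if k: "k \<in> Frob - {\<zero>}" for k
  proof -
    obtain x where x: "x \<in> carrier U" "k = x [^] p" using k by (auto simp: Frob_def)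
    then have nz: "x \<noteq> \<zero>" using k frob_zero by auto
    have "k \<otimes> (inv x) [^] p = \<one>"
      using x inv_nonzero[OF x(1) nz] by (simp add: frob_mult[symmetric])
    then have "inv k = (inv x) [^] p"
      using x inv_nonzero[OF x(1) nz] by (intro comm_inv_char) auto
    then show ?thesis using inv_nonzero[OF x(1) nz] by (auto simp: Frob_def)
  qed
qed

lemma poly_eval_closed [simp]:
  "\<lbrakk>\<And>i. f i \<in> carrier U; x \<in> carrier U\<rbrakk> \<Longrightarrow> (\<Oplus>i\<in>{..<n::nat}. f i \<otimes> x [^] i) \<in> carrier U"
  by (intro finsum_closed) auto

text \<open>If \<open>g(c) = 0\<close> with \<open>g\<close> over the \<open>p\<close>-th powers of least degree \<open>d < p\<close>, then
  \<open>g'(c) \<noteq> 0\<close>, so by Taylor expansion the nilpotent \<open>1 \<otimes> c - c \<otimes> 1\<close> is a multiple of its own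
  square. Hence it vanishes, which forces \<open>c\<close> to be a \<open>p\<close>-th power.\<close>

lemma simple_root_in_Frob:
  assumes c: "c \<in> carrier U" and g: "\<And>i. g i \<in> Frob"
    and root: "(\<Oplus>i\<in>{..<n::nat}. g i \<otimes> c [^] i) = \<zero>"
    and simple: "(\<Oplus>i\<in>{..<n}. [i] \<cdot> (g i \<otimes> c [^] (i - 1))) \<noteq> \<zero>"
  shows "c \<in> Frob"
proof (rule ccontr)
  assume nc: "c \<notin> Frob"
  have Fd: "der U k = \<zero>" if "k \<in> Frob" for k using that der_pow_p by (auto simp: Frob_def)
  have Fc: "k \<in> carrier U" if "k \<in> Frob" for k using that by (auto simp: Frob_def)
  have gc: "g i \<in> carrier U" for i using Fc g by blast
  \<comment> \<open>Both factors are \<open>U\<close>, and the base is the field of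
    \<open>p\<close>-th powers, whose elements are constants.\<close>
  interpret T: tensor p U U Frob "\<lambda>x. x"
  proof (intro tensor.intro tensor_axioms.intro)
    show "dfield p U" "dfield p U" by (rule dfield_axioms)+
    show "subfield Frob U" by (rule Frob_subfield)
    show "der U k \<in> Frob" if "k \<in> Frob" for k
      using that Fd subringE(2)[OF subfieldE(1)[OF Frob_subfield]] by simp
    show "diff_hom_on Frob U U (\<lambda>x. x)" using Fc by (simp add: diff_hom_on_def)
  qed
  let ?R = T.OP.OR
  define y w where "y = T.gen c \<one>" and "w = T.gen \<one> c"
  define z where "z = w \<ominus>\<^bsub>?R\<^esub> y"
  have car: "y \<in> carrier ?R" "w \<in> carrier ?R" "z \<in> carrier ?R"
    using c by (auto simp: y_def w_def z_def)
  have wz: "w = y \<oplus>\<^bsub>?R\<^esub> z" unfolding z_def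
    by (use T.R.in_carrier_Cons T.R.in_carrier_Nil T.R.norm_eq[OF _ ring_norm_15, of "[w, y]"] car(1,2) in simp)
  have swap: "T.gen \<one> k = T.gen k \<one>" if "k \<in> Frob" for k
    using T.gen_K[of \<one> k \<one>] that Fc[OF that] by simp
  \<comment> \<open>\<open>c^p\<close> belongs to the base and moves across the tensor sign. So
    \<open>w\<close> and \<open>y\<close> have the same \<open>p\<close>-th power, and their
    difference \<open>z\<close> is nilpotent.\<close>
  have "c [^] p \<in> Frob" unfolding Frob_def by (rule imageI[OF c])
  then have "w [^]\<^bsub>?R\<^esub> p = y [^]\<^bsub>?R\<^esub> p"
    unfolding y_def w_def T.R_pow[OF one_closed c] T.R_pow[OF c one_closed] nat_pow_one by (rule swap)
  moreover have "w [^]\<^bsub>?R\<^esub> p = y [^]\<^bsub>?R\<^esub> p \<oplus>\<^bsub>?R\<^esub> z [^]\<^bsub>?R\<^esub> p"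
    unfolding wz using car by (intro T.R_frob)
  ultimately have zp: "z [^]\<^bsub>?R\<^esub> p = \<zero>\<^bsub>?R\<^esub>" using car by (simp add: T.R.add.r_cancel_one')
  define \<gamma> where "\<gamma> = (\<lambda>i. T.gen (g i) \<one>)"
  have \<gamma>: "\<gamma> i \<in> carrier ?R" for i using gc by (simp add: \<gamma>_def)
  have g_hom: "(\<Oplus>\<^bsub>?R\<^esub>i\<in>{..<m}. \<gamma> i \<otimes>\<^bsub>?R\<^esub> w [^]\<^bsub>?R\<^esub> i) = T.gen \<one> (\<Oplus>i\<in>{..<m}. g i \<otimes> c [^] i)" for m :: nat
  proof (induction m)
    case (Suc m)
    have "\<gamma> m \<otimes>\<^bsub>?R\<^esub> w [^]\<^bsub>?R\<^esub> m = T.gen \<one> (g m \<otimes> c [^] m)"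
      unfolding \<gamma>_def w_def swap[OF g, symmetric] using gc c by (simp add: T.R_pow T.R_mult)
    then show ?case using Suc \<gamma> car gc c
      by (simp add: T.R.finsum_lessThan_Suc finsum_lessThan_Suc T.R_add_right)
  qed (simp add: T.R_zero_right)
  have h_hom: "(\<Oplus>\<^bsub>?R\<^esub>i\<in>{..<m}. \<gamma> i \<otimes>\<^bsub>?R\<^esub> y [^]\<^bsub>?R\<^esub> i) = T.gen (\<Oplus>i\<in>{..<m}. g i \<otimes> c [^] i) \<one>" for m :: nat
  proof (induction m)
    case (Suc m)
    then show ?case using \<gamma> car gc c
      by (simp add: T.R.finsum_lessThan_Suc finsum_lessThan_Suc T.R_add_left \<gamma>_def y_def T.R_pow T.R_mult)
  qed (simp add: T.R_zero_left)
  have nat_gen: "[m] \<cdot>\<^bsub>?R\<^esub> T.gen x \<one> = T.gen ([m] \<cdot> x) \<one>" if "x \<in> carrier U" for m :: nat and x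
    by (induction m) (use that in \<open>auto simp: T.R_zero_left T.R_add_left\<close>)
  have d_hom: "(\<Oplus>\<^bsub>?R\<^esub>i\<in>{..<m}. [i] \<cdot>\<^bsub>?R\<^esub> (\<gamma> i \<otimes>\<^bsub>?R\<^esub> y [^]\<^bsub>?R\<^esub> (i - 1))) = T.gen (\<Oplus>i\<in>{..<m}. [i] \<cdot> (g i \<otimes> c [^] (i - 1))) \<one>" for m :: nat
  proof (induction m)
    case (Suc m)
    have "(\<Oplus>i\<in>{..<m}. [i] \<cdot> (g i \<otimes> c [^] (i - 1))) \<in> carrier U" using gc c by (intro finsum_closed) auto
    then show ?case using Suc \<gamma> car gc c
      by (simp add: T.R.finsum_lessThan_Suc finsum_lessThan_Suc T.R_add_left \<gamma>_def y_def T.R_pow T.R_mult nat_gen)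
  qed (simp add: T.R_zero_left)
  define e where "e = (\<Oplus>i\<in>{..<n}. [i] \<cdot> (g i \<otimes> c [^] (i - 1)))"
  have e: "e \<in> carrier U" "e \<noteq> \<zero>" using gc c simple by (auto simp: e_def intro!: finsum_closed)
  obtain s where s: "s \<in> carrier ?R" and tay: "(\<Oplus>\<^bsub>?R\<^esub>i\<in>{..<n}. \<gamma> i \<otimes>\<^bsub>?R\<^esub> w [^]\<^bsub>?R\<^esub> i) =
    (\<Oplus>\<^bsub>?R\<^esub>i\<in>{..<n}. \<gamma> i \<otimes>\<^bsub>?R\<^esub> y [^]\<^bsub>?R\<^esub> i) \<oplus>\<^bsub>?R\<^esub>
    (\<Oplus>\<^bsub>?R\<^esub>i\<in>{..<n}. [i] \<cdot>\<^bsub>?R\<^esub> (\<gamma> i \<otimes>\<^bsub>?R\<^esub> y [^]\<^bsub>?R\<^esub> (i - 1))) \<otimes>\<^bsub>?R\<^esub> z \<oplus>\<^bsub>?R\<^esub> (z \<otimes>\<^bsub>?R\<^esub> z) \<otimes>\<^bsub>?R\<^esub> s"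
    unfolding wz using T.R.taylor[OF car(1,3), of \<gamma> n] \<gamma> by blast
  have 0: "T.gen e \<one> \<otimes>\<^bsub>?R\<^esub> z \<oplus>\<^bsub>?R\<^esub> (z \<otimes>\<^bsub>?R\<^esub> z) \<otimes>\<^bsub>?R\<^esub> s = \<zero>\<^bsub>?R\<^esub>"
    using tay e car s unfolding g_hom h_hom d_hom root e_def[symmetric] by (simp add: T.R_zero_left T.R_zero_right)
  define i where "i = T.gen (inv e) \<one>"
  have i: "i \<in> carrier ?R" "i \<otimes>\<^bsub>?R\<^esub> T.gen e \<one> = \<one>\<^bsub>?R\<^esub>"
    using inv_nonzero[OF e] e by (auto simp: i_def T.R_mult T.R_one)
  define t where "t = \<ominus>\<^bsub>?R\<^esub> (i \<otimes>\<^bsub>?R\<^esub> s)"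
  have t: "t \<in> carrier ?R" using i s by (simp add: t_def)
  have zz: "z = z \<otimes>\<^bsub>?R\<^esub> (z \<otimes>\<^bsub>?R\<^esub> t)"
  proof -
    define E where "E = T.gen e \<one>"
    have E: "E \<in> carrier ?R" using e by (simp add: E_def)
    have "i \<otimes>\<^bsub>?R\<^esub> (E \<otimes>\<^bsub>?R\<^esub> z \<oplus>\<^bsub>?R\<^esub> (z \<otimes>\<^bsub>?R\<^esub> z) \<otimes>\<^bsub>?R\<^esub> s) = \<zero>\<^bsub>?R\<^esub>"
      using 0 i by (simp add: E_def)
    moreover have "i \<otimes>\<^bsub>?R\<^esub> (E \<otimes>\<^bsub>?R\<^esub> z \<oplus>\<^bsub>?R\<^esub> (z \<otimes>\<^bsub>?R\<^esub> z) \<otimes>\<^bsub>?R\<^esub> s)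
       = (i \<otimes>\<^bsub>?R\<^esub> E) \<otimes>\<^bsub>?R\<^esub> z \<ominus>\<^bsub>?R\<^esub> z \<otimes>\<^bsub>?R\<^esub> (z \<otimes>\<^bsub>?R\<^esub> t)"
      unfolding t_def by (rule T.R.square_multiple_identity[OF i(1) E car(3) s])
    ultimately have "z \<ominus>\<^bsub>?R\<^esub> z \<otimes>\<^bsub>?R\<^esub> (z \<otimes>\<^bsub>?R\<^esub> t) = \<zero>\<^bsub>?R\<^esub>"
      using i(2) T.R.l_one[OF car(3)] by (simp only: E_def)
    then show ?thesis by (rule T.R.eq_of_minus) (intro car(3) T.R.m_closed t)+
  qed
  \<comment> \<open>Substituting the equation into itself puts arbitrarily high powers of the
    nilpotent \<open>z\<close> on the right.\<close>
  have "z = z \<otimes>\<^bsub>?R\<^esub> (z [^]\<^bsub>?R\<^esub> m \<otimes>\<^bsub>?R\<^esub> t [^]\<^bsub>?R\<^esub> m)" for m :: nat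
  proof (induction m)
    case (Suc m)
    define a where "a = z [^]\<^bsub>?R\<^esub> m"
    define b where "b = t [^]\<^bsub>?R\<^esub> m"
    have ab: "a \<in> carrier ?R" "b \<in> carrier ?R" using car t by (auto simp: a_def b_def)
    have "z = (z \<otimes>\<^bsub>?R\<^esub> (z \<otimes>\<^bsub>?R\<^esub> t)) \<otimes>\<^bsub>?R\<^esub> (a \<otimes>\<^bsub>?R\<^esub> b)"
      unfolding zz[symmetric] a_def b_def by (rule Suc)
    also have "\<dots> = z \<otimes>\<^bsub>?R\<^esub> ((a \<otimes>\<^bsub>?R\<^esub> z) \<otimes>\<^bsub>?R\<^esub> (b \<otimes>\<^bsub>?R\<^esub> t))"
      using ab car t by (simp add: T.R.m_ac)
    finally show ?case by (simp add: a_def b_def)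
  qed (use car in simp)
  from this[of p] have "z = \<zero>\<^bsub>?R\<^esub>" using zp car t by simp
  then have "w = y" using wz car by simp
  \<comment> \<open>A functional that vanishes on the base field but not at \<open>c\<close> tells
    \<open>w\<close> from \<open>y\<close>.\<close>
  have "c \<notin> Span Frob [\<one>]"
  proof
    assume "c \<in> Span Frob [\<one>]"
    then obtain k where "k \<in> Frob" "c = k \<otimes> \<one> \<oplus> \<zero>" unfolding span_cons_iff span_nil by blast
    then show False using nc Fc by simp
  qed
  then obtain l where l: "l \<in> T.\<Lambda>" "\<forall>x\<in>Span Frob [\<one>]. l x = \<zero>" "l c = \<one>"
    using T.exists_functional[of "[\<one>]" c] c by auto
  have "l \<one> = \<zero>" using l(2) Span_base_incl[OF Frob_subfield, of "[\<one>]"] by auto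
  then have "w l \<one> = \<one>" "y l \<one> = \<zero>" using l c by (auto simp: w_def y_def T.gen_def)
  then show False using \<open>w = y\<close> by simp
qed

text \<open>A relation whose formal derivative does not vanish at \<open>c\<close> would make
  \<open>c\<close> a \<open>p\<close>-th power. So the derivative is again a relation, one term
  shorter and with coefficients \<open>[Suc i] \<cdot> g (Suc i)\<close>. By induction these vanish,
  and the factors are below \<open>p\<close>, so they can be cancelled.\<close>

lemma pow_independent:
  assumes c: "c \<in> carrier U" "c \<notin> Frob" and g: "\<And>i. g i \<in> Frob" and N: "N \<le> p"
    and rel: "(\<Oplus>i\<in>{..<N}. g i \<otimes> c [^] i) = \<zero>"
  shows "\<forall>i<N. g i = \<zero>"
  using g N rel
proof (induction N arbitrary: g)
  case (Suc N)
  have gc: "g i \<in> carrier U" for i using Suc.prems(1)[of i] by (auto simp: Frob_def)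
  have Fsub: "[n] \<cdot> x \<in> Frob" if "x \<in> Frob" for n :: nat and x
    by (induction n) (use that subringE[OF subfieldE(1)[OF Frob_subfield]] in auto)
  define e where "e = (\<Oplus>i\<in>{..<Suc N}. [i] \<cdot> (g i \<otimes> c [^] (i - 1)))"
  have "e = \<zero>" using simple_root_in_Frob[OF c(1) Suc.prems(1,3)] c(2) unfolding e_def by blast
  moreover have "e = (\<Oplus>i\<in>{..<N}. ([Suc i] \<cdot> g (Suc i)) \<otimes> c [^] i)"
  proof -
    have "(\<Oplus>i\<in>{..<Suc m}. [i] \<cdot> (g i \<otimes> c [^] (i - 1))) = (\<Oplus>i\<in>{..<m}. ([Suc i] \<cdot> g (Suc i)) \<otimes> c [^] i)" for m :: nat
    proof (induction m)
      case 0
      then show ?case using gc c by (simp add: finsum_lessThan_Suc)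
    next
      case (Suc m)
      have "(\<Oplus>i\<in>{..<Suc (Suc m)}. [i] \<cdot> (g i \<otimes> c [^] (i - 1)))
        = (\<Oplus>i\<in>{..<Suc m}. [i] \<cdot> (g i \<otimes> c [^] (i - 1))) \<oplus> [Suc m] \<cdot> (g (Suc m) \<otimes> c [^] m)"
        using gc c by (subst finsum_lessThan_Suc) auto
      also have "[Suc m] \<cdot> (g (Suc m) \<otimes> c [^] m) = ([Suc m] \<cdot> g (Suc m)) \<otimes> c [^] m"
        using gc c by (intro add_pow_ldistr[symmetric]) auto
      finally show ?case unfolding Suc using gc c by (subst (2) finsum_lessThan_Suc) auto
    qed
    then show ?thesis by (simp add: e_def)
  qed
  ultimately have "(\<Oplus>i\<in>{..<N}. ([Suc i] \<cdot> g (Suc i)) \<otimes> c [^] i) = \<zero>" by simp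
  then have "\<forall>i<N. [Suc i] \<cdot> g (Suc i) = \<zero>"
    by (intro Suc.IH[of "\<lambda>i. [Suc i] \<cdot> g (Suc i)", OF Fsub[OF Suc.prems(1)]]) (use Suc.prems(2) in auto)
  then have z: "g (Suc i) = \<zero>" if "i < N" for i
    using nat_cancel[of "Suc i" "g (Suc i)"] that gc Suc.prems(2) by simp
  have "(\<Oplus>i\<in>{..<Suc m}. g i \<otimes> c [^] i) = g 0" if "m \<le> N" for m
    using that by (induction m) (use gc c z in \<open>auto simp: finsum_lessThan_Suc\<close>)
  then have "g 0 = \<zero>" using Suc.prems(3) by simp
  then show ?case using z by (metis less_Suc_eq_0_disj)
qed simp

end

text \<open>The polynomial ring \<open>U[X]\<close> acts on sequences by shifting; \<open>nab\<close> makes \<open>X\<close> a solution of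
  the equation. If \<open>r\<^sup>p = 0\<close>, then \<open>r = 0\<close>, because \<open>(r l)(j)\<^sup>p\<close> is the value at \<open>0\<close> of \<open>r\<^sup>p\<close> at the
  sequence that carries \<open>l(j + m)\<^sup>p\<close> at the index \<open>p m\<close>.\<close>

locale poly_ops = dfield p U for p and U :: "'u diff_ring" (structure) +
  fixes q :: nat
begin

definition \<Lambda> :: "(nat \<Rightarrow> 'u) set" where "\<Lambda> = {l. \<forall>i. l i \<in> carrier U}"

definition gen :: "'u \<Rightarrow> nat \<Rightarrow> (nat \<Rightarrow> 'u) \<Rightarrow> nat \<Rightarrow> 'u" where
  "gen f n = (\<lambda>l i. if l \<in> \<Lambda> then f \<otimes> l (i + n) else \<zero>)"

definition G where "G = {gen f n | f n. f \<in> carrier U}"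

text \<open>Regard \<open>l\<close> as a functional on \<open>U[X]\<close> with the value
  \<open>l i\<close> at \<open>X^i\<close>. Then this is \<open>D \<circ> l - l \<circ> D\<close>
  for the derivation with \<open>D X = X^(q+1)\<close>, under which
  \<open>D X^i = i X^(i+q)\<close>.\<close>

definition nab :: "(nat \<Rightarrow> 'u) \<Rightarrow> nat \<Rightarrow> 'u" where
  "nab l = (\<lambda>i. der U (l i) \<ominus> [i] \<cdot> l (i + q))"

lemma \<Lambda>D: "l \<in> \<Lambda> \<Longrightarrow> l i \<in> carrier U" by (simp add: \<Lambda>_def)

lemma gen_in: "f \<in> carrier U \<Longrightarrow> gen f n \<in> G" unfolding G_def by blast

lemma gen_cases:
  assumes "g \<in> G" obtains f n where "g = gen f n" "f \<in> carrier U"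
  using assms unfolding G_def by blast

lemma G_all: "(\<forall>g\<in>G. Q g) \<longleftrightarrow> (\<forall>f\<in>carrier U. \<forall>n. Q (gen f n))"
  unfolding G_def by blast

lemma gen_closed: "\<lbrakk>f \<in> carrier U; l \<in> \<Lambda>\<rbrakk> \<Longrightarrow> gen f n l \<in> \<Lambda>"
  by (simp add: gen_def \<Lambda>_def)

lemma gen_outside: "l \<notin> \<Lambda> \<Longrightarrow> gen f n l = (\<lambda>_. \<zero>)"
  by (simp add: gen_def)

lemma gen_comp:
  assumes "f \<in> carrier U" "g \<in> carrier U"
  shows "gen f n (gen g m l) = gen (f \<otimes> g) (n + m) l"
proof (cases "l \<in> \<Lambda>")
  case True
  then show ?thesis using assms gen_closed[OF assms(2) True] \<Lambda>D[OF True] by (simp add: gen_def m_assoc add.assoc)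
next
  case False
  then show ?thesis using assms by (auto simp: gen_def fun_eq_iff)
qed

lemma nab_gen:
  assumes f: "f \<in> carrier U" and l: "l \<in> \<Lambda>"
  shows "nab (gen f n l) = (\<lambda>i. (gen (der U f) n l i \<oplus> gen ([n] \<cdot> f) (n + q) l i) \<oplus> gen f n (nab l) i)"
proof
  fix i
  have nl: "nab l \<in> \<Lambda>" using l by (simp add: nab_def \<Lambda>_def)
  have 1: "(a \<otimes> b \<oplus> f \<otimes> c) \<ominus> I \<otimes> (f \<otimes> e) = (a \<otimes> b \<oplus> (N \<otimes> f) \<otimes> e) \<oplus> f \<otimes> (c \<ominus> (I \<oplus> N) \<otimes> e)"
    if "a \<in> carrier U" "b \<in> carrier U" "f \<in> carrier U" "c \<in> carrier U" "e \<in> carrier U" "I \<in> carrier U" "N \<in> carrier U" for a b f c e I N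
    by (use in_carrier_Cons in_carrier_Nil norm_eq[OF _ ring_norm_16, of "[a, b, f, c, I, e, N]"] that in simp)
  have 2: "[(i + n)] \<cdot> l (i + n + q) = ([i] \<cdot> \<one> \<oplus> [n] \<cdot> \<one>) \<otimes> l (i + n + q)"
    using \<Lambda>D[OF l] by (subst add_pow_nat_mult) (auto simp: add.nat_pow_mult)
  have 3: "[i] \<cdot> (f \<otimes> l (i + n + q)) = ([i] \<cdot> \<one>) \<otimes> (f \<otimes> l (i + n + q))"
    using \<Lambda>D[OF l] f by (subst add_pow_nat_mult) auto
  have 4: "[n] \<cdot> f = ([n] \<cdot> \<one>) \<otimes> f"
    using f by (subst add_pow_nat_mult) auto
  have "nab (gen f n l) i = (der U f \<otimes> l (i + n) \<oplus> f \<otimes> der U (l (i + n))) \<ominus> ([i] \<cdot> \<one>) \<otimes> (f \<otimes> l (i + n + q))"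
    using l f \<Lambda>D[OF l] 3 by (simp add: nab_def gen_def d_mult add.commute add.left_commute)
  also have "\<dots> = (der U f \<otimes> l (i + n) \<oplus> (([n] \<cdot> \<one>) \<otimes> f) \<otimes> l (i + n + q))
     \<oplus> f \<otimes> (der U (l (i + n)) \<ominus> ([i] \<cdot> \<one> \<oplus> [n] \<cdot> \<one>) \<otimes> l (i + n + q))"
    using f \<Lambda>D[OF l] by (intro 1) auto
  also have "\<dots> = (gen (der U f) n l i \<oplus> gen ([n] \<cdot> f) (n + q) l i) \<oplus> gen f n (nab l) i"
    using l nl 2 4 by (simp add: gen_def nab_def add.assoc)
  finally show "nab (gen f n l) i = (gen (der U f) n l i \<oplus> gen ([n] \<cdot> f) (n + q) l i) \<oplus> gen f n (nab l) i" .
qed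

lemma op_ring_U: "op_ring U \<Lambda> G nab"
proof (rule op_ring.intro[OF is_abelian_group])
  have "\<forall>g\<in>G. \<forall>l. (l \<notin> \<Lambda> \<longrightarrow> g l = (\<lambda>_. \<zero>)) \<and> (l \<in> \<Lambda> \<longrightarrow> g l \<in> \<Lambda>)"
    unfolding G_all by (simp add: gen_outside gen_closed)
  moreover have "\<forall>g\<in>G. \<forall>l\<in>\<Lambda>. \<forall>m\<in>\<Lambda>. g (\<lambda>i. l i \<oplus> m i) = (\<lambda>i. g l i \<oplus> g m i)"
    unfolding G_all by (simp add: gen_def r_distr \<Lambda>_def)
  moreover have "\<forall>g\<in>G. \<forall>h\<in>G. (\<forall>l\<in>\<Lambda>. g (h l) = h (g l)) \<and> g \<circ> h \<in> G"
    unfolding G_all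
  proof (intro ballI allI conjI)
    fix f n g m assume "f \<in> carrier U" "g \<in> carrier U"
    then show "gen f n (gen g m l) = gen g m (gen f n l)" for l by (simp add: gen_comp m_comm add.commute)
    have "gen f n \<circ> gen g m = gen (f \<otimes> g) (n + m)"
      using \<open>f \<in> carrier U\<close> \<open>g \<in> carrier U\<close> by (intro ext) (simp add: gen_comp)
    then show "gen f n \<circ> gen g m \<in> G" using \<open>f \<in> carrier U\<close> \<open>g \<in> carrier U\<close> by (simp add: gen_in)
  qed
  moreover have "\<forall>g\<in>G. (\<lambda>l i. \<ominus> g l i) \<in> G"
    unfolding G_all
  proof (intro ballI allI)
    fix f n assume f: "f \<in> carrier U"
    have "(\<lambda>l i. \<ominus> gen f n l i) = gen (\<ominus> f) n" using f by (auto simp: gen_def fun_eq_iff \<Lambda>_def l_minus)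
    then show "(\<lambda>l i. \<ominus> gen f n l i) \<in> G" using f by (simp add: gen_in)
  qed
  moreover have "\<forall>g\<in>G. \<exists>h\<in>G. \<exists>h'\<in>G. \<forall>l\<in>\<Lambda>. nab (g l) = (\<lambda>i. (h l i \<oplus> h' l i) \<oplus> g (nab l) i)"
    unfolding G_all
  proof (intro ballI allI)
    fix f n assume f: "f \<in> carrier U"
    then show "\<exists>h\<in>G. \<exists>h'\<in>G. \<forall>l\<in>\<Lambda>. nab (gen f n l) = (\<lambda>i. (h l i \<oplus> h' l i) \<oplus> gen f n (nab l) i)"
      using nab_gen[OF f] gen_in[of "der U f" n] gen_in[of "[n] \<cdot> f" "n + q"]
      by (intro bexI[of _ "gen (der U f) n"] bexI[of _ "gen ([n] \<cdot> f) (n + q)"]) auto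
  qed
  moreover have "(\<lambda>l. if l \<in> \<Lambda> then l else (\<lambda>_. \<zero>)) \<in> G"
  proof -
    have "(\<lambda>l. if l \<in> \<Lambda> then l else (\<lambda>_. \<zero>)) = gen \<one> 0" by (auto simp: gen_def fun_eq_iff \<Lambda>_def)
    then show ?thesis by (simp add: gen_in)
  qed
  moreover have "(\<lambda>_. \<zero>) \<in> \<Lambda>" by (simp add: \<Lambda>_def)
  moreover have "\<forall>l\<in>\<Lambda>. \<forall>i. l i \<in> carrier U" by (auto simp: \<Lambda>_def)
  moreover have "\<forall>l\<in>\<Lambda>. \<forall>m\<in>\<Lambda>. (\<lambda>i. l i \<oplus> m i) \<in> \<Lambda>" by (simp add: \<Lambda>_def)
  moreover have "\<forall>l\<in>\<Lambda>. nab l \<in> \<Lambda>" by (simp add: \<Lambda>_def nab_def)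
  moreover have "\<forall>l\<in>\<Lambda>. \<forall>m\<in>\<Lambda>. nab (\<lambda>i. l i \<oplus> m i) = (\<lambda>i. nab l i \<oplus> nab m i)"
  proof -
    have eq: "(a \<oplus> b) \<ominus> (a' \<oplus> b') = (a \<ominus> a') \<oplus> (b \<ominus> b')"
      if "a \<in> carrier U" "b \<in> carrier U" "a' \<in> carrier U" "b' \<in> carrier U" for a b a' b'
      using that by (simp add: a_minus_def minus_add a_ac)
    show ?thesis by (auto simp: nab_def fun_eq_iff d_add eq \<Lambda>_def add.nat_pow_distrib)
  qed
  ultimately show "op_ring_axioms U \<Lambda> G nab" unfolding op_ring_axioms_def by (intro conjI) (simp_all only: Ball_def simp_thms, simp_all)
qed

end

sublocale poly_ops \<subseteq> OP: op_ring U \<Lambda> G nab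
  by (rule op_ring_U)

sublocale poly_ops \<subseteq> R: derivation_ring OP.OR OP.dO
  by (rule OP.OR_derivation)

context poly_ops
begin

declare OP.OR_simps [simp del]

lemma gen_car [simp]: "f \<in> carrier U \<Longrightarrow> gen f n \<in> carrier OP.OR"
  using OP.gen_ops[OF gen_in] by (simp add: OP.OR_simps)

lemma R_mult: "\<lbrakk>f \<in> carrier U; g \<in> carrier U\<rbrakk> \<Longrightarrow> gen f n \<otimes>\<^bsub>OP.OR\<^esub> gen g m = gen (f \<otimes> g) (n + m)"
  by (simp add: OP.OR_simps gen_comp fun_eq_iff)

lemma R_one: "\<one>\<^bsub>OP.OR\<^esub> = gen \<one> 0"
  by (auto simp: OP.OR_simps OP.one_op_def gen_def fun_eq_iff \<Lambda>D)

lemma R_zero: "gen \<zero> n = \<zero>\<^bsub>OP.OR\<^esub>"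
  by (auto simp: OP.OR_simps gen_def fun_eq_iff \<Lambda>D)

lemma R_add: "\<lbrakk>f \<in> carrier U; g \<in> carrier U\<rbrakk> \<Longrightarrow> gen (f \<oplus> g) n = gen f n \<oplus>\<^bsub>OP.OR\<^esub> gen g n"
  by (auto simp: OP.OR_simps gen_def fun_eq_iff \<Lambda>D l_distr)

lemma R_pow: "f \<in> carrier U \<Longrightarrow> gen f m [^]\<^bsub>OP.OR\<^esub> (n::nat) = gen (f [^] n) (n * m)"
  by (induction n) (simp_all add: R_one R_mult add.commute)

text \<open>At \<open>f = \<one>\<close> and \<open>n = 1\<close> this says that \<open>X\<close>
  solves the equation.\<close>

lemma R_dO:
  assumes f: "f \<in> carrier U"
  shows "OP.dO (gen f n) = gen (der U f) n \<oplus>\<^bsub>OP.OR\<^esub> gen ([n] \<cdot> f) (n + q)"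
proof -
  have c: "gen (der U f) n \<in> OP.ops" "gen ([n] \<cdot> f) (n + q) \<in> OP.ops"
    using f by (auto intro!: OP.gen_ops gen_in)
  show ?thesis
    using OP.dO_gen[OF gen_in[OF f] OP.ops_add[OF c]] nab_gen[OF f] by (simp add: OP.OR_simps)
qed

lemma R_char: "[p] \<cdot>\<^bsub>OP.OR\<^esub> \<one>\<^bsub>OP.OR\<^esub> = \<zero>\<^bsub>OP.OR\<^esub>"
proof -
  note c = OP.ops_carrier[OF OP.gen_ops[OF gen_in[OF one_closed]]]
  have "[p] \<cdot>\<^bsub>OP.OR\<^esub> \<one>\<^bsub>OP.OR\<^esub> = (\<lambda>\<xi> i. [p] \<cdot> (\<one>\<^bsub>OP.OR\<^esub> \<xi> i))" by (rule OP.OR_char)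
  also have "\<dots> = (\<lambda>_ _. \<zero>)"
    unfolding R_one char_p_mult[OF c] ..
  finally show ?thesis by (simp add: OP.OR_simps)
qed

lemma twist:
  assumes "r \<in> OP.ops" and l: "l \<in> \<Lambda>"
  shows "(r [^]\<^bsub>OP.OR\<^esub> p) (\<lambda>m. if p dvd m then l (m div p + j) [^] p else \<zero>) 0 = (r l j) [^] p"
  using assms(1)
proof (induction rule: OP.ops.induct)
  case ops_zero
  have "(\<lambda>_ _. \<zero>) = \<zero>\<^bsub>OP.OR\<^esub>" by (simp add: OP.OR_simps)
  moreover have "\<zero>\<^bsub>OP.OR\<^esub> [^]\<^bsub>OP.OR\<^esub> p = \<zero>\<^bsub>OP.OR\<^esub>" by (rule R.nat_pow_zero[OF p_gt(3)])
  ultimately show ?case unfolding frob_zero by (simp only: OP.OR_simps(4))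
next
  case (ops_add_gen g r)
  let ?\<mu> = "\<lambda>m. if p dvd m then l (m div p + j) [^] p else \<zero>"
  have \<mu>: "?\<mu> \<in> \<Lambda>" using l by (auto simp: \<Lambda>_def)
  obtain f n where fn: "g = gen f n" "f \<in> carrier U" using ops_add_gen(1) by (rule gen_cases)
  have rc: "r \<in> carrier OP.OR" using ops_add_gen(2) by (simp add: OP.OR_simps)
  have "(\<lambda>\<xi> i. g \<xi> i \<oplus> r \<xi> i) = gen f n \<oplus>\<^bsub>OP.OR\<^esub> r" unfolding fn(1) by (simp add: OP.OR_simps)
  then have "(\<lambda>\<xi> i. g \<xi> i \<oplus> r \<xi> i) [^]\<^bsub>OP.OR\<^esub> p = gen (f [^] p) (p * n) \<oplus>\<^bsub>OP.OR\<^esub> r [^]\<^bsub>OP.OR\<^esub> p"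
    using R.freshmans_dream[OF prime_p R_char gen_car[OF fn(2)] rc] R_pow[OF fn(2)] by simp
  then have "((\<lambda>\<xi> i. g \<xi> i \<oplus> r \<xi> i) [^]\<^bsub>OP.OR\<^esub> p) ?\<mu> 0 = gen (f [^] p) (p * n) ?\<mu> 0 \<oplus> (r l j) [^] p"
    using ops_add_gen(3) by (simp add: OP.OR_simps)
  also have "gen (f [^] p) (p * n) ?\<mu> 0 = (g l j) [^] p"
    using \<mu> l fn p_gt \<Lambda>D[OF l] by (simp add: gen_def frob_mult add.commute)
  finally show ?case
    using frob_add OP.ops_carrier[OF OP.gen_ops[OF ops_add_gen(1)]] OP.ops_carrier[OF ops_add_gen(2)] by simp
qed

lemma R_reduced:
  assumes r: "r \<in> carrier OP.OR" "r \<otimes>\<^bsub>OP.OR\<^esub> r = \<zero>\<^bsub>OP.OR\<^esub>"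
  shows "r = \<zero>\<^bsub>OP.OR\<^esub>"
proof -
  have ro: "r \<in> OP.ops" using r(1) by (simp add: OP.OR_simps)
  obtain n where n: "p = Suc (Suc n)" using p_gt(1) by (cases p rule: nat.exhaust; cases "p - 1") auto
  have "r [^]\<^bsub>OP.OR\<^esub> p = r [^]\<^bsub>OP.OR\<^esub> n \<otimes>\<^bsub>OP.OR\<^esub> (r \<otimes>\<^bsub>OP.OR\<^esub> r)"
    unfolding n using r(1) by (simp add: R.m_assoc)
  also have "\<dots> = \<zero>\<^bsub>OP.OR\<^esub>" using r by simp
  finally have rp: "r [^]\<^bsub>OP.OR\<^esub> p = (\<lambda>_ _. \<zero>)" by (simp add: OP.OR_simps)
  have "r l j = \<zero>" for l j
  proof (cases "l \<in> \<Lambda>")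
    case True
    have "(r l j) [^] p = \<zero>" using twist[OF ro True, of j] unfolding rp by (rule sym)
    then show ?thesis using frob_eq_zero[OF OP.ops_carrier[OF ro]] by blast
  next
    case False
    then show ?thesis using OP.ops_outside[OF ro False] by simp
  qed
  then show ?thesis by (auto simp: OP.OR_simps fun_eq_iff)
qed

text \<open>The product of the factors \<open>X - v\<close>. A homomorphism to a field that does not
  kill it sends \<open>X\<close> away from the image of each \<open>v\<close>.\<close>

primrec lin :: "'u list \<Rightarrow> (nat \<Rightarrow> 'u) \<Rightarrow> nat \<Rightarrow> 'u" where
  "lin [] = \<one>\<^bsub>OP.OR\<^esub>"
| "lin (v # vs) = lin vs \<otimes>\<^bsub>OP.OR\<^esub> (gen \<one> (Suc 0) \<oplus>\<^bsub>OP.OR\<^esub> gen (\<ominus> v) 0)"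

lemma lin_car: "set vs \<subseteq> carrier U \<Longrightarrow> lin vs \<in> carrier OP.OR"
  by (induction vs) auto

text \<open>The product is monic of degree \<open>length vs\<close>: on a sequence that vanishes
  below this index only the leading term contributes.\<close>

lemma lin_eval:
  "\<lbrakk>set vs \<subseteq> carrier U; l \<in> \<Lambda>; \<forall>i<length vs. l i = \<zero>\<rbrakk> \<Longrightarrow> lin vs l 0 = l (length vs)"
proof (induction vs arbitrary: l)
  case Nil
  then show ?case by (simp add: OP.OR_simps OP.one_op_def)
next
  case (Cons v vs)
  let ?l = "(gen \<one> (Suc 0) \<oplus>\<^bsub>OP.OR\<^esub> gen (\<ominus> v) 0) l"
  have v: "v \<in> carrier U" using Cons by simp
  have l: "?l i = l (Suc i) \<oplus> (\<ominus> v) \<otimes> l i" for i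
    using Cons(3) \<Lambda>D[OF Cons(3)] by (simp add: OP.OR_simps gen_def)
  have "?l \<in> \<Lambda>" using v l \<Lambda>D[OF Cons(3)] by (simp add: \<Lambda>_def)
  moreover have "\<forall>i<length vs. ?l i = \<zero>" using Cons(4) v by (simp add: l)
  ultimately have "lin vs ?l 0 = ?l (length vs)" using Cons by auto
  then show ?case using v \<Lambda>D[OF Cons(3)] Cons(4) by (simp add: OP.OR_simps(2)) (simp add: l)
qed

end

text \<open>The polynomial ring \<open>U[X]\<close> with \<open>D X = X^(q+1)\<close> is reduced, so
  it maps to a differential field without killing the product of the \<open>X - v\<close>; the image
  of \<open>X\<close> is the new solution. Since any finite set can be evaded, solutions turn out to
  be infinite in number.\<close>

theorem exists_solution_extension:
  fixes U :: "'u::infinite diff_ring" and q :: nat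
  assumes U: "dfield p U" and vs: "set vs \<subseteq> carrier U"
  shows "\<exists>(L::'u diff_ring) i t. differential_field p L \<and> diff_embedding i U L \<and> t \<in> carrier L \<and>
    der L t = t [^]\<^bsub>L\<^esub> (q + 1) \<and> (\<forall>v\<in>set vs. t \<noteq> i v)"
proof -
  interpret dfield p U by (rule U)
  interpret poly_ops p U q by unfold_locales
  have "lin vs \<noteq> \<zero>\<^bsub>OP.OR\<^esub>"
  proof
    assume "lin vs = \<zero>\<^bsub>OP.OR\<^esub>"
    moreover have "lin vs (\<lambda>i. if i = length vs then \<one>\<^bsub>U\<^esub> else \<zero>\<^bsub>U\<^esub>) 0 = \<one>\<^bsub>U\<^esub>"
      using vs by (subst lin_eval) (auto simp: \<Lambda>_def)
    ultimately show False by (simp add: OP.OR_simps)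
  qed
  \<comment> \<open>A monomial is named by a list whose head is the coefficient; the length of the
    tail is the exponent.\<close>
  have "G \<subseteq> range (\<lambda>xs. gen (hd xs) (length (tl xs)))"
  proof
    fix g assume "g \<in> G"
    then obtain f n where fu: "g = gen f n" by (rule gen_cases)
    show "g \<in> range (\<lambda>xs. gen (hd xs) (length (tl xs)))"
      unfolding fu by (rule range_eqI[of _ _ "f # replicate n f"]) simp
  qed
  then obtain g :: "'u list \<Rightarrow> (nat \<Rightarrow> 'u) \<Rightarrow> nat \<Rightarrow> 'u" where g: "carrier OP.OR \<subseteq> range g"
    using OP.ops_coded[of "\<lambda>xs. gen (hd xs) (length (tl xs))"] by blast
  have "\<exists>(L::'u diff_ring) h. differential_field p L \<and> h \<in> ring_hom OP.OR L \<and>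
    (\<forall>x\<in>carrier OP.OR. h (OP.dO x) = der L (h x)) \<and> h (lin vs) \<noteq> \<zero>\<^bsub>L\<^esub>"
    by (rule R.exists_differential_field_hom[OF _ lin_car[OF vs] \<open>lin vs \<noteq> _\<close> R_char g]) (rule R_reduced)
  then obtain L :: "'u diff_ring" and h where L: "differential_field p L" and h: "h \<in> ring_hom OP.OR L"
    and hd: "\<And>x. x \<in> carrier OP.OR \<Longrightarrow> h (OP.dO x) = der L (h x)" and hs: "h (lin vs) \<noteq> \<zero>\<^bsub>L\<^esub>"
    by (elim exE conjE) simp
  interpret L: dfield p L using L prime_p by (simp add: dfield_def)
  have i: "(\<lambda>f. h (gen f 0)) \<in> ring_hom U L"
  proof (rule ring_hom_memI)
    fix x y assume xy: "x \<in> carrier U" "y \<in> carrier U"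
    show "h (gen (x \<otimes>\<^bsub>U\<^esub> y) 0) = h (gen x 0) \<otimes>\<^bsub>L\<^esub> h (gen y 0)"
      using ring_hom_mult[OF h, of "gen x 0" "gen y 0"] xy by (simp add: R_mult)
    show "h (gen (x \<oplus>\<^bsub>U\<^esub> y) 0) = h (gen x 0) \<oplus>\<^bsub>L\<^esub> h (gen y 0)"
      using ring_hom_add[OF h, of "gen x 0" "gen y 0"] xy by (simp add: R_add)
  next
    show "h (gen \<one>\<^bsub>U\<^esub> 0) = \<one>\<^bsub>L\<^esub>" using ring_hom_one[OF h] by (simp add: R_one)
    show "h (gen x 0) \<in> carrier L" if "x \<in> carrier U" for x
      using ring_hom_closed[OF h gen_car[OF that]] .
  qed
  have "h (gen (der U f) 0) = der L (h (gen f 0))" if f: "f \<in> carrier U" for f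
    using hd[of "gen f 0"] f by (simp add: R_dO R_zero)
  then have emb: "diff_embedding (\<lambda>f. h (gen f 0)) U L"
    using non_trivial_field_hom_is_inj[OF i field_axioms L.field_axioms] i by (simp add: diff_embedding_def)
  let ?X = "gen \<one>\<^bsub>U\<^esub> (Suc 0)"
  have hX: "h ?X \<in> carrier L" using ring_hom_closed[OF h gen_car[OF one_closed]] .
  have hpow: "h (r [^]\<^bsub>OP.OR\<^esub> n) = h r [^]\<^bsub>L\<^esub> n" if "r \<in> carrier OP.OR" for r and n :: nat
    by (induction n) (use that ring_hom_mult[OF h] ring_hom_one[OF h] in auto)
  have "?X [^]\<^bsub>OP.OR\<^esub> (q + 1) = gen \<one>\<^bsub>U\<^esub> (q + 1)"
    using R_pow[OF one_closed, of "Suc 0" "q + 1"] by (simp only: nat_pow_one mult_Suc_right mult_0_right add_0_right)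
  then have "OP.dO ?X = ?X [^]\<^bsub>OP.OR\<^esub> (q + 1)" by (simp add: R_dO R_zero del: R.nat_pow_Suc)
  then have dX: "der L (h ?X) = h ?X [^]\<^bsub>L\<^esub> (q + 1)" using hd[of ?X] hpow[of ?X "q + 1"] by simp
  have "h ?X \<noteq> h (gen v 0)" if v: "v \<in> set vs" for v
  proof
    assume eq: "h ?X = h (gen v 0)"
    have "h (lin ws) = \<zero>\<^bsub>L\<^esub>" if "v \<in> set ws" "set ws \<subseteq> carrier U" for ws
      using that
    proof (induction ws)
      case (Cons w ws)
      have c: "w \<in> carrier U" "lin ws \<in> carrier OP.OR" "h (lin ws) \<in> carrier L" "h (gen w 0) \<in> carrier L"
        using Cons lin_car ring_hom_closed[OF h] by auto
      have 0: "h (gen (\<ominus>\<^bsub>U\<^esub> w) 0) = \<ominus>\<^bsub>L\<^esub> h (gen w 0)"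
        using ring_hom_add[OF i, of w "\<ominus>\<^bsub>U\<^esub> w"] c ring_hom_zero[OF i is_ring L.is_ring] ring_hom_closed[OF i]
        by (simp add: r_neg) (metis L.minus_equality L.a_comm a_inv_closed)
      have "h (lin (w # ws)) = h (lin ws) \<otimes>\<^bsub>L\<^esub> (h ?X \<oplus>\<^bsub>L\<^esub> \<ominus>\<^bsub>L\<^esub> h (gen w 0))"
        using c ring_hom_mult[OF h] ring_hom_add[OF h] 0 by simp
      then show ?case using Cons c eq hX by (auto simp: L.r_neg)
    qed simp
    then show False using hs v vs by blast
  qed
  then show ?thesis using L emb hX dX by (intro exI[of _ L] exI[of _ "\<lambda>f. h (gen f 0)"] exI[of _ "h ?X"]) simp
qed

section \<open>Eigenvectors of the derivation\<close>

context dfield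
begin

definition dsub :: "'u set \<Rightarrow> bool" where
  "dsub K \<longleftrightarrow> subfield K U \<and> (\<forall>k\<in>K. der U k \<in> K)"

definition cst :: "'u set" where "cst = {c \<in> carrier U. der U c = \<zero>}"

text \<open>As \<open>p\<close>-th powers are constant, the constants of \<open>K\<close> are then
  exactly its \<open>p\<close>-th powers. This yields separability of \<open>U\<close> over
  \<open>K\<close> in \<open>good_sep\<close>.\<close>

definition good :: "'u set \<Rightarrow> bool" where
  "good K \<longleftrightarrow> dsub K \<and> (\<forall>c\<in>K. der U c = \<zero> \<longrightarrow> (\<exists>x\<in>K. x [^] p = c))"

lemma dsubD:
  assumes "dsub K"
  shows "subfield K U" "k \<in> K \<Longrightarrow> k \<in> carrier U" "\<zero> \<in> K" "\<one> \<in> K"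
    "\<lbrakk>a \<in> K; b \<in> K\<rbrakk> \<Longrightarrow> a \<oplus> b \<in> K" "\<lbrakk>a \<in> K; b \<in> K\<rbrakk> \<Longrightarrow> a \<otimes> b \<in> K"
    "a \<in> K \<Longrightarrow> \<ominus> a \<in> K" "\<lbrakk>a \<in> K; b \<in> K\<rbrakk> \<Longrightarrow> a \<ominus> b \<in> K" "\<lbrakk>a \<in> K; a \<noteq> \<zero>\<rbrakk> \<Longrightarrow> inv a \<in> K"
    "a \<in> K \<Longrightarrow> der U a \<in> K" "a \<in> K \<Longrightarrow> a [^] (n::nat) \<in> K" "a \<in> K \<Longrightarrow> [n] \<cdot> a \<in> K"
proof -
  have K: "subfield K U" and d: "\<forall>k\<in>K. der U k \<in> K" using assms by (auto simp: dsub_def)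
  note sr = subringE[OF subfieldE(1)[OF K]]
  show "subfield K U" by (rule K)
  show "k \<in> K \<Longrightarrow> k \<in> carrier U" for k using sr(1) by blast
  show z: "\<zero> \<in> K" and o: "\<one> \<in> K" using sr by auto
  show add: "\<lbrakk>a \<in> K; b \<in> K\<rbrakk> \<Longrightarrow> a \<oplus> b \<in> K" and mul: "\<lbrakk>a \<in> K; b \<in> K\<rbrakk> \<Longrightarrow> a \<otimes> b \<in> K"
    and neg: "a \<in> K \<Longrightarrow> \<ominus> a \<in> K" for a b using sr by auto
  show "\<lbrakk>a \<in> K; b \<in> K\<rbrakk> \<Longrightarrow> a \<ominus> b \<in> K" for a b using add neg by (simp add: a_minus_def)
  show "\<lbrakk>a \<in> K; a \<noteq> \<zero>\<rbrakk> \<Longrightarrow> inv a \<in> K" for a using subfield_m_inv(1)[OF K, of a] by auto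
  show "a \<in> K \<Longrightarrow> der U a \<in> K" for a using d by blast
  show "a \<in> K \<Longrightarrow> a [^] n \<in> K" for a and n :: nat by (induction n) (auto intro: o mul)
  show "a \<in> K \<Longrightarrow> [n] \<cdot> a \<in> K" for a and n :: nat by (induction n) (auto intro: z add)
qed

lemma cstD: "c \<in> cst \<Longrightarrow> c \<in> carrier U" "c \<in> cst \<Longrightarrow> der U c = \<zero>"
  by (auto simp: cst_def)

lemma der_inv:
  assumes "x \<in> carrier U" "x \<noteq> \<zero>"
  shows "der U (inv x) = \<ominus> (der U x \<otimes> (inv x \<otimes> inv x))"
proof -
  note i = inv_nonzero[OF assms]
  have "der U x \<otimes> inv x \<oplus> x \<otimes> der U (inv x) = der U (x \<otimes> inv x)"
    by (rule d_mult[symmetric, OF assms(1) i(1)])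
  also have "\<dots> = \<zero>" using i by simp
  finally have "inv x \<otimes> (der U x \<otimes> inv x \<oplus> x \<otimes> der U (inv x)) = \<zero>" using i by simp
  moreover have "inv x \<otimes> (der U x \<otimes> inv x \<oplus> x \<otimes> der U (inv x)) = der U x \<otimes> (inv x \<otimes> inv x) \<oplus> (inv x \<otimes> x) \<otimes> der U (inv x)"
  proof -
    have "j \<otimes> (a \<otimes> j \<oplus> y \<otimes> b) = a \<otimes> (j \<otimes> j) \<oplus> (j \<otimes> y) \<otimes> b"
      if "j \<in> carrier U" "a \<in> carrier U" "y \<in> carrier U" "b \<in> carrier U" for j a y b
      by (use in_carrier_Cons in_carrier_Nil norm_eq[OF _ ring_norm_17, of "[j, a, y, b]"] that in simp)
    from this[OF i(1) d_closed[OF assms(1)] assms(1) d_closed[OF i(1)]] show ?thesis .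
  qed
  ultimately have "der U x \<otimes> (inv x \<otimes> inv x) \<oplus> der U (inv x) = \<zero>" using i by simp
  then show ?thesis using assms i
    by (metis a_comm d_closed m_closed minus_equality)
qed

lemma cst_dsub: "dsub cst"
proof -
  have "subfield cst U"
  proof (rule subfieldI'[OF subringI])
    show "inv k \<in> cst" if "k \<in> cst - {\<zero>}" for k
      using that inv_nonzero[of k] der_inv[of k] by (auto simp: cst_def a_minus_def intro: minus_equality)
  qed (auto simp: cst_def d_minus d_mult d_add intro: minus_equality)
  then show ?thesis by (auto simp: dsub_def cst_def)
qed

lemma pow_p_const: "x \<in> carrier U \<Longrightarrow> x [^] p \<in> cst"
  by (simp add: cst_def der_pow_p)

lemma der_finsum:
  assumes "finite I" "\<And>i. i \<in> I \<Longrightarrow> f i \<in> carrier U"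
  shows "der U (\<Oplus>i\<in>I. f i) = (\<Oplus>i\<in>I. der U (f i))"
  using assms by (induction I rule: finite_induct) (auto simp: finsum_insert Pi_def d_add)

lemma finsum_scale:
  assumes "finite I" "a \<in> carrier U" "\<And>i. i \<in> I \<Longrightarrow> F i \<in> carrier U"
  shows "(\<Oplus>i\<in>I. a \<otimes> F i) = a \<otimes> (\<Oplus>i\<in>I. F i)"
  using assms finsum_rdistr[of I a F] by auto

text \<open>Differentiating a linear relation between eigenvectors and subtracting a multiple of it
  removes a term, so a shortest relation has coefficients that are themselves eigenvectors.\<close>

lemma eigen_relation:
  assumes E: "dsub E" and I: "finite I"
    and v: "\<And>i. i \<in> I \<Longrightarrow> v i \<in> carrier U" "\<And>i. i \<in> I \<Longrightarrow> der U (v i) = \<theta> i \<otimes> v i"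
    and \<theta>: "\<And>i. i \<in> I \<Longrightarrow> \<theta> i \<in> E"
    and f: "\<And>i. i \<in> I \<Longrightarrow> f i \<in> E" "(\<Oplus>i\<in>I. f i \<otimes> v i) = \<zero>" "j \<in> I" "f j \<noteq> \<zero>"
  shows "\<exists>g j. j \<in> I \<and> (\<forall>i\<in>I. g i \<in> E) \<and> (\<Oplus>i\<in>I. g i \<otimes> v i) = \<zero> \<and> g j = \<one> \<and>
    (\<forall>i\<in>I. der U (g i) = (\<theta> j \<ominus> \<theta> i) \<otimes> g i)"
  using f
proof (induction "card {i \<in> I. f i \<noteq> \<zero>}" arbitrary: f j rule: less_induct)
  case less
  note Ed = dsubD[OF E]
  define g where "g = (\<lambda>i. inv (f j) \<otimes> f i)"
  have fj: "f j \<in> carrier U" "inv (f j) \<in> E" "inv (f j) \<in> carrier U" "inv (f j) \<otimes> f j = \<one>"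
    using less.prems Ed(2,9) inv_nonzero[of "f j"] by auto
  have gE: "g i \<in> E" if "i \<in> I" for i using less.prems(1)[OF that] fj Ed(6) by (simp add: g_def)
  have gc: "g i \<in> carrier U" "der U (g i) \<in> carrier U" "\<theta> i \<in> carrier U" if "i \<in> I" for i
    using gE[OF that] \<theta>[OF that] Ed(2) by auto
  have fvc: "f i \<otimes> v i \<in> carrier U" if "i \<in> I" for i
    using less.prems(1)[OF that] Ed(2) v(1)[OF that] by auto
  have gvc: "g i \<otimes> v i \<in> carrier U" if "i \<in> I" for i
    using gc[OF that] v(1)[OF that] by auto
  have gj: "g j = \<one>" using fj by (simp add: g_def)
  have grel: "(\<Oplus>i\<in>I. g i \<otimes> v i) = \<zero>"
  proof -
    have "(\<Oplus>i\<in>I. g i \<otimes> v i) = (\<Oplus>i\<in>I. inv (f j) \<otimes> (f i \<otimes> v i))"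
    proof (rule finsum_cong'[OF refl])
      show "(\<lambda>i. inv (f j) \<otimes> (f i \<otimes> v i)) \<in> I \<rightarrow> carrier U" using fvc fj by auto
      show "g i \<otimes> v i = inv (f j) \<otimes> (f i \<otimes> v i)" if "i \<in> I" for i
        unfolding g_def using less.prems(1)[OF that] Ed(2) v(1)[OF that] fj by (intro m_assoc) auto
    qed
    also have "\<dots> = inv (f j) \<otimes> (\<Oplus>i\<in>I. f i \<otimes> v i)"
      by (rule finsum_scale[OF I fj(3) fvc])
    finally show ?thesis using less.prems(2) fj by simp
  qed
  define h where "h = (\<lambda>i. der U (g i) \<ominus> (\<theta> j \<ominus> \<theta> i) \<otimes> g i)"
  have hE: "h i \<in> E" if "i \<in> I" for i
    unfolding h_def
    by (rule Ed(8)[OF Ed(10)[OF gE[OF that]] Ed(6)[OF Ed(8)[OF \<theta>[OF less.prems(3)] \<theta>[OF that]] gE[OF that]]])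
  show ?case
  proof (cases "\<forall>i\<in>I. h i = \<zero>")
    case True
    have "der U (g i) = (\<theta> j \<ominus> \<theta> i) \<otimes> g i" if i: "i \<in> I" for i
    proof (rule eq_of_minus)
      show "der U (g i) \<ominus> (\<theta> j \<ominus> \<theta> i) \<otimes> g i = \<zero>" using True i by (simp add: h_def)
    qed (use gc[OF i] gc[OF less.prems(3)] in simp_all)
    then have "j \<in> I \<and> (\<forall>i\<in>I. g i \<in> E) \<and> (\<Oplus>i\<in>I. g i \<otimes> v i) = \<zero> \<and> g j = \<one> \<and>
      (\<forall>i\<in>I. der U (g i) = (\<theta> j \<ominus> \<theta> i) \<otimes> g i)"
      using gE grel gj less.prems(3) by blast
    then show ?thesis by blast
  next
    case False
    then obtain k where k: "k \<in> I" "h k \<noteq> \<zero>" by blast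
    have hj: "h j = \<zero>" unfolding h_def gj using gc[OF less.prems(3)] by (simp add: a_minus_def r_neg)
    have hz: "h i = \<zero>" if "i \<in> I" "f i = \<zero>" for i
      unfolding h_def using that fj gc[OF that(1)] gc[OF less.prems(3)] by (simp add: g_def a_minus_def)
    have "{i \<in> I. h i \<noteq> \<zero>} \<subset> {i \<in> I. f i \<noteq> \<zero>}" using hj hz less.prems(3,4) by auto
    then have lt: "card {i \<in> I. h i \<noteq> \<zero>} < card {i \<in> I. f i \<noteq> \<zero>}" using I by (intro psubset_card_mono) auto
    have "(\<Oplus>i\<in>I. h i \<otimes> v i) = (\<Oplus>i\<in>I. der U (g i \<otimes> v i) \<oplus> (\<ominus> \<theta> j) \<otimes> (g i \<otimes> v i))"
    proof (rule finsum_cong'[OF refl])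
      fix i assume i: "i \<in> I"
      have id: "(a \<ominus> (t \<ominus> s) \<otimes> b) \<otimes> w = (a \<otimes> w \<oplus> b \<otimes> (s \<otimes> w)) \<oplus> (\<ominus> t) \<otimes> (b \<otimes> w)"
        if "a \<in> carrier U" "t \<in> carrier U" "s \<in> carrier U" "b \<in> carrier U" "w \<in> carrier U" for a t s b w
        by (use in_carrier_Cons in_carrier_Nil norm_eq[OF _ ring_norm_18, of "[a, t, s, b, w]"] that in simp)
      show "h i \<otimes> v i = der U (g i \<otimes> v i) \<oplus> (\<ominus> \<theta> j) \<otimes> (g i \<otimes> v i)"
        unfolding h_def using gc[OF i] gc[OF less.prems(3)] v(1)[OF i] by (simp add: d_mult v(2)[OF i] id)
    next
      show "(\<lambda>i. der U (g i \<otimes> v i) \<oplus> (\<ominus> \<theta> j) \<otimes> (g i \<otimes> v i)) \<in> I \<rightarrow> carrier U"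
        using gvc gc(3)[OF less.prems(3)] by auto
    qed
    also have "\<dots> = (\<Oplus>i\<in>I. der U (g i \<otimes> v i)) \<oplus> (\<Oplus>i\<in>I. (\<ominus> \<theta> j) \<otimes> (g i \<otimes> v i))"
      by (rule finsum_addf) (use gvc gc(3)[OF less.prems(3)] in auto)
    also have "(\<Oplus>i\<in>I. der U (g i \<otimes> v i)) = der U (\<Oplus>i\<in>I. g i \<otimes> v i)"
      by (rule der_finsum[OF I gvc, symmetric])
    also have "(\<Oplus>i\<in>I. (\<ominus> \<theta> j) \<otimes> (g i \<otimes> v i)) = (\<ominus> \<theta> j) \<otimes> (\<Oplus>i\<in>I. g i \<otimes> v i)"
      by (rule finsum_scale[OF I a_inv_closed[OF gc(3)[OF less.prems(3)]] gvc])
    finally have "(\<Oplus>i\<in>I. h i \<otimes> v i) = \<zero>" using grel gc[OF less.prems(3)] by simp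
    then show ?thesis using less.hyps[OF lt hE _ k] by blast
  qed
qed

text \<open>The compositum of \<open>K\<close> and the constants.\<close>

inductive_set EK :: "'u set \<Rightarrow> 'u set" for K where
  EK_zero: "\<zero> \<in> EK K"
| EK_step: "\<lbrakk>k \<in> K; c \<in> cst; x \<in> EK K\<rbrakk> \<Longrightarrow> k \<otimes> c \<oplus> x \<in> EK K"

context
  fixes K assumes K: "dsub K"
begin

lemma EK_carrier: "x \<in> EK K \<Longrightarrow> x \<in> carrier U"
  by (induction rule: EK.induct) (auto simp: dsubD(2)[OF K] cstD)

lemma EK_add: "\<lbrakk>x \<in> EK K; y \<in> EK K\<rbrakk> \<Longrightarrow> x \<oplus> y \<in> EK K"
proof (induction rule: EK.induct)
  case (EK_step k c x)
  then show ?case using EK.EK_step[of k K c "x \<oplus> y"] EK_carrier dsubD(2)[OF K] cstD by (simp add: a_assoc)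
qed (simp add: EK_carrier)

lemma EK_prod: "\<lbrakk>k \<in> K; c \<in> cst\<rbrakk> \<Longrightarrow> k \<otimes> c \<in> EK K"
  using EK_step[of k K c \<zero>] EK_zero[of K] dsubD(2)[OF K] cstD by simp

lemma EK_K: "k \<in> K \<Longrightarrow> k \<in> EK K"
  using EK_prod[of k \<one>] dsubD(2)[OF K] dsubD(4)[OF cst_dsub] by simp

lemma EK_const: "c \<in> cst \<Longrightarrow> c \<in> EK K"
  using EK_prod[of \<one> c] cstD dsubD(4)[OF K] by simp

lemma EK_mult_gen: "\<lbrakk>x \<in> EK K; k \<in> K; c \<in> cst\<rbrakk> \<Longrightarrow> (k \<otimes> c) \<otimes> x \<in> EK K"
proof (induction rule: EK.induct)
  case EK_zero
  then show ?case using EK.EK_zero dsubD(2)[OF K] cstD by simp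
next
  case (EK_step k' c' x)
  have "(k \<otimes> k') \<otimes> (c \<otimes> c') \<oplus> (k \<otimes> c) \<otimes> x \<in> EK K"
    by (rule EK.EK_step[OF dsubD(6)[OF K EK_step(5,1)] dsubD(6)[OF cst_dsub EK_step(6,2)] EK_step(4)[OF EK_step(5,6)]])
  then show ?case using EK_step EK_carrier dsubD(2)[OF K] cstD by (simp add: r_distr m_ac)
qed

lemma EK_mult: "\<lbrakk>x \<in> EK K; y \<in> EK K\<rbrakk> \<Longrightarrow> x \<otimes> y \<in> EK K"
proof (induction rule: EK.induct)
  case EK_zero
  then show ?case using EK.EK_zero EK_carrier by simp
next
  case (EK_step k c x)
  then show ?case using EK_add[OF EK_mult_gen[of y k c]] EK_carrier dsubD(2)[OF K] cstD by (simp add: l_distr)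
qed

lemma EK_pow: "x \<in> EK K \<Longrightarrow> x [^] (n::nat) \<in> EK K"
  by (induction n) (auto intro: EK_mult EK_K dsubD(4)[OF K])

text \<open>The finite sums of products already form a field: the inverse of \<open>x\<close> is
  \<open>x^(p-1)\<close> times the \<open>p\<close>-th power of the inverse, and the latter factor
  is a constant.\<close>

lemma EK_dsub: "dsub (EK K)"
proof -
  have neg: "\<ominus> x \<in> EK K" if "x \<in> EK K" for x
    using EK_mult[OF EK_K[OF dsubD(7)[OF K dsubD(4)[OF K]]] that] EK_carrier[OF that] by (simp add: l_minus)
  have "subfield (EK K) U"
  proof (rule subfieldI'[OF subringI])
    show "EK K \<subseteq> carrier U" using EK_carrier by blast
    show "\<one> \<in> EK K" by (rule EK_K[OF dsubD(4)[OF K]])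
    show "\<ominus> x \<in> EK K" if "x \<in> EK K" for x by (rule neg[OF that])
    show "x \<otimes> y \<in> EK K" "x \<oplus> y \<in> EK K" if "x \<in> EK K" "y \<in> EK K" for x y
      using EK_mult EK_add that by auto
    show "inv x \<in> EK K" if x: "x \<in> EK K - {\<zero>}" for x
    proof -
      have x': "x \<in> carrier U" "x \<noteq> \<zero>" using x EK_carrier by auto
      have "x [^] (p - 1) \<otimes> (inv x) [^] p \<in> EK K"
        by (rule EK_mult[OF EK_pow EK_const[OF pow_p_const]]) (use x inv_nonzero[OF x'] in auto)
      then show ?thesis by (simp only: inv_pow_p[OF x', symmetric])
    qed
  qed
  moreover have "der U x \<in> EK K" if "x \<in> EK K" for x
    using that
  proof (induction rule: EK.induct)
    case (EK_step k c x)
    have "der U (k \<otimes> c \<oplus> x) = der U k \<otimes> c \<oplus> der U x"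
      using EK_step EK_carrier dsubD(2)[OF K] cstD by (simp add: d_add d_mult)
    then show ?case using EK.EK_step[OF dsubD(10)[OF K EK_step(1)] EK_step(2,4)] by simp
  qed (simp add: EK.EK_zero)
  ultimately show ?thesis by (simp add: dsub_def)
qed

text \<open>Confines an element of the compositum to a space of finite dimension over the constants,
  where eigenvalues can be counted.\<close>

lemma EK_span: "x \<in> EK K \<Longrightarrow> \<exists>as. set as \<subseteq> K \<and> x \<in> Span cst as"
proof (induction rule: EK.induct)
  case (EK_step k c x)
  then obtain as where "set as \<subseteq> K" "x \<in> Span cst as" by blast
  moreover have "k \<otimes> c = c \<otimes> k" using EK_step dsubD(2)[OF K] cstD by (simp add: m_comm)
  ultimately show ?case using EK_step by (intro exI[of _ "k # as"]) (auto simp only: span_cons_iff list.set insert_subset)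
qed (intro exI[of _ "[]"], simp)

end

text \<open>\<open>Ev K\<close> collects the constant eigenvalues of the derivation on \<open>EK K\<close>; \<open>PR K v\<close> is the ring
  \<open>K[v]\<close>, and \<open>Fr R\<close> is the field of fractions of \<open>R\<close>.\<close>

definition Ev :: "'u set \<Rightarrow> 'u set" where
  "Ev K = {\<theta> \<in> cst. \<exists>y\<in>EK K. y \<noteq> \<zero> \<and> der U y = \<theta> \<otimes> y}"

inductive_set PR :: "'u set \<Rightarrow> 'u \<Rightarrow> 'u set" for K v where
  PR_K: "k \<in> K \<Longrightarrow> k \<in> PR K v"
| PR_var: "v \<in> PR K v"
| PR_add: "\<lbrakk>x \<in> PR K v; y \<in> PR K v\<rbrakk> \<Longrightarrow> x \<oplus> y \<in> PR K v"
| PR_mult: "\<lbrakk>x \<in> PR K v; y \<in> PR K v\<rbrakk> \<Longrightarrow> x \<otimes> y \<in> PR K v"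

definition Fr :: "'u set \<Rightarrow> 'u set" where
  "Fr R = {x \<otimes> inv y | x y. x \<in> R \<and> y \<in> R \<and> y \<noteq> \<zero>}"

definition poly :: "nat \<Rightarrow> (nat \<Rightarrow> 'u) \<Rightarrow> 'u \<Rightarrow> 'u" where
  "poly N f v = (\<Oplus>i\<in>{..<N}. f i \<otimes> v [^] i)"

definition transc :: "'u set \<Rightarrow> 'u \<Rightarrow> bool" where
  "transc K v \<longleftrightarrow> (\<forall>N f. (\<forall>i. f i \<in> K) \<longrightarrow> poly N f v = \<zero> \<longrightarrow> (\<forall>i<N. f i = \<zero>))"

text \<open>The set of pairs generated by the pairs \<open>(k, \<sigma> k)\<close> and
  \<open>(v, w)\<close> under sums and products. It becomes the graph of an extension of
  \<open>\<sigma>\<close> to \<open>K[v]\<close> once \<open>v\<close> is transcendental.\<close>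

inductive rel :: "'u set \<Rightarrow> ('u \<Rightarrow> 'u) \<Rightarrow> 'u \<Rightarrow> 'u \<Rightarrow> 'u \<Rightarrow> 'u \<Rightarrow> bool" for K \<sigma> v w where
  rel_K: "k \<in> K \<Longrightarrow> rel K \<sigma> v w k (\<sigma> k)"
| rel_var: "rel K \<sigma> v w v w"
| rel_add: "\<lbrakk>rel K \<sigma> v w x x'; rel K \<sigma> v w y y'\<rbrakk> \<Longrightarrow> rel K \<sigma> v w (x \<oplus> y) (x' \<oplus> y')"
| rel_mult: "\<lbrakk>rel K \<sigma> v w x x'; rel K \<sigma> v w y y'\<rbrakk> \<Longrightarrow> rel K \<sigma> v w (x \<otimes> y) (x' \<otimes> y')"

lemma poly_0 [simp]: "poly 0 f v = \<zero>"
  by (simp add: poly_def)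

lemma poly_Suc:
  "\<lbrakk>\<And>i. f i \<in> carrier U; v \<in> carrier U\<rbrakk> \<Longrightarrow> poly (Suc N) f v = poly N f v \<oplus> f N \<otimes> v [^] N"
  unfolding poly_def by (subst finsum_lessThan_Suc) auto

lemma poly_carrier [simp]: "\<lbrakk>\<And>i. f i \<in> carrier U; v \<in> carrier U\<rbrakk> \<Longrightarrow> poly N f v \<in> carrier U"
  unfolding poly_def by (intro finsum_closed) auto

lemma poly_add:
  assumes "\<And>i. f i \<in> carrier U" "\<And>i. g i \<in> carrier U" "v \<in> carrier U"
  shows "poly N (\<lambda>i. f i \<oplus> g i) v = poly N f v \<oplus> poly N g v"
  by (induction N) (use assms in \<open>auto simp: poly_Suc l_distr a_ac\<close>)

lemma poly_scale:
  assumes "\<And>i. f i \<in> carrier U" "k \<in> carrier U" "v \<in> carrier U"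
  shows "poly N (\<lambda>i. k \<otimes> f i) v = k \<otimes> poly N f v"
  by (induction N) (use assms in \<open>auto simp: poly_Suc r_distr m_assoc\<close>)

lemma poly_pad:
  assumes "\<And>i. f i \<in> carrier U" "v \<in> carrier U" "N \<le> M"
  shows "poly M (\<lambda>i. if i < N then f i else \<zero>) v = poly N f v"
proof -
  have "poly N (\<lambda>i. if i < N then f i else \<zero>) v = poly N f v"
    unfolding poly_def using assms by (intro finsum_cong') auto
  moreover have "poly (N + m) (\<lambda>i. if i < N then f i else \<zero>) v = poly N (\<lambda>i. if i < N then f i else \<zero>) v" for m
    by (induction m) (use assms in \<open>auto simp: poly_Suc\<close>)
  ultimately show ?thesis using assms(3) by (metis le_add_diff_inverse)
qed

lemma poly_shift:
  assumes "\<And>i. f i \<in> carrier U" "v \<in> carrier U"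
  shows "poly (Suc N) (\<lambda>i. case i of 0 \<Rightarrow> \<zero> | Suc j \<Rightarrow> f j) v = v \<otimes> poly N f v"
proof (induction N)
  case (Suc N)
  have c: "(case i of 0 \<Rightarrow> \<zero> | Suc j \<Rightarrow> f j) \<in> carrier U" for i using assms by (cases i) auto
  show ?case using Suc assms c by (subst poly_Suc) (auto simp: poly_Suc[of f] r_distr m_ac)
qed (use assms in \<open>simp add: poly_Suc split: nat.split\<close>)

text \<open>Pairs made of a polynomial at \<open>v\<close> and its conjugate at \<open>w\<close>
  include the generators of \<open>rel\<close> and are closed under sums and products; a product
  reduces to scaling by elements of \<open>K\<close> and shifting by powers of the variable. With
  the identity for \<open>\<sigma>\<close> this gives a normal form for elements of
  \<open>K[v]\<close>.\<close>

lemma rel_normal_form: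
  assumes K: "dsub K" and \<sigma>: "diff_hom_on K U U \<sigma>" and v: "v \<in> carrier U" and w: "w \<in> carrier U"
    and r: "rel K \<sigma> v w x y"
  shows "\<exists>N f. (\<forall>i. f i \<in> K) \<and> x = poly N f v \<and> y = poly N (\<lambda>i. \<sigma> (f i)) w"
proof -
  note Kd = dsubD[OF K] and \<sigma>d = diff_hom_onD[OF \<sigma>]
  have \<sigma>0: "\<sigma> \<zero> = \<zero>" using \<sigma>d(3)[of \<zero> \<zero>] \<sigma>d(1)[of \<zero>] Kd(3) add.r_cancel_one'[of "\<sigma> \<zero>" "\<sigma> \<zero>"] by simp
  define NF where "NF = (\<lambda>x y. \<exists>N f. (\<forall>i. f i \<in> K) \<and> x = poly N f v \<and> y = poly N (\<lambda>i. \<sigma> (f i)) w)"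
  have I: "NF (poly N f v) (poly N (\<lambda>i. \<sigma> (f i)) w)" if "\<forall>i. f i \<in> K" for N f using that by (auto simp: NF_def)
  have car: "x \<in> carrier U" "y \<in> carrier U" if "NF x y" for x y
    using that v w Kd(2) \<sigma>d(1) by (auto simp: NF_def)
  have add: "NF (x \<oplus> x') (y \<oplus> y')" if xy: "NF x y" and xy': "NF x' y'" for x y x' y'
  proof -
    obtain N f where f: "\<forall>i. f i \<in> K" "x = poly N f v" "y = poly N (\<lambda>i. \<sigma> (f i)) w" using xy by (auto simp: NF_def)
    obtain M g where g: "\<forall>i. g i \<in> K" "x' = poly M g v" "y' = poly M (\<lambda>i. \<sigma> (g i)) w" using xy' by (auto simp: NF_def)
    define f' g' where "f' = (\<lambda>i. if i < N then f i else \<zero>)" and "g' = (\<lambda>i. if i < M then g i else \<zero>)"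
    have K': "f' i \<in> K" "g' i \<in> K" for i using f g Kd(3) by (auto simp: f'_def g'_def)
    have s: "(\<lambda>i. \<sigma> (f' i)) = (\<lambda>i. if i < N then \<sigma> (f i) else \<zero>)" "(\<lambda>i. \<sigma> (g' i)) = (\<lambda>i. if i < M then \<sigma> (g i) else \<zero>)"
      using \<sigma>0 by (auto simp: f'_def g'_def)
    have 1: "x = poly (max N M) f' v" "x' = poly (max N M) g' v"
      unfolding f(2) g(2) f'_def g'_def using f(1) g(1) Kd(2) v by (simp_all add: poly_pad)
    have 2: "y = poly (max N M) (\<lambda>i. \<sigma> (f' i)) w" "y' = poly (max N M) (\<lambda>i. \<sigma> (g' i)) w"
      unfolding f(3) g(3) s using f(1) g(1) \<sigma>d(1) w by (simp_all add: poly_pad)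
    have 3: "x \<oplus> x' = poly (max N M) (\<lambda>i. f' i \<oplus> g' i) v" unfolding 1 using K' Kd(2) v by (intro poly_add[symmetric]) auto
    have "y \<oplus> y' = poly (max N M) (\<lambda>i. \<sigma> (f' i) \<oplus> \<sigma> (g' i)) w" unfolding 2 using K' \<sigma>d(1) w by (intro poly_add[symmetric]) auto
    also have "\<dots> = poly (max N M) (\<lambda>i. \<sigma> (f' i \<oplus> g' i)) w" using \<sigma>d(3) K' by simp
    finally show ?thesis unfolding 3 using I[of "\<lambda>i. f' i \<oplus> g' i" "max N M"] K' Kd(5) by simp
  qed
  have scale: "NF (k \<otimes> x) (\<sigma> k \<otimes> y)" if xy: "NF x y" and k: "k \<in> K" for k x y
  proof -
    obtain N f where f: "\<forall>i. f i \<in> K" "x = poly N f v" "y = poly N (\<lambda>i. \<sigma> (f i)) w" using xy by (auto simp: NF_def)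
    have "poly N (\<lambda>i. \<sigma> (k \<otimes> f i)) w = \<sigma> k \<otimes> y"
      using f k \<sigma>d(1,4) w poly_scale[of "\<lambda>i. \<sigma> (f i)" "\<sigma> k" w N] by simp
    moreover have "poly N (\<lambda>i. k \<otimes> f i) v = k \<otimes> x" using f k Kd(2) v by (simp add: poly_scale)
    ultimately show ?thesis using I[of "\<lambda>i. k \<otimes> f i" N] f k Kd(6) by simp
  qed
  have shift: "NF (v \<otimes> x) (w \<otimes> y)" if xy: "NF x y" for x y
  proof -
    obtain N f where f: "\<forall>i. f i \<in> K" "x = poly N f v" "y = poly N (\<lambda>i. \<sigma> (f i)) w" using xy by (auto simp: NF_def)
    have "(\<lambda>i. \<sigma> (case i of 0 \<Rightarrow> \<zero> | Suc j \<Rightarrow> f j)) = (\<lambda>i. case i of 0 \<Rightarrow> \<zero> | Suc j \<Rightarrow> \<sigma> (f j))"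
      using \<sigma>0 by (auto simp: fun_eq_iff split: nat.split)
    then show ?thesis
      using I[of "\<lambda>i. case i of 0 \<Rightarrow> \<zero> | Suc j \<Rightarrow> f j" "Suc N"] f Kd(2,3) \<sigma>d(1) v w
      by (simp add: poly_shift split: nat.split)
  qed
  have shift_pow: "NF (v [^] n \<otimes> x) (w [^] n \<otimes> y)" if "NF x y" for x y and n :: nat
  proof (induction n)
    case (Suc n)
    then show ?case using shift[OF Suc] car[OF that] v w by (simp add: m_ac)
  qed (use that car[OF that] in simp)
  have mult: "NF (x \<otimes> x') (y \<otimes> y')" if xy: "NF x y" and xy': "NF x' y'" for x y x' y'
  proof -
    obtain N f where f: "\<forall>i. f i \<in> K" "x = poly N f v" "y = poly N (\<lambda>i. \<sigma> (f i)) w" using xy by (auto simp: NF_def)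
    have fc: "f i \<in> carrier U" "\<sigma> (f i) \<in> carrier U" for i using f Kd(2) \<sigma>d(1) by auto
    note c' = car[OF xy']
    have "NF (poly n f v \<otimes> x') (poly n (\<lambda>i. \<sigma> (f i)) w \<otimes> y')" for n
    proof (induction n)
      case 0
      then show ?case using I[of "\<lambda>_. \<zero>" 0] Kd(3) c' by simp
    next
      case (Suc n)
      have fn: "f n \<in> K" using f by blast
      from add[OF Suc scale[OF shift_pow[OF xy', of n] fn]]
      show ?case using fc v w c' by (simp add: poly_Suc l_distr m_assoc)
    qed
    then show ?thesis using f by simp
  qed
  have "NF x y" using r
  proof (induction rule: rel.induct)
    case (rel_K k)
    then show ?case using I[of "\<lambda>_. k" 1] Kd(2) \<sigma>d(1) v w by (simp add: poly_Suc)
  next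
    case rel_var
    have "NF \<one> \<one>" using I[of "\<lambda>_. \<one>" 1] Kd(4) \<sigma>d(2) v w by (simp add: poly_Suc)
    then show ?case using shift[of \<one> \<one>] v w by simp
  qed (use add mult in blast)+
  then show ?thesis by (simp add: NF_def)
qed

lemma rel_carrier:
  assumes K: "dsub K" and \<sigma>: "diff_hom_on K U U \<sigma>" and v: "v \<in> carrier U" and w: "w \<in> carrier U"
    and r: "rel K \<sigma> v w x y"
  shows "x \<in> carrier U" "y \<in> carrier U"
  using r by (induction rule: rel.induct) (use v w dsubD(2)[OF K] diff_hom_onD(1)[OF \<sigma>] in auto)

lemma PR_rel: "x \<in> PR K v \<Longrightarrow> \<exists>y. rel K \<sigma> v w x y"
  by (induction rule: PR.induct) (auto intro: rel.intros)

lemma rel_PR: "rel K \<sigma> v w x y \<Longrightarrow> x \<in> PR K v \<and> y \<in> PR (\<sigma> ` K) w"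
  by (induction rule: rel.induct) (auto intro: PR.intros)

lemma rel_surj: "y \<in> PR (\<sigma> ` K) w \<Longrightarrow> \<exists>x. rel K \<sigma> v w x y"
  by (induction rule: PR.induct) (auto intro: rel.intros)

lemma rel_id: "x \<in> PR K v \<Longrightarrow> rel K (\<lambda>x. x) v v x x"
  by (induction rule: PR.induct) (auto intro: rel.intros)

lemma diff_hom_id: "dsub K \<Longrightarrow> diff_hom_on K U U (\<lambda>x. x)"
  using dsubD(2) by (auto simp: diff_hom_on_def)

lemma PR_normal_form:
  assumes K: "dsub K" and v: "v \<in> carrier U" and x: "x \<in> PR K v"
  shows "\<exists>N f. (\<forall>i. f i \<in> K) \<and> x = poly N f v"
  using rel_normal_form[OF K diff_hom_id[OF K] v v rel_id[OF x]] by blast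

end

section \<open>Fields of fractions of differential subrings\<close>

context dfield
begin

lemma inv_mult_nonzero:
  assumes "x \<in> carrier U" "x \<noteq> \<zero>" "y \<in> carrier U" "y \<noteq> \<zero>"
  shows "inv (x \<otimes> y) = inv x \<otimes> inv y"
proof -
  note i = inv_nonzero[OF assms(1,2)] and j = inv_nonzero[OF assms(3,4)]
  have "(x \<otimes> y) \<otimes> (inv x \<otimes> inv y) = (x \<otimes> inv x) \<otimes> (y \<otimes> inv y)"
    using assms(1,3) i(1) j(1) by (simp only: m_ac m_closed)
  then show ?thesis using assms i j by (intro comm_inv_char) auto
qed

lemma fraction_eq_iff:
  assumes "x \<in> carrier U" "y \<in> carrier U" "y \<noteq> \<zero>" "z \<in> carrier U"
  shows "z = x \<otimes> inv y \<longleftrightarrow> z \<otimes> y = x"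
proof -
  note i = inv_nonzero[OF assms(2,3)]
  have "(x \<otimes> inv y) \<otimes> y = x" using assms i by (simp add: m_assoc)
  moreover have "(z \<otimes> y) \<otimes> inv y = z" using assms i by (simp add: m_assoc)
  ultimately show ?thesis by auto
qed

definition dring :: "'u set \<Rightarrow> bool" where
  "dring R \<longleftrightarrow> R \<subseteq> carrier U \<and> \<one> \<in> R \<and> (\<forall>a\<in>R. \<forall>b\<in>R. a \<oplus> b \<in> R \<and> a \<otimes> b \<in> R) \<and>
    (\<forall>a\<in>R. \<ominus> a \<in> R \<and> der U a \<in> R)"

lemma dringD:
  assumes "dring R"
  shows "a \<in> R \<Longrightarrow> a \<in> carrier U" "\<one> \<in> R" "\<zero> \<in> R" "\<lbrakk>a \<in> R; b \<in> R\<rbrakk> \<Longrightarrow> a \<oplus> b \<in> R"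
    "\<lbrakk>a \<in> R; b \<in> R\<rbrakk> \<Longrightarrow> a \<otimes> b \<in> R" "a \<in> R \<Longrightarrow> \<ominus> a \<in> R" "a \<in> R \<Longrightarrow> der U a \<in> R"
    "\<lbrakk>a \<in> R; b \<in> R\<rbrakk> \<Longrightarrow> a \<ominus> b \<in> R"
proof -
  show c: "a \<in> R \<Longrightarrow> a \<in> carrier U" for a using assms by (auto simp: dring_def)
  show o: "\<one> \<in> R" using assms by (auto simp: dring_def)
  show add: "\<lbrakk>a \<in> R; b \<in> R\<rbrakk> \<Longrightarrow> a \<oplus> b \<in> R" for a b using assms by (auto simp: dring_def)
  show "\<lbrakk>a \<in> R; b \<in> R\<rbrakk> \<Longrightarrow> a \<otimes> b \<in> R" for a b using assms by (auto simp: dring_def)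
  show neg: "a \<in> R \<Longrightarrow> \<ominus> a \<in> R" for a using assms by (auto simp: dring_def)
  show "a \<in> R \<Longrightarrow> der U a \<in> R" for a using assms by (auto simp: dring_def)
  show "\<zero> \<in> R" using add[OF o neg[OF o]] by (simp add: r_neg)
  show "\<lbrakk>a \<in> R; b \<in> R\<rbrakk> \<Longrightarrow> a \<ominus> b \<in> R" for a b using add neg by (simp add: a_minus_def)
qed

lemma Fr_cases:
  assumes "z \<in> Fr R"
  obtains x y where "z = x \<otimes> inv y" "x \<in> R" "y \<in> R" "y \<noteq> \<zero>"
  using assms by (auto simp: Fr_def)

lemma FrI: "\<lbrakk>x \<in> R; y \<in> R; y \<noteq> \<zero>\<rbrakk> \<Longrightarrow> x \<otimes> inv y \<in> Fr R"
  by (auto simp: Fr_def)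

lemma fraction_ops:
  assumes "x \<in> carrier U" "y \<in> carrier U" "y \<noteq> \<zero>" "x' \<in> carrier U" "y' \<in> carrier U" "y' \<noteq> \<zero>"
  shows "x \<otimes> inv y \<oplus> x' \<otimes> inv y' = (x \<otimes> y' \<oplus> x' \<otimes> y) \<otimes> inv (y \<otimes> y')"
    "(x \<otimes> inv y) \<otimes> (x' \<otimes> inv y') = (x \<otimes> x') \<otimes> inv (y \<otimes> y')"
    "der U (x \<otimes> inv y) = (der U x \<otimes> y \<ominus> x \<otimes> der U y) \<otimes> inv (y \<otimes> y)"
proof -
  note i = inv_nonzero[OF assms(2,3)] and j = inv_nonzero[OF assms(5,6)]
  have yy: "y \<otimes> y' \<noteq> \<zero>" "y \<otimes> y \<noteq> \<zero>" using assms by (auto simp: integral_iff)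
  have 1: "(x \<otimes> a \<oplus> x' \<otimes> b) \<otimes> (y \<otimes> y') = (x \<otimes> (a \<otimes> y)) \<otimes> y' \<oplus> (x' \<otimes> (b \<otimes> y')) \<otimes> y"
    if "a \<in> carrier U" "b \<in> carrier U" for a b
    by (use in_carrier_Cons in_carrier_Nil norm_eq[OF _ ring_norm_19, of "[x, a, x', b, y, y']"] that assms(1,2,4,5) in simp)
  show "x \<otimes> inv y \<oplus> x' \<otimes> inv y' = (x \<otimes> y' \<oplus> x' \<otimes> y) \<otimes> inv (y \<otimes> y')"
    using assms i j yy by (subst fraction_eq_iff) (simp_all add: 1)
  have 2: "(x \<otimes> a) \<otimes> (x' \<otimes> b) \<otimes> (y \<otimes> y') = (x \<otimes> (a \<otimes> y)) \<otimes> (x' \<otimes> (b \<otimes> y'))"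
    if "a \<in> carrier U" "b \<in> carrier U" for a b
    by (use in_carrier_Cons in_carrier_Nil norm_eq[OF _ ring_norm_20, of "[x, a, x', b, y, y']"] that assms(1,2,4,5) in simp)
  show "(x \<otimes> inv y) \<otimes> (x' \<otimes> inv y') = (x \<otimes> x') \<otimes> inv (y \<otimes> y')"
    using assms i j yy by (subst fraction_eq_iff) (simp_all add: 2)
  \<comment> \<open>The quotient rule comes from differentiating
    \<open>x = z \<otimes> y\<close>.\<close>
  define z where "z = x \<otimes> inv y"
  have z: "z \<in> carrier U" "x = z \<otimes> y" using assms i by (auto simp: z_def m_assoc)
  have dx: "der U x = der U z \<otimes> y \<oplus> z \<otimes> der U y" unfolding z(2) using z(1) assms(2) by (rule d_mult)
  have 3: "b \<otimes> (y \<otimes> y) = (b \<otimes> y \<oplus> z \<otimes> a) \<otimes> y \<ominus> (z \<otimes> y) \<otimes> a"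
    if "a \<in> carrier U" "b \<in> carrier U" for a b
    by (use in_carrier_Cons in_carrier_Nil norm_eq[OF _ ring_norm_21, of "[b, y, z, a]"] that assms(2) z(1) in simp)
  have "der U z = (der U x \<otimes> y \<ominus> x \<otimes> der U y) \<otimes> inv (y \<otimes> y)"
    using assms z(1) yy by (subst fraction_eq_iff) (simp_all add: 3[of "der U y" "der U z"] dx z(2)[symmetric])
  then show "der U (x \<otimes> inv y) = (der U x \<otimes> y \<ominus> x \<otimes> der U y) \<otimes> inv (y \<otimes> y)" by (simp only: z_def)
qed

lemma Fr_incl: "dring R \<Longrightarrow> x \<in> R \<Longrightarrow> x \<in> Fr R"
  using FrI[of x R \<one>] dringD[of R] by simp

lemma Fr_dsub:
  assumes R: "dring R"
  shows "dsub (Fr R)"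
proof -
  note Rd = dringD[OF R]
  have prod: "y \<otimes> y' \<in> R \<and> y \<otimes> y' \<noteq> \<zero>" if "y \<in> R" "y \<noteq> \<zero>" "y' \<in> R" "y' \<noteq> \<zero>" for y y'
    using that Rd(1)[OF that(1)] Rd(1)[OF that(3)] Rd(5)[OF that(1,3)] by (simp add: integral_iff)
  have "subfield (Fr R) U"
  proof (rule subfieldI'[OF subringI])
    show "Fr R \<subseteq> carrier U" using Rd(1) inv_nonzero(1) by (auto simp: Fr_def)
    show "\<one> \<in> Fr R" by (rule Fr_incl[OF R Rd(2)])
    fix a assume a: "a \<in> Fr R"
    obtain x y where 1: "a = x \<otimes> inv y" "x \<in> R" "y \<in> R" "y \<noteq> \<zero>" using a by (rule Fr_cases)
    note c = Rd(1)[OF 1(2)] Rd(1)[OF 1(3)] 1(4)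
    have "\<ominus> a = (\<ominus> x) \<otimes> inv y" unfolding 1(1) using c inv_nonzero[OF c(2,3)] by (simp add: l_minus)
    then show "\<ominus> a \<in> Fr R" using FrI[OF Rd(6)[OF 1(2)] 1(3,4)] by simp
    fix b assume b: "b \<in> Fr R"
    obtain x' y' where 2: "b = x' \<otimes> inv y'" "x' \<in> R" "y' \<in> R" "y' \<noteq> \<zero>" using b by (rule Fr_cases)
    note c' = Rd(1)[OF 2(2)] Rd(1)[OF 2(3)] 2(4)
    note yy = prod[OF 1(3,4) 2(3,4)]
    show "a \<oplus> b \<in> Fr R" unfolding 1(1) 2(1) fraction_ops(1)[OF c c']
      using FrI[OF Rd(4)[OF Rd(5)[OF 1(2) 2(3)] Rd(5)[OF 2(2) 1(3)]]] yy by blast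
    show "a \<otimes> b \<in> Fr R" unfolding 1(1) 2(1) fraction_ops(2)[OF c c']
      using FrI[OF Rd(5)[OF 1(2) 2(2)]] yy by blast
  next
    fix a assume a: "a \<in> Fr R - {\<zero>}"
    then have "a \<in> Fr R" by simp
    then obtain x y where 1: "a = x \<otimes> inv y" "x \<in> R" "y \<in> R" "y \<noteq> \<zero>" by (rule Fr_cases)
    note c = Rd(1)[OF 1(2)] Rd(1)[OF 1(3)] 1(4)
    note i = inv_nonzero[OF c(2,3)]
    have x: "x \<noteq> \<zero>" using 1(1) a i by auto
    have "y \<otimes> inv x = inv a"
      using c i x inv_nonzero[OF c(1) x] inv_mult_nonzero[OF c(1) x i(1,4)]
        comm_inv_char[of "inv y" y] by (simp add: 1(1) m_comm)
    then show "inv a \<in> Fr R" using FrI[OF 1(3,2) x] by simp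
  qed
  moreover have "der U a \<in> Fr R" if a: "a \<in> Fr R" for a
  proof -
    obtain x y where 1: "a = x \<otimes> inv y" "x \<in> R" "y \<in> R" "y \<noteq> \<zero>" using a by (rule Fr_cases)
    note c = Rd(1)[OF 1(2)] Rd(1)[OF 1(3)] 1(4)
    show ?thesis unfolding 1(1) fraction_ops(3)[OF c c]
      using FrI[OF Rd(8)[OF Rd(5)[OF Rd(7)[OF 1(2)] 1(3)] Rd(5)[OF 1(2) Rd(7)[OF 1(3)]]]] prod[OF 1(3,4) 1(3,4)] by blast
  qed
  ultimately show ?thesis by (simp add: dsub_def)
qed

lemma diff_hom_on_zero:
  assumes "dring R" "diff_hom_on R U U \<tau>"
  shows "\<tau> \<zero> = \<zero>"
  using diff_hom_onD(3)[OF assms(2), of \<zero> \<zero>] diff_hom_onD(1)[OF assms(2), of \<zero>] dringD(3)[OF assms(1)]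
    add.r_cancel_one'[of "\<tau> \<zero>" "\<tau> \<zero>"] by simp

lemma diff_hom_on_minus:
  assumes "dring R" "diff_hom_on R U U \<tau>" "a \<in> R" "b \<in> R"
  shows "\<tau> (a \<ominus> b) = \<tau> a \<ominus> \<tau> b"
proof -
  note Rd = dringD[OF assms(1)] and \<tau>d = diff_hom_onD[OF assms(2)]
  have "\<tau> (a \<ominus> b) \<oplus> \<tau> b = \<tau> ((a \<ominus> b) \<oplus> b)" using \<tau>d(3) Rd(8) assms(3,4) by simp
  also have "(a \<ominus> b) \<oplus> b = a" using Rd(1)[OF assms(3)] Rd(1)[OF assms(4)] by (simp add: a_minus_def a_assoc l_neg)
  finally have "\<tau> a = \<tau> (a \<ominus> b) \<oplus> \<tau> b" by simp
  then show ?thesis using \<tau>d(1)[OF assms(4)] \<tau>d(1)[OF Rd(8)[OF assms(3,4)]]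
    by (simp add: a_minus_def a_assoc r_neg)
qed

text \<open>Injectivity keeps the images of denominators nonzero, and cross multiplication shows
  that the value does not depend on the representative picked by \<open>rp\<close>.\<close>

lemma Fr_extend:
  assumes R: "dring R" and \<tau>: "diff_hom_on R U U \<tau>" and inj: "\<And>x. \<lbrakk>x \<in> R; \<tau> x = \<zero>\<rbrakk> \<Longrightarrow> x = \<zero>"
  shows "\<exists>\<tau>'. diff_hom_on (Fr R) U U \<tau>' \<and> (\<forall>x\<in>R. \<tau>' x = \<tau> x) \<and> \<tau>' ` Fr R = Fr (\<tau> ` R)"
proof -
  note Rd = dringD[OF R] and \<tau>d = diff_hom_onD[OF \<tau>]
  define rp where "rp = (\<lambda>z. SOME xy. fst xy \<in> R \<and> snd xy \<in> R \<and> snd xy \<noteq> \<zero> \<and> z = fst xy \<otimes> inv (snd xy))"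
  define \<tau>' where "\<tau>' = (\<lambda>z. \<tau> (fst (rp z)) \<otimes> inv (\<tau> (snd (rp z))))"
  have key: "\<tau>' (x \<otimes> inv y) = \<tau> x \<otimes> inv (\<tau> y)" if xy: "x \<in> R" "y \<in> R" "y \<noteq> \<zero>" for x y
  proof -
    let ?z = "x \<otimes> inv y"
    have "fst (rp ?z) \<in> R \<and> snd (rp ?z) \<in> R \<and> snd (rp ?z) \<noteq> \<zero> \<and> ?z = fst (rp ?z) \<otimes> inv (snd (rp ?z))"
      unfolding rp_def by (rule someI[of _ "(x, y)"]) (use xy in simp)
    then obtain a b where ab: "rp ?z = (a, b)" "a \<in> R" "b \<in> R" "b \<noteq> \<zero>" "?z = a \<otimes> inv b"
      by (cases "rp ?z") auto
    note c = Rd(1)[OF xy(1)] Rd(1)[OF xy(2)] xy(3) and c' = Rd(1)[OF ab(2)] Rd(1)[OF ab(3)] ab(4)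
    note i = inv_nonzero[OF c(2,3)]
    have "?z \<otimes> b = a" using ab(5) fraction_eq_iff[OF c', of ?z] c i by simp
    moreover have "?z \<otimes> y = x" using fraction_eq_iff[OF c, of ?z] c i by simp
    ultimately have "a \<otimes> y = x \<otimes> b" using c c' i by (metis m_assoc m_comm m_closed)
    then have "\<tau> (a \<otimes> y) = \<tau> (x \<otimes> b)" by simp
    then have t: "\<tau> a \<otimes> \<tau> y = \<tau> x \<otimes> \<tau> b" using \<tau>d(4) xy ab by simp
    have n: "\<tau> y \<noteq> \<zero>" "\<tau> b \<noteq> \<zero>" using inj xy ab by blast+
    have ct: "\<tau> x \<in> carrier U" "\<tau> y \<in> carrier U" "\<tau> a \<in> carrier U" "\<tau> b \<in> carrier U" using \<tau>d(1) xy ab by auto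
    note j = inv_nonzero[OF ct(2) n(1)] and k = inv_nonzero[OF ct(4) n(2)]
    have "(\<tau> a \<otimes> inv (\<tau> b)) \<otimes> \<tau> y = (\<tau> a \<otimes> \<tau> y) \<otimes> inv (\<tau> b)" using ct k by (simp add: m_ac)
    also have "\<dots> = \<tau> x" unfolding t using ct k by (simp add: m_assoc)
    finally have "\<tau> a \<otimes> inv (\<tau> b) = \<tau> x \<otimes> inv (\<tau> y)" using fraction_eq_iff[OF ct(1,2) n(1)] ct k by simp
    then show ?thesis by (simp add: \<tau>'_def ab(1))
  qed
  have prod: "y \<otimes> y' \<in> R \<and> y \<otimes> y' \<noteq> \<zero>" if "y \<in> R" "y \<noteq> \<zero>" "y' \<in> R" "y' \<noteq> \<zero>" for y y'
    using that Rd(1)[OF that(1)] Rd(1)[OF that(3)] Rd(5)[OF that(1,3)] by (simp add: integral_iff)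
  have ext: "\<tau>' x = \<tau> x" if "x \<in> R" for x
    using key[OF that Rd(2)] that Rd(1)[OF that] \<tau>d(1)[OF that] \<tau>d(2) by simp
  have "diff_hom_on (Fr R) U U \<tau>'" unfolding diff_hom_on_def
  proof (intro conjI ballI)
    show "\<tau>' \<one> = \<one>" using ext[OF Rd(2)] \<tau>d(2) by simp
    fix a assume a: "a \<in> Fr R"
    obtain x y where 1: "a = x \<otimes> inv y" "x \<in> R" "y \<in> R" "y \<noteq> \<zero>" using a by (rule Fr_cases)
    note c = Rd(1)[OF 1(2)] Rd(1)[OF 1(3)] 1(4)
    have t: "\<tau> x \<in> carrier U" "\<tau> y \<in> carrier U" "\<tau> y \<noteq> \<zero>" using \<tau>d(1) 1 inj by auto
    show "\<tau>' a \<in> carrier U" unfolding 1(1) key[OF 1(2-4)] using t inv_nonzero[OF t(2,3)] by simp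
    have yy: "y \<otimes> y \<in> R" "y \<otimes> y \<noteq> \<zero>" using prod[OF 1(3,4) 1(3,4)] by auto
    have num: "der U x \<otimes> y \<in> R" "x \<otimes> der U y \<in> R" using Rd(5,7) 1 by auto
    have "\<tau>' (der U a) = \<tau> (der U x \<otimes> y \<ominus> x \<otimes> der U y) \<otimes> inv (\<tau> (y \<otimes> y))"
      unfolding 1(1) fraction_ops(3)[OF c c] by (rule key[OF Rd(8)[OF num] yy])
    also have "\<dots> = (der U (\<tau> x) \<otimes> \<tau> y \<ominus> \<tau> x \<otimes> der U (\<tau> y)) \<otimes> inv (\<tau> y \<otimes> \<tau> y)"
      using diff_hom_on_minus[OF R \<tau> num] \<tau>d(4,5) Rd(7) 1 by simp
    also have "\<dots> = der U (\<tau>' a)" unfolding 1(1) key[OF 1(2-4)] by (rule fraction_ops(3)[OF t t, symmetric])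
    finally show "\<tau>' (der U a) = der U (\<tau>' a)" .
    fix b assume b: "b \<in> Fr R"
    obtain x' y' where 2: "b = x' \<otimes> inv y'" "x' \<in> R" "y' \<in> R" "y' \<noteq> \<zero>" using b by (rule Fr_cases)
    note c' = Rd(1)[OF 2(2)] Rd(1)[OF 2(3)] 2(4)
    have t': "\<tau> x' \<in> carrier U" "\<tau> y' \<in> carrier U" "\<tau> y' \<noteq> \<zero>" using \<tau>d(1) 2 inj by auto
    have yy': "y \<otimes> y' \<in> R" "y \<otimes> y' \<noteq> \<zero>" using prod[OF 1(3,4) 2(3,4)] by auto
    have m: "x \<otimes> y' \<in> R" "x' \<otimes> y \<in> R" "x \<otimes> x' \<in> R" using Rd(5) 1 2 by auto
    show "\<tau>' (a \<oplus> b) = \<tau>' a \<oplus> \<tau>' b"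
      unfolding 1(1) 2(1) fraction_ops(1)[OF c c'] key[OF Rd(4)[OF m(1,2)] yy'] key[OF 1(2-4)] key[OF 2(2-4)] fraction_ops(1)[OF t t']
      using \<tau>d(3)[OF m(1,2)] \<tau>d(4) 1 2 by simp
    show "\<tau>' (a \<otimes> b) = \<tau>' a \<otimes> \<tau>' b"
      unfolding 1(1) 2(1) fraction_ops(2)[OF c c'] key[OF m(3) yy'] key[OF 1(2-4)] key[OF 2(2-4)] fraction_ops(2)[OF t t']
      using \<tau>d(4) 1 2 by simp
  qed
  moreover have "\<tau>' ` Fr R = Fr (\<tau> ` R)"
  proof
    show "\<tau>' ` Fr R \<subseteq> Fr (\<tau> ` R)"
    proof
      fix b assume "b \<in> \<tau>' ` Fr R"
      then obtain a where a: "a \<in> Fr R" "b = \<tau>' a" by blast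
      obtain x y where 1: "a = x \<otimes> inv y" "x \<in> R" "y \<in> R" "y \<noteq> \<zero>" using a(1) by (rule Fr_cases)
      have "\<tau> y \<noteq> \<zero>" using inj 1 by blast
      then show "b \<in> Fr (\<tau> ` R)" unfolding a(2) 1(1) key[OF 1(2-4)] using 1 by (intro FrI) auto
    qed
    show "Fr (\<tau> ` R) \<subseteq> \<tau>' ` Fr R"
    proof
      fix b assume "b \<in> Fr (\<tau> ` R)"
      then obtain x y where 1: "b = \<tau> x \<otimes> inv (\<tau> y)" "x \<in> R" "y \<in> R" "\<tau> y \<noteq> \<zero>" by (auto elim!: Fr_cases)
      have y: "y \<noteq> \<zero>" using 1 diff_hom_on_zero[OF R \<tau>] by auto
      show "b \<in> \<tau>' ` Fr R" unfolding 1(1) key[OF 1(2,3) y, symmetric] by (rule imageI[OF FrI[OF 1(2,3) y]])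
    qed
  qed
  ultimately show ?thesis using ext by blast
qed

lemma PR_dring:
  assumes K: "dsub K" and v: "v \<in> carrier U" and dv: "der U v \<in> PR K v"
  shows "dring (PR K v)"
proof -
  have c: "x \<in> carrier U" if "x \<in> PR K v" for x
    using that by (induction rule: PR.induct) (use v dsubD(2)[OF K] in auto)
  have one: "\<one> \<in> PR K v" by (rule PR_K[OF dsubD(4)[OF K]])
  have "\<ominus> x \<in> PR K v" if "x \<in> PR K v" for x
    using PR_mult[OF PR_K[OF dsubD(7)[OF K dsubD(4)[OF K]]] that] c[OF that] by (simp add: l_minus)
  moreover have "der U x \<in> PR K v" if "x \<in> PR K v" for x
    using that
  proof (induction rule: PR.induct)
    case (PR_K k)
    show ?case by (rule PR.PR_K[OF dsubD(10)[OF K PR_K]])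
  next
    case PR_var
    show ?case by (rule dv)
  next
    case (PR_add x y)
    show ?case using PR.PR_add[OF PR_add(3,4)] by (simp add: d_add c[OF PR_add(1)] c[OF PR_add(2)])
  next
    case (PR_mult x y)
    show ?case using PR.PR_add[OF PR.PR_mult[OF PR_mult(3,2)] PR.PR_mult[OF PR_mult(1,4)]]
      by (simp add: d_mult c[OF PR_mult(1)] c[OF PR_mult(2)])
  qed
  moreover have "a \<oplus> b \<in> PR K v" "a \<otimes> b \<in> PR K v" if "a \<in> PR K v" "b \<in> PR K v" for a b
    by (rule PR_add[OF that], rule PR_mult[OF that])
  ultimately show ?thesis using c one unfolding dring_def by auto
qed

text \<open>A polynomial that vanishes at the transcendental \<open>v\<close> has zero coefficients,
  so a pair with first entry 0 has second entry 0. Subtraction is not among the generators of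
  \<open>rel\<close>; it is performed by multiplying with the pair of
  \<open>\<ominus> \<one>\<close> and \<open>\<sigma> (\<ominus> \<one>)\<close>.\<close>

lemma rel_unique:
  assumes K: "dsub K" and \<sigma>: "diff_hom_on K U U \<sigma>" and v: "v \<in> carrier U" and w: "w \<in> carrier U"
    and tv: "transc K v" and r: "rel K \<sigma> v w x y" "rel K \<sigma> v w x z"
  shows "y = z"
proof -
  note Kd = dsubD[OF K] and \<sigma>d = diff_hom_onD[OF \<sigma>]
  have zero: "b = \<zero>" if ab: "rel K \<sigma> v w \<zero> b" for b
  proof -
    obtain N f where f: "\<forall>i. f i \<in> K" "\<zero> = poly N f v" "b = poly N (\<lambda>i. \<sigma> (f i)) w"
      using rel_normal_form[OF K \<sigma> v w ab] by blast
    have "\<forall>i<N. f i = \<zero>" using tv f(1,2) unfolding transc_def by metis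
    then have "\<And>i. i < N \<Longrightarrow> \<sigma> (f i) = \<zero>"
      using \<sigma>d(3)[of \<zero> \<zero>] \<sigma>d(1)[of \<zero>] Kd(3) add.r_cancel_one'[of "\<sigma> \<zero>" "\<sigma> \<zero>"] by simp
    then have "b = (\<Oplus>i\<in>{..<N}. \<zero>)" unfolding f(3) poly_def using w by (intro finsum_cong') auto
    then show ?thesis by simp
  qed
  note c = rel_carrier[OF K \<sigma> v w]
  have m1: "rel K \<sigma> v w (\<ominus> \<one>) (\<sigma> (\<ominus> \<one>))" by (rule rel_K[OF Kd(7)[OF Kd(4)]])
  have "rel K \<sigma> v w \<zero> (y \<oplus> \<sigma> (\<ominus> \<one>) \<otimes> z)"
    using rel_add[OF r(1) rel_mult[OF m1 r(2)]] c[OF r(1)] by (simp add: l_minus r_neg)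
  then have 1: "y \<oplus> \<sigma> (\<ominus> \<one>) \<otimes> z = \<zero>" by (rule zero)
  \<comment> \<open>The same computation with \<open>z\<close> against itself identifies
    \<open>\<sigma> (\<ominus> \<one>) \<otimes> z\<close> as the negative of
    \<open>z\<close>.\<close>
  have "rel K \<sigma> v w \<zero> (z \<oplus> \<sigma> (\<ominus> \<one>) \<otimes> z)"
    using rel_add[OF r(2) rel_mult[OF m1 r(2)]] c[OF r(1)] by (simp add: l_minus r_neg)
  then have 2: "z \<oplus> \<sigma> (\<ominus> \<one>) \<otimes> z = \<zero>" by (rule zero)
  have "\<sigma> (\<ominus> \<one>) \<otimes> z \<in> carrier U" using c[OF r(2)] c[OF m1] by simp
  then show ?thesis using minus_equality[OF 1] minus_equality[OF 2] c[OF r(1)] c[OF r(2)] by simp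
qed

text \<open>The extension sends \<open>v\<close> to \<open>w\<close>; both satisfy the same equation of order one.\<close>

lemma extend_hom:
  assumes K: "dsub K" and \<sigma>: "diff_hom_on K U U \<sigma>"
    and v: "v \<in> carrier U" "der U v = v [^] (q::nat)" and w: "w \<in> carrier U" "der U w = w [^] q"
    and tv: "transc K v" and tw: "transc (\<sigma> ` K) w"
  shows "\<exists>\<tau>. diff_hom_on (Fr (PR K v)) U U \<tau> \<and> (\<forall>k\<in>K. \<tau> k = \<sigma> k) \<and> \<tau> v = w \<and>
    \<tau> ` Fr (PR K v) = Fr (PR (\<sigma> ` K) w)"
proof -
  note Kd = dsubD[OF K] and \<sigma>d = diff_hom_onD[OF \<sigma>]
  let ?r = "rel K \<sigma> v w"
  note c = rel_carrier[OF K \<sigma> v(1) w(1)] and uniq = rel_unique[OF K \<sigma> v(1) w(1) tv]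
  have powr: "?r (v [^] n) (w [^] n)" for n :: nat
  proof (induction n)
    case 0
    then show ?case using rel_K[OF Kd(4), of \<sigma> v w] \<sigma>d(2) by simp
  next
    case (Suc n)
    then show ?case using rel_mult[OF Suc rel_var] by simp
  qed
  have derr: "?r (der U x) (der U y)" if "?r x y" for x y
    using that
  proof (induction rule: rel.induct)
    case (rel_K k)
    then show ?case using rel.rel_K[OF Kd(10)[OF rel_K], of \<sigma> v w] \<sigma>d(5) by simp
  next
    case rel_var
    then show ?case using powr v w by simp
  next
    case (rel_add x x' y y')
    then show ?case using rel.rel_add[OF rel_add(3,4)] c[OF rel_add(1)] c[OF rel_add(2)] by (simp add: d_add)
  next
    case (rel_mult x x' y y')
    then show ?case
      using rel.rel_add[OF rel.rel_mult[OF rel_mult(3,2)] rel.rel_mult[OF rel_mult(1,4)]] c[OF rel_mult(1)] c[OF rel_mult(2)]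
      by (simp add: d_mult)
  qed
  define \<tau> where "\<tau> = (\<lambda>x. SOME y. ?r x y)"
  have \<tau>r: "?r x (\<tau> x)" if "x \<in> PR K v" for x
    unfolding \<tau>_def using PR_rel[OF that] by (rule someI_ex)
  \<comment> \<open>By uniqueness the choice made in \<open>\<tau>\<close> is no choice.\<close>
  have \<tau>I: "\<tau> x = y" if "?r x y" for x y
    using uniq[OF \<tau>r that] rel_PR[OF that] by blast
  have powPR: "v [^] n \<in> PR K v" for n :: nat using rel_PR[OF powr] by blast
  have R: "dring (PR K v)" by (rule PR_dring[OF K v(1)]) (simp add: v(2) powPR)
  have hom: "diff_hom_on (PR K v) U U \<tau>" unfolding diff_hom_on_def
  proof (intro conjI ballI)
    show "\<tau> \<one> = \<one>" using \<tau>I[OF rel_K[OF Kd(4)]] \<sigma>d(2) by simp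
    fix x assume x: "x \<in> PR K v"
    show "\<tau> x \<in> carrier U" using c[OF \<tau>r[OF x]] by simp
    show "\<tau> (der U x) = der U (\<tau> x)" by (rule \<tau>I[OF derr[OF \<tau>r[OF x]]])
    fix y assume y: "y \<in> PR K v"
    show "\<tau> (x \<oplus> y) = \<tau> x \<oplus> \<tau> y" by (rule \<tau>I[OF rel_add[OF \<tau>r[OF x] \<tau>r[OF y]]])
    show "\<tau> (x \<otimes> y) = \<tau> x \<otimes> \<tau> y" by (rule \<tau>I[OF rel_mult[OF \<tau>r[OF x] \<tau>r[OF y]]])
  qed
  have inj: "x = \<zero>" if x: "x \<in> PR K v" "\<tau> x = \<zero>" for x
  proof -
    obtain N f where f: "\<forall>i. f i \<in> K" "x = poly N f v" "\<tau> x = poly N (\<lambda>i. \<sigma> (f i)) w"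
      using rel_normal_form[OF K \<sigma> v(1) w(1) \<tau>r[OF x(1)]] by blast
    have "\<forall>i. \<sigma> (f i) \<in> \<sigma> ` K" using f(1) by blast
    then have 0: "\<sigma> (f i) = \<zero>" if "i < N" for i using tw f(3) x(2) that unfolding transc_def by metis
    have "f i = \<zero>" if "i < N" for i
    proof (rule ccontr)
      assume nz: "f i \<noteq> \<zero>"
      have fi: "f i \<in> K" using f(1) by blast
      have "\<sigma> (f i \<otimes> inv (f i)) = \<sigma> (f i) \<otimes> \<sigma> (inv (f i))" by (rule \<sigma>d(4)[OF fi Kd(9)[OF fi nz]])
      also have "\<dots> = \<zero>" using 0[OF that] \<sigma>d(1)[OF Kd(9)[OF fi nz]] by simp
      finally show False using inv_nonzero[OF Kd(2)[OF fi] nz] \<sigma>d(2) by simp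
    qed
    then have "x = (\<Oplus>i\<in>{..<N}. \<zero>)" unfolding f(2) poly_def using v by (intro finsum_cong') auto
    then show ?thesis by simp
  qed
  obtain \<tau>' where t: "diff_hom_on (Fr (PR K v)) U U \<tau>'" "\<forall>x\<in>PR K v. \<tau>' x = \<tau> x" "\<tau>' ` Fr (PR K v) = Fr (\<tau> ` PR K v)"
    using Fr_extend[OF R hom inj] by blast
  have "\<tau> ` PR K v = PR (\<sigma> ` K) w"
  proof
    show "\<tau> ` PR K v \<subseteq> PR (\<sigma> ` K) w" using rel_PR[OF \<tau>r] by blast
    show "PR (\<sigma> ` K) w \<subseteq> \<tau> ` PR K v"
    proof
      fix y assume "y \<in> PR (\<sigma> ` K) w"
      then obtain x where x: "?r x y" using rel_surj by blast
      show "y \<in> \<tau> ` PR K v" using \<tau>I[OF x] rel_PR[OF x] by blast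
    qed
  qed
  moreover have "\<tau>' k = \<sigma> k" if "k \<in> K" for k using t(2) \<tau>I[OF rel_K[OF that]] PR_K[OF that] by simp
  moreover have "\<tau>' v = w" using t(2) \<tau>I[OF rel_var] PR_var by simp
  ultimately show ?thesis using t by auto
qed

end

section \<open>Transcendence of solutions\<close>

context dfield
begin

text \<open>Exponents are sorted by their residue modulo \<open>p\<close>, so that the coefficients
  of \<open>1, v, ..., v^(p-1)\<close> become polynomials in the constant
  \<open>v^p\<close>.\<close>

lemma poly_split:
  assumes f: "\<And>i. f i \<in> carrier U" and v: "v \<in> carrier U"
  shows "poly (p * M) f v = (\<Oplus>j\<in>{..<p}. poly M (\<lambda>i. f (p * i + j)) (v [^] p) \<otimes> v [^] j)"
proof (induction M)
  case 0
  have "(\<Oplus>j\<in>{..<p}. poly 0 (\<lambda>i. f (p * i + j)) (v [^] p) \<otimes> v [^] j) = (\<Oplus>j\<in>{..<p}. \<zero>)"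
    using v by (intro finsum_cong') auto
  then show ?case by simp
next
  case (Suc M)
  have vp: "v [^] p \<in> carrier U" using v by simp
  have 1: "poly (p * M + m) f v = poly (p * M) f v \<oplus> (\<Oplus>j\<in>{..<m}. (f (p * M + j) \<otimes> (v [^] p) [^] M) \<otimes> v [^] j)" for m
  proof (induction m)
    case (Suc m)
    have "v [^] (p * M + m) = (v [^] p) [^] M \<otimes> v [^] m" using v by (simp add: nat_pow_pow nat_pow_mult)
    then have "f (p * M + m) \<otimes> v [^] (p * M + m) = (f (p * M + m) \<otimes> (v [^] p) [^] M) \<otimes> v [^] m"
      using f v by (simp add: m_assoc)
    moreover have "(\<Oplus>j\<in>{..<m}. (f (p * M + j) \<otimes> (v [^] p) [^] M) \<otimes> v [^] j) \<in> carrier U"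
      using f v by (intro finsum_closed) auto
    moreover have "(\<Oplus>j\<in>{..<Suc m}. (f (p * M + j) \<otimes> (v [^] p) [^] M) \<otimes> v [^] j) =
      (\<Oplus>j\<in>{..<m}. (f (p * M + j) \<otimes> (v [^] p) [^] M) \<otimes> v [^] j) \<oplus> (f (p * M + m) \<otimes> (v [^] p) [^] M) \<otimes> v [^] m"
      using f v by (subst finsum_lessThan_Suc) auto
    ultimately show ?case using Suc f v by (simp add: poly_Suc a_assoc)
  qed (use f v in simp)
  have "(\<Oplus>j\<in>{..<p}. poly (Suc M) (\<lambda>i. f (p * i + j)) (v [^] p) \<otimes> v [^] j)
    = (\<Oplus>j\<in>{..<p}. poly M (\<lambda>i. f (p * i + j)) (v [^] p) \<otimes> v [^] j \<oplus> (f (p * M + j) \<otimes> (v [^] p) [^] M) \<otimes> v [^] j)"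
    using f v by (intro finsum_cong') (auto simp: poly_Suc l_distr)
  also have "\<dots> = poly (p * M) f v \<oplus> (\<Oplus>j\<in>{..<p}. (f (p * M + j) \<otimes> (v [^] p) [^] M) \<otimes> v [^] j)"
    unfolding Suc using f v by (intro finsum_addf) auto
  finally show ?case using 1[of p] by (simp add: add.commute)
qed

lemma poly_frob:
  assumes f: "\<And>i. f i \<in> carrier U" and v: "v \<in> carrier U"
  shows "poly N (\<lambda>i. f i [^] p) (v [^] p) = (poly N f v) [^] p"
proof (induction N)
  case (Suc N)
  have "(v [^] p) [^] N = (v [^] N) [^] p" using v by (simp add: nat_pow_pow mult.commute)
  then show ?case using Suc f v by (simp add: poly_Suc frob_add frob_mult)
qed (simp add: frob_zero)

lemma der_poly_const:
  assumes f: "\<And>i. f i \<in> carrier U" and c: "c \<in> cst"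
  shows "der U (poly N f c) = poly N (\<lambda>i. der U (f i)) c"
proof (induction N)
  case (Suc N)
  have "c [^] N \<in> cst" by (rule dsubD(11)[OF cst_dsub c])
  then show ?case using Suc f cstD[OF c] cstD[of "c [^] N"] by (simp add: poly_Suc d_add d_mult)
qed simp

definition submon :: "'u set \<Rightarrow> bool" where
  "submon S \<longleftrightarrow> S \<subseteq> carrier U \<and> \<zero> \<in> S \<and> (\<forall>a\<in>S. \<forall>b\<in>S. a \<oplus> b \<in> S)"

lemma submon_mult: "\<lbrakk>submon S; s \<in> S\<rbrakk> \<Longrightarrow> [(n::nat)] \<cdot> s \<in> S"
  by (induction n) (auto simp: submon_def)

text \<open>A Bezout relation \<open>a m = b p + 1\<close> writes \<open>t\<close> as a multiple of
  \<open>[m] \<cdot> t\<close>, because multiples of \<open>p\<close> vanish.\<close>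

lemma submon_cancel:
  assumes S: "submon S" and t: "t \<in> carrier U" and m: "\<not> p dvd m" "[m] \<cdot> t \<in> S"
  shows "t \<in> S"
proof -
  have "coprime m p" using m(1) prime_p by (metis coprime_commute prime_imp_coprime)
  moreover have "m \<noteq> 0" using m(1) by (metis dvd_0_right)
  ultimately obtain a b where ab: "a * m = b * p + 1"
    using bezout_nat[of m p] by (metis coprime_iff_gcd_eq_1 mult.commute)
  have "[(a * m)] \<cdot> t = [a] \<cdot> ([m] \<cdot> t)" using t by (simp add: add.nat_pow_pow mult.commute)
  moreover have "[(b * p + 1)] \<cdot> t = [b] \<cdot> ([p] \<cdot> t) \<oplus> t"
    using t by (simp add: add.nat_pow_pow mult.commute)
  ultimately have "t = [a] \<cdot> ([m] \<cdot> t)" using ab t char_p_mult by simp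
  then show ?thesis using submon_mult[OF S m(2), of a] by simp
qed

text \<open>The invariant carried along when solutions are adjoined: \<open>S\<close> bounds the
  constant eigenvalues on the compositum of \<open>K\<close> with the constants, and
  \<open>good\<close> keeps \<open>U\<close> separable over \<open>K\<close>.\<close>

definition tame :: "'u set \<Rightarrow> 'u set \<Rightarrow> bool" where
  "tame K S \<longleftrightarrow> good K \<and> submon S \<and> Ev K \<subseteq> S"

lemma eigen_pow:
  assumes v: "v \<in> carrier U" "\<theta> \<in> carrier U" "der U v = \<theta> \<otimes> v"
  shows "der U (v [^] (n::nat)) = ([n] \<cdot> \<theta>) \<otimes> v [^] n"
proof (induction n)
  case (Suc n)
  have "der U (v [^] Suc n) = (([n] \<cdot> \<theta>) \<otimes> v [^] n) \<otimes> v \<oplus> v [^] n \<otimes> (\<theta> \<otimes> v)"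
    using v Suc by (simp add: d_mult)
  also have "\<dots> = ([n] \<cdot> \<theta> \<oplus> \<theta>) \<otimes> (v [^] n \<otimes> v)"
  proof -
    have "(a \<otimes> w) \<otimes> v \<oplus> w \<otimes> (\<theta> \<otimes> v) = (a \<oplus> \<theta>) \<otimes> (w \<otimes> v)" if "a \<in> carrier U" "w \<in> carrier U" for a w
      by (use in_carrier_Cons in_carrier_Nil norm_eq[OF _ ring_norm_22, of "[a, w, v, \<theta>]"] that v(1,2) in simp)
    then show ?thesis using v by simp
  qed
  finally show ?case by simp
qed (use v in simp)

text \<open>Comparing powers of \<open>v\<close> produces differences of multiples of the
  eigenvalue. As natural multiples they stay within reach of \<open>submon_cancel\<close>.\<close>

lemma nat_diff_mult:
  assumes "i \<le> p" "t \<in> carrier U"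
  shows "[j] \<cdot> t \<ominus> [i] \<cdot> t = [(j + (p - i))] \<cdot> t"
proof -
  have "[(p - i)] \<cdot> t \<oplus> [i] \<cdot> t = \<zero>"
    using assms char_p_mult by (simp add: add.nat_pow_mult)
  then have "\<ominus> ([i] \<cdot> t) = [(p - i)] \<cdot> t" using assms by (intro minus_equality) auto
  then show ?thesis using assms by (simp add: a_minus_def add.nat_pow_mult)
qed

context
  fixes K S v \<theta>
  assumes tame: "tame K S" and v: "v \<in> carrier U" "v \<noteq> \<zero>" and \<theta>: "\<theta> \<in> cst" "\<theta> \<notin> S" "der U v = \<theta> \<otimes> v"
    and \<theta>PR: "\<theta> \<in> PR K v"
begin

lemma K_good: "good K" and K_dsub: "dsub K" and S_mon: "submon S" and Ev_S: "Ev K \<subseteq> S"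
  using tame by (auto simp: tame_def good_def)

text \<open>Otherwise \<open>[m] \<cdot> \<theta>\<close> would be an eigenvalue and hence in
  \<open>S\<close>, and division by \<open>m\<close> modulo \<open>p\<close> would put
  \<open>\<theta>\<close> in \<open>S\<close>.\<close>

lemma nEv:
  assumes "\<beta> \<in> EK K" "\<beta> \<noteq> \<zero>" "der U \<beta> = ([m] \<cdot> \<theta>) \<otimes> \<beta>"
  shows "p dvd m"
proof (rule ccontr)
  assume m: "\<not> p dvd m"
  have "[m] \<cdot> \<theta> \<in> Ev K" unfolding Ev_def using assms dsubD(12)[OF cst_dsub \<theta>(1)] by blast
  then show False using submon_cancel[OF S_mon _ m, of \<theta>] Ev_S \<theta> cstD by blast
qed

text \<open>The powers \<open>v^j\<close> are eigenvectors with eigenvalues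
  \<open>[j] \<cdot> \<theta>\<close>. In a relation normalised at \<open>j\<close> by
  \<open>eigen_relation\<close>, the coefficient at \<open>i\<close> has eigenvalue
  \<open>(j - i)\<close> times \<open>\<theta>\<close>, which \<open>nEv\<close> forbids for
  \<open>i\<close> different from \<open>j\<close>. Only \<open>v^j\<close> would remain, and it is
  not 0.\<close>

lemma powers_independent:
  assumes f: "\<And>j. j < p \<Longrightarrow> f j \<in> EK K" and rel: "(\<Oplus>j\<in>{..<p}. f j \<otimes> v [^] j) = \<zero>"
  shows "\<forall>j<p. f j = \<zero>"
proof (rule ccontr)
  assume "\<not> (\<forall>j<p. f j = \<zero>)"
  then obtain j0 where j0: "j0 \<in> {..<p}" "f j0 \<noteq> \<zero>" by auto
  note EKd = EK_dsub[OF K_dsub]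
  have vi: "v [^] i \<in> carrier U" for i :: nat using v by simp
  have \<theta>E: "[i] \<cdot> \<theta> \<in> EK K" for i :: nat by (rule EK_const[OF K_dsub dsubD(12)[OF cst_dsub \<theta>(1)]])
  have fE: "f j \<in> EK K" if "j \<in> {..<p}" for j using f that by simp
  obtain g j where g: "j \<in> {..<p}" "\<forall>i\<in>{..<p}. g i \<in> EK K" "(\<Oplus>i\<in>{..<p}. g i \<otimes> v [^] i) = \<zero>" "g j = \<one>"
    "\<forall>i\<in>{..<p}. der U (g i) = ([j] \<cdot> \<theta> \<ominus> [i] \<cdot> \<theta>) \<otimes> g i"
    using eigen_relation[OF EKd finite_lessThan vi eigen_pow[OF v(1) cstD(1)[OF \<theta>(1)] \<theta>(3)] \<theta>E fE rel j0] by blast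
  have "g i = \<zero>" if i: "i < p" "i \<noteq> j" for i
  proof (rule ccontr)
    assume nz: "g i \<noteq> \<zero>"
    have "der U (g i) = ([(j + (p - i))] \<cdot> \<theta>) \<otimes> g i"
      using g(5) i nat_diff_mult[of i \<theta> j] cstD[OF \<theta>(1)] by simp
    then have "p dvd j + (p - i)" using nEv[OF _ nz] g(2) i by blast
    then obtain k where k: "j + (p - i) = p * k" by (elim dvdE)
    \<comment> \<open>A multiple of \<open>p\<close> strictly between 0 and \<open>2 p\<close> is
      \<open>p\<close> itself, and that would mean \<open>i = j\<close>.\<close>
    have b: "0 < j + (p - i)" "j + (p - i) < p * 2" "j + (p - i) \<noteq> p" using i g(1) by auto
    have "k \<noteq> 0" "k \<noteq> 1" using b(1,3) unfolding k by auto
    then have "p * 2 \<le> p * k" by (intro mult_le_mono2) linarith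
    then show False using b(2) unfolding k by linarith
  qed
  then have "(\<Oplus>i\<in>{..<p}. g i \<otimes> v [^] i) = (\<Oplus>i\<in>{..<p}. if j = i then v [^] j else \<zero>)"
    using v g(4) by (intro finsum_cong') auto
  also have "\<dots> = v [^] j" using add.finprod_singleton[OF g(1), of "\<lambda>_. v [^] j"] v by simp
  finally have "v [^] j = \<zero>" using g(3) by (rule trans[OF sym])
  then show False using nat_pow_nonzero[OF v, of j] by contradiction
qed

text \<open>The powers of the constant \<open>v^p\<close> are eigenvectors for the eigenvalue 0, so
  a relation normalised by \<open>eigen_relation\<close> has constant coefficients in
  \<open>K\<close>. As \<open>K\<close> is good these are \<open>p\<close>-th powers, and extracting
  the root yields a relation of the same length for \<open>v\<close> itself.\<close>

lemma const_poly_zero: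
  assumes IH: "\<And>g. \<lbrakk>\<And>i. g i \<in> K; poly M g v = \<zero>\<rbrakk> \<Longrightarrow> \<forall>i<M. g i = \<zero>"
    and f: "\<And>i. f i \<in> K" and z: "poly M f (v [^] p) = \<zero>"
  shows "\<forall>i<M. f i = \<zero>"
proof (rule ccontr)
  assume "\<not> (\<forall>i<M. f i = \<zero>)"
  then obtain j0 where j0: "j0 \<in> {..<M}" "f j0 \<noteq> \<zero>" by auto
  note Kd = dsubD[OF K_dsub]
  have vi: "(v [^] p) [^] i \<in> carrier U" for i :: nat using v by simp
  have dv: "der U ((v [^] p) [^] i) = \<zero> \<otimes> (v [^] p) [^] i" for i :: nat
    using dsubD(11)[OF cst_dsub pow_p_const[OF v(1)]] v by (simp add: cst_def)
  obtain g j where g: "j \<in> {..<M}" "\<forall>i\<in>{..<M}. g i \<in> K" "(\<Oplus>i\<in>{..<M}. g i \<otimes> (v [^] p) [^] i) = \<zero>" "g j = \<one>"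
    "\<forall>i\<in>{..<M}. der U (g i) = (\<zero> \<ominus> \<zero>) \<otimes> g i"
    using eigen_relation[OF K_dsub finite_lessThan vi dv Kd(3) f z[unfolded poly_def] j0] by blast
  have "\<exists>x\<in>K. x [^] p = g i" if "i < M" for i
  proof -
    have "der U (g i) = \<zero>" using g(2,5) that Kd(2) by (simp add: a_minus_def)
    then show ?thesis using K_good g(2) that unfolding good_def by blast
  qed
  then obtain x where x: "\<And>i. i < M \<Longrightarrow> x i \<in> K \<and> x i [^] p = g i" by metis
  define y where "y = (\<lambda>i. if i < M then x i else \<zero>)"
  have y: "y i \<in> K" for i using x Kd(3) by (simp add: y_def)
  have "(poly M y v) [^] p = poly M (\<lambda>i. y i [^] p) (v [^] p)" using y Kd(2) v by (intro poly_frob[symmetric]) auto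
  also have "\<dots> = (\<Oplus>i\<in>{..<M}. g i \<otimes> (v [^] p) [^] i)"
    unfolding poly_def using g(2) x Kd(2) vi by (intro finsum_cong') (auto simp: y_def)
  finally have "poly M y v = \<zero>" using g(3) frob_eq_zero y Kd(2) v by simp
  then have "y j = \<zero>" using IH[of y, OF y] g(1) by simp
  then have "x j = \<zero>" using g(1) by (simp add: y_def)
  then have "x j [^] p = \<zero>" using frob_zero by simp
  moreover have "x j [^] p = \<one>" using x[of j] g(1,4) by simp
  ultimately show False by simp
qed

lemma block_EK:
  assumes "\<And>i. f i \<in> K"
  shows "poly M f (v [^] p) \<in> EK K"
proof (induction M)
  case 0
  then show ?case using EK_zero by simp
next
  case (Suc M)
  have "f M \<otimes> (v [^] p) [^] M \<in> EK K"
    by (rule EK_prod[OF K_dsub assms dsubD(11)[OF cst_dsub pow_p_const[OF v(1)]]])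
  then show ?case using EK_add[OF K_dsub Suc] assms dsubD(2)[OF K_dsub] v by (simp add: poly_Suc)
qed

text \<open>Sorted by exponents modulo \<open>p\<close>, a relation of length \<open>N\<close>
  splits into \<open>p\<close> blocks, which vanish separately by \<open>powers_independent\<close>.
  Each block is a relation of length about \<open>N / p\<close> for \<open>v^p\<close>, and
  \<open>const_poly_zero\<close> reduces it to relations for \<open>v\<close> covered by the
  induction hypothesis.\<close>

lemma transc_v: "transc K v"
proof -
  note Kd = dsubD[OF K_dsub]
  have "\<forall>f. (\<forall>i. f i \<in> K) \<longrightarrow> poly N f v = \<zero> \<longrightarrow> (\<forall>i<N. f i = \<zero>)" for N
  proof (induction N rule: less_induct)
    case (less N)
    show ?case
    proof (intro allI impI)
      fix f i assume f: "\<forall>i. f i \<in> K" and z: "poly N f v = \<zero>" and i: "i < N"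
      have fc: "f i \<in> carrier U" for i using f Kd(2) by blast
      show "f i = \<zero>"
      proof (cases "N = 1")
        case True
        then show ?thesis using z i fc v by (simp add: poly_Suc)
      next
        case False
        \<comment> \<open>\<open>N / p\<close> rounded up. It is smaller than \<open>N\<close>
          because both \<open>N\<close> and \<open>p\<close> are at least 2 here, which is why
          \<open>N = 1\<close> was settled separately.\<close>
        define M where "M = (N + p - 1) div p"
        have div: "p * M + (N + p - 1) mod p = N + p - 1" "(N + p - 1) mod p < p"
          using p_gt by (simp_all add: M_def)
        have M: "N \<le> p * M" using div by linarith
        have M': "M < N"
        proof (rule ccontr)
          assume "\<not> M < N"
          then have "p * N \<le> p * M" by simp
          then have le: "p * N \<le> N + p - 1" using div by linarith
          have "2 \<le> N" "2 \<le> p" using i False p_gt by linarith+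
          then obtain n q where "N = 2 + n" "p = 2 + q" unfolding le_iff_add by blast
          then show False using le by (simp add: algebra_simps)
        qed
        define f' where "f' = (\<lambda>i. if i < N then f i else \<zero>)"
        have f': "f' i \<in> K" "f' i \<in> carrier U" for i using f fc Kd(3) by (auto simp: f'_def)
        have "poly (p * M) f' v = \<zero>" unfolding f'_def using z fc v M by (simp add: poly_pad)
        then have "(\<Oplus>j\<in>{..<p}. poly M (\<lambda>i. f' (p * i + j)) (v [^] p) \<otimes> v [^] j) = \<zero>"
          using poly_split[OF f'(2) v(1), of M] by simp
        then have "\<forall>j<p. poly M (\<lambda>i. f' (p * i + j)) (v [^] p) = \<zero>"
          by (intro powers_independent block_EK f'(1)) auto
        \<comment> \<open>The coefficient with index \<open>i\<close> stands in block
          \<open>i mod p\<close> at place \<open>i div p\<close>.\<close>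
        moreover have "i mod p < p" using p_gt by simp
        ultimately have z': "poly M (\<lambda>k. f' (p * k + i mod p)) (v [^] p) = \<zero>" by blast
        have "\<forall>k<M. f' (p * k + i mod p) = \<zero>"
        proof (rule const_poly_zero[OF _ f'(1) z'])
          show "\<forall>i<M. g i = \<zero>" if "\<And>i. g i \<in> K" "poly M g v = \<zero>" for g
            using less[OF M'] that by blast
        qed
        moreover have "i div p < M" using i M p_gt by (simp add: less_mult_imp_div_less mult.commute)
        ultimately have "f' (p * (i div p) + i mod p) = \<zero>" by blast
        then show ?thesis using i by (simp add: f'_def)
      qed
    qed
  qed
  then show ?thesis by (simp add: transc_def)
qed

lemma PR_blocks:
  assumes x: "x \<in> PR K v"
  shows "\<exists>M F. (\<forall>i. F i \<in> K) \<and> x = (\<Oplus>j\<in>{..<p}. poly M (\<lambda>i. F (p * i + j)) (v [^] p) \<otimes> v [^] j)"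
proof -
  note Kd = dsubD[OF K_dsub]
  obtain N f where f: "\<forall>i. f i \<in> K" "x = poly N f v" using PR_normal_form[OF K_dsub v(1) x] by blast
  define f' where "f' = (\<lambda>i. if i < N then f i else \<zero>)"
  have f': "f' i \<in> K" "f' i \<in> carrier U" for i using f Kd(2,3) by (auto simp: f'_def)
  have "N \<le> p * N" using p_gt by simp
  then have "x = poly (p * N) f' v" unfolding f'_def f(2) using f(1) Kd(2) v by (simp add: poly_pad)
  then show ?thesis
    by (intro exI[of _ N] exI[of _ f'] conjI allI f'(1)) (rule trans[OF _ poly_split[OF f'(2) v(1), of N]])
qed

lemma PR_v_dring: "dring (PR K v)"
  by (rule PR_dring[OF K_dsub v(1)]) (simp add: \<theta>(3) PR_mult[OF \<theta>PR PR_var])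

text \<open>The fraction \<open>x / y\<close> is rewritten as
  \<open>x y^(p-1) / y^p\<close>.\<close>

lemma Fr_const_denominator:
  assumes "z \<in> Fr (PR K v)"
  shows "\<exists>x\<in>PR K v. \<exists>y\<in>PR K v. y \<noteq> \<zero> \<and> z = x \<otimes> (inv y) [^] p \<and> inv y \<in> carrier U"
proof -
  note R = dringD[OF PR_v_dring]
  obtain x y where xy: "z = x \<otimes> inv y" "x \<in> PR K v" "y \<in> PR K v" "y \<noteq> \<zero>" using assms by (rule Fr_cases)
  note c = R(1)[OF xy(2)] R(1)[OF xy(3)]
  note i = inv_nonzero[OF c(2) xy(4)]
  have pw: "y [^] n \<in> PR K v" for n :: nat by (induction n) (use R(2,5) xy(3) in auto)
  have "z = (x \<otimes> y [^] (p - 1)) \<otimes> (inv y) [^] p"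
  proof -
    have "(x \<otimes> y [^] (p - 1)) \<otimes> (inv y) [^] p = x \<otimes> (y [^] (p - 1) \<otimes> (inv y) [^] p)"
      using c i(1) by (intro m_assoc) auto
    also have "y [^] (p - 1) \<otimes> (inv y) [^] p = inv y" by (rule inv_pow_p[OF c(2) xy(4), symmetric])
    finally show ?thesis using xy(1) by simp
  qed
  moreover have "x \<otimes> y [^] (p - 1) \<in> PR K v" by (rule R(5)[OF xy(2) pw])
  ultimately show ?thesis using xy i by blast
qed

text \<open>Differentiation maps \<open>\<beta> j \<otimes> v [^] j\<close> to a multiple of the
  same power of \<open>v\<close>. Since these powers are independent over the compositum, the
  equation can be compared coefficient by coefficient.\<close>

lemma der_blocks:
  assumes \<beta>: "\<And>j. j < p \<Longrightarrow> \<beta> j \<in> EK K" and \<eta>: "\<eta> \<in> cst"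
    and eq: "der U (\<Oplus>j\<in>{..<p}. \<beta> j \<otimes> v [^] j) = \<eta> \<otimes> (\<Oplus>j\<in>{..<p}. \<beta> j \<otimes> v [^] j)"
  shows "\<forall>j<p. der U (\<beta> j) = (\<eta> \<ominus> [j] \<cdot> \<theta>) \<otimes> \<beta> j"
proof -
  note EKd = dsubD[OF EK_dsub[OF K_dsub]]
  have bc: "\<beta> j \<in> carrier U" if "j < p" for j using \<beta>[OF that] EKd(2) by blast
  have \<eta>c: "\<eta> \<in> carrier U" and \<theta>c: "\<theta> \<in> carrier U" using \<eta> \<theta> cstD by auto
  define h where "h = (\<lambda>j. der U (\<beta> j) \<ominus> (\<eta> \<ominus> [j] \<cdot> \<theta>) \<otimes> \<beta> j)"
  have hE: "h j \<in> EK K" if "j < p" for j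
    unfolding h_def
    by (rule EKd(8)[OF EKd(10)[OF \<beta>[OF that]] EKd(6)[OF EKd(8)[OF EK_const[OF K_dsub \<eta>] EK_const[OF K_dsub dsubD(12)[OF cst_dsub \<theta>(1)]]] \<beta>[OF that]]])
  have id: "(a \<ominus> (t \<ominus> s) \<otimes> b) \<otimes> w = (a \<otimes> w \<oplus> b \<otimes> (s \<otimes> w)) \<oplus> (\<ominus> t) \<otimes> (b \<otimes> w)"
    if "a \<in> carrier U" "t \<in> carrier U" "s \<in> carrier U" "b \<in> carrier U" "w \<in> carrier U" for a t s b w
    by (use in_carrier_Cons in_carrier_Nil norm_eq[OF _ ring_norm_18, of "[a, t, s, b, w]"] that in simp)
  have bv: "\<beta> j \<otimes> v [^] j \<in> carrier U" if "j \<in> {..<p}" for j using bc that v by simp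
  have "(\<Oplus>j\<in>{..<p}. h j \<otimes> v [^] j) = (\<Oplus>j\<in>{..<p}. der U (\<beta> j \<otimes> v [^] j) \<oplus> (\<ominus> \<eta>) \<otimes> (\<beta> j \<otimes> v [^] j))"
  proof (rule finsum_cong'[OF refl])
    fix j assume j: "j \<in> {..<p}"
    have "der U (v [^] j) = ([j] \<cdot> \<theta>) \<otimes> v [^] j" by (rule eigen_pow[OF v(1) \<theta>c \<theta>(3)])
    then show "h j \<otimes> v [^] j = der U (\<beta> j \<otimes> v [^] j) \<oplus> (\<ominus> \<eta>) \<otimes> (\<beta> j \<otimes> v [^] j)"
      using bc j \<eta>c \<theta>c v by (simp add: h_def d_mult id)
  qed (use bv \<eta>c in auto)
  also have "\<dots> = (\<Oplus>j\<in>{..<p}. der U (\<beta> j \<otimes> v [^] j)) \<oplus> (\<Oplus>j\<in>{..<p}. (\<ominus> \<eta>) \<otimes> (\<beta> j \<otimes> v [^] j))"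
    by (rule finsum_addf) (use bv \<eta>c in auto)
  also have "(\<Oplus>j\<in>{..<p}. der U (\<beta> j \<otimes> v [^] j)) = der U (\<Oplus>j\<in>{..<p}. \<beta> j \<otimes> v [^] j)"
    by (rule der_finsum[OF finite_lessThan bv, symmetric])
  also have "(\<Oplus>j\<in>{..<p}. (\<ominus> \<eta>) \<otimes> (\<beta> j \<otimes> v [^] j)) = (\<ominus> \<eta>) \<otimes> (\<Oplus>j\<in>{..<p}. \<beta> j \<otimes> v [^] j)"
    by (rule finsum_scale[OF finite_lessThan a_inv_closed[OF \<eta>c] bv])
  finally have "(\<Oplus>j\<in>{..<p}. h j \<otimes> v [^] j) = \<zero>"
    unfolding eq using \<eta>c bv by (simp add: l_minus r_neg finsum_closed Pi_def)
  then have "\<forall>j<p. h j = \<zero>" by (intro powers_independent hE)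
  then show ?thesis unfolding h_def using bc \<eta>c \<theta>c by (auto intro!: eq_of_minus)
qed

text \<open>After its denominator is made a \<open>p\<close>-th power, a constant of
  \<open>K(v)\<close> is determined by a constant \<open>x\<close> in \<open>K[v]\<close>. The
  coefficient of \<open>x\<close> at \<open>v^j\<close> has eigenvalue \<open>(p - j)\<close> times
  \<open>\<theta>\<close>, so \<open>nEv\<close> leaves only \<open>j = 0\<close>. What remains is a
  polynomial in \<open>v^p\<close> whose coefficients are constants of \<open>K\<close>, hence
  \<open>p\<close>-th powers.\<close>

lemma good_ext: "good (Fr (PR K v))"
proof -
  note Kd = dsubD[OF K_dsub] and R = dringD[OF PR_v_dring]
  have "\<exists>x\<in>Fr (PR K v). x [^] p = c" if c: "c \<in> Fr (PR K v)" "der U c = \<zero>" for c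
  proof -
    obtain x y where xy: "x \<in> PR K v" "y \<in> PR K v" "y \<noteq> \<zero>" "c = x \<otimes> (inv y) [^] p" "inv y \<in> carrier U"
      using Fr_const_denominator[OF c(1)] by blast
    note cr = R(1)[OF xy(1)] R(1)[OF xy(2)]
    note i = inv_nonzero[OF cr(2) xy(3)]
    have "der U c = der U x \<otimes> (inv y) [^] p" unfolding xy(4) using cr i der_pow_p by (simp add: d_mult)
    then have "der U x \<otimes> (inv y) [^] p = \<zero>" using c(2) by (rule trans[OF sym])
    then have dx: "der U x = \<zero>"
      using integral[of "der U x" "(inv y) [^] p"] cr i nat_pow_nonzero[OF i(1,4), of p] by auto
    obtain M F where F: "\<forall>i. F i \<in> K" "x = (\<Oplus>j\<in>{..<p}. poly M (\<lambda>i. F (p * i + j)) (v [^] p) \<otimes> v [^] j)"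
      using PR_blocks[OF xy(1)] by blast
    have Fc: "F i \<in> carrier U" for i using F(1) Kd(2) by blast
    define \<beta> where "\<beta> = (\<lambda>j. poly M (\<lambda>i. F (p * i + j)) (v [^] p))"
    have \<beta>: "\<beta> j \<in> EK K" for j unfolding \<beta>_def using F(1) by (intro block_EK) auto
    have bc: "\<beta> j \<in> carrier U" for j using \<beta> EK_carrier[OF K_dsub] by blast
    have xb: "x = (\<Oplus>j\<in>{..<p}. \<beta> j \<otimes> v [^] j)" unfolding \<beta>_def by (rule F(2))
    have "\<forall>j<p. der U (\<beta> j) = (\<zero> \<ominus> [j] \<cdot> \<theta>) \<otimes> \<beta> j"
      by (rule der_blocks[OF \<beta> dsubD(3)[OF cst_dsub]]) (use dx xb cr in auto)
    then have d\<beta>: "der U (\<beta> j) = ([(p - j)] \<cdot> \<theta>) \<otimes> \<beta> j" if "j < p" for j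
      using that nat_diff_mult[of j \<theta> 0] cstD[OF \<theta>(1)] by simp
    have bz: "\<beta> j = \<zero>" if j: "0 < j" "j < p" for j
    proof (rule ccontr)
      assume nz: "\<beta> j \<noteq> \<zero>"
      have "p dvd p - j" by (rule nEv[OF \<beta> nz d\<beta>[OF j(2)]])
      then show False using j by (auto dest: dvd_imp_le)
    qed
    have "x = (\<Oplus>j\<in>{..<p}. if 0 = j then \<beta> 0 else \<zero>)"
      unfolding xb using bz bc v by (intro finsum_cong') auto
    also have "\<dots> = \<beta> 0" using add.finprod_singleton[of 0 "{..<p}" "\<lambda>_. \<beta> 0"] bc p_gt by simp
    finally have x0: "x = poly M (\<lambda>i. F (p * i)) (v [^] p)" by (simp add: \<beta>_def)
    \<comment> \<open>Differentiating a polynomial in the constant \<open>v^p\<close> touches only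
      its coefficients, and \<open>const_poly_zero\<close> makes each derived coefficient
      vanish.\<close>
    have dz: "poly M (\<lambda>i. der U (F (p * i))) (v [^] p) = \<zero>"
      using dx unfolding x0 using der_poly_const[of "\<lambda>i. F (p * i)", OF Fc pow_p_const[OF v(1)], of M] by simp
    have dF: "\<forall>i<M. der U (F (p * i)) = \<zero>"
    proof (rule const_poly_zero[OF _ _ dz])
      show "der U (F (p * i)) \<in> K" for i by (rule Kd(10)) (use F(1) in blast)
      show "\<forall>i<M. g i = \<zero>" if "\<And>i. g i \<in> K" "poly M g v = \<zero>" for g
        using transc_v that unfolding transc_def by blast
    qed
    have "\<exists>r\<in>K. r [^] p = F (p * i)" if "i < M" for i
    proof -
      have "F (p * i) \<in> K" using F(1) by blast
      then show ?thesis using K_good dF that unfolding good_def by blast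
    qed
    then obtain r where r: "\<And>i. i < M \<Longrightarrow> r i \<in> K \<and> r i [^] p = F (p * i)" by metis
    define r' where "r' = (\<lambda>i. if i < M then r i else \<zero>)"
    have r': "r' i \<in> K" "r' i \<in> carrier U" for i using r Kd(2,3) by (auto simp: r'_def)
    have pr: "poly N r' v \<in> PR K v" for N
    proof (induction N)
      case 0
      show ?case using PR_K[OF Kd(3)] by simp
    next
      case (Suc N)
      have vp: "v [^] n \<in> PR K v" for n :: nat by (induction n) (simp_all add: R(2) PR_mult[OF _ PR_var])
      show ?case using PR_add[OF Suc PR_mult[OF PR_K[OF r'(1)[of N]] vp[of N]]] r' v by (simp add: poly_Suc)
    qed
    have "(poly M r' v) [^] p = poly M (\<lambda>i. r' i [^] p) (v [^] p)" using r' v by (intro poly_frob[symmetric])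
    also have "\<dots> = x" unfolding x0 poly_def using r Fc v by (intro finsum_cong') (auto simp: r'_def)
    finally have "c = (poly M r' v \<otimes> inv y) [^] p" unfolding xy(4) using r' v i by (simp add: frob_mult)
    then show ?thesis using FrI[OF pr xy(2,3)] by blast
  qed
  then show ?thesis using Fr_dsub[OF PR_v_dring] by (auto simp: good_def)
qed

text \<open>An eigenvector in the compositum of \<open>K(v)\<close> with the constants is a
  combination of \<open>1, v, ..., v^(p-1)\<close> over \<open>EK K\<close>. A nonzero coefficient
  at \<open>v^j\<close> is itself an eigenvector, with eigenvalue
  \<open>\<eta> \<ominus> [j] \<cdot> \<theta>\<close>, which therefore lies in
  \<open>S\<close>.\<close>

lemma Ev_ext: "Ev (Fr (PR K v)) \<subseteq> {s \<oplus> [n] \<cdot> \<theta> | s (n::nat). s \<in> S}"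
proof
  fix \<eta> assume "\<eta> \<in> Ev (Fr (PR K v))"
  then obtain z where \<eta>: "\<eta> \<in> cst" and z: "z \<in> EK (Fr (PR K v))" "z \<noteq> \<zero>" "der U z = \<eta> \<otimes> z"
    by (auto simp: Ev_def)
  note EKd = dsubD[OF EK_dsub[OF K_dsub]] and R = dringD[OF PR_v_dring]
  \<comment> \<open>The span of the first \<open>p\<close> powers of \<open>v\<close> over the
    compositum. It contains \<open>K[v]\<close> and admits constant factors, so \<open>K(v)\<close>
    and all its products with constants lie in it too.\<close>
  define T where "T = {(\<Oplus>j\<in>{..<p}. \<beta> j \<otimes> v [^] j) | \<beta>. \<forall>j. \<beta> j \<in> EK K}"
  have Tadd: "a \<oplus> b \<in> T" if ab: "a \<in> T" "b \<in> T" for a b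
  proof -
    obtain \<beta> \<gamma> where bg: "a = (\<Oplus>j\<in>{..<p}. \<beta> j \<otimes> v [^] j)" "\<forall>j. \<beta> j \<in> EK K"
      "b = (\<Oplus>j\<in>{..<p}. \<gamma> j \<otimes> v [^] j)" "\<forall>j. \<gamma> j \<in> EK K" using ab by (auto simp: T_def)
    have c: "\<beta> j \<in> carrier U" "\<gamma> j \<in> carrier U" for j using bg EKd(2) by auto
    have "(\<Oplus>j\<in>{..<p}. (\<beta> j \<oplus> \<gamma> j) \<otimes> v [^] j) = (\<Oplus>j\<in>{..<p}. \<beta> j \<otimes> v [^] j \<oplus> \<gamma> j \<otimes> v [^] j)"
      using c v by (intro finsum_cong') (auto simp: l_distr)
    also have "\<dots> = a \<oplus> b" unfolding bg(1,3) using c v by (intro finsum_addf) auto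
    finally have "a \<oplus> b = (\<Oplus>j\<in>{..<p}. (\<beta> j \<oplus> \<gamma> j) \<otimes> v [^] j)" by (rule sym)
    then show ?thesis unfolding T_def
      by (intro CollectI exI[of _ "\<lambda>j. \<beta> j \<oplus> \<gamma> j"] conjI allI EKd(5)) (use bg in auto)
  qed
  have Tconst: "a \<otimes> c \<in> T" if a: "a \<in> T" and c: "c \<in> cst" for a c
  proof -
    obtain \<beta> where b: "a = (\<Oplus>j\<in>{..<p}. \<beta> j \<otimes> v [^] j)" "\<forall>j. \<beta> j \<in> EK K" using a by (auto simp: T_def)
    have bc: "\<beta> j \<in> carrier U" for j using b EKd(2) by auto
    have cc: "c \<in> carrier U" using cstD c by blast
    have "(\<Oplus>j\<in>{..<p}. (c \<otimes> \<beta> j) \<otimes> v [^] j) = (\<Oplus>j\<in>{..<p}. c \<otimes> (\<beta> j \<otimes> v [^] j))"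
      using bc cc v by (intro finsum_cong') (auto simp: m_assoc)
    also have "\<dots> = c \<otimes> a" unfolding b(1) using bc v by (intro finsum_scale finite_lessThan cc) auto
    finally have "a \<otimes> c = (\<Oplus>j\<in>{..<p}. (c \<otimes> \<beta> j) \<otimes> v [^] j)"
      using bc cc v unfolding b(1) by (simp add: m_comm finsum_closed Pi_def)
    then show ?thesis unfolding T_def
      by (intro CollectI exI[of _ "\<lambda>j. c \<otimes> \<beta> j"] conjI allI EKd(6)[OF EK_const[OF K_dsub c]]) (use b in auto)
  qed
  have PRT: "x \<in> T" if x: "x \<in> PR K v" for x
  proof -
    obtain M F where F: "\<forall>i. F i \<in> K" "x = (\<Oplus>j\<in>{..<p}. poly M (\<lambda>i. F (p * i + j)) (v [^] p) \<otimes> v [^] j)"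
      using PR_blocks[OF x] by blast
    have "poly M (\<lambda>i. F (p * i + j)) (v [^] p) \<in> EK K" for j using F(1) by (intro block_EK) auto
    then show ?thesis unfolding T_def using F(2) by (intro CollectI exI[of _ "\<lambda>j. poly M (\<lambda>i. F (p * i + j)) (v [^] p)"]) auto
  qed
  have FrT: "z \<in> T" if z': "z \<in> Fr (PR K v)" for z
  proof -
    obtain x y where xy: "x \<in> PR K v" "z = x \<otimes> (inv y) [^] p" "inv y \<in> carrier U"
      using Fr_const_denominator[OF z'] by blast
    show ?thesis unfolding xy(2) by (rule Tconst[OF PRT[OF xy(1)] pow_p_const[OF xy(3)]])
  qed
  have "z \<in> T" using z(1)
  proof (induction rule: EK.induct)
    case EK_zero
    show ?case by (rule PRT[OF R(3)])
  next
    case (EK_step k c x)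
    show ?case by (rule Tadd[OF Tconst[OF FrT[OF EK_step(1)] EK_step(2)] EK_step(4)])
  qed
  then obtain \<beta> where b: "z = (\<Oplus>j\<in>{..<p}. \<beta> j \<otimes> v [^] j)" "\<forall>j. \<beta> j \<in> EK K" by (auto simp: T_def)
  have d: "\<forall>j<p. der U (\<beta> j) = (\<eta> \<ominus> [j] \<cdot> \<theta>) \<otimes> \<beta> j"
    by (rule der_blocks[OF _ \<eta>]) (use b z(3) in auto)
  have "\<exists>j<p. \<beta> j \<noteq> \<zero>"
  proof (rule ccontr)
    assume "\<not> (\<exists>j<p. \<beta> j \<noteq> \<zero>)"
    then have "z = (\<Oplus>j\<in>{..<p}. \<zero>)" unfolding b(1) using v by (intro finsum_cong') auto
    then show False using z(2) by simp
  qed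
  then obtain j where j: "j < p" "\<beta> j \<noteq> \<zero>" by blast
  have c: "\<eta> \<in> carrier U" "[j] \<cdot> \<theta> \<in> carrier U" using \<eta> \<theta> cstD by auto
  have "\<eta> \<ominus> [j] \<cdot> \<theta> \<in> cst" by (rule dsubD(8)[OF cst_dsub \<eta> dsubD(12)[OF cst_dsub \<theta>(1)]])
  then have "\<eta> \<ominus> [j] \<cdot> \<theta> \<in> S" using d j b(2) Ev_S unfolding Ev_def by blast
  moreover have "\<eta> = (\<eta> \<ominus> [j] \<cdot> \<theta>) \<oplus> [j] \<cdot> \<theta>" using c by (simp add: a_minus_def a_assoc l_neg)
  ultimately show "\<eta> \<in> {s \<oplus> [n] \<cdot> \<theta> | s (n::nat). s \<in> S}" by blast
qed

lemma tame_ext: "tame (Fr (PR K v)) {s \<oplus> [n] \<cdot> \<theta> | s (n::nat). s \<in> S}"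
proof -
  have \<theta>c: "\<theta> \<in> carrier U" using \<theta> cstD by blast
  have Sc: "s \<in> carrier U" if "s \<in> S" for s using S_mon that by (auto simp: submon_def)
  have "submon {s \<oplus> [n] \<cdot> \<theta> | s (n::nat). s \<in> S}" unfolding submon_def
  proof (intro conjI ballI)
    show "{s \<oplus> [n] \<cdot> \<theta> | s (n::nat). s \<in> S} \<subseteq> carrier U" using Sc \<theta>c by auto
    have "\<zero> = \<zero> \<oplus> [(0::nat)] \<cdot> \<theta>" by simp
    then show "\<zero> \<in> {s \<oplus> [n] \<cdot> \<theta> | s (n::nat). s \<in> S}" using S_mon unfolding submon_def by blast
    fix a b assume "a \<in> {s \<oplus> [n] \<cdot> \<theta> | s (n::nat). s \<in> S}" "b \<in> {s \<oplus> [n] \<cdot> \<theta> | s (n::nat). s \<in> S}"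
    then obtain s n t m where 1: "a = s \<oplus> [(n::nat)] \<cdot> \<theta>" "s \<in> S" "b = t \<oplus> [(m::nat)] \<cdot> \<theta>" "t \<in> S" by blast
    have "a \<oplus> b = (s \<oplus> t) \<oplus> [(n + m)] \<cdot> \<theta>"
      unfolding 1 using Sc[OF 1(2)] Sc[OF 1(4)] \<theta>c by (simp add: add.nat_pow_mult[symmetric] a_ac)
    moreover have "s \<oplus> t \<in> S" using S_mon 1 by (auto simp: submon_def)
    ultimately show "a \<oplus> b \<in> {s \<oplus> [n] \<cdot> \<theta> | s (n::nat). s \<in> S}" by blast
  qed
  then show ?thesis using good_ext Ev_ext by (simp add: tame_def)
qed

end

end

section \<open>Separability over good subfields\<close>

context dfield
begin

lemma sub_span:
  assumes K: "subfield K U" and us: "set us \<subseteq> carrier U"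
  shows "x \<in> Span K us \<Longrightarrow> x \<in> carrier U" "\<zero> \<in> Span K us"
    "\<lbrakk>x \<in> Span K us; y \<in> Span K us\<rbrakk> \<Longrightarrow> x \<oplus> y \<in> Span K us"
    "\<lbrakk>k \<in> K; x \<in> Span K us\<rbrakk> \<Longrightarrow> k \<otimes> x \<in> Span K us"
    "x \<in> Span K us \<Longrightarrow> \<ominus> x \<in> Span K us"
  using Span_subgroup_props[OF K us] Span_smult_closed[OF K us] by auto

lemma const_subfield:
  assumes K: "dsub K"
  shows "dsub (K \<inter> cst)"
proof -
  have "subfield (K \<inter> cst) U"
  proof (rule subfieldI')
    show "subring (K \<inter> cst) U"
      using dsubD[OF K] dsubD[OF cst_dsub] by (intro subringI) auto
    show "inv k \<in> K \<inter> cst" if k: "k \<in> K \<inter> cst - {\<zero>}" for k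
      using k dsubD(9)[OF K, of k] dsubD(9)[OF cst_dsub, of k] by auto
  qed
  then show ?thesis using dsubD(3)[OF K] dsubD(3)[OF cst_dsub] cstD(2) by (auto simp: dsub_def)
qed

lemma der_span_const:
  assumes K: "dsub K" and ds: "set ds \<subseteq> cst" and w: "w \<in> Span K ds"
  shows "der U w \<in> Span K ds"
  using ds w
proof (induction ds arbitrary: w)
  case (Cons d ds)
  note Kd = dsubD[OF K]
  have dsc: "set ds \<subseteq> carrier U" and d: "d \<in> carrier U" "der U d = \<zero>" using Cons(2) cstD by auto
  obtain k x where kx: "k \<in> K" "x \<in> Span K ds" "w = k \<otimes> d \<oplus> x" using Cons(3) by (auto simp: span_cons_iff simp del: Span.simps)
  have "der U w = der U k \<otimes> d \<oplus> der U x"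
    using kx d Kd(2) sub_span(1)[OF Kd(1) dsc] by (simp add: d_add d_mult)
  moreover have "der U x \<in> Span K ds" using Cons kx by simp
  ultimately show ?case using Kd(10)[OF kx(1)] unfolding span_cons_iff by blast
qed simp

text \<open>A differential subfield and the field of constants are linearly disjoint.\<close>

lemma const_span_descent:
  assumes K: "dsub K"
  shows "\<lbrakk>set ds \<subseteq> cst; c \<in> cst; c \<in> Span K ds\<rbrakk> \<Longrightarrow> c \<in> Span (K \<inter> cst) ds"
proof (induction ds arbitrary: c)
  case (Cons d ds)
  note Kd = dsubD[OF K] and K0 = dsubD[OF const_subfield[OF K]]
  have ds: "set ds \<subseteq> cst" and d: "d \<in> cst" using Cons(2) by auto
  have dsc: "set ds \<subseteq> carrier U" using ds cstD by auto
  note sp = sub_span[OF Kd(1) dsc] and sp0 = sub_span[OF K0(1) dsc]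
  note dc = cstD[OF d] and cc = cstD[OF Cons(3)]
  obtain k w where kw: "k \<in> K" "w \<in> Span K ds" "c = k \<otimes> d \<oplus> w"
    using Cons(4) unfolding span_cons_iff by blast
  have kc: "k \<in> carrier U" and wc: "w \<in> carrier U" using Kd(2)[OF kw(1)] sp(1)[OF kw(2)] by auto
  show ?case
  proof (cases "d \<in> Span K ds")
    case True
    have "c \<in> Span K ds" unfolding kw(3) by (rule sp(3)[OF sp(4)[OF kw(1) True] kw(2)])
    then have "c \<in> Span (K \<inter> cst) ds" by (rule Cons.IH[OF ds Cons(3)])
    moreover have "c = \<zero> \<otimes> d \<oplus> c" using dc cc by simp
    ultimately show ?thesis using K0(3) unfolding span_cons_iff by blast
  next
    case False
    have dw: "der U w \<in> Span K ds" by (rule der_span_const[OF K ds kw(2)])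
    have "der U c = der U k \<otimes> d \<oplus> der U w" unfolding kw(3) using kc dc wc by (simp add: d_add d_mult)
    then have eq: "der U k \<otimes> d \<oplus> der U w = \<zero>" using cc by simp
    \<comment> \<open>Otherwise dividing the derived equation by \<open>der U k\<close> would put
      \<open>d\<close> in the span of \<open>ds\<close>.\<close>
    have "der U k = \<zero>"
    proof (rule ccontr)
      assume nz: "der U k \<noteq> \<zero>"
      have dk: "der U k \<in> K" by (rule Kd(10)[OF kw(1)])
      note i = inv_nonzero[OF Kd(2)[OF dk] nz]
      have "der U k \<otimes> d = \<ominus> der U w" using eq Kd(2)[OF dk] dc d_closed[OF wc] by (metis m_closed minus_equality add.inv_closed minus_minus)
      then have "inv (der U k) \<otimes> (der U k \<otimes> d) = inv (der U k) \<otimes> (\<ominus> der U w)" by simp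
      then have "d = inv (der U k) \<otimes> (\<ominus> der U w)"
        using i Kd(2)[OF dk] dc by (simp add: m_assoc[symmetric])
      then have "d \<in> Span K ds" using sp(4)[OF Kd(9)[OF dk nz] sp(5)[OF dw]] by simp
      then show False using False by contradiction
    qed
    then have k0: "k \<in> K \<inter> cst" using kw(1) kc by (simp add: cst_def)
    have "der U w = \<zero>" using eq \<open>der U k = \<zero>\<close> dc wc by simp
    then have "w \<in> Span (K \<inter> cst) ds" using Cons.IH[OF ds _ kw(2)] wc by (simp add: cst_def)
    then show ?thesis using k0 kw(3) unfolding span_cons_iff by blast
  qed
qed simp

lemma frob_span:
  assumes K: "dsub K" and K0: "\<And>k. k \<in> K0 \<Longrightarrow> \<exists>x\<in>K. x [^] p = k"
  shows "\<lbrakk>set us \<subseteq> carrier U; z \<in> Span K0 (map (\<lambda>x. x [^] p) us)\<rbrakk> \<Longrightarrow> \<exists>y\<in>Span K us. z = y [^] p"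
proof (induction us arbitrary: z)
  case Nil
  then have "z = \<zero>" by simp
  then have "z = \<zero> [^] p" using frob_zero by (rule trans[OF _ sym])
  then show ?case by (intro bexI[of _ \<zero>]) simp_all
next
  case (Cons u us)
  note Kd = dsubD[OF K]
  have us: "set us \<subseteq> carrier U" and u: "u \<in> carrier U" using Cons(2) by auto
  obtain k w where kw: "k \<in> K0" "w \<in> Span K0 (map (\<lambda>x. x [^] p) us)" "z = k \<otimes> u [^] p \<oplus> w"
    using Cons(3) unfolding list.map span_cons_iff by blast
  obtain y where y: "y \<in> Span K us" "w = y [^] p" using Cons.IH[OF us kw(2)] by blast
  obtain x where x: "x \<in> K" "x [^] p = k" using K0[OF kw(1)] by blast
  have c: "x \<in> carrier U" "y \<in> carrier U" using Kd(2)[OF x(1)] sub_span(1)[OF Kd(1) us y(1)] by auto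
  have "z = (x \<otimes> u \<oplus> y) [^] p" unfolding kw(3) x(2)[symmetric] y(2) using c u by (simp add: frob_add frob_mult)
  moreover have "x \<otimes> u \<oplus> y \<in> Span K (u # us)" unfolding span_cons_iff using x(1) y(1) by blast
  ultimately show ?case by (rule bexI)
qed

text \<open>\<open>p\<close>-th powers are constants, so linear disjointness allows the coefficients
  to be taken among the constants of \<open>K\<close>. These have \<open>p\<close>-th roots in
  \<open>K\<close>, and injectivity of the Frobenius map recovers the relation for \<open>u\<close>
  itself.\<close>

lemma good_sep:
  assumes K: "good K" and T: "tensor p U M K \<sigma>"
  shows "tensor.sep p U K"
proof -
  interpret T: tensor p U M K \<sigma> by (rule T)
  have Kd: "dsub K" and rt: "\<And>c. c \<in> K \<inter> cst \<Longrightarrow> \<exists>x\<in>K. x [^] p = c" using K by (auto simp: good_def cst_def)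
  show ?thesis unfolding T.sep_def
  proof (intro allI impI)
    fix us u assume us: "set us \<subseteq> carrier U" and u: "u \<in> carrier U"
      and sp: "u [^] p \<in> Span K (map (\<lambda>x. x [^] p) us)"
    have "set (map (\<lambda>x. x [^] p) us) \<subseteq> cst" using us pow_p_const by auto
    then have "u [^] p \<in> Span (K \<inter> cst) (map (\<lambda>x. x [^] p) us)"
      using const_span_descent[OF Kd _ pow_p_const[OF u] sp] by simp
    then obtain y where y: "y \<in> Span K us" "u [^] p = y [^] p" using frob_span[OF Kd rt us] by blast
    then have "u = y" using frob_inj[OF u sub_span(1)[OF dsubD(1)[OF Kd] us]] by blast
    then show "u \<in> Span K us" using y by simp
  qed
qed

section \<open>The prime field\<close>

abbreviation PF where "PF \<equiv> prime_subfield U"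

lemma prime_field_elems: "PF = range (\<lambda>n::nat. [n] \<cdot> \<one>)"
  by (simp add: prime_subfield_def)

lemma prime_frob:
  assumes "x \<in> PF" shows "x [^] p = x"
proof -
  obtain n where n: "x = [(n::nat)] \<cdot> \<one>" using assms by (auto simp: prime_field_elems)
  have "([n] \<cdot> \<one>) [^] p = [n] \<cdot> \<one>"
    by (induction n) (simp_all add: frob_zero frob_add)
  then show ?thesis using n by simp
qed

lemma prime_const: "x \<in> PF \<Longrightarrow> x \<in> cst"
  using dsubD(12)[OF cst_dsub dsubD(4)[OF cst_dsub]] by (auto simp: prime_field_elems)

lemma prime_dsub: "dsub PF"
proof -
  have c: "x \<in> PF \<Longrightarrow> x \<in> carrier U" for x using prime_const cstD by blast
  have mult: "x \<otimes> y \<in> PF" if xy: "x \<in> PF" "y \<in> PF" for x y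
  proof -
    obtain m n where "x = [(m::nat)] \<cdot> \<one>" "y = [(n::nat)] \<cdot> \<one>" using xy by (auto simp: prime_field_elems)
    then have "x \<otimes> y = [(m * n)] \<cdot> \<one>" by (simp add: add_pow_ldistr add_pow_rdistr add.nat_pow_pow mult.commute)
    then show ?thesis by (auto simp: prime_field_elems)
  qed
  have one: "\<one> \<in> PF"
  proof -
    have "\<one> = [(1::nat)] \<cdot> \<one>" by simp
    then show ?thesis unfolding prime_field_elems by blast
  qed
  have pow: "x [^] n \<in> PF" if "x \<in> PF" for x and n :: nat
    by (induction n) (use one mult that in auto)
  have "subfield PF U"
  proof (rule subfieldI')
    show "subring PF U"
    proof (rule subringI)
      fix x y assume xy: "x \<in> PF" "y \<in> PF"
      obtain m n where mn: "x = [(m::nat)] \<cdot> \<one>" "y = [(n::nat)] \<cdot> \<one>" using xy by (auto simp: prime_field_elems)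
      have "x \<oplus> y = [(m + n)] \<cdot> \<one>" unfolding mn by (simp add: add.nat_pow_mult)
      then show "x \<oplus> y \<in> PF" by (auto simp: prime_field_elems)
      have "[(p - 1)] \<cdot> x \<oplus> x = [p] \<cdot> x" using p_gt c[OF xy(1)] by (metis Suc_diff_1 add.nat_pow_Suc)
      then have "\<ominus> x = [(p - 1)] \<cdot> x" using char_p_mult c[OF xy(1)] by (intro minus_equality) auto
      also have "\<dots> = [((p - 1) * m)] \<cdot> \<one>" unfolding mn by (simp add: add.nat_pow_pow mult.commute)
      finally show "\<ominus> x \<in> PF" by (auto simp: prime_field_elems)
      show "x \<otimes> y \<in> PF" by (rule mult[OF xy])
    qed (use c one in auto)
    fix x assume x: "x \<in> PF - {\<zero>}"
    have xc: "x \<in> carrier U" "x \<noteq> \<zero>" using x c by auto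
    note i = inv_nonzero[OF xc]
    \<comment> \<open>By Fermat \<open>x^p = x\<close>, so the inverse is the power
      \<open>x^(p-2)\<close>, which stays in the prime field.\<close>
    have "p = Suc (Suc (p - 2))" using p_gt by simp
    then have "x [^] (p - 2) \<otimes> x \<otimes> x = x" using prime_frob[of x] x by (metis DiffD1 nat_pow_Suc)
    then have "(x [^] (p - 2) \<otimes> x \<otimes> x) \<otimes> (inv x \<otimes> inv x) = x \<otimes> (inv x \<otimes> inv x)" by simp
    moreover have "(a \<otimes> x \<otimes> x) \<otimes> (inv x \<otimes> inv x) = a" if "a \<in> carrier U" for a
    proof -
      have "(a \<otimes> x \<otimes> x) \<otimes> (inv x \<otimes> inv x) = a \<otimes> ((x \<otimes> inv x) \<otimes> (x \<otimes> inv x))"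
        using that xc(1) i(1) by (simp add: m_ac)
      then show ?thesis using that i by simp
    qed
    moreover have "x \<otimes> (inv x \<otimes> inv x) = inv x" using xc i by (simp add: m_assoc[symmetric])
    ultimately have "inv x = x [^] (p - 2)" using xc by simp
    then show "inv x \<in> PF" using pow x by simp
  qed
  moreover have "\<zero> \<in> PF" using subringE(2)[OF subfieldE(1)[OF \<open>subfield PF U\<close>]] .
  ultimately show ?thesis using prime_const cstD(2) by (auto simp: dsub_def)
qed

text \<open>The compositum of the prime field with the constants consists of constants, on which
  only the eigenvalue 0 occurs. This is the base of every tower of solutions.\<close>

lemma prime_tame: "tame PF {\<zero>}"
proof -
  have "good PF" using prime_dsub prime_frob by (auto simp: good_def)
  moreover have "submon {\<zero>}" by (simp add: submon_def)
  moreover have "Ev PF \<subseteq> {\<zero>}"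
  proof
    fix \<theta> assume "\<theta> \<in> Ev PF"
    then obtain y where y: "\<theta> \<in> cst" "y \<in> EK PF" "y \<noteq> \<zero>" "der U y = \<theta> \<otimes> y" by (auto simp: Ev_def)
    have "y \<in> cst" using y(2)
    proof (induction rule: EK.induct)
      case EK_zero
      show ?case by (rule dsubD(3)[OF cst_dsub])
    next
      case (EK_step k c x)
      show ?case by (rule dsubD(5)[OF cst_dsub dsubD(6)[OF cst_dsub prime_const[OF EK_step(1)] EK_step(2)] EK_step(4)])
    qed
    then show "\<theta> \<in> {\<zero>}" using y cstD integral[of \<theta> y] by auto
  qed
  ultimately show ?thesis by (simp add: tame_def)
qed

lemma PR_const:
  assumes c: "c \<in> cst" and x: "x \<in> PR PF c"
  shows "x \<in> cst"
  using x
proof (induction rule: PR.induct)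
  case (PR_K k) show ?case by (rule prime_const[OF PR_K])
next
  case PR_var show ?case by (rule c)
next
  case (PR_add x y) show ?case by (rule dsubD(5)[OF cst_dsub PR_add(3,4)])
next
  case (PR_mult x y) show ?case by (rule dsubD(6)[OF cst_dsub PR_mult(3,4)])
qed

section \<open>Adjoining a p-th root of a constant\<close>

context
  fixes c assumes c: "c \<in> cst" "c \<notin> Frob"
begin

lemma PFc_dring: "dring (PR PF c)"
proof (rule PR_dring[OF prime_dsub cstD(1)[OF c(1)]])
  show "der U c \<in> PR PF c" unfolding cstD(2)[OF c(1)] by (rule PR_K[OF dsubD(3)[OF prime_dsub]])
qed

abbreviation "Kc \<equiv> Fr (PR PF c)"

lemma Kc_dsub: "dsub Kc" by (rule Fr_dsub[OF PFc_dring])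

lemma Kc_const:
  assumes z: "z \<in> Kc" shows "z \<in> cst"
proof -
  obtain x y where xy: "z = x \<otimes> inv y" "x \<in> PR PF c" "y \<in> PR PF c" "y \<noteq> \<zero>" using z by (rule Fr_cases)
  show ?thesis unfolding xy(1)
    by (rule dsubD(6)[OF cst_dsub PR_const[OF c(1) xy(2)] dsubD(9)[OF cst_dsub PR_const[OF c(1) xy(3)] xy(4)]])
qed

text \<open>The denominator is made a \<open>p\<close>-th power and the numerator is sorted by
  exponents modulo \<open>p\<close>. Elements of the prime field are their own \<open>p\<close>-th
  powers, so each polynomial in \<open>c^p\<close> over it is the \<open>p\<close>-th power of a
  polynomial in \<open>c\<close>.\<close>

lemma Kc_expansion:
  assumes z: "z \<in> Kc"
  shows "\<exists>\<kappa>. (\<forall>j. \<kappa> j \<in> Kc) \<and> z = (\<Oplus>j\<in>{..<p}. \<kappa> j [^] p \<otimes> c [^] j)"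
proof -
  note Kd = dsubD[OF Kc_dsub] and R = dringD[OF PFc_dring]
  have cc: "c \<in> carrier U" using c cstD by blast
  obtain x y where xy: "z = x \<otimes> inv y" "x \<in> PR PF c" "y \<in> PR PF c" "y \<noteq> \<zero>" using z by (rule Fr_cases)
  have yK: "y \<in> Kc" and xK: "x \<in> Kc" using Fr_incl[OF PFc_dring] xy by auto
  have yc: "y \<in> carrier U" "x \<in> carrier U" using R(1) xy by auto
  note i = inv_nonzero[OF yc(1) xy(4)]
  have cK: "c \<in> Kc" by (rule Fr_incl[OF PFc_dring PR_var])
  have pw: "y [^] n \<in> PR PF c" for n :: nat by (induction n) (simp_all add: R(2) PR_mult[OF _ xy(3)])
  have x': "x \<otimes> y [^] (p - 1) \<in> PR PF c" by (rule R(5)[OF xy(2) pw])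
  obtain N f where f: "\<forall>i. f i \<in> PF" "x \<otimes> y [^] (p - 1) = poly N f c" using PR_normal_form[OF prime_dsub cc x'] by blast
  define f' where "f' = (\<lambda>i. if i < N then f i else \<zero>)"
  have f': "f' i \<in> PF" for i using f(1) dsubD(3)[OF prime_dsub] by (simp add: f'_def)
  have f'c: "f' i \<in> carrier U" for i using prime_const[OF f'] cstD by blast
  have fc: "f i \<in> carrier U" for i using f(1) prime_const cstD by blast
  have "N \<le> p * N" using p_gt by simp
  then have "x \<otimes> y [^] (p - 1) = poly (p * N) f' c" unfolding f'_def f(2) using fc cc by (simp add: poly_pad)
  also have "\<dots> = (\<Oplus>j\<in>{..<p}. poly N (\<lambda>i. f' (p * i + j)) (c [^] p) \<otimes> c [^] j)"
    by (rule poly_split[OF f'c cc])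
  also have "\<dots> = (\<Oplus>j\<in>{..<p}. (poly N (\<lambda>i. f' (p * i + j)) c) [^] p \<otimes> c [^] j)"
  proof -
    have "poly N (\<lambda>i. f' (p * i + j) [^] p) (c [^] p) = (poly N (\<lambda>i. f' (p * i + j)) c) [^] p" for j
      by (rule poly_frob[OF f'c cc])
    then show ?thesis by (simp only: prime_frob[OF f'])
  qed
  finally have e: "x \<otimes> y [^] (p - 1) = (\<Oplus>j\<in>{..<p}. (poly N (\<lambda>i. f' (p * i + j)) c) [^] p \<otimes> c [^] j)" .
  have pK: "poly M (\<lambda>i. f' (p * i + j)) c \<in> Kc" for M j
  proof (induction M)
    case 0
    show ?case using Kd(3) by simp
  next
    case (Suc M)
    have "f' (p * M + j) \<in> Kc" by (rule Fr_incl[OF PFc_dring PR_K[OF f']])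
    from Kd(5)[OF Suc Kd(6)[OF this Kd(11)[OF cK, of M]]] show ?case using f'c cc by (simp add: poly_Suc)
  qed
  have pc: "poly N (\<lambda>i. f' (p * i + j)) c \<in> carrier U" for j by (rule Kd(2)[OF pK])
  define \<kappa> where "\<kappa> = (\<lambda>j. poly N (\<lambda>i. f' (p * i + j)) c \<otimes> inv y)"
  have \<kappa>: "\<kappa> j \<in> Kc" for j unfolding \<kappa>_def by (rule Kd(6)[OF pK Kd(9)[OF yK xy(4)]])
  have "z = (x \<otimes> y [^] (p - 1)) \<otimes> (inv y) [^] p"
  proof -
    have "(x \<otimes> y [^] (p - 1)) \<otimes> (inv y) [^] p = x \<otimes> (y [^] (p - 1) \<otimes> (inv y) [^] p)"
      using yc i(1) by (intro m_assoc) auto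
    also have "y [^] (p - 1) \<otimes> (inv y) [^] p = inv y" by (rule inv_pow_p[OF yc(1) xy(4), symmetric])
    finally show ?thesis using xy(1) by simp
  qed
  also have "\<dots> = (inv y) [^] p \<otimes> (\<Oplus>j\<in>{..<p}. (poly N (\<lambda>i. f' (p * i + j)) c) [^] p \<otimes> c [^] j)"
    unfolding e using pc cc i by (intro m_comm finsum_closed) auto
  also have "\<dots> = (\<Oplus>j\<in>{..<p}. (inv y) [^] p \<otimes> ((poly N (\<lambda>i. f' (p * i + j)) c) [^] p \<otimes> c [^] j))"
    by (rule finsum_scale[OF finite_lessThan, symmetric]) (use pc cc i in auto)
  also have "\<dots> = (\<Oplus>j\<in>{..<p}. \<kappa> j [^] p \<otimes> c [^] j)"
    unfolding \<kappa>_def using pc cc i by (intro finsum_cong') (auto simp: frob_mult m_ac)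
  finally show ?thesis using \<kappa> by blast
qed

text \<open>The coefficients are expanded by \<open>Kc_expansion\<close>; additivity of the
  Frobenius map then gathers, for each \<open>j\<close>, the terms at \<open>c^j\<close> into a
  single \<open>p\<close>-th power.\<close>

lemma Kc_span:
  "\<lbrakk>set us \<subseteq> carrier U; z \<in> Span Kc (map (\<lambda>x. x [^] p) us)\<rbrakk> \<Longrightarrow>
    \<exists>y. (\<forall>j. y j \<in> Span Kc us) \<and> z = (\<Oplus>j\<in>{..<p}. y j [^] p \<otimes> c [^] j)"
proof (induction us arbitrary: z)
  case Nil
  have "z = (\<Oplus>j\<in>{..<p}. \<zero> [^] p \<otimes> c [^] j)" using Nil cstD[OF c(1)] by (simp add: frob_zero)
  then show ?case by (intro exI[of _ "\<lambda>_. \<zero>"]) simp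
next
  case (Cons u us)
  note Kd = dsubD[OF Kc_dsub]
  have cc: "c \<in> carrier U" using c cstD by blast
  have us: "set us \<subseteq> carrier U" and u: "u \<in> carrier U" using Cons(2) by auto
  obtain k w where kw: "k \<in> Kc" "w \<in> Span Kc (map (\<lambda>x. x [^] p) us)" "z = k \<otimes> u [^] p \<oplus> w"
    using Cons(3) unfolding list.map span_cons_iff by blast
  obtain y where y: "\<forall>j. y j \<in> Span Kc us" "w = (\<Oplus>j\<in>{..<p}. y j [^] p \<otimes> c [^] j)" using Cons.IH[OF us kw(2)] by blast
  obtain \<kappa> where k: "\<forall>j. \<kappa> j \<in> Kc" "k = (\<Oplus>j\<in>{..<p}. \<kappa> j [^] p \<otimes> c [^] j)" using Kc_expansion[OF kw(1)] by blast
  have cl: "\<kappa> j \<in> carrier U" "y j \<in> carrier U" for j using k(1) y(1) Kd(2) sub_span(1)[OF Kd(1) us] by blast+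
  have "k \<otimes> u [^] p = u [^] p \<otimes> k" using Kd(2)[OF kw(1)] u by (intro m_comm) auto
  also have "\<dots> = (\<Oplus>j\<in>{..<p}. u [^] p \<otimes> (\<kappa> j [^] p \<otimes> c [^] j))"
    unfolding k(2) by (rule finsum_scale[OF finite_lessThan, symmetric]) (use cl cc u in auto)
  finally have "z = (\<Oplus>j\<in>{..<p}. u [^] p \<otimes> (\<kappa> j [^] p \<otimes> c [^] j)) \<oplus> (\<Oplus>j\<in>{..<p}. y j [^] p \<otimes> c [^] j)"
    unfolding kw(3) y(2) by simp
  also have "\<dots> = (\<Oplus>j\<in>{..<p}. u [^] p \<otimes> (\<kappa> j [^] p \<otimes> c [^] j) \<oplus> y j [^] p \<otimes> c [^] j)"
    by (rule finsum_addf[symmetric]) (use cl cc u in auto)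
  also have "\<dots> = (\<Oplus>j\<in>{..<p}. (\<kappa> j \<otimes> u \<oplus> y j) [^] p \<otimes> c [^] j)"
    using cl cc u by (intro finsum_cong') (auto simp: frob_mult frob_add l_distr r_distr m_ac)
  finally have z: "z = (\<Oplus>j\<in>{..<p}. (\<kappa> j \<otimes> u \<oplus> y j) [^] p \<otimes> c [^] j)" .
  have "\<kappa> j \<otimes> u \<oplus> y j \<in> Span Kc (u # us)" for j unfolding span_cons_iff using k(1) y(1) by blast
  then show ?case by (intro exI[of _ "\<lambda>j. \<kappa> j \<otimes> u \<oplus> y j"] conjI allI z)
qed

text \<open>The Frobenius map commutes with the derivation on \<open>Kc\<close> because both
  \<open>Kc\<close> and its image consist of constants.\<close>

lemma Kc_tensor: "tensor p U U Kc (\<lambda>x. x [^] p)"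
proof -
  note Kd = dsubD[OF Kc_dsub]
  have "diff_hom_on Kc U U (\<lambda>x. x [^] p)"
    unfolding diff_hom_on_def using Kd(2) Kc_const cstD(2) der_pow_p by (simp add: frob_add frob_mult frob_zero)
  then show ?thesis by (intro tensor.intro tensor_axioms.intro dfield_axioms Kd(1,10))
qed

text \<open>By \<open>Kc_span\<close>, \<open>u^p\<close> is a combination of the powers of
  \<open>c\<close> whose coefficients are \<open>p\<close>-th powers of elements of the span of
  \<open>us\<close>. Independence of these powers of \<open>c\<close> identifies \<open>u\<close>
  with the element belonging to \<open>j = 0\<close>.\<close>

lemma Kc_sep: "tensor.sep p U Kc"
proof -
  note Kd = dsubD[OF Kc_dsub]
  interpret T: tensor p U U Kc "\<lambda>x. x [^] p" by (rule Kc_tensor)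
  have cc: "c \<in> carrier U" using c cstD by blast
  show ?thesis unfolding T.sep_def
  proof (intro allI impI)
    fix us u assume us: "set us \<subseteq> carrier U" and u: "u \<in> carrier U"
      and sp: "u [^] p \<in> Span Kc (map (\<lambda>x. x [^] p) us)"
    obtain y where y: "\<forall>j. y j \<in> Span Kc us" "u [^] p = (\<Oplus>j\<in>{..<p}. y j [^] p \<otimes> c [^] j)"
      using Kc_span[OF us sp] by blast
    have yc: "y j \<in> carrier U" for j using y(1) sub_span(1)[OF Kd(1) us] by blast
    \<comment> \<open>The relation with \<open>u^p\<close> moved into the term \<open>j = 0\<close>,
      where the coefficient is still a \<open>p\<close>-th power.\<close>
    define g where "g = (\<lambda>j. if j = 0 then (y 0 \<ominus> u) [^] p else y j [^] p)"
    have g: "g j \<in> Frob" for j unfolding g_def Frob_def using yc u by auto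
    have gc: "g j \<in> carrier U" for j unfolding g_def using yc u by auto
    have "(\<Oplus>j\<in>{..<p}. g j \<otimes> c [^] j) = (\<Oplus>j\<in>{..<p}. y j [^] p \<otimes> c [^] j \<oplus> (if 0 = j then \<ominus> (u [^] p) else \<zero>))"
      using yc u cc by (intro finsum_cong') (auto simp: g_def frob_add frob_minus a_minus_def l_distr)
    also have "\<dots> = u [^] p \<oplus> (\<Oplus>j\<in>{..<p}. if 0 = j then \<ominus> (u [^] p) else \<zero>)"
      unfolding y(2) using yc u cc by (intro finsum_addf) (auto simp: Pi_def finsum_closed)
    also have "(\<Oplus>j\<in>{..<p}. if 0 = j then \<ominus> (u [^] p) else \<zero>) = \<ominus> (u [^] p)"
      using add.finprod_singleton[of 0 "{..<p}" "\<lambda>_. \<ominus> (u [^] p)"] u p_gt by simp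
    finally have "(\<Oplus>j\<in>{..<p}. g j \<otimes> c [^] j) = \<zero>" using u by (simp add: r_neg)
    then have "g 0 = \<zero>" using pow_independent[of c g p, OF cc c(2) g] p_gt by blast
    then have "y 0 \<ominus> u = \<zero>" using frob_eq_zero yc u by (simp add: g_def)
    then have "y 0 = u" using yc u by simp
    then show "u \<in> Span Kc us" using y(1) by metis
  qed
qed

end

end

text \<open>If \<open>c\<close> is not yet a \<open>p\<close>-th power, two copies of
  \<open>U\<close> are amalgamated along the field generated by \<open>c\<close>, embedded in the
  second copy by the Frobenius map. The image of \<open>c\<close> in the first copy then becomes the
  \<open>p\<close>-th power of its image in the second.\<close>

theorem exists_root_extension:
  fixes U :: "'u::infinite diff_ring" (structure)
  assumes U: "dfield p U" and c: "c \<in> carrier U" "der U c = \<zero>\<^bsub>U\<^esub>"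
  shows "\<exists>(L::'u diff_ring) i y. differential_field p L \<and> diff_embedding i U L \<and> y \<in> carrier L \<and> y [^]\<^bsub>L\<^esub> p = i c"
proof -
  interpret dfield p U by (rule U)
  show ?thesis
  proof (cases "c \<in> Frob")
    case True
    have "diff_embedding (\<lambda>x. x) U U" by (auto simp: diff_embedding_def ring_hom_def)
    then show ?thesis using True diff_field unfolding Frob_def by blast
  next
    case False
    have cc: "c \<in> cst" using c by (simp add: cst_def)
    obtain L :: "'u diff_ring" and i j where L: "differential_field p L" "diff_embedding i U L" "diff_embedding j U L"
      "\<forall>k\<in>Fr (PR PF c). i k = j (k [^] p)"
      using exists_amalgam[OF Kc_tensor[OF cc False] Kc_sep[OF cc False]] by blast
    have "c \<in> Fr (PR PF c)" by (rule Fr_incl[OF PFc_dring[OF cc False] PR_var])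
    then have ic: "i c = j (c [^] p)" using L(4) by blast
    interpret L: field L using L(1) by (simp add: differential_field_def)
    have jh: "j \<in> ring_hom U L" using L(3) by (simp add: diff_embedding_def)
    have "j (c [^] n) = j c [^]\<^bsub>L\<^esub> n" for n :: nat
      by (induction n) (use ring_hom_mult[OF jh] ring_hom_one[OF jh] c(1) in simp_all)
    then have "j c [^]\<^bsub>L\<^esub> p = i c" using ic by simp
    moreover have "j c \<in> carrier L" by (rule ring_hom_closed[OF jh c(1)])
    ultimately show ?thesis using L by blast
  qed
qed

section \<open>Relations between solutions\<close>

context dfield
begin

lemma frob_pow_add: "\<lbrakk>x \<in> carrier U; y \<in> carrier U\<rbrakk> \<Longrightarrow> (x \<oplus> y) [^] (p ^ k) = x [^] (p ^ k) \<oplus> y [^] (p ^ k)"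
  by (rule freshmans_dream_pow[OF prime_p char_p])

lemma pow_Suc_p: "x \<in> carrier U \<Longrightarrow> x [^] (p ^ Suc k) = (x [^] (p ^ k)) [^] p"
  by (simp add: nat_pow_pow mult.commute)

lemma frob_pow_inj: "\<lbrakk>x \<in> carrier U; y \<in> carrier U; x [^] (p ^ k) = y [^] (p ^ k)\<rbrakk> \<Longrightarrow> x = y"
proof (induction k)
  case (Suc k)
  have "x [^] (p ^ k) = y [^] (p ^ k)"
    by (rule frob_inj) (use Suc(2-) in \<open>simp_all only: pow_Suc_p nat_pow_closed\<close>)
  then show ?case by (rule Suc.IH[OF Suc(2,3)])
qed simp

lemma prime_frob_pow: "x \<in> PF \<Longrightarrow> x [^] (p ^ k) = x"
proof (induction k)
  case 0
  then show ?case using cstD(1)[OF prime_const] by simp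
next
  case (Suc k)
  then show ?case using prime_frob[OF Suc(2)] cstD(1)[OF prime_const[OF Suc(2)]] by (simp only: pow_Suc_p)
qed

lemma pow_const:
  assumes "x \<in> carrier U" "k \<ge> 1" shows "x [^] (p ^ k) \<in> cst"
proof -
  obtain j where k: "k = Suc j" using assms(2) by (cases k) auto
  show ?thesis unfolding k pow_Suc_p[OF assms(1)] by (rule pow_p_const) (use assms in simp)
qed

text \<open>Coefficients from the prime field are their own roots, so roots can be extracted from
  the vectors alone.\<close>

lemma frob_pow_span:
  "\<lbrakk>set us \<subseteq> carrier U; z \<in> Span PF (map (\<lambda>x. x [^] (p ^ k)) us)\<rbrakk> \<Longrightarrow> \<exists>y\<in>Span PF us. z = y [^] (p ^ k)"
proof (induction k arbitrary: z)
  case 0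
  have "map (\<lambda>x. x [^] (p ^ 0)) us = us" using 0(1) by (intro map_idI) auto
  then have "z \<in> Span PF us" using 0(2) by (simp only:)
  moreover from this have "z = z [^] (p ^ 0)" using sub_span(1)[OF dsubD(1)[OF prime_dsub] 0(1)] by simp
  ultimately show ?case by blast
next
  case (Suc k)
  have c: "set (map (\<lambda>x. x [^] (p ^ k)) us) \<subseteq> carrier U" using Suc(2) by auto
  have "map (\<lambda>x. x [^] (p ^ Suc k)) us = map (\<lambda>x. x [^] p) (map (\<lambda>x. x [^] (p ^ k)) us)"
    unfolding map_map using Suc(2) by (intro map_cong refl) (simp only: pow_Suc_p comp_def subsetD)
  then have z: "z \<in> Span PF (map (\<lambda>x. x [^] p) (map (\<lambda>x. x [^] (p ^ k)) us))" using Suc(3) by (simp only:)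
  have rt: "\<exists>x\<in>PF. x [^] p = k" if "k \<in> PF" for k using that prime_frob by blast
  obtain y where y: "y \<in> Span PF (map (\<lambda>x. x [^] (p ^ k)) us)" "z = y [^] p" using frob_span[OF prime_dsub rt c z] by blast
  obtain w where w: "w \<in> Span PF us" "y = w [^] (p ^ k)" using Suc.IH[OF Suc(2) y(1)] by blast
  have "z = w [^] (p ^ Suc k)" unfolding y(2) w(2) using sub_span(1)[OF dsubD(1)[OF prime_dsub] Suc(2) w(1)] by (simp only: pow_Suc_p)
  then show ?case using w(1) by blast
qed

abbreviation sol where "sol k \<equiv> nonzero_solutions p k U"

lemma solD:
  assumes "v \<in> sol k"
  shows "v \<in> carrier U" "v \<noteq> \<zero>" "der U v = v [^] (p ^ k + 1)" "der U v = v [^] (p ^ k) \<otimes> v"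
  using assms by (auto simp: nonzero_solutions_def)

lemma PR_pow: "\<one> \<in> K \<Longrightarrow> v [^] (n::nat) \<in> PR K v"
  by (induction n) (simp_all add: PR_K PR_mult[OF _ PR_var])

lemma sol_ext:
  assumes T: "tame K S" and k: "k \<ge> 1" and v: "v \<in> sol k" "v [^] (p ^ k) \<notin> S"
  shows "transc K v" "tame (Fr (PR K v)) {s \<oplus> [n] \<cdot> (v [^] (p ^ k)) | s (n::nat). s \<in> S}"
proof -
  have "\<one> \<in> K" using T dsubD(4) by (auto simp: tame_def good_def)
  note P = PR_pow[OF this]
  note s = solD[OF v(1)]
  show "transc K v" by (rule transc_v[OF T s(1,2) pow_const[OF s(1) k] v(2) s(4) P])
  show "tame (Fr (PR K v)) {s \<oplus> [n] \<cdot> (v [^] (p ^ k)) | s (n::nat). s \<in> S}"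
    by (rule tame_ext[OF T s(1,2) pow_const[OF s(1) k] v(2) s(4) P])
qed

lemma PF_sub: "dsub K \<Longrightarrow> x \<in> PF \<Longrightarrow> x \<in> K"
  using dsubD(12)[OF _ dsubD(4)] by (auto simp: prime_field_elems)

lemma span_sub:
  assumes K: "dsub K"
  shows "\<lbrakk>set us \<subseteq> K; x \<in> Span PF us\<rbrakk> \<Longrightarrow> x \<in> K"
proof (induction us arbitrary: x)
  case Nil
  then show ?case using dsubD(3)[OF K] by simp
next
  case (Cons u us)
  have us: "u \<in> K" "set us \<subseteq> K" using Cons(2) by auto
  obtain k w where kw: "k \<in> PF" "w \<in> Span PF us" "x = k \<otimes> u \<oplus> w" using Cons(3) unfolding span_cons_iff by blast
  show ?case unfolding kw(3) by (rule dsubD(5)[OF K dsubD(6)[OF K PF_sub[OF K kw(1)] us(1)] Cons.IH[OF us(2) kw(2)]])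
qed

lemma poly_monom:
  assumes "u \<in> carrier U" "v \<in> carrier U" "a < N"
  shows "poly N (\<lambda>i. if i = a then u else \<zero>) v = u \<otimes> v [^] a"
proof -
  have "poly N (\<lambda>i. if i = a then u else \<zero>) v = (\<Oplus>i\<in>{..<N}. if a = i then u \<otimes> v [^] a else \<zero>)"
    unfolding poly_def using assms by (intro finsum_cong') auto
  also have "\<dots> = u \<otimes> v [^] a"
    using add.finprod_singleton[of a "{..<N}" "\<lambda>_. u \<otimes> v [^] a"] assms by simp
  finally show ?thesis .
qed

text \<open>Both sides of the equation are polynomials in the transcendental \<open>x\<close> over
  \<open>K\<close>. With \<open>q = p^k\<close>, the coefficient at \<open>x^q\<close> gives
  \<open>e s = 0\<close>, and that at \<open>x^(q+1)\<close> gives \<open>e^2 = e\<close>.\<close>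

lemma lin_step:
  assumes K: "dsub K" and k: "k \<ge> 1" and x: "x \<in> sol k" "transc K x" and s: "s \<in> K" and e: "e \<in> PF"
    and eq: "der U (e \<otimes> x \<oplus> s) = (e \<otimes> x \<oplus> s) [^] (p ^ k + 1)"
  shows "(e = \<zero> \<and> der U s = s [^] (p ^ k + 1)) \<or> (s = \<zero> \<and> e = \<one>)"
proof -
  define q where "q = p ^ k"
  have q: "q > 1" using one_less_power[of p k] p_gt k by (simp add: q_def)
  note Kd = dsubD[OF K] and X = solD[OF x(1), folded q_def]
  have eK: "e \<in> K" by (rule PF_sub[OF K e])
  have ec: "e \<in> carrier U" "der U e = \<zero>" using cstD prime_const e by auto
  have sc: "s \<in> carrier U" by (rule Kd(2)[OF s])
  have dsc: "der U s \<in> carrier U" using sc by simp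
  have xc: "x \<in> carrier U" by (rule X(1))
  have pw: "y [^] (q + 1) = y [^] q \<otimes> y" if "y \<in> carrier U" for y using that by simp
  have "(e \<otimes> x \<oplus> s) [^] q = e \<otimes> x [^] q \<oplus> s [^] q"
    using frob_pow_add[of "e \<otimes> x" s k] prime_frob_pow[OF e, of k] ec sc xc
    by (simp add: q_def nat_pow_distrib)
  then have r: "(e \<otimes> x \<oplus> s) [^] (q + 1) = (e \<otimes> x [^] q \<oplus> s [^] q) \<otimes> (e \<otimes> x \<oplus> s)"
    using ec sc xc by simp
  have l: "der U (e \<otimes> x \<oplus> s) = e \<otimes> (x [^] q \<otimes> x) \<oplus> der U s"
    using ec sc xc X(4) by (simp add: d_add d_mult)
  \<comment> \<open>The coefficients of the difference of both sides at \<open>x^0\<close>,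
    \<open>x^1\<close>, \<open>x^q\<close> and \<open>x^(q+1)\<close>. As \<open>q > 1\<close>,
    these exponents are distinct and the coefficients do not mix.\<close>
  define f0 f1 f2 f3 where "f0 = s [^] q \<otimes> s \<ominus> der U s" and "f1 = s [^] q \<otimes> e" and "f2 = e \<otimes> s" and "f3 = e \<otimes> e \<ominus> e"
  have fK: "f0 \<in> K" "f1 \<in> K" "f2 \<in> K" "f3 \<in> K" unfolding f0_def f1_def f2_def f3_def
    by (rule Kd(8)[OF Kd(6)[OF Kd(11)[OF s] s] Kd(10)[OF s]], rule Kd(6)[OF Kd(11)[OF s] eK], rule Kd(6)[OF eK s], rule Kd(8)[OF Kd(6)[OF eK eK] eK])
  note fc = fK[THEN Kd(2)]
  define F where "F = (\<lambda>a u (i::nat). if i = a then u else \<zero>)"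
  have Fc: "F a u i \<in> carrier U" if "u \<in> carrier U" for a u i using that by (simp add: F_def)
  have FK: "F a u i \<in> K" if "u \<in> K" for a u i using that Kd(3) by (simp add: F_def)
  define f where "f = (\<lambda>i. F 0 f0 i \<oplus> (F 1 f1 i \<oplus> (F q f2 i \<oplus> F (q + 1) f3 i)))"
  have f: "f i \<in> K" for i unfolding f_def
    by (rule Kd(5)[OF FK[OF fK(1)] Kd(5)[OF FK[OF fK(2)] Kd(5)[OF FK[OF fK(3)] FK[OF fK(4)]]]])
  have pm: "poly (q + 2) (F a u) x = u \<otimes> x [^] a" if "u \<in> carrier U" "a < q + 2" for a u
    unfolding F_def by (rule poly_monom[OF that(1) xc that(2)])
  have "poly (q + 2) f x = f0 \<otimes> x [^] (0::nat) \<oplus> (f1 \<otimes> x [^] (1::nat) \<oplus> (f2 \<otimes> x [^] q \<oplus> f3 \<otimes> x [^] (q + 1)))"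
    unfolding f_def using Fc fc xc by (simp only: poly_add add.m_closed pm)
  also have "\<dots> = f0 \<oplus> (f1 \<otimes> x \<oplus> (f2 \<otimes> x [^] q \<oplus> f3 \<otimes> (x [^] q \<otimes> x)))" using fc xc by simp
  also have "\<dots> = (e \<otimes> x [^] q \<oplus> s [^] q) \<otimes> (e \<otimes> x \<oplus> s) \<ominus> (e \<otimes> (x [^] q \<otimes> x) \<oplus> der U s)"
  proof -
    have "(S \<otimes> s \<ominus> D) \<oplus> ((S \<otimes> e) \<otimes> x \<oplus> ((e \<otimes> s) \<otimes> X \<oplus> (e \<otimes> e \<ominus> e) \<otimes> (X \<otimes> x))) =
      (e \<otimes> X \<oplus> S) \<otimes> (e \<otimes> x \<oplus> s) \<ominus> (e \<otimes> (X \<otimes> x) \<oplus> D)"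
      if "S \<in> carrier U" "D \<in> carrier U" "X \<in> carrier U" for S D X
      by (use in_carrier_Cons in_carrier_Nil norm_eq[OF _ ring_norm_23, of "[S, s, D, e, x, X]"] that ec(1) sc xc in simp)
    then show ?thesis unfolding f0_def f1_def f2_def f3_def using sc xc by simp
  qed
  also have "\<dots> = \<zero>" using eq[folded q_def] r l ec sc xc by simp
  finally have fz: "f i = \<zero>" if "i < q + 2" for i using x(2) f that unfolding transc_def by blast
  have z: "f0 = \<zero>" "f2 = \<zero>" "f3 = \<zero>"
    using fz[of 0] fz[of q] fz[of "q + 1"] q fc by (simp_all add: f_def F_def)
  show ?thesis
  proof (cases "e = \<zero>")
    case True
    have "s [^] q \<otimes> s = der U s"
      by (rule eq_of_minus[OF z(1)[unfolded f0_def]]) (intro m_closed nat_pow_closed sc d_closed)+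
    then have "der U s = s [^] (q + 1)" unfolding pw[OF sc] by (rule sym)
    then show ?thesis using True unfolding q_def by blast
  next
    case False
    have "s = \<zero>" using z(2) False integral[of e s] ec sc by (auto simp: f2_def)
    moreover have "e \<otimes> e = e \<otimes> \<one>" unfolding r_one[OF ec(1)]
      by (rule eq_of_minus[OF z(3)[unfolded f3_def]]) (intro m_closed ec(1))+
    then have "e = \<one>" unfolding m_lcancel[OF False ec(1) ec(1) one_closed] .
    ultimately show ?thesis by simp
  qed
qed

section \<open>Towers of solutions over the prime field\<close>

fun tower :: "'u list \<Rightarrow> 'u set" where
  "tower [] = PF"
| "tower (x # xs) = Fr (PR (tower xs) x)"

text \<open>The clause on the span keeps the induction going. If \<open>x^(p^k)\<close> lay in the
  span of the earlier powers, \<open>frob_pow_span\<close> and uniqueness of roots would put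
  \<open>x\<close> in the span of the earlier solutions, and by that clause \<open>x\<close> would
  be one of them. The clause itself is propagated by \<open>lin_step\<close>. The last clause serves
  \<open>tower_hom\<close>.\<close>

lemma tower_tame:
  assumes k: "k \<ge> 1"
  shows "\<lbrakk>set xs \<subseteq> sol k; distinct xs\<rbrakk> \<Longrightarrow> tame (tower xs) (Span PF (map (\<lambda>x. x [^] (p ^ k)) xs)) \<and> set xs \<subseteq> tower xs \<and>
    (\<forall>s\<in>Span PF xs. der U s = s [^] (p ^ k + 1) \<longrightarrow> s = \<zero> \<or> s \<in> set xs)
    \<and> (\<forall>y ys. xs = y # ys \<longrightarrow> transc (tower ys) y)"
proof (induction xs)
  case Nil
  then show ?case using prime_tame by simp
next
  case (Cons x xs)
  have xs: "set xs \<subseteq> sol k" "distinct xs" and x: "x \<in> sol k" "x \<notin> set xs" using Cons(2,3) by auto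
  have xc: "x \<in> carrier U" "x \<noteq> \<zero>" and xsc: "set xs \<subseteq> carrier U" using solD x(1) xs(1) by auto
  have T: "tame (tower xs) (Span PF (map (\<lambda>x. x [^] (p ^ k)) xs))" and sub: "set xs \<subseteq> tower xs"
    and L: "\<And>s. \<lbrakk>s \<in> Span PF xs; der U s = s [^] (p ^ k + 1)\<rbrakk> \<Longrightarrow> s = \<zero> \<or> s \<in> set xs"
    using Cons.IH[OF xs] by blast+
  have K: "dsub (tower xs)" using T by (simp add: tame_def good_def)
  have nS: "x [^] (p ^ k) \<notin> Span PF (map (\<lambda>x. x [^] (p ^ k)) xs)"
  proof
    assume "x [^] (p ^ k) \<in> Span PF (map (\<lambda>x. x [^] (p ^ k)) xs)"
    then obtain y where y: "y \<in> Span PF xs" "x [^] (p ^ k) = y [^] (p ^ k)" using frob_pow_span[OF xsc] by blast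
    have "x = y" by (rule frob_pow_inj[OF xc(1) sub_span(1)[OF dsubD(1)[OF prime_dsub] xsc y(1)] y(2)])
    then show False using L[of x] y(1) solD(3)[OF x(1)] xc x(2) by blast
  qed
  note ext = sol_ext[OF T k x(1) nS]
  \<comment> \<open>Natural multiples are the multiples by elements of the prime field, so the
    monoid of the enlarged tower is again a span.\<close>
  have "{s \<oplus> [n] \<cdot> (x [^] (p ^ k)) | s (n::nat). s \<in> Span PF (map (\<lambda>x. x [^] (p ^ k)) xs)} =
    Span PF (map (\<lambda>x. x [^] (p ^ k)) (x # xs))" (is "?L = ?R")
  proof -
    have e: "([n] \<cdot> \<one>) \<otimes> x [^] (p ^ k) \<oplus> s = s \<oplus> [n] \<cdot> (x [^] (p ^ k))"
      if s: "s \<in> Span PF (map (\<lambda>x. x [^] (p ^ k)) xs)" for s and n :: nat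
    proof -
      have "set (map (\<lambda>x. x [^] (p ^ k)) xs) \<subseteq> carrier U" using xsc by auto
      then have "s \<in> carrier U" using sub_span(1)[OF dsubD(1)[OF prime_dsub] _ s] by blast
      then show ?thesis using xc by (simp add: add_pow_ldistr a_comm)
    qed
    show ?thesis
    proof (intro subset_antisym subsetI)
      fix y assume "y \<in> ?L"
      then obtain s n where "y = s \<oplus> [(n::nat)] \<cdot> (x [^] (p ^ k))" "s \<in> Span PF (map (\<lambda>x. x [^] (p ^ k)) xs)" by blast
      moreover have "[n] \<cdot> \<one> \<in> PF" unfolding prime_field_elems by (rule rangeI)
      ultimately show "y \<in> ?R" unfolding list.map span_cons_iff using e[of s n, symmetric] by blast
    next
      fix y assume "y \<in> ?R"
      then obtain f s where 1: "f \<in> PF" "y = f \<otimes> x [^] (p ^ k) \<oplus> s" "s \<in> Span PF (map (\<lambda>x. x [^] (p ^ k)) xs)"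
        unfolding list.map span_cons_iff by blast
      obtain n :: nat where n: "f = [n] \<cdot> \<one>" using 1(1) unfolding prime_field_elems by blast
      have "y = s \<oplus> [n] \<cdot> (x [^] (p ^ k))" unfolding 1(2) n by (rule e[OF 1(3)])
      then show "y \<in> ?L" using 1(3) by blast
    qed
  qed
  then have "tame (tower (x # xs)) (Span PF (map (\<lambda>x. x [^] (p ^ k)) (x # xs)))" using ext(2) by (simp only: tower.simps)
  moreover have "set (x # xs) \<subseteq> tower (x # xs)"
  proof -
    have R: "dring (PR (tower xs) x)"
      by (rule PR_dring[OF K xc(1)]) (simp only: solD(3)[OF x(1)] PR_pow dsubD(4)[OF K])
    have "y \<in> tower (x # xs)" if "y \<in> set (x # xs)" for y
      unfolding tower.simps by (rule Fr_incl[OF R]) (use that sub in \<open>auto intro: PR_var PR_K\<close>)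
    then show ?thesis by blast
  qed
  moreover have "\<forall>s\<in>Span PF (x # xs). der U s = s [^] (p ^ k + 1) \<longrightarrow> s = \<zero> \<or> s \<in> set (x # xs)"
  proof (intro ballI impI)
    fix s assume s: "s \<in> Span PF (x # xs)" "der U s = s [^] (p ^ k + 1)"
    obtain e w where ew: "e \<in> PF" "w \<in> Span PF xs" "s = e \<otimes> x \<oplus> w" using s(1) unfolding span_cons_iff by blast
    have wK: "w \<in> tower xs" by (rule span_sub[OF K sub ew(2)])
    have wc: "w \<in> carrier U" by (rule dsubD(2)[OF K wK])
    from lin_step[OF K k x(1) ext(1) wK ew(1) s(2)[unfolded ew(3)]]
    consider "e = \<zero>" "der U w = w [^] (p ^ k + 1)" | "w = \<zero>" "e = \<one>" by blast
    then show "s = \<zero> \<or> s \<in> set (x # xs)"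
    proof cases
      case 1
      then have "s = w" using ew(3) wc xc by simp
      then show ?thesis using L[OF ew(2) 1(2)] by auto
    next
      case 2
      then show ?thesis using ew(3) xc by simp
    qed
  qed
  ultimately show ?case using ext(1) by blast
qed

text \<open>The map is extended one solution at a time. Its image is tracked because
  \<open>extend_hom\<close> asks that the new \<open>y\<close> be transcendental over the image,
  which \<open>tower_tame\<close> provides for the tower of \<open>ys\<close>.\<close>

lemma tower_hom:
  assumes k: "k \<ge> 1"
  shows "\<lbrakk>length xs = length ys; set xs \<subseteq> sol k; set ys \<subseteq> sol k; distinct xs; distinct ys\<rbrakk> \<Longrightarrow>
    \<exists>\<sigma>. diff_hom_on (tower xs) U U \<sigma> \<and> map \<sigma> xs = ys \<and> \<sigma> ` tower xs = tower ys \<and> (\<forall>x\<in>PF. \<sigma> x = x)"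
proof (induction xs ys rule: list_induct2)
  case Nil
  show ?case by (intro exI[of _ "\<lambda>x. x"]) (simp add: diff_hom_id[OF prime_dsub])
next
  case (Cons x xs y ys)
  have x: "x \<in> sol k" "set xs \<subseteq> sol k" "distinct xs" and y: "y \<in> sol k" "set ys \<subseteq> sol k" "distinct ys"
    using Cons(3-6) by auto
  obtain \<sigma> where \<sigma>: "diff_hom_on (tower xs) U U \<sigma>" "map \<sigma> xs = ys" "\<sigma> ` tower xs = tower ys" "\<forall>x\<in>PF. \<sigma> x = x"
    using Cons.IH[OF x(2) y(2) x(3) y(3)] by blast
  have tx: "transc (tower xs) x" using tower_tame[OF k Cons(3,5)] by blast
  have ty: "transc (\<sigma> ` tower xs) y" unfolding \<sigma>(3) using tower_tame[OF k Cons(4,6)] by blast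
  note T = tower_tame[OF k x(2,3)]
  have K: "dsub (tower xs)" using conjunct1[OF T] by (simp only: tame_def good_def)
  have sub: "set xs \<subseteq> tower xs" by (rule conjunct1[OF conjunct2[OF T]])
  obtain \<tau> where \<tau>: "diff_hom_on (Fr (PR (tower xs) x)) U U \<tau>" "\<forall>k\<in>tower xs. \<tau> k = \<sigma> k" "\<tau> x = y"
    "\<tau> ` Fr (PR (tower xs) x) = Fr (PR (\<sigma> ` tower xs) y)"
    using extend_hom[OF K \<sigma>(1) solD(1,3)[OF x(1)] solD(1,3)[OF y(1)] tx ty] by (elim exE conjE) (rule that; assumption)
  have "map \<tau> xs = ys" unfolding \<sigma>(2)[symmetric] using sub \<tau>(2) by (intro map_cong refl) blast
  moreover have "\<tau> x = x" if x: "x \<in> PF" for x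
    using bspec[OF \<tau>(2) PF_sub[OF K x]] bspec[OF \<sigma>(4) x] by simp
  ultimately show ?case using \<tau> \<sigma>(3) by (intro exI[of _ \<tau>]) simp
qed

section \<open>Constant eigenvalues on finite-dimensional spaces\<close>

lemma span_finsum:
  "\<lbrakk>distinct is; \<And>i. y i \<in> carrier U; z \<in> Span cst (map y is)\<rbrakk> \<Longrightarrow>
    \<exists>f. (\<forall>i. f i \<in> cst) \<and> z = (\<Oplus>i\<in>set is. f i \<otimes> y i)"
proof (induction "is" arbitrary: z)
  case Nil
  then show ?case using dsubD(3)[OF cst_dsub] by (intro exI[of _ "\<lambda>_. \<zero>"]) simp
next
  case (Cons j js)
  obtain k w where kw: "k \<in> cst" "w \<in> Span cst (map y js)" "z = k \<otimes> y j \<oplus> w"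
    using Cons(4) unfolding list.map span_cons_iff by blast
  have js: "distinct js" "j \<notin> set js" using Cons(2) by auto
  obtain f where f: "\<forall>i. f i \<in> cst" "w = (\<Oplus>i\<in>set js. f i \<otimes> y i)" using Cons.IH[OF js(1) Cons(3) kw(2)] by blast
  have fc: "f i \<in> carrier U" for i using f(1) cstD(1) by blast
  have kc: "k \<in> carrier U" using kw(1) cstD(1) by blast
  have "(\<Oplus>i\<in>set js. (f(j := k)) i \<otimes> y i) = w" unfolding f(2) using js(2) fc Cons(3) by (intro finsum_cong') auto
  moreover have "(\<Oplus>i\<in>set (j # js). (f(j := k)) i \<otimes> y i) = k \<otimes> y j \<oplus> (\<Oplus>i\<in>set js. (f(j := k)) i \<otimes> y i)"
    using js(2) fc kc Cons(3) by (simp add: finsum_insert)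
  ultimately have "z = (\<Oplus>i\<in>set (j # js). (f(j := k)) i \<otimes> y i)" using kw(3) by simp
  then show ?case using f(1) kw(1) by (intro exI[of _ "f(j := k)"]) simp
qed

text \<open>Over the constants the normalised coefficients of \<open>eigen_relation\<close> have
  derivative 0, so \<open>j \<ominus> i\<close> annihilates the coefficient at \<open>i\<close>.
  Only the term at \<open>j\<close> survives, and \<open>y j\<close> is not 0.\<close>

lemma eigenvectors_independent:
  assumes y: "\<And>\<theta>. y \<theta> \<in> carrier U" "\<And>\<theta>. \<theta> \<in> X \<Longrightarrow> y \<theta> \<noteq> \<zero> \<and> der U (y \<theta>) = \<theta> \<otimes> y \<theta>" and X: "X \<subseteq> cst"
  shows "\<lbrakk>set ts \<subseteq> X; distinct ts\<rbrakk> \<Longrightarrow> independent cst (map y ts)"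
proof (induction ts)
  case (Cons t ts)
  have ts: "set ts \<subseteq> X" "distinct ts" "t \<notin> set ts" "t \<in> X" using Cons(2,3) by auto
  have "y t \<notin> Span cst (map y ts)"
  proof
    assume "y t \<in> Span cst (map y ts)"
    then obtain f where f: "\<forall>i. f i \<in> cst" "y t = (\<Oplus>i\<in>set ts. f i \<otimes> y i)" using span_finsum[of ts y "y t", OF ts(2) y(1)] by blast
    \<comment> \<open>The dependence is read as a relation with coefficient -1 at
      \<open>t\<close>.\<close>
    define g where "g = f(t := \<ominus> \<one>)"
    have gC: "g i \<in> cst" for i using f(1) dsubD(7)[OF cst_dsub dsubD(4)[OF cst_dsub]] by (simp add: g_def)
    have gc: "g i \<in> carrier U" for i by (rule cstD(1)[OF gC])
    have "(\<Oplus>i\<in>set ts. g i \<otimes> y i) = y t" unfolding f(2) using ts(3) gc y(1) f(1) cstD(1)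
      by (intro finsum_cong') (auto simp: g_def)
    moreover have "(\<Oplus>i\<in>insert t (set ts). g i \<otimes> y i) = g t \<otimes> y t \<oplus> (\<Oplus>i\<in>set ts. g i \<otimes> y i)"
      using ts(3) gc y(1) by (intro finsum_insert) auto
    ultimately have z: "(\<Oplus>i\<in>insert t (set ts). g i \<otimes> y i) = \<zero>" using y(1) by (simp add: g_def l_minus l_neg)
    have gt: "t \<in> insert t (set ts)" "g t \<noteq> \<zero>" by (auto simp: g_def)
    have sub: "i \<in> X" if "i \<in> insert t (set ts)" for i using that ts(1,4) by blast
    obtain h j where h: "j \<in> insert t (set ts)" "\<forall>i\<in>insert t (set ts). h i \<in> cst"
      "(\<Oplus>i\<in>insert t (set ts). h i \<otimes> y i) = \<zero>" "h j = \<one>" "\<forall>i\<in>insert t (set ts). der U (h i) = (j \<ominus> i) \<otimes> h i"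
      using eigen_relation[OF cst_dsub finite.insertI[OF finite_set] y(1) conjunct2[OF y(2)[OF sub]] subsetD[OF X sub] gC z gt] by blast
    have "h i = \<zero>" if i: "i \<in> insert t (set ts)" "i \<noteq> j" for i
    proof -
      have c: "h i \<in> carrier U" "der U (h i) = \<zero>" "i \<in> carrier U" "j \<in> carrier U"
        using h(1,2) i(1) sub X cstD by blast+
      then have "(j \<ominus> i) \<otimes> h i = \<zero>" using h(5) i(1) by metis
      moreover have "j \<ominus> i \<noteq> \<zero>" using i(2) c by auto
      ultimately show ?thesis using integral[of "j \<ominus> i" "h i"] c by auto
    qed
    then have "(\<Oplus>i\<in>insert t (set ts). h i \<otimes> y i) = (\<Oplus>i\<in>insert t (set ts). if j = i then y j else \<zero>)"
      using y(1) h(4) by (intro finsum_cong') auto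
    also have "\<dots> = y j" using add.finprod_singleton[OF h(1), of "\<lambda>_. y j"] y(1) by simp
    finally show False using h(3) y(2)[OF sub[OF h(1)]] by simp
  qed
  then show ?case unfolding list.map by (intro li_Cons y(1) Cons.IH ts(1,2))
qed simp

text \<open>Eigenvectors for distinct eigenvalues are independent, so their number is bounded by the
  dimension over the constants.\<close>

lemma finite_eigenvalues:
  assumes as: "set as \<subseteq> carrier U"
  shows "finite {\<theta> \<in> cst. \<exists>y\<in>Span cst as. y \<noteq> \<zero> \<and> der U y = \<theta> \<otimes> y}" (is "finite ?X")
proof (rule ccontr)
  assume inf: "infinite ?X"
  note C = dsubD(1)[OF cst_dsub]
  obtain Vs where Vs: "independent cst Vs" "Span cst Vs = Span cst as" by (rule filter_base[OF C as])
  have dim: "dimension (length Vs) cst (Span cst as)" by (rule dimensionI[OF C Vs])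
  \<comment> \<open>The default value 0 keeps \<open>y\<close> in the carrier at every argument, as
    \<open>eigenvectors_independent\<close> demands.\<close>
  define y where "y = (\<lambda>\<theta>. if \<theta> \<in> ?X then SOME y. y \<in> Span cst as \<and> y \<noteq> \<zero> \<and> der U y = \<theta> \<otimes> y else \<zero>)"
  have yX: "y \<theta> \<in> Span cst as \<and> y \<theta> \<noteq> \<zero> \<and> der U (y \<theta>) = \<theta> \<otimes> y \<theta>" if "\<theta> \<in> ?X" for \<theta>
    unfolding y_def if_P[OF that] by (rule someI_ex) (use that in blast)
  have yc: "y \<theta> \<in> carrier U" for \<theta>
    using yX[of \<theta>] sub_span(1)[OF C as] by (cases "\<theta> \<in> ?X") (auto simp: y_def)
  obtain F where F: "F \<subseteq> ?X" "finite F" "card F = Suc (length Vs)" using infinite_arbitrarily_large[OF inf] by blast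
  obtain ts where ts: "set ts = F" "distinct ts" using finite_distinct_list[OF F(2)] by blast
  have "independent cst (map y ts)"
    by (rule eigenvectors_independent[where X = ?X]) (use yc yX ts F(1) in auto)
  moreover have "set (map y ts) \<subseteq> Span cst as" unfolding set_map ts(1) using yX F(1) by blast
  ultimately have "length (map y ts) \<le> length Vs" by (rule independent_length_le_dimension[OF C dim])
  then show False using F(3) distinct_card[OF ts(2)] ts(1) by simp
qed

end

section \<open>Definable sets and algebraic closure\<close>

primrec tm_vars :: "tm \<Rightarrow> nat" where
  "tm_vars (tm.Var i) = Suc i"
| "tm_vars tm.Zero = 0"
| "tm_vars tm.One = 0"
| "tm_vars (tm.Add s t) = max (tm_vars s) (tm_vars t)"
| "tm_vars (tm.Neg t) = tm_vars t"
| "tm_vars (tm.Mult s t) = max (tm_vars s) (tm_vars t)"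
| "tm_vars (tm.Der t) = tm_vars t"

primrec fm_vars :: "fm \<Rightarrow> nat" where
  "fm_vars (FEq s t) = max (tm_vars s) (tm_vars t)"
| "fm_vars (FNot \<phi>) = fm_vars \<phi>"
| "fm_vars (FAnd \<phi> \<psi>) = max (fm_vars \<phi>) (fm_vars \<psi>)"
| "fm_vars (FEx i \<phi>) = fm_vars \<phi>"

primrec tm_ren :: "(nat \<Rightarrow> nat) \<Rightarrow> tm \<Rightarrow> tm" where
  "tm_ren r (tm.Var i) = tm.Var (r i)"
| "tm_ren r tm.Zero = Zero"
| "tm_ren r tm.One = One"
| "tm_ren r (tm.Add s t) = tm.Add (tm_ren r s) (tm_ren r t)"
| "tm_ren r (tm.Neg t) = tm.Neg (tm_ren r t)"
| "tm_ren r (tm.Mult s t) = tm.Mult (tm_ren r s) (tm_ren r t)"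
| "tm_ren r (tm.Der t) = tm.Der (tm_ren r t)"

lemma eval_cong: "\<lbrakk>\<And>i. i < tm_vars t \<Longrightarrow> e i = e' i\<rbrakk> \<Longrightarrow> Defs.eval R e t = Defs.eval R e' t"
  by (induction t) auto

lemma sat_cong: "\<lbrakk>\<And>i. i < fm_vars \<phi> \<Longrightarrow> e i = e' i\<rbrakk> \<Longrightarrow> sat R e \<phi> = sat R e' \<phi>"
proof (induction \<phi> arbitrary: e e')
  case (FEq s t)
  have "Defs.eval R e s = Defs.eval R e' s" "Defs.eval R e t = Defs.eval R e' t"
    by (rule eval_cong; use FEq in simp)+
  then show ?case by simp
next
  case (FNot \<phi>)
  from FNot.IH[of e e', OF FNot.prems] show ?case by simp
next
  case (FAnd \<phi> \<psi>)
  have "sat R e \<phi> = sat R e' \<phi>" "sat R e \<psi> = sat R e' \<psi>"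
    by (rule FAnd.IH; use FAnd.prems in simp)+
  then show ?case by simp
next
  case (FEx i \<phi>)
  have "sat R (e(i := x)) \<phi> = sat R (e'(i := x)) \<phi>" for x by (rule FEx.IH) (use FEx.prems in auto)
  then show ?case by simp
qed

lemma eval_ren: "Defs.eval R e (tm_ren r t) = Defs.eval R (\<lambda>i. e (r i)) t"
  by (induction t) auto

text \<open>The map \<open>r\<close> is arbitrary, so a bound variable is first moved to an index
  above all images of variables of the body, lest it capture one of them. One formula serves every
  structure on the type.\<close>

lemma sat_rename: "\<exists>\<psi>. \<forall>(R :: 'u diff_ring) e. sat R e \<psi> \<longleftrightarrow> sat R (\<lambda>i. e (r i)) \<phi>"
proof (induction \<phi> arbitrary: r)
  case (FEq s t)
  show ?case by (intro exI[of _ "FEq (tm_ren r s) (tm_ren r t)"]) (simp add: eval_ren)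
next
  case (FNot \<phi>)
  then obtain \<psi> where "\<forall>(R :: 'u diff_ring) e. sat R e \<psi> \<longleftrightarrow> sat R (\<lambda>i. e (r i)) \<phi>" by blast
  then show ?case by (intro exI[of _ "FNot \<psi>"]) simp
next
  case (FAnd \<phi>1 \<phi>2)
  obtain \<psi>1 where "\<forall>(R :: 'u diff_ring) e. sat R e \<psi>1 \<longleftrightarrow> sat R (\<lambda>i. e (r i)) \<phi>1" using FAnd.IH(1) by blast
  moreover obtain \<psi>2 where "\<forall>(R :: 'u diff_ring) e. sat R e \<psi>2 \<longleftrightarrow> sat R (\<lambda>i. e (r i)) \<phi>2" using FAnd.IH(2) by blast
  ultimately show ?case by (intro exI[of _ "FAnd \<psi>1 \<psi>2"]) simp
next
  case (FEx i \<phi>)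
  have "finite (r ` {..<fm_vars \<phi>})" by simp
  then obtain k where k: "\<And>j. j < fm_vars \<phi> \<Longrightarrow> r j < k" unfolding finite_nat_set_iff_bounded by auto
  obtain \<psi> where \<psi>: "\<forall>(R :: 'u diff_ring) e. sat R e \<psi> \<longleftrightarrow> sat R (\<lambda>j. e ((r(i := k)) j)) \<phi>" using FEx.IH by blast
  have "sat R (\<lambda>j. (e(k := x)) ((r(i := k)) j)) \<phi> = sat R ((\<lambda>j. e (r j))(i := x)) \<phi>" for R :: "'u diff_ring" and e x
    by (rule sat_cong) (auto dest: k)
  then show ?case by (intro exI[of _ "FEx k \<psi>"]) (simp add: \<psi>)
qed

definition lenv :: "'u diff_ring \<Rightarrow> 'u list \<Rightarrow> nat \<Rightarrow> 'u" where
  "lenv R xs i = (if i < length xs then xs ! i else \<zero>\<^bsub>R\<^esub>)"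

lemma holds_lenv: "holds R \<phi> xs = sat R (lenv R xs) \<phi>"
  unfolding holds_def lenv_def by (rule refl)

text \<open>A predicate of assignments is definable with parameters in C if it is given by a formula each
  of whose variables reads either an entry of the assignment (Inl) or a fixed parameter (Inr). The
  value 0 is always allowed, being the value of the variables beyond the end of a list.\<close>

definition dfb :: "'u diff_ring \<Rightarrow> 'u set \<Rightarrow> ((nat \<Rightarrow> 'u) \<Rightarrow> bool) \<Rightarrow> bool" where
  "dfb U C Q \<longleftrightarrow> (\<exists>\<phi> src. (\<forall>i d. src i = Inr d \<longrightarrow> d \<in> insert \<zero>\<^bsub>U\<^esub> C) \<and>
     (\<forall>e. Q e \<longleftrightarrow> sat U (\<lambda>i. case_sum e id (src i)) \<phi>))"

lemma dfbE:
  assumes "dfb U C Q"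
  obtains \<phi> src where "\<And>i d. src i = Inr d \<Longrightarrow> d \<in> insert \<zero>\<^bsub>U\<^esub> C"
    "\<And>e. Q e \<longleftrightarrow> sat U (\<lambda>i. case_sum e id (src i)) \<phi>"
  using assms unfolding dfb_def by blast

lemma dfbI:
  assumes "\<And>i d. src i = Inr d \<Longrightarrow> d \<in> insert \<zero>\<^bsub>U\<^esub> C" "\<And>e. Q e \<longleftrightarrow> sat U (\<lambda>i. case_sum e id (src i)) \<phi>"
  shows "dfb U C Q"
  unfolding dfb_def using assms by blast

text \<open>Supplies indices that the predicate does not read, which can then hold auxiliary
  elements.\<close>

lemma dfb_local:
  assumes "dfb U C Q"
  obtains N where "\<And>e e'. (\<And>i. i < N \<Longrightarrow> e i = e' i) \<Longrightarrow> Q e = Q e'"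
proof -
  obtain \<phi> src where "\<forall>e. Q e \<longleftrightarrow> sat U (\<lambda>i. case_sum e id (src i)) \<phi>" using assms unfolding dfb_def by blast
  note Q = this[rule_format]
  have "finite ((\<lambda>i. case_sum id (\<lambda>_. 0) (src i)) ` {..<fm_vars \<phi>})" by simp
  then obtain N where N: "\<And>i. i < fm_vars \<phi> \<Longrightarrow> case_sum id (\<lambda>_. 0) (src i) < N"
    unfolding finite_nat_set_iff_bounded by auto
  show ?thesis
  proof (rule that)
    fix e e' :: "nat \<Rightarrow> 'a" assume e: "\<And>i. i < N \<Longrightarrow> e i = e' i"
    show "Q e = Q e'" unfolding Q
    proof (rule sat_cong)
      fix i assume "i < fm_vars \<phi>"
      from N[OF this] show "case_sum e id (src i) = case_sum e' id (src i)" by (auto split: sum.splits intro: e)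
    qed
  qed
qed

lemma dfb_eq: "dfb U C (\<lambda>e. Defs.eval U e s = Defs.eval U e t)"
  by (rule dfbI[of Inl _ _ _ "FEq s t"]) auto

lemma dfb_not: "dfb U C Q \<Longrightarrow> dfb U C (\<lambda>e. \<not> Q e)"
proof (erule dfbE)
  fix \<phi> src assume a: "\<And>i d. src i = Inr d \<Longrightarrow> d \<in> insert \<zero>\<^bsub>U\<^esub> C" "\<And>e. Q e \<longleftrightarrow> sat U (\<lambda>i. case_sum e id (src i)) \<phi>"
  show ?thesis by (rule dfbI[of src _ _ _ "FNot \<phi>", OF a(1)]) (simp_all add: a(2))
qed

lemma dfb_sub: "dfb U C Q \<Longrightarrow> dfb U C (\<lambda>e. Q (\<lambda>i. e (r i)))"
proof (erule dfbE)
  fix \<phi> src assume a: "\<And>i d. src i = Inr d \<Longrightarrow> d \<in> insert \<zero>\<^bsub>U\<^esub> C" "\<And>e. Q e \<longleftrightarrow> sat U (\<lambda>i. case_sum e id (src i)) \<phi>"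
  have "case_sum (\<lambda>i. e (r i)) id (src i) = case_sum e id (map_sum r id (src i))" for e :: "nat \<Rightarrow> 'a" and i by (cases "src i") auto
  then show ?thesis
    by (intro dfbI[of "\<lambda>i. map_sum r id (src i)" _ _ _ \<phi>]) (auto simp: a(2) map_sum_def split: sum.splits dest: a(1))
qed

lemma dfb_and:
  assumes "dfb U C P" "dfb U C Q" shows "dfb U C (\<lambda>e. P e \<and> Q e)"
proof -
  obtain \<phi> src where "\<forall>i d. src i = Inr d \<longrightarrow> d \<in> insert \<zero>\<^bsub>U\<^esub> C" "\<forall>e. P e \<longleftrightarrow> sat U (\<lambda>i. case_sum e id (src i)) \<phi>"
    using assms(1) unfolding dfb_def by blast
  note a = this[rule_format]
  obtain \<psi> src' where "\<forall>i d. src' i = Inr d \<longrightarrow> d \<in> insert \<zero>\<^bsub>U\<^esub> C" "\<forall>e. Q e \<longleftrightarrow> sat U (\<lambda>i. case_sum e id (src' i)) \<psi>"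
    using assms(2) unfolding dfb_def by blast
  note b = this[rule_format]
  \<comment> \<open>The two formulas are kept apart: one reads the even positions, the other the odd
    ones.\<close>
  obtain \<phi>' where 1: "\<forall>(R :: 'a diff_ring) e. sat R e \<phi>' \<longleftrightarrow> sat R (\<lambda>i. e (2 * i)) \<phi>" using sat_rename by blast
  obtain \<psi>' where 2: "\<forall>(R :: 'a diff_ring) e. sat R e \<psi>' \<longleftrightarrow> sat R (\<lambda>i. e (Suc (2 * i))) \<psi>" using sat_rename[of "\<lambda>i. Suc (2 * i)"] by blast
  show ?thesis
    by (rule dfbI[of "\<lambda>i. if even i then src (i div 2) else src' (i div 2)" _ _ _ "FAnd \<phi>' \<psi>'"])
      (auto simp: a(2) b(2) 1 2 dest: a(1) b(1) split: if_splits)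
qed

lemma dfb_ex:
  assumes "dfb U C Q" shows "dfb U C (\<lambda>e. \<exists>x\<in>carrier U. Q (e(j := x)))"
proof -
  obtain \<phi> src where "\<forall>i d. src i = Inr d \<longrightarrow> d \<in> insert \<zero>\<^bsub>U\<^esub> C" "\<forall>e. Q e \<longleftrightarrow> sat U (\<lambda>i. case_sum e id (src i)) \<phi>"
    using assms(1) unfolding dfb_def by blast
  note a = this[rule_format]
  \<comment> \<open>Position 0 is reserved for the witness; every other source moves up by
    one.\<close>
  define r where "r = (\<lambda>i. if src i = Inl j then 0 else Suc i)"
  define src' where "src' = (\<lambda>i. case i of 0 \<Rightarrow> Inr \<zero>\<^bsub>U\<^esub> | Suc k \<Rightarrow> src k)"
  obtain \<phi>' where 1: "\<forall>(R :: 'a diff_ring) e. sat R e \<phi>' \<longleftrightarrow> sat R (\<lambda>i. e (r i)) \<phi>" using sat_rename by blast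
  have "((\<lambda>i. case_sum e id (src' i))(0 := x)) (r i) = case_sum (e(j := x)) id (src i)" for e x i
    by (cases "src i") (auto simp: r_def src'_def)
  then have "sat U ((\<lambda>i. case_sum e id (src' i))(0 := x)) \<phi>' \<longleftrightarrow> Q (e(j := x))" for e x
    using 1 a(2) by simp
  then show ?thesis
    by (intro dfbI[of src' _ _ _ "FEx 0 \<phi>'"]) (auto simp: src'_def dest: a(1) split: nat.splits)
qed

lemma dfb_param: "d \<in> C \<Longrightarrow> dfb U C (\<lambda>e. e i = d)"
  by (rule dfbI[of "\<lambda>n. if n = 0 then Inl i else Inr d" _ _ _ "FEq (tm.Var 0) (tm.Var 1)"]) (auto split: if_splits)

lemma dfb_True: "dfb U C (\<lambda>_. True)"
  using dfb_eq[of U C tm.Zero Zero] by simp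

text \<open>At least \<open>m\<close> elements. The first disjunct is there because
  \<open>card\<close> is 0 on infinite sets.\<close>

definition many :: "'u diff_ring \<Rightarrow> nat \<Rightarrow> ('u \<Rightarrow> bool) \<Rightarrow> bool" where
  "many U m P \<longleftrightarrow> infinite {x \<in> carrier U. P x} \<or> m \<le> card {x \<in> carrier U. P x}"

lemma card_ge_Suc_iff:
  "infinite S \<or> Suc m \<le> card S \<longleftrightarrow> (\<exists>z\<in>S. infinite (S - {z}) \<or> m \<le> card (S - {z}))"
proof (cases "finite S")
  case True
  have c: "card (S - {z}) = card S - 1" if "z \<in> S" for z using that by (rule card_Diff_singleton)
  have "Suc m \<le> card S \<longleftrightarrow> S \<noteq> {} \<and> m \<le> card S - 1"
    using True card_gt_0_iff[of S] by (cases "card S") simp_all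
  then show ?thesis using True c by (metis all_not_in_conv finite_Diff)
next
  case False
  then have "S \<noteq> {}" by auto
  then show ?thesis using False by auto
qed

lemma many_Suc: "many U (Suc m) P \<longleftrightarrow> (\<exists>z\<in>carrier U. P z \<and> many U m (\<lambda>x. P x \<and> x \<noteq> z))"
proof -
  have e: "{x \<in> carrier U. P x \<and> x \<noteq> z} = {x \<in> carrier U. P x} - {z}" for z by auto
  show ?thesis unfolding many_def e card_ge_Suc_iff by blast
qed

lemma dfb_many: "dfb U C Q \<Longrightarrow> dfb U C (\<lambda>e. many U m (\<lambda>x. Q (e(0 := x))))"
proof (induction m arbitrary: Q)
  case 0
  then show ?case using dfb_True by (simp add: many_def)
next
  case (Suc m)
  obtain N where N: "\<And>e e'. (\<And>i. i < N \<Longrightarrow> e i = e' i) \<Longrightarrow> Q e = Q e'" using Suc.prems by (rule dfb_local) blast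
  \<comment> \<open>An index that \<open>Q\<close> does not read and that differs from 0; it holds
    the element to be removed.\<close>
  define k where "k = Suc N"
  have 1: "dfb U C (\<lambda>e. many U m (\<lambda>x. Q (e(0 := x)) \<and> (e(0 := x)) 0 \<noteq> (e(0 := x)) k))"
    by (rule Suc.IH[of "\<lambda>e. Q e \<and> e 0 \<noteq> e k"]) (intro dfb_and dfb_not Suc.prems dfb_eq[of U C "tm.Var 0" "tm.Var k", simplified])
  have 2: "dfb U C (\<lambda>e. Q (\<lambda>i. e ((id(0 := k)) i)))" by (rule dfb_sub[OF Suc.prems])
  have q: "Q ((e(k := z))(0 := x)) = Q (e(0 := x))" for e z x by (rule N) (simp add: k_def)
  have "Q (\<lambda>i. (e(k := z)) ((id(0 := k)) i)) = Q (e(0 := z))" for e z by (rule N) (auto simp: k_def)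
  then have eq: "(\<lambda>e. \<exists>z\<in>carrier U. Q (\<lambda>i. (e(k := z)) ((id(0 := k)) i)) \<and>
      many U m (\<lambda>x. Q ((e(k := z))(0 := x)) \<and> ((e(k := z))(0 := x)) 0 \<noteq> ((e(k := z))(0 := x)) k)) =
    (\<lambda>e. many U (Suc m) (\<lambda>x. Q (e(0 := x))))"
    unfolding many_Suc q by (simp add: k_def)
  from dfb_ex[OF dfb_and[OF 2 1], of k] show ?case unfolding eq .
qed

text \<open>Only variables below \<open>fm_vars\<close> matter, so finitely many parameters suffice,
  and a renaming brings them behind the \<open>n\<close> entries as \<open>holds\<close>
  expects.\<close>

lemma dfb_holds:
  assumes "dfb U C Q"
  shows "\<exists>\<phi> cs. set cs \<subseteq> C \<and> (\<forall>xs. length xs = n \<longrightarrow> Q (lenv U xs) = holds U \<phi> (xs @ cs))"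
proof -
  obtain \<phi> src where "\<forall>i d. src i = Inr d \<longrightarrow> d \<in> insert \<zero>\<^bsub>U\<^esub> C" "\<forall>e. Q e \<longleftrightarrow> sat U (\<lambda>i. case_sum e id (src i)) \<phi>"
    using assms(1) unfolding dfb_def by blast
  note a = this[rule_format]
  have "finite {d \<in> C. \<exists>i<fm_vars \<phi>. src i = Inr d}"
  proof (rule finite_subset)
    show "{d \<in> C. \<exists>i<fm_vars \<phi>. src i = Inr d} \<subseteq> (\<lambda>i. projr (src i)) ` {..<fm_vars \<phi>}"
    proof
      fix d assume "d \<in> {d \<in> C. \<exists>i<fm_vars \<phi>. src i = Inr d}"
      then obtain i where "i < fm_vars \<phi>" "src i = Inr d" by blast
      then show "d \<in> (\<lambda>i. projr (src i)) ` {..<fm_vars \<phi>}" by (intro image_eqI[of _ _ i]) simp_all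
    qed
  qed simp
  from finite_list[OF this] obtain cs where cs: "set cs = {d \<in> C. \<exists>i<fm_vars \<phi>. src i = Inr d}" ..
  have "\<forall>i. \<exists>m. i < fm_vars \<phi> \<longrightarrow> (\<forall>xs. length xs = n \<longrightarrow> lenv U (xs @ cs) m = case_sum (lenv U xs) id (src i))"
  proof
    fix i
    show "\<exists>m. i < fm_vars \<phi> \<longrightarrow> (\<forall>xs. length xs = n \<longrightarrow> lenv U (xs @ cs) m = case_sum (lenv U xs) id (src i))"
  proof (cases "i < fm_vars \<phi>")
    case True
    show ?thesis
    proof (cases "src i")
      case (Inl j)
      \<comment> \<open>Entries beyond the first \<open>n\<close> have the value 0, and so does the
        index just past the parameters.\<close>
      show ?thesis
        by (rule exI[of _ "if j < n then j else n + length cs"]) (auto simp: Inl lenv_def nth_append)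
    next
      case (Inr d)
      show ?thesis
      proof (cases "d \<in> C")
        case True
        then have "d \<in> set cs" using cs Inr \<open>i < fm_vars \<phi>\<close> by auto
        then obtain m where "m < length cs" "cs ! m = d" by (auto simp: in_set_conv_nth)
        then show ?thesis by (intro exI[of _ "n + m"]) (simp add: Inr lenv_def nth_append)
      next
        case False
        then have "d = \<zero>\<^bsub>U\<^esub>" using a(1)[OF Inr] by simp
        then show ?thesis by (intro exI[of _ "n + length cs"]) (simp add: Inr lenv_def)
      qed
    qed
  qed simp
  qed
  from choice[OF this] obtain r where "\<forall>i. i < fm_vars \<phi> \<longrightarrow> (\<forall>xs. length xs = n \<longrightarrow> lenv U (xs @ cs) (r i) = case_sum (lenv U xs) id (src i))" ..
  note r = this[rule_format]
  obtain \<psi> where \<psi>: "\<forall>(R :: 'a diff_ring) e. sat R e \<psi> \<longleftrightarrow> sat R (\<lambda>i. e (r i)) \<phi>" using sat_rename by blast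
  have "Q (lenv U xs) = holds U \<psi> (xs @ cs)" if n: "length xs = n" for xs
  proof -
    have "sat U (\<lambda>i. lenv U (xs @ cs) (r i)) \<phi> = sat U (\<lambda>i. case_sum (lenv U xs) id (src i)) \<phi>"
      by (rule sat_cong) (rule r[OF _ n])
    then show ?thesis unfolding a(2) holds_lenv using \<psi> by simp
  qed
  moreover have "set cs \<subseteq> C" unfolding cs by blast
  ultimately show ?thesis by (intro exI[of _ \<psi>] exI[of _ cs] conjI allI impI)
qed

lemma holds_dfb:
  assumes "set cs \<subseteq> C"
  shows "dfb U C (\<lambda>e. holds U \<phi> (map e [0..<n] @ cs))"
proof (rule dfbI)
  define src where "src = (\<lambda>i. if i < n then Inl i else if i < n + length cs then Inr (cs ! (i - n)) else Inr \<zero>\<^bsub>U\<^esub>)"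
  show "d \<in> insert \<zero>\<^bsub>U\<^esub> C" if "src i = Inr d" for i d
  proof -
    have "\<not> i < n \<Longrightarrow> i < n + length cs \<Longrightarrow> i - n < length cs" by linarith
    then have "\<not> i < n \<Longrightarrow> i < n + length cs \<Longrightarrow> cs ! (i - n) \<in> C" using assms nth_mem by blast
    then show ?thesis using that by (auto simp: src_def split: if_splits)
  qed
  show "holds U \<phi> (map e [0..<n] @ cs) = sat U (\<lambda>i. case_sum e id (src i)) \<phi>" for e
    unfolding holds_lenv by (rule sat_cong) (auto simp: lenv_def src_def nth_append)
qed

lemma definable_iff_dfb:
  "definable_over U C X \<longleftrightarrow> (\<exists>Q. dfb U C Q \<and> X = {x \<in> carrier U. Q (\<lambda>_. x)})"
proof
  assume "definable_over U C X"
  then obtain \<phi> cs where f: "set cs \<subseteq> C" "X = sols U (\<phi>, cs)" by (auto simp: definable_over_def pfms_def)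
  have "X = {x \<in> carrier U. holds U \<phi> (map (\<lambda>_. x) [0..<1] @ cs)}" by (simp add: f(2) sols_def)
  then show "\<exists>Q. dfb U C Q \<and> X = {x \<in> carrier U. Q (\<lambda>_. x)}" using holds_dfb[OF f(1), of U \<phi> 1] by blast
next
  assume "\<exists>Q. dfb U C Q \<and> X = {x \<in> carrier U. Q (\<lambda>_. x)}"
  then obtain Q where Q: "dfb U C Q" "X = {x \<in> carrier U. Q (\<lambda>_. x)}" by blast
  obtain \<phi> cs where f: "set cs \<subseteq> C" "\<forall>xs. length xs = 1 \<longrightarrow> Q (\<lambda>i. lenv U xs 0) = holds U \<phi> (xs @ cs)"
    using dfb_holds[OF dfb_sub[OF Q(1), of "\<lambda>_. 0"], of 1] by blast
  have "Q (\<lambda>_. x) = holds U \<phi> (x # cs)" for x using f(2)[rule_format, of "[x]"] by (simp add: lenv_def)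
  then have "X = sols U (\<phi>, cs)" "(\<phi>, cs) \<in> pfms C" unfolding Q(2) sols_def pfms_def using f(1) by auto
  then show "definable_over U C X" unfolding definable_over_def by blast
qed

section \<open>Algebraic closure\<close>

lemma acl_iff:
  "x \<in> acl U C \<longleftrightarrow> (\<exists>Q. dfb U C Q \<and> finite {y \<in> carrier U. Q (\<lambda>_. y)} \<and> x \<in> carrier U \<and> Q (\<lambda>_. x))"
  unfolding acl_def definable_iff_dfb by blast

lemma acl_carrier: "acl U C \<subseteq> carrier U" by (auto simp: acl_iff)

lemma definable_mono: "\<lbrakk>definable_over U C X; C \<subseteq> C'\<rbrakk> \<Longrightarrow> definable_over U C' X"
  unfolding definable_over_def pfms_def by blast

lemma acl_mono: "C \<subseteq> C' \<Longrightarrow> acl U C \<subseteq> acl U C'"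
  unfolding acl_def using definable_mono by blast

lemma acl_incl: "C \<subseteq> carrier U \<Longrightarrow> C \<subseteq> acl U C"
proof
  fix d assume d: "C \<subseteq> carrier U" "d \<in> C"
  have "{y \<in> carrier U. y = d} = {d}" using d by auto
  then show "d \<in> acl U C" unfolding acl_iff using d dfb_param[OF d(2), of U 0] by (intro exI[of _ "\<lambda>e. e 0 = d"]) auto
qed

text \<open>The parameter \<open>d\<close> is turned into entry 0 and all other entries move up by
  one.\<close>

lemma dfb_insert:
  assumes "dfb U (insert d C) Q"
  obtains Q' where "dfb U C Q'" "\<And>e. Q e = Q' (case_nat d e)"
proof -
  obtain \<phi> src where "\<forall>i c. src i = Inr c \<longrightarrow> c \<in> insert \<zero>\<^bsub>U\<^esub> (insert d C)" "\<forall>e. Q e \<longleftrightarrow> sat U (\<lambda>i. case_sum e id (src i)) \<phi>"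
    using assms(1) unfolding dfb_def by blast
  note a = this[rule_format]
  define src' where "src' = (\<lambda>i. case src i of Inl j \<Rightarrow> Inl (Suc j) | Inr c \<Rightarrow> if c \<in> insert \<zero>\<^bsub>U\<^esub> C then Inr c else Inl 0)"
  have 1: "dfb U C (\<lambda>e. sat U (\<lambda>i. case_sum e id (src' i)) \<phi>)"
    by (rule dfbI[of src']) (auto simp: src'_def split: sum.splits if_splits)
  have "case_sum (case_nat d e) id (src' i) = case_sum e id (src i)" for e i
    using a(1)[of i] by (cases "src i") (auto simp: src'_def)
  then have "Q e = sat U (\<lambda>i. case_sum (case_nat d e) id (src' i)) \<phi>" for e using a(2) by simp
  from that[OF 1 this] show ?thesis .
qed

text \<open>Turn \<open>d\<close> into a variable \<open>z\<close> that ranges over the finite set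
  defining \<open>d\<close>. Requiring of \<open>z\<close> that its own fibre have at most as many
  elements as the fibre of \<open>d\<close> leaves a finite union of finite fibres, and this union
  is definable over \<open>C\<close>.\<close>

lemma acl_insert:
  assumes d: "d \<in> acl U C" shows "acl U (insert d C) \<subseteq> acl U C"
proof
  fix x assume "x \<in> acl U (insert d C)"
  then obtain Q where Q: "dfb U (insert d C) Q" "finite {y \<in> carrier U. Q (\<lambda>_. y)}" "x \<in> carrier U" "Q (\<lambda>_. x)"
    unfolding acl_iff by blast
  obtain G where G: "dfb U C G" "finite {y \<in> carrier U. G (\<lambda>_. y)}" "d \<in> carrier U" "G (\<lambda>_. d)"
    using d unfolding acl_iff by blast
  obtain Q' where Q': "dfb U C Q'" "\<And>e. Q e = Q' (case_nat d e)" using Q(1) by (rule dfb_insert) blast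
  define P where "P = (\<lambda>z x. Q' (case_nat z (\<lambda>_. x)))"
  define m where "m = card {y \<in> carrier U. P d y}"
  have fP: "finite {y \<in> carrier U. P d y}" using Q(2) by (simp add: P_def Q'(2))
  have cn: "(\<lambda>i. e (case i of 0 \<Rightarrow> 1 | Suc _ \<Rightarrow> 0)) = case_nat (e 1) (\<lambda>_. e 0)" for e :: "nat \<Rightarrow> 'a" by (auto split: nat.splits)
  have P1: "dfb U C (\<lambda>e. P (e 1) (e 0))" using dfb_sub[OF Q'(1), of "\<lambda>i. case i of 0 \<Rightarrow> 1 | Suc _ \<Rightarrow> 0"] unfolding cn P_def .
  have P2: "dfb U C (\<lambda>e. many U (Suc m) (P (e 1)))" using dfb_many[OF P1, of "Suc m"] by (simp add: one_neq_zero)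
  have P3: "dfb U C (\<lambda>e. G (\<lambda>_. e 1))" using dfb_sub[OF G(1), of "\<lambda>_. 1"] .
  define R where "R = (\<lambda>e :: nat \<Rightarrow> 'a. \<exists>z\<in>carrier U. G (\<lambda>_. z) \<and> P z (e 0) \<and> \<not> many U (Suc m) (P z))"
  have "dfb U C R" using dfb_ex[OF dfb_and[OF P3 dfb_and[OF P1 dfb_not[OF P2]]], of 1] unfolding R_def by simp
  moreover have "finite {y \<in> carrier U. R (\<lambda>_. y)}"
  proof (rule finite_subset)
    show "{y \<in> carrier U. R (\<lambda>_. y)} \<subseteq> (\<Union>z\<in>{z \<in> {y \<in> carrier U. G (\<lambda>_. y)}. \<not> many U (Suc m) (P z)}. {y \<in> carrier U. P z y})"
      unfolding R_def by blast
    show "finite (\<Union>z\<in>{z \<in> {y \<in> carrier U. G (\<lambda>_. y)}. \<not> many U (Suc m) (P z)}. {y \<in> carrier U. P z y})"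
    proof (rule finite_UN_I)
      show "finite {z \<in> {y \<in> carrier U. G (\<lambda>_. y)}. \<not> many U (Suc m) (P z)}" using G(2) by (rule finite_subset[rotated]) blast
    qed (simp add: many_def)
  qed
  moreover have "R (\<lambda>_. x)" unfolding R_def
  proof (intro bexI[OF _ G(3)] conjI G(4))
    show "P d x" using Q(4) by (simp add: P_def Q'(2))
    show "\<not> many U (Suc m) (P d)" using fP by (simp add: many_def m_def)
  qed
  ultimately show "x \<in> acl U C" unfolding acl_iff using Q(3) by blast
qed

text \<open>A formula has finitely many parameters, and these can be discharged one at a time by
  \<open>acl_insert\<close>.\<close>

lemma acl_acl: "acl U (acl U C) \<subseteq> acl U C"
proof
  have fin: "finite D \<Longrightarrow> D \<subseteq> acl U C \<Longrightarrow> acl U (D \<union> C) \<subseteq> acl U C" for D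
  proof (induction D rule: finite_induct)
    case (insert d D)
    have "d \<in> acl U (D \<union> C)" using insert.prems acl_mono[of C "D \<union> C" U] by blast
    then have "acl U (insert d (D \<union> C)) \<subseteq> acl U (D \<union> C)" by (rule acl_insert)
    then show ?case using insert by auto
  qed simp
  fix x assume "x \<in> acl U (acl U C)"
  then obtain f where f: "f \<in> pfms (acl U C)" "finite (sols U f)" "x \<in> sols U f" unfolding acl_def definable_over_def by blast
  have "f \<in> pfms (set (snd f))" by (simp add: pfms_def)
  then have "x \<in> acl U (set (snd f))" using f unfolding acl_def definable_over_def by blast
  also have "\<dots> \<subseteq> acl U (set (snd f) \<union> C)" by (rule acl_mono) simp
  also have "\<dots> \<subseteq> acl U C" using f(1) by (intro fin) (auto simp: pfms_def)
  finally show "x \<in> acl U C" .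
qed

lemma acl_finite:
  assumes "dfb U (acl U C) Q" "finite {y \<in> carrier U. Q (\<lambda>_. y)}" "x \<in> carrier U" "Q (\<lambda>_. x)"
  shows "x \<in> acl U C"
proof -
  have "x \<in> acl U (acl U C)" unfolding acl_iff by (intro exI[of _ Q] conjI assms)
  then show ?thesis by (rule subsetD[OF acl_acl])
qed

lemma definable_diff:
  assumes "definable_over U C X" "definable_over U C Y" shows "definable_over U C (X - Y)" "definable_over U C (X \<inter> Y)"
proof -
  obtain P where P: "dfb U C P" "X = {x \<in> carrier U. P (\<lambda>_. x)}" using assms(1) unfolding definable_iff_dfb by (elim exE conjE)
  obtain Q where Q: "dfb U C Q" "Y = {x \<in> carrier U. Q (\<lambda>_. x)}" using assms(2) unfolding definable_iff_dfb by (elim exE conjE)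
  have 1: "X - Y = {x \<in> carrier U. P (\<lambda>_. x) \<and> \<not> Q (\<lambda>_. x)}" and 2: "X \<inter> Y = {x \<in> carrier U. P (\<lambda>_. x) \<and> Q (\<lambda>_. x)}"
    unfolding P(2) Q(2) by auto
  show "definable_over U C (X - Y)" unfolding definable_iff_dfb 1
    by (rule exI[of _ "\<lambda>e. P e \<and> \<not> Q e"]) (simp add: dfb_and[OF P(1) dfb_not[OF Q(1)]])
  show "definable_over U C (X \<inter> Y)" unfolding definable_iff_dfb 2
    by (rule exI[of _ "\<lambda>e. P e \<and> Q e"]) (simp add: dfb_and[OF P(1) Q(1)])
qed

section \<open>Saturation\<close>

lemma pfms_definable: "f \<in> pfms C \<Longrightarrow> definable_over U C (sols U f)"
  unfolding definable_over_def by blast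

text \<open>Saturation speaks of complete types, so the family is first enlarged by Zorn's principle
  to a maximal finitely satisfiable set of formulas. It is complete: if neither a formula nor its
  negation could be added, the two finite obstructions together would be unsatisfiable.\<close>

lemma saturated_realize:
  assumes sat: "sufficiently_saturated \<kappa> U" and C: "C \<subseteq> carrier U" "|C| <o \<kappa>"
    and D: "\<And>X. X \<in> \<X> \<Longrightarrow> definable_over U C X"
    and fip: "\<And>F. \<lbrakk>F \<subseteq> \<X>; finite F\<rbrakk> \<Longrightarrow> \<exists>x\<in>carrier U. \<forall>X\<in>F. x \<in> X"
  shows "\<exists>x\<in>carrier U. \<forall>X\<in>\<X>. x \<in> X"
proof -
  define FS where "FS = (\<lambda>q. q \<subseteq> pfms C \<and> (\<forall>F\<subseteq>q. finite F \<longrightarrow> (\<exists>x\<in>carrier U. \<forall>f\<in>F. x \<in> sols U f)))"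
  define q0 where "q0 = {f \<in> pfms C. sols U f \<in> \<X>}"
  have "FS q0" unfolding FS_def
  proof (intro conjI allI impI)
    show "q0 \<subseteq> pfms C" by (auto simp: q0_def)
    fix F assume "F \<subseteq> q0" "finite F"
    then show "\<exists>x\<in>carrier U. \<forall>f\<in>F. x \<in> sols U f" using fip[of "sols U ` F"] by (auto simp: q0_def)
  qed
  define \<A> where "\<A> = {q. FS q \<and> q0 \<subseteq> q}"
  have "\<exists>q\<in>\<A>. \<forall>q'\<in>\<A>. q \<subseteq> q' \<longrightarrow> q' = q"
  proof (rule subset_Zorn_nonempty)
    show "\<A> \<noteq> {}" using \<open>FS q0\<close> by (auto simp: \<A>_def)
    fix c assume c: "c \<noteq> {}" "subset.chain \<A> c"
    have "FS (\<Union>c)" unfolding FS_def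
    proof (intro conjI allI impI)
      show "\<Union>c \<subseteq> pfms C" using c(2) by (auto simp: subset.chain_def \<A>_def FS_def)
      fix F assume F: "F \<subseteq> \<Union>c" "finite F"
      obtain q where q: "q \<in> c" "F \<subseteq> q" using finite_subset_Union_chain[OF F(2,1) c] by blast
      have "FS q" using q(1) c(2) by (auto simp: subset.chain_def \<A>_def)
      then show "\<exists>x\<in>carrier U. \<forall>f\<in>F. x \<in> sols U f" using q(2) F(2) by (auto simp: FS_def)
    qed
    moreover have "q0 \<subseteq> \<Union>c"
    proof -
      obtain q where "q \<in> c" using c(1) by blast
      moreover from this have "q0 \<subseteq> q" using c(2) unfolding subset.chain_def \<A>_def by blast
      ultimately show ?thesis by blast
    qed
    ultimately show "\<Union>c \<in> \<A>" unfolding \<A>_def by blast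
  qed
  then obtain q where qA: "q \<in> \<A>" "\<forall>q'\<in>\<A>. q \<subseteq> q' \<longrightarrow> q' = q" by (elim bexE)
  have q: "FS q" "q0 \<subseteq> q" using qA(1) unfolding \<A>_def by blast+
  have max: "q' = q" if "FS q'" "q \<subseteq> q'" for q'
  proof -
    have "q' \<in> \<A>" using that q(2) unfolding \<A>_def by blast
    then show ?thesis using qA(2) that(2) by blast
  qed
  have ins: "\<exists>F\<subseteq>q. finite F \<and> \<not> (\<exists>x\<in>carrier U. x \<in> sols U g \<and> (\<forall>f\<in>F. x \<in> sols U f))" if g: "g \<in> pfms C" "g \<notin> q" for g
  proof -
    have "\<not> FS (insert g q)" using max[of "insert g q"] g(2) by blast
    then obtain F where F: "F \<subseteq> insert g q" "finite F" "\<not> (\<exists>x\<in>carrier U. \<forall>f\<in>F. x \<in> sols U f)"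
      using q(1) g(1) unfolding FS_def by blast
    have "F - {g} \<subseteq> q" "finite (F - {g})" using F by auto
    moreover have "\<not> (\<exists>x\<in>carrier U. x \<in> sols U g \<and> (\<forall>f\<in>F - {g}. x \<in> sols U f))" using F(3) by blast
    ultimately show ?thesis by blast
  qed
  have "q \<in> complete_types U C" unfolding complete_types_def
  proof (intro CollectI conjI ballI)
    show "q \<subseteq> pfms C" "\<forall>F\<subseteq>q. finite F \<longrightarrow> (\<exists>x\<in>carrier U. \<forall>f\<in>F. x \<in> sols U f)" using q(1) by (auto simp: FS_def)
    fix g assume g: "g \<in> pfms C"
    obtain \<phi> cs where pc: "g = (\<phi>, cs)" by (cases g)
    have "(\<phi>, cs) \<in> q \<or> (FNot \<phi>, cs) \<in> q"
    proof (rule ccontr)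
      assume n: "\<not> ((\<phi>, cs) \<in> q \<or> (FNot \<phi>, cs) \<in> q)"
      have "(\<phi>, cs) \<in> pfms C" "(FNot \<phi>, cs) \<in> pfms C" using g by (auto simp: pc pfms_def)
      then obtain F G where F: "F \<subseteq> q" "finite F" "\<not> (\<exists>x\<in>carrier U. x \<in> sols U (\<phi>, cs) \<and> (\<forall>f\<in>F. x \<in> sols U f))"
        and G: "G \<subseteq> q" "finite G" "\<not> (\<exists>x\<in>carrier U. x \<in> sols U (FNot \<phi>, cs) \<and> (\<forall>f\<in>G. x \<in> sols U f))"
        using ins[of "(\<phi>, cs)"] ins[of "(FNot \<phi>, cs)"] n by blast
      have "F \<union> G \<subseteq> q" "finite (F \<union> G)" using F(1,2) G(1,2) by auto
      then obtain x where x: "x \<in> carrier U" "\<forall>f\<in>F \<union> G. x \<in> sols U f"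
        using q(1) unfolding FS_def by blast
      then have "x \<in> sols U (\<phi>, cs) \<or> x \<in> sols U (FNot \<phi>, cs)" by (auto simp: sols_def holds_def)
      then show False using F(3) G(3) x by blast
    qed
    then show "case g of (\<phi>, cs) \<Rightarrow> (\<phi>, cs) \<in> q \<or> (FNot \<phi>, cs) \<in> q" by (simp add: pc)
  qed
  then obtain x where x: "x \<in> carrier U" "\<forall>f\<in>q. x \<in> sols U f" using sat C unfolding sufficiently_saturated_def by blast
  have "x \<in> X" if X: "X \<in> \<X>" for X
  proof -
    obtain f where "f \<in> pfms C" "X = sols U f" using D[OF X] unfolding definable_over_def by blast
    then show ?thesis using x(2) q(2) X unfolding q0_def by blast
  qed
  then show ?thesis using x(1) by blast
qed

text \<open>As \<open>X\<close> is infinite, removing finitely many finite sets never empties it. By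
  saturation some point of \<open>X\<close> escapes every finite set definable over
  \<open>C\<close>.\<close>

lemma saturated_transcendental:
  assumes sat: "sufficiently_saturated \<kappa> U" and C: "C \<subseteq> carrier U" "|C| <o \<kappa>"
    and X: "definable_over U C X" "infinite X"
  shows "\<exists>x\<in>X. x \<notin> acl U C"
proof -
  have Xc: "X \<subseteq> carrier U" using X(1) unfolding definable_iff_dfb by blast
  let ?\<X> = "insert X {X - F | F. definable_over U C F \<and> finite F}"
  have "\<exists>x\<in>carrier U. \<forall>Y\<in>?\<X>. x \<in> Y"
  proof (rule saturated_realize[OF sat C])
    show "definable_over U C Y" if "Y \<in> ?\<X>" for Y using that X(1) definable_diff(1) by blast
    fix \<F> assume F: "\<F> \<subseteq> ?\<X>" "finite \<F>"
    have "finite (X - Y)" if "Y \<in> ?\<X>" for Y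
    proof (cases "Y = X")
      case False
      then obtain F where F: "Y = X - F" "finite F" using \<open>Y \<in> ?\<X>\<close> by blast
      have "X - Y \<subseteq> F" unfolding F(1) by blast
      then show ?thesis using F(2) finite_subset by blast
    qed simp
    then have "finite (\<Union>Y\<in>\<F>. X - Y)" using F by (intro finite_UN_I) auto
    then have "\<not> X \<subseteq> (\<Union>Y\<in>\<F>. X - Y)" using X(2) finite_subset by blast
    then show "\<exists>x\<in>carrier U. \<forall>Y\<in>\<F>. x \<in> Y" using Xc by blast
  qed
  then obtain x where x: "x \<in> carrier U" "\<forall>Y\<in>?\<X>. x \<in> Y" by (elim bexE)
  have "x \<in> X" by (rule bspec[OF x(2)]) simp
  moreover have "x \<notin> acl U C"
  proof
    assume "x \<in> acl U C"
    then obtain F where F: "definable_over U C F" "finite F" "x \<in> F" unfolding acl_def by blast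
    have "x \<in> X - F" by (rule bspec[OF x(2)]) (use F in blast)
    then show False using F(3) by simp
  qed
  ultimately show ?thesis by blast
qed

lemma small_insert:
  assumes "sufficiently_saturated \<kappa> U" "|C| <o \<kappa>" shows "|insert b C| <o \<kappa>"
proof -
  have k: "Card_order \<kappa>" "natLeq <o \<kappa>" using assms(1) by (auto simp: sufficiently_saturated_def)
  have "\<not> finite (Field \<kappa>)"
  proof
    assume "finite (Field \<kappa>)"
    then have "|Field \<kappa>| <o natLeq" by (simp add: finite_iff_ordLess_natLeq)
    then have "\<kappa> <o natLeq" using card_of_Field_ordIso[OF k(1)] ordIso_ordLess_trans ordIso_symmetric by blast
    then show False using k(2) not_ordLess_ordLeq ordLess_imp_ordLeq by blast
  qed
  moreover have "|{b}| <o \<kappa>"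
    using k(2) finite_iff_ordLess_natLeq[of "{b}"] ordLess_transitive by blast
  ultimately have "|{b} \<union> C| <o \<kappa>" using card_of_Un_ordLess_infinite_Field k(1) assms(2) by blast
  then show ?thesis by simp
qed

lemma small_finite:
  assumes "sufficiently_saturated \<kappa> U" "finite C" shows "|C| <o \<kappa>"
  using assms finite_iff_ordLess_natLeq[of C] ordLess_transitive unfolding sufficiently_saturated_def by blast

section \<open>Models of the model companion\<close>

primrec tm_pow :: "tm \<Rightarrow> nat \<Rightarrow> tm" where
  "tm_pow t 0 = tm.One"
| "tm_pow t (Suc n) = tm.Mult (tm_pow t n) t"

lemma eval_pow: "Defs.eval R e (tm_pow t n) = Defs.eval R e t [^]\<^bsub>R\<^esub> n"
  by (induction n) auto

definition sol_fm :: "nat \<Rightarrow> nat \<Rightarrow> fm" where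
  "sol_fm p k = FAnd (FNot (FEq (tm.Var 0) tm.Zero)) (FEq (tm.Der (tm.Var 0)) (tm_pow (tm.Var 0) (p ^ k + 1)))"

lemma holds_sol_fm: "holds R (sol_fm p k) (x # xs) \<longleftrightarrow> x \<noteq> \<zero>\<^bsub>R\<^esub> \<and> der R x = x [^]\<^bsub>R\<^esub> (p ^ k + 1)"
  unfolding sol_fm_def holds_lenv sat.simps eval_pow Defs.eval.simps by (simp add: lenv_def)

lemma sols_sol_fm: "sols R (sol_fm p k, cs) = nonzero_solutions p k R"
  unfolding sols_def fst_conv snd_conv holds_sol_fm nonzero_solutions_def by auto

lemma lenv_Cons: "(\<lambda>i. lenv R xs (i - 1))(0 := x) = lenv R (x # xs)"
  by (auto simp: lenv_def nth_Cons split: nat.splits)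

text \<open>The formula does not depend on the structure. Finiteness of a definable set, being the
  failure of \<open>many R m\<close> for some \<open>m\<close>, can therefore be transferred between
  structures.\<close>

lemma many_fm: "\<exists>\<chi>. \<forall>(R :: 'u diff_ring) e. sat R e \<chi> \<longleftrightarrow> many R m (\<lambda>x. sat R (e(0 := x)) \<phi>)"
proof (induction m arbitrary: \<phi>)
  case 0
  show ?case by (intro exI[of _ "FEq tm.Zero tm.Zero"]) (simp add: many_def)
next
  case (Suc m)
  define k where "k = Suc (fm_vars \<phi>)"
  obtain \<chi> where \<chi>: "\<forall>(R :: 'u diff_ring) e. sat R e \<chi> \<longleftrightarrow> many R m (\<lambda>x. sat R (e(0 := x)) (FAnd \<phi> (FNot (FEq (tm.Var 0) (tm.Var k)))))"
    using Suc by blast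
  obtain \<psi> where \<psi>: "\<forall>(R :: 'u diff_ring) e. sat R e \<psi> \<longleftrightarrow> sat R (\<lambda>i. e ((id(0 := k)) i)) \<phi>" using sat_rename by blast
  have 1: "sat R (\<lambda>i. (e(k := z)) ((id(0 := k)) i)) \<phi> = sat R (e(0 := z)) \<phi>" for R :: "'u diff_ring" and e z
    by (rule sat_cong) (auto simp: k_def)
  have 2: "sat R ((e(k := z))(0 := x)) \<phi> = sat R (e(0 := x)) \<phi>" for R :: "'u diff_ring" and e z x
    by (rule sat_cong) (auto simp: k_def)
  have "sat R e (FEx k (FAnd \<psi> \<chi>)) \<longleftrightarrow> many R (Suc m) (\<lambda>x. sat R (e(0 := x)) \<phi>)" for R :: "'u diff_ring" and e
    unfolding many_Suc sat.simps \<psi>[rule_format] \<chi>[rule_format] 1 2 by (simp add: k_def)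
  then show ?case by blast
qed

lemma many_holds: "\<exists>\<chi>. \<forall>(R :: 'u diff_ring) xs. holds R \<chi> xs \<longleftrightarrow> many R m (\<lambda>x. holds R \<phi> (x # xs))"
proof -
  obtain \<chi> where \<chi>: "\<forall>(R :: 'u diff_ring) e. sat R e \<chi> \<longleftrightarrow> many R m (\<lambda>x. sat R (e(0 := x)) \<phi>)" using many_fm by blast
  obtain \<psi> where \<psi>: "\<forall>(R :: 'u diff_ring) e. sat R e \<psi> \<longleftrightarrow> sat R (\<lambda>i. e (i - 1)) \<chi>"
    using sat_rename[of "\<lambda>i. i - 1" \<chi>] by blast
  have "holds R \<psi> xs \<longleftrightarrow> many R m (\<lambda>x. holds R \<phi> (x # xs))" for R :: "'u diff_ring" and xs
    unfolding holds_lenv \<psi>[rule_format] \<chi>[rule_format] lenv_Cons by (rule refl)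
  then show ?thesis by blast
qed

lemma many_one: "many R (Suc 0) P \<longleftrightarrow> (\<exists>x\<in>carrier R. P x)"
  unfolding many_Suc by (simp add: many_def)

lemma emb_zero:
  assumes "differential_ring M" "differential_ring N" "diff_embedding h M N"
  shows "h \<zero>\<^bsub>M\<^esub> = \<zero>\<^bsub>N\<^esub>"
proof -
  interpret M: differential_ring M by fact
  interpret N: differential_ring N by fact
  show ?thesis by (rule ring_hom_zero[OF _ M.ring_axioms N.ring_axioms]) (use assms(3) in \<open>simp add: diff_embedding_def\<close>)
qed

lemma emb_comp:
  assumes "diff_embedding f M N" "diff_embedding g N L"
  shows "diff_embedding (g \<circ> f) M L"
proof -
  have "f x \<in> carrier N" if "x \<in> carrier M" for x
    using assms(1) that ring_hom_closed unfolding diff_embedding_def by metis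
  then show ?thesis using assms unfolding diff_embedding_def
    by (auto intro: ring_hom_trans simp: inj_on_def)
qed

lemma eval_emb:
  assumes M: "differential_ring M" and N: "differential_ring N" and h: "diff_embedding h M N" and e: "\<And>i. e i \<in> carrier M"
  shows "Defs.eval M e t \<in> carrier M \<and> h (Defs.eval M e t) = Defs.eval N (\<lambda>i. h (e i)) t"
proof -
  interpret M: differential_ring M by fact
  interpret N: differential_ring N by fact
  have hom: "h \<in> ring_hom M N" using h by (simp add: diff_embedding_def)
  interpret H: ring_hom_cring M N h by unfold_locales (rule hom)
  show ?thesis
    by (induction t) (use e h M.der_closed emb_zero[OF M N h] in \<open>auto simp: diff_embedding_def\<close>)
qed

lemma lenv_map: "h \<zero>\<^bsub>M\<^esub> = \<zero>\<^bsub>N\<^esub> \<Longrightarrow> lenv N (map h xs) = (\<lambda>i. h (lenv M xs i))"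
  by (auto simp: lenv_def)

lemma lenv_carrier: "\<lbrakk>set xs \<subseteq> carrier R; \<zero>\<^bsub>R\<^esub> \<in> carrier R\<rbrakk> \<Longrightarrow> lenv R xs i \<in> carrier R"
  using nth_mem[of i xs] by (auto simp: lenv_def)

lemma differential_field_ring: "differential_field p R \<Longrightarrow> differential_ring R"
  by (simp add: differential_field_def)

text \<open>The boolean is the polarity: \<open>False\<close> marks an inequation.\<close>

fun lits_fm :: "(bool \<times> tm \<times> tm) list \<Rightarrow> fm" where
  "lits_fm [] = FEq tm.Zero tm.Zero"
| "lits_fm ((b, s, t) # ls) = FAnd (if b then FEq s t else FNot (FEq s t)) (lits_fm ls)"

lemma sat_lits: "sat R e (lits_fm ls) \<longleftrightarrow> (\<forall>(b, s, t)\<in>set ls. (Defs.eval R e s = Defs.eval R e t) = b)"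
  by (induction ls rule: lits_fm.induct) auto

section \<open>Consequences of model completeness\<close>

context
  fixes p :: nat and DCF :: "fm set" and U :: "'u::infinite diff_ring" (structure)
  assumes p: "prime p" and mc: "model_companion DCF (differential_field p :: 'u diff_ring \<Rightarrow> bool)"
    and U: "is_model U DCF"
begin

lemma U_ring: "differential_ring U" using U by (simp add: is_model_def)

lemma extend_to_model: "differential_field p M \<Longrightarrow> \<exists>(N :: 'u diff_ring) h. is_model N DCF \<and> diff_embedding h M N" for M :: "'u diff_ring"
  using mc unfolding model_companion_def by blast

lemma model_complete: "\<lbrakk>is_model N DCF; diff_embedding h U N\<rbrakk> \<Longrightarrow> elementary_embedding h U N" for N :: "'u diff_ring"
  using mc U unfolding model_companion_def by blast

lemma elementary_over:
  fixes L :: "'u diff_ring"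
  assumes L: "differential_field p L" and i: "diff_embedding i U L"
  shows "\<exists>(N :: 'u diff_ring) j. differential_ring N \<and> diff_embedding j L N \<and> elementary_embedding (j \<circ> i) U N"
proof -
  obtain N :: "'u diff_ring" and j where N: "is_model N DCF" "diff_embedding j L N"
    using extend_to_model[OF L] by blast
  have "elementary_embedding (j \<circ> i) U N" by (rule model_complete[OF N(1) emb_comp[OF i N(2)]])
  then show ?thesis using N unfolding is_model_def by blast
qed

text \<open>Existential closedness of \<open>U\<close>: the extension \<open>L\<close> embeds in a
  model in which \<open>U\<close> is elementary, so the existence of a solution descends from
  \<open>L\<close> to \<open>U\<close>.\<close>

lemma solve_in_model:
  fixes L :: "'u diff_ring"
  assumes L: "differential_field p L" and i: "diff_embedding i U L" and xs: "set xs \<subseteq> carrier U"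
    and t: "t \<in> carrier L" "\<forall>(b, s, r)\<in>set ls. (Defs.eval L (lenv L (t # map i xs)) s = Defs.eval L (lenv L (t # map i xs)) r) = b"
  shows "\<exists>u\<in>carrier U. \<forall>(b, s, r)\<in>set ls. (Defs.eval U (lenv U (u # xs)) s = Defs.eval U (lenv U (u # xs)) r) = b"
proof -
  obtain N :: "'u diff_ring" and j where N: "differential_ring N" "diff_embedding j L N" "elementary_embedding (j \<circ> i) U N"
    using elementary_over[OF L i] by blast
  note Lr = differential_field_ring[OF L]
  interpret Lr: differential_ring L by (rule Lr)
  interpret Ur: differential_ring U by (rule U_ring)
  have ih: "i x \<in> carrier L" if "x \<in> carrier U" for x
    using ring_hom_closed[of i U L x] i that by (simp add: diff_embedding_def)
  have jt: "j t \<in> carrier N" using ring_hom_closed[of j L N t] N(2) t(1) by (simp add: diff_embedding_def)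
  have inj: "inj_on j (carrier L)" using N(2) by (simp add: diff_embedding_def)
  obtain \<chi> where \<chi>: "\<forall>(R :: 'u diff_ring) ys. holds R \<chi> ys \<longleftrightarrow> many R (Suc 0) (\<lambda>x. holds R (lits_fm ls) (x # ys))"
    using many_holds[of "Suc 0" "lits_fm ls"] by blast
  have c: "lenv L (t # map i xs) n \<in> carrier L" for n by (rule lenv_carrier) (use t(1) xs ih in auto)
  have le: "lenv N (j t # map (j \<circ> i) xs) = (\<lambda>n. j (lenv L (t # map i xs) n))"
    using lenv_map[of j L N "t # map i xs", OF emb_zero[OF Lr N(1,2)]] by simp
  have ev: "(Defs.eval N (lenv N (j t # map (j \<circ> i) xs)) s = Defs.eval N (lenv N (j t # map (j \<circ> i) xs)) r)
    = (Defs.eval L (lenv L (t # map i xs)) s = Defs.eval L (lenv L (t # map i xs)) r)" for s r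
  proof -
    have s: "Defs.eval L (lenv L (t # map i xs)) s \<in> carrier L" "j (Defs.eval L (lenv L (t # map i xs)) s) = Defs.eval N (\<lambda>n. j (lenv L (t # map i xs) n)) s" for s
      using eval_emb[OF Lr N(1,2), of "lenv L (t # map i xs)" s, OF c] by auto
    show ?thesis unfolding le s(2)[symmetric] by (rule inj_on_eq_iff[OF inj s(1) s(1)])
  qed
  have "holds N (lits_fm ls) (j t # map (j \<circ> i) xs)" unfolding holds_lenv sat_lits ev by (rule t(2))
  then have "holds N \<chi> (map (j \<circ> i) xs)" unfolding \<chi>[rule_format] many_one using jt by blast
  then have "holds U \<chi> xs" using N(3) xs unfolding elementary_embedding_def by blast
  then show ?thesis unfolding \<chi>[rule_format] many_one unfolding holds_lenv sat_lits .
qed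

text \<open>A model is at first only a differential ring inside a differential field. Inverses exist
  in the larger field, and existential closedness brings them back.\<close>

lemma model_dfield: "dfield p U"
proof -
  obtain L :: "'u diff_ring" and h where L: "differential_field p L" "diff_embedding h U L"
    using mc U unfolding model_companion_def by blast
  interpret Ur: differential_ring U by (rule U_ring)
  have F: "field L" and ch: "[p] \<cdot>\<^bsub>L\<^esub> \<one>\<^bsub>L\<^esub> = \<zero>\<^bsub>L\<^esub>" using L(1) by (auto simp: differential_field_def)
  interpret L: field L by (rule F)
  have hom: "h \<in> ring_hom U L" and inj: "inj_on h (carrier U)" using L(2) by (auto simp: diff_embedding_def)
  interpret H: ring_hom_cring U L h by unfold_locales (rule hom)
  have "h ([n] \<cdot> \<one>) = [n] \<cdot>\<^bsub>L\<^esub> \<one>\<^bsub>L\<^esub>" for n :: nat by (induction n) auto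
  then have "h ([p] \<cdot> \<one>) = h \<zero>" using ch by simp
  then have char: "[p] \<cdot> \<one> = \<zero>" by (rule inj_onD[OF inj]) simp_all
  have "field U"
  proof (rule Ur.cring_fieldI2)
    show "\<zero> \<noteq> \<one>" using H.hom_zero H.hom_one L.one_not_zero by metis
    fix a assume a: "a \<in> carrier U" "a \<noteq> \<zero>"
    have ha: "h a \<in> carrier L" "h a \<noteq> \<zero>\<^bsub>L\<^esub>" using a inj_on_eq_iff[OF inj a(1) Ur.zero_closed] by auto
    note iv = L.inv_nonzero[OF ha]
    have "\<exists>u\<in>carrier U. \<forall>(b, s, r)\<in>set [(True, tm.Mult (tm.Var 1) (tm.Var 0), tm.One)].
        (Defs.eval U (lenv U (u # [a])) s = Defs.eval U (lenv U (u # [a])) r) = b"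
      by (rule solve_in_model[OF L _ iv(1)]) (use a iv in \<open>auto simp: lenv_def\<close>)
    then show "\<exists>b\<in>carrier U. a \<otimes> b = \<one>" by (auto simp: lenv_def)
  qed
  then show ?thesis using p U_ring char by (simp add: dfield_def differential_field_def)
qed

lemma model_root:
  assumes c: "c \<in> carrier U" "der U c = \<zero>"
  shows "\<exists>x\<in>carrier U. x [^] p = c"
proof -
  obtain L :: "'u diff_ring" and i y where L: "differential_field p L" "diff_embedding i U L" "y \<in> carrier L" "y [^]\<^bsub>L\<^esub> p = i c"
    using exists_root_extension[OF model_dfield c] by blast
  have "\<exists>u\<in>carrier U. \<forall>(b, s, r)\<in>set [(True, tm_pow (tm.Var 0) p, tm.Var 1)].
      (Defs.eval U (lenv U (u # [c])) s = Defs.eval U (lenv U (u # [c])) r) = b"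
    by (rule solve_in_model[OF L(1,2) _ L(3)]) (use c L(4) in \<open>auto simp: lenv_def eval_pow\<close>)
  then show ?thesis by (auto simp: lenv_def eval_pow)
qed

text \<open>A finite set of solutions can be evaded by a new solution in an extension, and
  existential closedness would find such a solution in \<open>U\<close>.\<close>

lemma model_infinite_solutions: "infinite (nonzero_solutions p k U)"
proof
  assume fin: "finite (nonzero_solutions p k U)"
  interpret dfield p U by (rule model_dfield)
  \<comment> \<open>Zero joins the elements to be evaded, since it satisfies the equation
    too.\<close>
  have "finite (insert \<zero> (nonzero_solutions p k U))" using fin by simp
  from finite_list[OF this] obtain vs where vs: "set vs = insert \<zero> (nonzero_solutions p k U)" ..
  have vsc: "set vs \<subseteq> carrier U" unfolding vs nonzero_solutions_def by auto
  obtain L :: "'u diff_ring" and i t where L: "differential_field p L" "diff_embedding i U L" "t \<in> carrier L"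
    "der L t = t [^]\<^bsub>L\<^esub> (p ^ k + 1)" "\<forall>v\<in>set vs. t \<noteq> i v"
    using exists_solution_extension[OF model_dfield vsc, of "p ^ k"] by blast
  \<comment> \<open>One equation, and one inequation for each listed element; variable
    \<open>Suc j\<close> reads entry \<open>j\<close> of the list because variable 0 is the
    unknown.\<close>
  define ls where "ls = (True, tm.Der (tm.Var 0), tm_pow (tm.Var 0) (p ^ k + 1)) # map (\<lambda>j. (False, tm.Var 0, tm.Var (Suc j))) [0..<length vs]"
  have ev: "(\<forall>(b, s, r)\<in>set ls. (Defs.eval R (lenv R (u # ws)) s = Defs.eval R (lenv R (u # ws)) r) = b) \<longleftrightarrow>
    der R u = u [^]\<^bsub>R\<^esub> (p ^ k + 1) \<and> u \<notin> set ws" if "length ws = length vs" for R :: "'u diff_ring" and u ws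
    unfolding ls_def using that by (auto simp: lenv_def eval_pow in_set_conv_nth simp del: nat_pow_Suc)
  have "t \<notin> set (map i vs)" using L(5) by auto
  then have "\<forall>(b, s, r)\<in>set ls. (Defs.eval L (lenv L (t # map i vs)) s = Defs.eval L (lenv L (t # map i vs)) r) = b"
    unfolding ev[OF length_map] using L(4) by blast
  then have "\<exists>u\<in>carrier U. \<forall>(b, s, r)\<in>set ls. (Defs.eval U (lenv U (u # vs)) s = Defs.eval U (lenv U (u # vs)) r) = b"
    by (rule solve_in_model[OF L(1,2) vsc L(3)])
  then obtain u where u: "u \<in> carrier U" "der U u = u [^] (p ^ k + 1)" "u \<notin> set vs" unfolding ev[OF refl] by blast
  then show False unfolding vs nonzero_solutions_def by blast
qed

text \<open>Amalgamate two copies of \<open>U\<close> along \<open>\<sigma>\<close> and embed the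
  amalgam in a model. Both copies are elementary in it, and there an element of \<open>K\<close> in
  the first copy coincides with its image under \<open>\<sigma>\<close> in the second.\<close>

lemma model_elementary:
  assumes K: "dfield.good p U K" and \<sigma>: "diff_hom_on K U U \<sigma>" and xs: "set xs \<subseteq> K"
  shows "holds U \<phi> xs \<longleftrightarrow> holds U \<phi> (map \<sigma> xs)"
proof -
  interpret dfield p U by (rule model_dfield)
  have Kd: "dsub K" using K by (simp add: good_def)
  have T: "tensor p U U K \<sigma>" by (intro tensor.intro tensor_axioms.intro dfield_axioms dsubD(1,10)[OF Kd] \<sigma>)
  obtain L :: "'u diff_ring" and i j where L: "differential_field p L" "diff_embedding i U L" "diff_embedding j U L"
    "\<forall>k\<in>K. i k = j (\<sigma> k)"
    using exists_amalgam[OF T good_sep[OF K T]] by blast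
  obtain N :: "'u diff_ring" and g where N: "is_model N DCF" "diff_embedding g L N"
    using extend_to_model[OF L(1)] by blast
  have e: "elementary_embedding (g \<circ> i) U N" "elementary_embedding (g \<circ> j) U N"
    by (rule model_complete[OF N(1) emb_comp[OF L(2) N(2)]], rule model_complete[OF N(1) emb_comp[OF L(3) N(2)]])
  have xsc: "set xs \<subseteq> carrier U" using xs dsubD(2)[OF Kd] by auto
  have \<sigma>xs: "set (map \<sigma> xs) \<subseteq> carrier U" using xs diff_hom_onD(1)[OF \<sigma>] by auto
  have "holds U \<phi> xs \<longleftrightarrow> holds N \<phi> (map (g \<circ> i) xs)" using e(1) xsc unfolding elementary_embedding_def by blast
  also have "map (g \<circ> i) xs = map (g \<circ> j) (map \<sigma> xs)" using L(4) xs by auto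
  also have "holds N \<phi> (map (g \<circ> j) (map \<sigma> xs)) \<longleftrightarrow> holds U \<phi> (map \<sigma> xs)" using e(2) \<sigma>xs unfolding elementary_embedding_def by blast
  finally show ?thesis .
qed

end

text \<open>Collects what the sequel uses of the model companion: roots of constants, infinitely
  many solutions, and elementarity of homomorphisms on good subfields. The theory itself no longer
  occurs.\<close>

locale saturated_dcf = dfield p U for p and U :: "'u::infinite diff_ring" (structure) +
  fixes \<kappa> :: "'k rel"
  assumes saturated: "sufficiently_saturated \<kappa> U"
    and root: "\<lbrakk>c \<in> carrier U; der U c = \<zero>\<rbrakk> \<Longrightarrow> \<exists>x\<in>carrier U. x [^] p = c"
    and infinite_sol: "infinite (sol k)"
    and elementary: "\<lbrakk>good K; diff_hom_on K U U \<sigma>; set xs \<subseteq> K\<rbrakk> \<Longrightarrow> holds U \<phi> xs \<longleftrightarrow> holds U \<phi> (map \<sigma> xs)"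
begin

section \<open>Algebraic closures as tame subfields\<close>

lemma acl_holds:
  assumes "set as \<subseteq> acl U C" "finite {y \<in> carrier U. holds U \<phi> (y # as)}" "x \<in> carrier U" "holds U \<phi> (x # as)"
  shows "x \<in> acl U C"
proof (rule acl_finite[OF holds_dfb[OF assms(1), of U \<phi> 1]])
  show "finite {y \<in> carrier U. holds U \<phi> (map (\<lambda>_. y) [0..<1] @ as)}" using assms(2) by simp
qed (use assms in simp_all)

lemma acl_unique:
  assumes "set as \<subseteq> acl U C" "\<And>y z. \<lbrakk>y \<in> carrier U; z \<in> carrier U; holds U \<phi> (y # as); holds U \<phi> (z # as)\<rbrakk> \<Longrightarrow> y = z"
    "x \<in> carrier U" "holds U \<phi> (x # as)"
  shows "x \<in> acl U C"
proof (rule acl_holds[OF assms(1) _ assms(3,4)])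
  have "{y \<in> carrier U. holds U \<phi> (y # as)} \<subseteq> {x}"
  proof
    fix y assume "y \<in> {y \<in> carrier U. holds U \<phi> (y # as)}"
    then have "y = x" by (intro assms(2)[OF _ assms(3) _ assms(4)]) simp_all
    then show "y \<in> {x}" by simp
  qed
  then show "finite {y \<in> carrier U. holds U \<phi> (y # as)}" by (rule finite_subset) simp
qed

text \<open>In characteristic \<open>p\<close> a root of order \<open>p^k\<close> is unique, hence
  definable from its power.\<close>

lemma acl_root:
  assumes "x \<in> carrier U" "x [^] (p ^ k) \<in> acl U C" shows "x \<in> acl U C"
proof (rule acl_unique[where as = "[x [^] (p ^ k)]" and \<phi> = "FEq (tm_pow (tm.Var 0) (p ^ k)) (tm.Var 1)"])
  fix y z assume "y \<in> carrier U" "z \<in> carrier U" "holds U (FEq (tm_pow (tm.Var 0) (p ^ k)) (tm.Var 1)) (y # [x [^] (p ^ k)])"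
    "holds U (FEq (tm_pow (tm.Var 0) (p ^ k)) (tm.Var 1)) (z # [x [^] (p ^ k)])"
  then show "y = z" by (intro frob_pow_inj[of y z k]) (simp_all add: holds_lenv lenv_def eval_pow)
qed (use assms in \<open>simp_all add: holds_lenv lenv_def eval_pow\<close>)

lemma acl_term:
  assumes "set as \<subseteq> acl U C" "Defs.eval U (lenv U as) t \<in> carrier U"
  shows "Defs.eval U (lenv U as) t \<in> acl U C"
proof -
  have h: "holds U (FEq (tm.Var 0) (tm_ren Suc t)) (y # as) \<longleftrightarrow> y = Defs.eval U (lenv U as) t" for y
  proof -
    have "(\<lambda>i. lenv U (y # as) (Suc i)) = lenv U as" by (auto simp: lenv_def)
    then show ?thesis unfolding holds_lenv sat.simps eval_ren by (simp add: lenv_def)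
  qed
  show ?thesis by (rule acl_unique[OF assms(1), where \<phi> = "FEq (tm.Var 0) (tm_ren Suc t)"]) (use assms(2) in \<open>simp_all add: h\<close>)
qed

lemma dfb_span:
  "set as \<subseteq> A \<Longrightarrow> set as \<subseteq> carrier U \<Longrightarrow> dfb U A (\<lambda>e. e 0 \<in> Span cst as)"
proof (induction as)
  case Nil
  show ?case using dfb_eq[of U A "tm.Var 0" tm.Zero] by simp
next
  case (Cons a as)
  have IH: "dfb U A (\<lambda>e. e 0 \<in> Span cst as)" and a: "a \<in> A" "a \<in> carrier U" and as: "set as \<subseteq> carrier U" using Cons by auto
  have 1: "dfb U A (\<lambda>e. e 2 \<in> Span cst as)" by (rule dfb_sub[OF IH, of "\<lambda>_. 2"])
  have 2: "dfb U A (\<lambda>e. der U (e 1) = \<zero>)" using dfb_eq[of U A "tm.Der (tm.Var 1)" tm.Zero] by simp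
  \<comment> \<open>Terms contain no parameters, so \<open>a\<close> is supplied as the value of an
    extra variable, which is then quantified away.\<close>
  have 3: "dfb U A (\<lambda>e. e 3 = a)" by (rule dfb_param[OF a(1)])
  have 4: "dfb U A (\<lambda>e. e 0 = e 1 \<otimes> e 3 \<oplus> e 2)"
    using dfb_eq[of U A "tm.Var 0" "tm.Add (tm.Mult (tm.Var 1) (tm.Var 3)) (tm.Var 2)"] by simp
  have "dfb U A (\<lambda>e. \<exists>k\<in>carrier U. \<exists>w\<in>carrier U. \<exists>z\<in>carrier U. der U k = \<zero> \<and> w \<in> Span cst as \<and> z = a \<and> e 0 = k \<otimes> z \<oplus> w)"
    using dfb_ex[OF dfb_ex[OF dfb_ex[OF dfb_and[OF 2 dfb_and[OF 1 dfb_and[OF 3 4]]], of 3], of 2], of 1] by (simp del: Span.simps)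
  moreover have "x \<in> Span cst (a # as) \<longleftrightarrow> (\<exists>k\<in>carrier U. \<exists>w\<in>carrier U. \<exists>z\<in>carrier U. der U k = \<zero> \<and> w \<in> Span cst as \<and> z = a \<and> x = k \<otimes> z \<oplus> w)" for x
    unfolding span_cons_iff using a(2) sub_span(1)[OF dsubD(1)[OF cst_dsub] as] unfolding cst_def by blast
  ultimately show ?case by (simp only:)
qed

context
  fixes C :: "'u set" assumes C: "C \<subseteq> carrier U"
begin

lemma acl_dsub: "dsub (acl U C)"
proof -
  have c: "x \<in> carrier U" if "x \<in> acl U C" for x by (rule subsetD[OF acl_carrier that])
  have one: "\<one> \<in> acl U C" using acl_term[of "[]" C tm.One] by simp
  have "subfield (acl U C) U"
  proof (rule subfieldI')
    show "subring (acl U C) U"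
    proof (rule subringI)
      show "\<ominus> x \<in> acl U C" if "x \<in> acl U C" for x
        using acl_term[of "[x]" C "tm.Neg (tm.Var 0)"] that c by (simp add: lenv_def)
      show "x \<otimes> y \<in> acl U C" if "x \<in> acl U C" "y \<in> acl U C" for x y
        using acl_term[of "[x, y]" C "tm.Mult (tm.Var 0) (tm.Var 1)"] that c by (simp add: lenv_def)
      show "x \<oplus> y \<in> acl U C" if "x \<in> acl U C" "y \<in> acl U C" for x y
        using acl_term[of "[x, y]" C "tm.Add (tm.Var 0) (tm.Var 1)"] that c by (simp add: lenv_def)
    qed (use c one in auto)
    fix x assume x: "x \<in> acl U C - {\<zero>}"
    have xc: "x \<in> carrier U" "x \<noteq> \<zero>" using x c by auto
    note iv = inv_nonzero[OF xc]
    show "inv x \<in> acl U C"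
    proof (rule acl_unique[where as = "[x]" and \<phi> = "FEq (tm.Mult (tm.Var 1) (tm.Var 0)) tm.One"])
      fix y z assume y: "y \<in> carrier U" "z \<in> carrier U" "holds U (FEq (tm.Mult (tm.Var 1) (tm.Var 0)) tm.One) (y # [x])"
        "holds U (FEq (tm.Mult (tm.Var 1) (tm.Var 0)) tm.One) (z # [x])"
      have "x \<otimes> y = x \<otimes> z" using y(3,4) by (simp add: holds_lenv lenv_def)
      then show "y = z" unfolding m_lcancel[OF xc(2,1) y(1,2)] .
    qed (use x iv in \<open>simp_all add: holds_lenv lenv_def\<close>)
  qed
  moreover have "der U x \<in> acl U C" if "x \<in> acl U C" for x
    using acl_term[of "[x]" C "tm.Der (tm.Var 0)"] that c by (simp add: lenv_def)
  ultimately show ?thesis by (simp add: dsub_def)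
qed

text \<open>A constant of the closure has a unique \<open>p\<close>-th root, which is again
  algebraic. An eigenvector of the compositum lies in the span, over the constants, of finitely many
  elements of the closure. The eigenvalues occurring on that span form a finite set definable over
  these elements, so each of them is algebraic.\<close>

lemma acl_tame: "tame (acl U C) (acl U C)"
proof -
  note Ad = dsubD[OF acl_dsub]
  have "good (acl U C)" unfolding good_def
  proof (intro conjI acl_dsub ballI impI)
    fix c assume c: "c \<in> acl U C" "der U c = \<zero>"
    obtain x where x: "x \<in> carrier U" "x [^] p = c" using root[OF Ad(2)[OF c(1)] c(2)] by blast
    have "x \<in> acl U C" by (rule acl_root[of x 1]) (use x c in simp_all)
    then show "\<exists>x\<in>acl U C. x [^] p = c" using x(2) by blast
  qed
  moreover have "submon (acl U C)" unfolding submon_def by (intro conjI ballI acl_carrier Ad(3) Ad(5))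
  moreover have "Ev (acl U C) \<subseteq> acl U C"
  proof
    fix \<theta> assume "\<theta> \<in> Ev (acl U C)"
    then obtain y where y: "\<theta> \<in> cst" "y \<in> EK (acl U C)" "y \<noteq> \<zero>" "der U y = \<theta> \<otimes> y" unfolding Ev_def by blast
    obtain as where as: "set as \<subseteq> acl U C" "y \<in> Span cst as" using EK_span[OF acl_dsub y(2)] by blast
    have asc: "set as \<subseteq> carrier U" by (rule subset_trans[OF as(1) acl_carrier])
    have sc: "x \<in> carrier U" if "x \<in> Span cst as" for x by (rule sub_span(1)[OF dsubD(1)[OF cst_dsub] asc that])
    have 1: "dfb U (acl U C) (\<lambda>e. e 1 \<in> Span cst as)" by (rule dfb_sub[OF dfb_span[OF as(1) asc], of "\<lambda>_. 1"])
    have 2: "dfb U (acl U C) (\<lambda>e. e 1 \<noteq> \<zero>)" using dfb_not[OF dfb_eq[of U _ "tm.Var 1" tm.Zero]] by simp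
    have 3: "dfb U (acl U C) (\<lambda>e. der U (e 1) = e 0 \<otimes> e 1)"
      using dfb_eq[of U _ "tm.Der (tm.Var 1)" "tm.Mult (tm.Var 0) (tm.Var 1)"] by simp
    have 4: "dfb U (acl U C) (\<lambda>e. der U (e 0) = \<zero>)" using dfb_eq[of U _ "tm.Der (tm.Var 0)" tm.Zero] by simp
    define Q where "Q = (\<lambda>e :: nat \<Rightarrow> 'u. der U (e 0) = \<zero> \<and> (\<exists>y\<in>carrier U. y \<in> Span cst as \<and> y \<noteq> \<zero> \<and> der U y = e 0 \<otimes> y))"
    have Q: "dfb U (acl U C) Q"
      unfolding Q_def using dfb_and[OF 4 dfb_ex[OF dfb_and[OF 1 dfb_and[OF 2 3]], of 1]] by (simp del: Span.simps)
    have ci: "x \<in> cst \<longleftrightarrow> x \<in> carrier U \<and> der U x = \<zero>" for x by (simp add: cst_def)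
    have "{x \<in> carrier U. Q (\<lambda>_. x)} = {\<theta> \<in> cst. \<exists>y\<in>Span cst as. y \<noteq> \<zero> \<and> der U y = \<theta> \<otimes> y}"
    proof (rule Collect_cong)
      fix x
      show "x \<in> carrier U \<and> Q (\<lambda>_. x) \<longleftrightarrow> x \<in> cst \<and> (\<exists>y\<in>Span cst as. y \<noteq> \<zero> \<and> der U y = x \<otimes> y)"
        unfolding Q_def ci[of x] using sc by blast
    qed
    then have "finite {x \<in> carrier U. Q (\<lambda>_. x)}" using finite_eigenvalues[OF asc] by (simp only:)
    moreover have "Q (\<lambda>_. \<theta>)" unfolding Q_def using y as(2) sc cstD(2)[OF y(1)] by blast
    ultimately show "\<theta> \<in> acl U C" using acl_finite[OF Q] cstD(1)[OF y(1)] by blast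
  qed
  ultimately show ?thesis by (simp add: tame_def)
qed

end

text \<open>The identity of \<open>K\<close> extends to the field generated by \<open>v\<close>,
  sending \<open>v\<close> to \<open>w\<close>. That field is good by \<open>sol_ext\<close>, so the
  extension preserves all formulas.\<close>

lemma tame_same_type:
  assumes T: "tame K S" and k: "k \<ge> 1" and v: "v \<in> sol k" "v [^] (p ^ k) \<notin> S" and w: "w \<in> sol k" "w [^] (p ^ k) \<notin> S"
    and xs: "set xs \<subseteq> K"
  shows "holds U \<phi> (v # xs) \<longleftrightarrow> holds U \<phi> (w # xs)"
proof -
  have K: "dsub K" using T by (simp add: tame_def good_def)
  note V = solD[OF v(1)] and W = solD[OF w(1)]
  have tw: "transc ((\<lambda>x. x) ` K) w" using sol_ext(1)[OF T k w] by simp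
  obtain \<tau> where \<tau>: "diff_hom_on (Fr (PR K v)) U U \<tau>" "\<forall>k\<in>K. \<tau> k = k" "\<tau> v = w"
    using extend_hom[OF K diff_hom_id[OF K] V(1,3) W(1,3) sol_ext(1)[OF T k v] tw] by (elim exE conjE) (rule that; assumption)
  have R: "dring (PR K v)"
    by (rule PR_dring[OF K V(1)]) (simp only: V(3) PR_pow dsubD(4)[OF K])
  have g: "good (Fr (PR K v))" using sol_ext(2)[OF T k v] by (simp add: tame_def)
  have "x \<in> Fr (PR K v)" if "x \<in> set (v # xs)" for x
    by (rule Fr_incl[OF R]) (use that xs in \<open>auto intro: PR_var PR_K\<close>)
  then have "holds U \<phi> (v # xs) \<longleftrightarrow> holds U \<phi> (map \<tau> (v # xs))" by (intro elementary[OF g \<tau>(1)]) blast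
  also have "map \<tau> (v # xs) = w # xs" using \<tau>(2,3) xs by (simp add: map_idI subset_eq)
  finally show ?thesis .
qed

section \<open>Minimality, disintegration and triviality\<close>

lemma sol_definable: "definable_over U C (sol k)"
  unfolding definable_over_def pfms_def using sols_sol_fm[of U p k "[]"] by (intro bexI[of _ "(sol_fm p k, [])"]) auto

text \<open>If both parts were infinite, saturation would place in each a solution outside the
  algebraic closure of the parameters; but any two such solutions have the same type over
  them.\<close>

lemma minimal:
  assumes k: "k \<ge> 1" and f: "f \<in> pfms (carrier U)"
  shows "finite (sol k \<inter> sols U f) \<or> finite (sol k - sols U f)"
proof (rule ccontr)
  assume n: "\<not> (finite (sol k \<inter> sols U f) \<or> finite (sol k - sols U f))"
  define C where "C = set (snd f)"
  have C: "C \<subseteq> carrier U" "|C| <o \<kappa>" using f small_finite[OF saturated] by (auto simp: C_def pfms_def)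
  have fC: "definable_over U C (sols U f)" by (rule pfms_definable) (simp add: pfms_def C_def)
  obtain a where a: "a \<in> sol k \<inter> sols U f" "a \<notin> acl U C"
    using saturated_transcendental[OF saturated C definable_diff(2)[OF sol_definable fC]] n by blast
  obtain b where b: "b \<in> sol k - sols U f" "b \<notin> acl U C"
    using saturated_transcendental[OF saturated C definable_diff(1)[OF sol_definable fC]] n by blast
  have s: "a \<in> sol k" "b \<in> sol k" using a b by auto
  have "a [^] (p ^ k) \<notin> acl U C" "b [^] (p ^ k) \<notin> acl U C"
    using acl_root[OF solD(1)[OF s(1)]] acl_root[OF solD(1)[OF s(2)]] a(2) b(2) by blast+
  then have "holds U (fst f) (a # snd f) \<longleftrightarrow> holds U (fst f) (b # snd f)"
    by (intro tame_same_type[OF acl_tame[OF C(1)] k s(1) _ s(2)]) (use acl_incl[OF C(1)] in \<open>simp_all add: C_def\<close>)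
  then show False using a(1) b(1) solD(1)[OF s(2)] by (simp add: sols_def)
qed

text \<open>The map is kept, and not only the equality of types, because \<open>acl_trivial\<close>
  moves a single solution and needs the others fixed.\<close>

lemma disintegrated:
  assumes k: "k \<ge> 1" and xs: "set xs \<subseteq> sol k" "distinct xs" and ys: "set ys \<subseteq> sol k" "distinct ys" and l: "length xs = length ys"
  shows "\<exists>\<sigma>. map \<sigma> xs = ys \<and> (\<forall>x\<in>PF. \<sigma> x = x) \<and>
    (\<forall>\<phi> cs. set cs \<subseteq> PF \<union> set xs \<longrightarrow> (holds U \<phi> cs \<longleftrightarrow> holds U \<phi> (map \<sigma> cs)))"
proof -
  obtain \<sigma> where \<sigma>: "diff_hom_on (tower xs) U U \<sigma>" "map \<sigma> xs = ys" "\<forall>x\<in>PF. \<sigma> x = x"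
    using tower_hom[OF k l xs(1) ys(1) xs(2) ys(2)] by (elim exE conjE) (rule that; assumption)
  note T = tower_tame[OF k xs]
  have g: "good (tower xs)" using conjunct1[OF T] by (simp only: tame_def)
  have K: "dsub (tower xs)" using g by (simp only: good_def)
  have "PF \<union> set xs \<subseteq> tower xs" using PF_sub[OF K] conjunct1[OF conjunct2[OF T]] by blast
  then show ?thesis using \<sigma>(2,3) elementary[OF g \<sigma>(1)] by (intro exI[of _ \<sigma>] conjI allI impI) (simp_all add: subset_trans)
qed

lemma disintegrated_type:
  assumes k: "k \<ge> 1" and xs: "set xs \<subseteq> sol k" "distinct xs" and ys: "set ys \<subseteq> sol k" "distinct ys" and l: "length xs = length ys"
  shows "same_type U PF xs ys"
proof -
  obtain \<sigma> where \<sigma>: "map \<sigma> xs = ys" "\<forall>x\<in>PF. \<sigma> x = x"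
    "\<forall>\<phi> cs. set cs \<subseteq> PF \<union> set xs \<longrightarrow> (holds U \<phi> cs \<longleftrightarrow> holds U \<phi> (map \<sigma> cs))" using disintegrated[OF assms] by blast
  have "holds U \<phi> (xs @ cs) \<longleftrightarrow> holds U \<phi> (ys @ cs)" if cs: "set cs \<subseteq> PF" for \<phi> cs
  proof -
    have "map \<sigma> cs = cs" using \<sigma>(2) cs by (intro map_idI) blast
    moreover have "set (xs @ cs) \<subseteq> PF \<union> set xs" using cs by auto
    ultimately show ?thesis using \<sigma>(3)[rule_format, of "xs @ cs" \<phi>] \<sigma>(1) by simp
  qed
  then show ?thesis using l by (simp add: same_type_def)
qed

text \<open>Suppose that \<open>a\<close> outside \<open>B\<close> is algebraic over
  \<open>B\<close>. Only finitely many parameters occur, so \<open>a\<close> can be exchanged for a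
  solution \<open>b\<close> different from them and outside the finite definable set containing
  \<open>a\<close>, while all parameters stay fixed.\<close>

lemma acl_trivial:
  assumes k: "k \<ge> 1" and B: "B \<subseteq> sol k" shows "acl U (PF \<union> B) \<inter> sol k = B"
proof
  have "PF \<union> B \<subseteq> carrier U" using B prime_const cstD(1) solD(1) by blast
  then show "B \<subseteq> acl U (PF \<union> B) \<inter> sol k" using acl_incl[of "PF \<union> B" U] B by blast
  show "acl U (PF \<union> B) \<inter> sol k \<subseteq> B"
  proof (rule ccontr)
    assume "\<not> acl U (PF \<union> B) \<inter> sol k \<subseteq> B"
    then obtain a where a: "a \<in> acl U (PF \<union> B)" "a \<in> sol k" "a \<notin> B" by blast
    obtain f where f: "f \<in> pfms (PF \<union> B)" "finite (sols U f)" "a \<in> sols U f"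
      using a(1) unfolding acl_def definable_over_def by blast
    define cs where "cs = snd f"
    have "infinite (sol k - (set cs \<union> sols U f))" using infinite_sol f(2) by (simp add: Diff_infinite_finite)
    then obtain b where b: "b \<in> sol k" "b \<notin> set cs" "b \<notin> sols U f" using infinite_imp_nonempty by blast
    \<comment> \<open>Repetitions are removed because \<open>disintegrated\<close> requires distinct
      entries.\<close>
    define bs where "bs = remdups (filter (\<lambda>x. x \<in> B) cs)"
    have bs: "set bs = B \<inter> set cs" "distinct bs" unfolding bs_def by auto
    obtain \<sigma> where \<sigma>: "map \<sigma> (a # bs) = b # bs" "\<forall>x\<in>PF. \<sigma> x = x"
      "\<forall>\<phi> xs. set xs \<subseteq> PF \<union> set (a # bs) \<longrightarrow> (holds U \<phi> xs \<longleftrightarrow> holds U \<phi> (map \<sigma> xs))"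
      using disintegrated[OF k, of "a # bs" "b # bs"] a b bs B by auto
    have cs: "set cs \<subseteq> PF \<union> B" using f(1) by (simp add: cs_def pfms_def)
    have "\<sigma> x = x" if "x \<in> set bs" for x using \<sigma>(1) that by (auto simp: map_eq_conv[of _ _ id, simplified])
    then have "map \<sigma> cs = cs" using \<sigma>(2) cs bs(1) by (intro map_idI) blast
    moreover have "set (a # cs) \<subseteq> PF \<union> set (a # bs)" using cs bs(1) by auto
    ultimately have "holds U (fst f) (a # cs) \<longleftrightarrow> holds U (fst f) (b # cs)"
      using \<sigma>(3)[rule_format, of "a # cs" "fst f"] \<sigma>(1) by simp
    then show False using f(3) b(3) solD(1)[OF b(1)] by (simp add: sols_def cs_def)
  qed
qed

text \<open>Saturation realises the type of a tuple of \<open>N\<close> inside \<open>U\<close>, one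
  coordinate at a time: a finite part of the type is a single conjunction, and its satisfiability is
  a formula about the coordinates already chosen.\<close>

lemma realize_list:
  fixes N :: "'u diff_ring"
  assumes N: "elementary_embedding h U N"
  shows "set ys \<subseteq> carrier N \<Longrightarrow> \<exists>xs. set xs \<subseteq> carrier U \<and> length xs = length ys \<and> (\<forall>\<phi>. holds U \<phi> xs \<longleftrightarrow> holds N \<phi> ys)"
proof (induction ys)
  case Nil
  have "holds U \<phi> [] \<longleftrightarrow> holds N \<phi> (map h [])" for \<phi>
    using N unfolding elementary_embedding_def by (metis empty_subsetI list.set(1))
  then show ?case by (intro exI[of _ "[]"]) simp
next
  case (Cons d ys)
  obtain xs where xs: "set xs \<subseteq> carrier U" "length xs = length ys" "\<forall>\<phi>. holds U \<phi> xs \<longleftrightarrow> holds N \<phi> ys" using Cons by auto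
  define \<X> where "\<X> = {sols U (\<phi>, xs) | \<phi>. holds N \<phi> (d # ys)}"
  have "\<exists>x\<in>carrier U. \<forall>X\<in>\<X>. x \<in> X"
  proof (rule saturated_realize[OF saturated xs(1) small_finite[OF saturated finite_set]])
    show "definable_over U (set xs) X" if "X \<in> \<X>" for X
      using that unfolding \<X>_def by (auto intro!: pfms_definable simp: pfms_def)
    have conj: "\<exists>\<phi>. holds N \<phi> (d # ys) \<and> (\<forall>X\<in>F. sols U (\<phi>, xs) \<subseteq> X)" if "finite F" "F \<subseteq> \<X>" for F
      using that
    proof (induction F rule: finite_induct)
      case empty
      show ?case by (intro exI[of _ "FEq tm.Zero tm.Zero"]) (simp add: holds_def)
    next
      case (insert X F)
      obtain \<phi> where \<phi>: "holds N \<phi> (d # ys)" "\<forall>X\<in>F. sols U (\<phi>, xs) \<subseteq> X" using insert by auto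
      obtain \<psi> where \<psi>: "holds N \<psi> (d # ys)" "X = sols U (\<psi>, xs)" using insert(4) unfolding \<X>_def by auto
      have "sols U (FAnd \<phi> \<psi>, xs) = sols U (\<phi>, xs) \<inter> sols U (\<psi>, xs)" by (auto simp: sols_def holds_def)
      then show ?case using \<phi> \<psi> by (intro exI[of _ "FAnd \<phi> \<psi>"]) (auto simp: holds_def)
    qed
    fix F assume "F \<subseteq> \<X>" "finite F"
    then obtain \<phi> where \<phi>: "holds N \<phi> (d # ys)" "\<forall>X\<in>F. sols U (\<phi>, xs) \<subseteq> X" using conj by blast
    obtain \<chi> where \<chi>: "\<forall>(R :: 'u diff_ring) zs. holds R \<chi> zs \<longleftrightarrow> many R (Suc 0) (\<lambda>x. holds R \<phi> (x # zs))"
      using many_holds[of "Suc 0" \<phi>] by blast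
    have "holds N \<chi> ys" unfolding \<chi>[rule_format] many_one using \<phi>(1) Cons.prems by auto
    then have "holds U \<chi> xs" using xs(3) by blast
    then obtain x where "x \<in> carrier U" "holds U \<phi> (x # xs)" unfolding \<chi>[rule_format] many_one by blast
    then show "\<exists>x\<in>carrier U. \<forall>X\<in>F. x \<in> X" using \<phi>(2) by (intro bexI[of _ x]) (auto simp: sols_def)
  qed
  then obtain x where x: "x \<in> carrier U" "\<forall>X\<in>\<X>. x \<in> X" by blast
  have le: "holds U \<phi> (x # xs)" if "holds N \<phi> (d # ys)" for \<phi>
  proof -
    have "x \<in> sols U (\<phi>, xs)" using x(2) that unfolding \<X>_def by blast
    then show ?thesis by (simp add: sols_def)
  qed
  have "holds U \<phi> (x # xs) \<longleftrightarrow> holds N \<phi> (d # ys)" for \<phi>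
    using le[of \<phi>] le[of "FNot \<phi>"] unfolding holds_lenv by auto
  then show ?case using x(1) xs(1,2) by (intro exI[of _ "x # xs"]) simp
qed

lemma many_finite: "finite {x \<in> carrier R. P x} \<longleftrightarrow> (\<exists>m. \<not> many R m P)"
  unfolding many_def by (metis lessI not_le)

text \<open>Parameters from an elementary extension are replaced by a tuple of \<open>U\<close> with
  the same type. Finiteness is the failure of some counting formula, so minimality in
  \<open>U\<close> passes to the extension.\<close>

lemma strongly_minimal_sol:
  assumes k: "k \<ge> 1" shows "strongly_minimal U PF (sol k)"
  unfolding strongly_minimal_def
proof (intro exI[of _ "sol_fm p k"] exI[of _ "[]"] conjI allI impI ballI)
  show "set [] \<subseteq> PF" "sol k = sols U (sol_fm p k, [])" by (simp_all add: sols_sol_fm)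
  fix N :: "'u diff_ring" and h assume N: "elementary_embedding h U N"
  have tr: "finite {x \<in> carrier N. holds N \<phi> (x # ys)} \<longleftrightarrow> finite {x \<in> carrier U. holds U \<phi> (x # xs)}"
    if "\<forall>\<phi>. holds U \<phi> xs \<longleftrightarrow> holds N \<phi> ys" for \<phi> xs ys
  proof -
    have "many N m (\<lambda>x. holds N \<phi> (x # ys)) \<longleftrightarrow> many U m (\<lambda>x. holds U \<phi> (x # xs))" for m
    proof -
      obtain \<chi> where "\<forall>(R :: 'u diff_ring) zs. holds R \<chi> zs \<longleftrightarrow> many R m (\<lambda>x. holds R \<phi> (x # zs))"
        using many_holds[of m \<phi>] by blast
      then show ?thesis using that by blast
    qed
    then show ?thesis unfolding many_finite by simp
  qed
  have m: "map h [] = []" by simp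
  \<comment> \<open>The empty tuple expresses that \<open>U\<close> and \<open>N\<close> satisfy the
    same sentences.\<close>
  obtain xs0 where "length xs0 = length ([] :: 'u list)" "\<forall>\<phi>. holds U \<phi> xs0 \<longleftrightarrow> holds N \<phi> []"
    using realize_list[OF N, of "[]"] by auto
  then have "finite {x \<in> carrier N. holds N (sol_fm p k) [x]} \<longleftrightarrow> finite {x \<in> carrier U. holds U (sol_fm p k) [x]}"
    using tr[of "[]" "[]"] by simp
  then show "infinite (sols N (sol_fm p k, map h []))"
    using infinite_sol[of k] sols_sol_fm[of U p k "[]"] unfolding m sols_def by simp
  fix f assume f: "f \<in> pfms (carrier N)"
  obtain \<phi> ys where fp: "f = (\<phi>, ys)" by (cases f)
  have "set ys \<subseteq> carrier N" using f by (simp add: fp pfms_def)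
  then obtain xs where xs: "set xs \<subseteq> carrier U" "\<forall>\<phi>. holds U \<phi> xs \<longleftrightarrow> holds N \<phi> ys" using realize_list[OF N] by blast
  have hf: "holds R (FAnd \<phi> \<psi>) zs \<longleftrightarrow> holds R \<phi> zs \<and> holds R \<psi> zs" "holds R (FNot \<phi>) zs \<longleftrightarrow> \<not> holds R \<phi> zs"
    for R :: "'u diff_ring" and \<phi> \<psi> zs by (simp_all add: holds_lenv)
  have s: "sols R (sol_fm p k, zs') \<inter> sols R (\<phi>, zs) = {x \<in> carrier R. holds R (FAnd (sol_fm p k) \<phi>) (x # zs)}"
    "sols R (sol_fm p k, zs') - sols R (\<phi>, zs) = {x \<in> carrier R. holds R (FAnd (sol_fm p k) (FNot \<phi>)) (x # zs)}"
    for R :: "'u diff_ring" and zs zs'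
    unfolding sols_def fst_conv snd_conv hf holds_sol_fm by blast+
  have "finite (sol k \<inter> sols U (\<phi>, xs)) \<or> finite (sol k - sols U (\<phi>, xs))"
    by (rule minimal[OF k]) (use xs(1) in \<open>simp add: pfms_def\<close>)
  then show "finite (sols N (sol_fm p k, map h []) \<inter> sols N f) \<or> finite (sols N (sol_fm p k, map h []) - sols N f)"
    unfolding fp s tr[OF xs(2)] sols_sol_fm[of U p k "[]", symmetric] .
qed

section \<open>Generic types and forking\<close>

definition gen :: "nat \<Rightarrow> 'u set \<Rightarrow> 'u pfm set" where
  "gen k B = {f \<in> pfms B. finite (sol k - sols U f)}"

lemma sol_minus_finite:
  assumes "finite X" shows "\<exists>x\<in>sol k. x \<notin> X"
proof -
  have "\<not> sol k \<subseteq> X" using assms infinite_sol finite_subset by blast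
  then show ?thesis by blast
qed

lemma sols_FNot: "sols U (FNot \<phi>, cs) = carrier U - sols U (\<phi>, cs)"
  by (auto simp: sols_def holds_def)

text \<open>By minimality a formula or its negation holds at all but finitely many solutions, so
  these formulas form the generic type of the set of solutions.\<close>

lemma gen_complete:
  assumes k: "k \<ge> 1" and B: "B \<subseteq> carrier U" shows "gen k B \<in> complete_types U B"
  unfolding complete_types_def
proof (intro CollectI conjI allI impI ballI)
  show "gen k B \<subseteq> pfms B" by (auto simp: gen_def)
  fix F assume F: "F \<subseteq> gen k B" "finite F"
  then have "finite (\<Union>f\<in>F. sol k - sols U f)" by (intro finite_UN_I) (auto simp: gen_def)
  then obtain x where "x \<in> sol k" "x \<notin> (\<Union>f\<in>F. sol k - sols U f)" using sol_minus_finite by blast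
  then show "\<exists>x\<in>carrier U. \<forall>f\<in>F. x \<in> sols U f" using solD(1) by blast
next
  fix g assume g: "g \<in> pfms B"
  obtain \<phi> cs where pc: "g = (\<phi>, cs)" by (cases g)
  have gU: "g \<in> pfms (carrier U)" using g B by (auto simp: pfms_def)
  have "sol k - sols U (FNot \<phi>, cs) = sol k \<inter> sols U (\<phi>, cs)" unfolding sols_FNot using solD(1) by blast
  then show "case g of (\<phi>, cs) \<Rightarrow> (\<phi>, cs) \<in> gen k B \<or> (FNot \<phi>, cs) \<in> gen k B"
    using minimal[OF k gU] g unfolding pc by (auto simp: gen_def pfms_def)
qed

text \<open>If finitely many dividing formulas covered almost all solutions, one of them would hold
  at infinitely many and so, by minimality, at almost all. That is expressed by a counting formula
  and passes to all conjugates of the parameters; any \<open>n\<close> conjugates then share a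
  solution, which contradicts dividing.\<close>

lemma cofinite_not_forking:
  assumes k: "k \<ge> 1" and r: "\<And>f. f \<in> r \<Longrightarrow> finite (sol k - sols U f)"
  shows "\<not> forks_over U C r"
proof
  assume "forks_over U C r"
  then obtain F D where FD: "F \<subseteq> r" "finite F" "finite D" "\<forall>d\<in>D. d \<in> pfms (carrier U) \<and> divides_over U C d"
    "\<forall>x\<in>carrier U. (\<forall>f\<in>F. x \<in> sols U f) \<longrightarrow> (\<exists>d\<in>D. x \<in> sols U d)" unfolding forks_over_def by blast
  have "\<exists>d\<in>D. infinite (sol k \<inter> sols U d)"
  proof (rule ccontr)
    assume "\<not> (\<exists>d\<in>D. infinite (sol k \<inter> sols U d))"
    then have "finite ((\<Union>f\<in>F. sol k - sols U f) \<union> (\<Union>d\<in>D. sol k \<inter> sols U d))"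
      by (intro finite_UnI finite_UN_I FD(2,3)) (use FD(1) r in blast)+
    then obtain x where "x \<in> sol k" "x \<notin> (\<Union>f\<in>F. sol k - sols U f) \<union> (\<Union>d\<in>D. sol k \<inter> sols U d)"
      using sol_minus_finite by blast
    then have "x \<in> carrier U" "\<forall>f\<in>F. x \<in> sols U f" "\<not> (\<exists>d\<in>D. x \<in> sols U d)" using solD(1) by blast+
    then show False using FD(5) by blast
  qed
  then obtain d where d: "d \<in> D" "infinite (sol k \<inter> sols U d)" by blast
  have fin: "finite (sol k - sols U d)" using minimal[OF k] FD(4) d by blast
  obtain \<phi> cs where dp: "d = (\<phi>, cs)" by (cases d)
  obtain n :: nat and bs where nb: "\<forall>i::nat. set (bs i) \<subseteq> carrier U \<and> same_type U C (bs i) cs"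
    "\<forall>I. finite I \<and> card I = n \<longrightarrow> (\<Inter>i\<in>I. sols U (\<phi>, bs i)) = {}"
    using FD(4) d(1) unfolding divides_over_def dp by auto
  have s: "sol k - sols U (\<phi>, zs) = {x \<in> carrier U. holds U (FAnd (sol_fm p k) (FNot \<phi>)) (x # zs)}" for zs
    unfolding sols_sol_fm[of U p k zs, symmetric] by (auto simp: sols_def holds_lenv)
  have "finite (sol k - sols U (\<phi>, bs i))" for i
  proof -
    obtain m where m: "\<not> many U m (\<lambda>x. holds U (FAnd (sol_fm p k) (FNot \<phi>)) (x # cs))"
      using fin unfolding dp s many_finite by blast
    obtain \<chi> where \<chi>: "\<forall>(R :: 'u diff_ring) zs. holds R \<chi> zs \<longleftrightarrow> many R m (\<lambda>x. holds R (FAnd (sol_fm p k) (FNot \<phi>)) (x # zs))"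
      using many_holds[of m "FAnd (sol_fm p k) (FNot \<phi>)"] by blast
    have "holds U \<chi> (bs i @ []) \<longleftrightarrow> holds U \<chi> (cs @ [])" using nb(1) unfolding same_type_def by (metis empty_subsetI list.set(1))
    then have "\<not> many U m (\<lambda>x. holds U (FAnd (sol_fm p k) (FNot \<phi>)) (x # bs i))" using m \<chi> by simp
    then show ?thesis unfolding s many_finite by blast
  qed
  then have "finite (\<Union>i\<in>{..<n}. sol k - sols U (\<phi>, bs i))" by (intro finite_UN_I finite_lessThan)
  then obtain x where "x \<in> sol k" "x \<notin> (\<Union>i\<in>{..<n}. sol k - sols U (\<phi>, bs i))" using sol_minus_finite by blast
  then have "x \<in> (\<Inter>i\<in>{..<n}. sols U (\<phi>, bs i))" by blast
  then show False using nb(2)[rule_format, of "{..<n}"] by simp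
qed

lemma sols_point: "d \<in> carrier U \<Longrightarrow> sols U (FEq (tm.Var 0) (tm.Var 1), [d]) = {d}"
  by (auto simp: sols_def holds_lenv lenv_def)

text \<open>Infinitely many solutions have the same type as \<open>d\<close> over the prime field,
  and the formulas naming two different ones exclude each other.\<close>

lemma point_divides:
  assumes k: "k \<ge> 1" and d: "d \<in> sol k"
  shows "divides_over U PF (FEq (tm.Var 0) (tm.Var 1), [d])"
proof -
  obtain b :: "nat \<Rightarrow> 'u" where b: "inj b" "range b \<subseteq> sol k" using infinite_countable_subset[OF infinite_sol] by blast
  have bs: "b i \<in> sol k" for i using b(2) by blast
  have "same_type U PF [b i] [d]" for i by (rule disintegrated_type[OF k]) (use bs d in auto)
  moreover have "(\<Inter>i\<in>I. sols U (FEq (tm.Var 0) (tm.Var 1), [b i])) = {}" if I: "finite I" "card I = 2" for I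
  proof -
    obtain i j where ij: "i \<in> I" "j \<in> I" "i \<noteq> j" using I(2) by (auto simp: card_2_iff)
    then have "b i \<noteq> b j" using b(1) by (auto dest: injD)
    then show ?thesis using ij sols_point[OF solD(1)[OF bs]] by blast
  qed
  ultimately show ?thesis unfolding divides_over_def
    by (intro exI[of _ 2] exI[of _ "\<lambda>i. [b i]"]) (use solD(1)[OF bs] in auto)
qed

text \<open>A formula true at only finitely many solutions is covered, on the set of solutions, by
  finitely many point formulas, and these divide. A nonforking extension therefore contains only
  formulas true at almost all solutions, and completeness makes it the generic type. Stationarity is
  immediate from this.\<close>

lemma nonforking_iff:
  assumes k: "k \<ge> 1" and B: "PF \<subseteq> B" "B \<subseteq> carrier U"
  shows "nonforking_extension U PF (gen k PF) B r \<longleftrightarrow> r = gen k B"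
proof
  assume "r = gen k B"
  moreover have "\<not> forks_over U PF (gen k B)" by (rule cofinite_not_forking[OF k]) (simp add: gen_def)
  moreover have "gen k PF \<subseteq> gen k B" using B(1) by (auto simp: gen_def pfms_def)
  ultimately show "nonforking_extension U PF (gen k PF) B r"
    using gen_complete[OF k B(2)] by (simp add: nonforking_extension_def)
next
  assume "nonforking_extension U PF (gen k PF) B r"
  then have r: "r \<in> complete_types U B" "gen k PF \<subseteq> r" "\<not> forks_over U PF r" by (auto simp: nonforking_extension_def)
  have rB: "r \<subseteq> pfms B" and rc: "\<And>\<phi> cs. (\<phi>, cs) \<in> pfms B \<Longrightarrow> (\<phi>, cs) \<in> r \<or> (FNot \<phi>, cs) \<in> r"
    using r(1) unfolding complete_types_def by auto
  have sub: "r \<subseteq> gen k B"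
  proof
    fix f assume f: "f \<in> r"
    have fB: "f \<in> pfms B" using f rB by blast
    then have fU: "f \<in> pfms (carrier U)" using B(2) by (auto simp: pfms_def)
    have "finite (sol k - sols U f)"
    proof (rule ccontr)
      assume "infinite (sol k - sols U f)"
      then have fin: "finite (sol k \<inter> sols U f)" using minimal[OF k fU] by blast
      define D where "D = (\<lambda>d. (FEq (tm.Var 0) (tm.Var 1), [d])) ` (sol k \<inter> sols U f)"
      have "(sol_fm p k, []) \<in> gen k PF" unfolding gen_def by (simp add: sols_sol_fm pfms_def)
      then have F: "{f, (sol_fm p k, [])} \<subseteq> r" "finite {f, (sol_fm p k, [])}" using r(2) f by auto
      have D: "finite D" "\<forall>d\<in>D. d \<in> pfms (carrier U) \<and> divides_over U PF d"
        unfolding D_def using fin point_divides[OF k] solD(1) by (auto simp: pfms_def)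
      have "\<forall>x\<in>carrier U. (\<forall>g\<in>{f, (sol_fm p k, [])}. x \<in> sols U g) \<longrightarrow> (\<exists>d\<in>D. x \<in> sols U d)"
        unfolding D_def using sols_point by (auto simp: sols_sol_fm)
      then have "forks_over U PF r" unfolding forks_over_def using F D by blast
      then show False using r(3) by contradiction
    qed
    then show "f \<in> gen k B" using fB by (simp add: gen_def)
  qed
  have "gen k B \<subseteq> r"
  proof
    fix f assume f: "f \<in> gen k B"
    obtain \<phi> cs where pc: "f = (\<phi>, cs)" by (cases f)
    show "f \<in> r"
    proof (rule ccontr)
      assume "f \<notin> r"
      then have "(FNot \<phi>, cs) \<in> gen k B" using rc[of \<phi> cs] f sub unfolding pc by (auto simp: gen_def)
      then have "finite ((sol k - sols U (FNot \<phi>, cs)) \<union> (sol k - sols U (\<phi>, cs)))" using f by (simp add: gen_def pc)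
      then obtain x where "x \<in> sol k" "x \<notin> (sol k - sols U (FNot \<phi>, cs)) \<union> (sol k - sols U (\<phi>, cs))" using sol_minus_finite by blast
      then show False unfolding sols_FNot by blast
    qed
  qed
  then show "r = gen k B" using sub by blast
qed

lemma PF_carrier: "PF \<subseteq> carrier U" using prime_const cstD(1) by blast

text \<open>All solutions have the same type over the prime field, so a formula over it that holds
  at one solution holds at all of them.\<close>

lemma gen_isolated: "k \<ge> 1 \<Longrightarrow> isolates_type U PF (sol k) (gen k PF)"
  unfolding isolates_type_def
proof (intro conjI ballI gen_complete PF_carrier)
  assume k: "k \<ge> 1"
  show "\<exists>f\<in>gen k PF. sol k = sols U f"
    by (intro bexI[of _ "(sol_fm p k, [])"]) (simp_all add: gen_def sols_sol_fm pfms_def)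
  fix f assume f: "f \<in> gen k PF"
  then have fin: "finite (sol k - sols U f)" and fP: "set (snd f) \<subseteq> PF" by (auto simp: gen_def pfms_def)
  obtain b where b: "b \<in> sol k" "b \<in> sols U f" using sol_minus_finite[OF fin] by blast
  show "sol k \<subseteq> sols U f"
  proof
    fix a assume a: "a \<in> sol k"
    have "same_type U PF [a] [b]" by (rule disintegrated_type[OF k]) (use a b in auto)
    then have "holds U (fst f) ([a] @ snd f) \<longleftrightarrow> holds U (fst f) ([b] @ snd f)" using fP unfolding same_type_def by blast
    then show "a \<in> sols U f" using b(2) solD(1)[OF a] by (simp add: sols_def)
  qed
qed

lemma gen_stationary: "k \<ge> 1 \<Longrightarrow> stationary \<kappa> U PF (gen k PF)"
  unfolding stationary_def using nonforking_iff by auto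

section \<open>Orthogonality of the generic types\<close>

lemma gen_realization:
  assumes k: "k \<ge> 1" and C: "PF \<subseteq> C" "C \<subseteq> carrier U" and a: "tp U C a = gen k C"
  shows "a \<in> sol k" "a \<notin> acl U C"
proof -
  have "(sol_fm p k, []) \<in> gen k C" by (simp add: gen_def sols_sol_fm pfms_def)
  then show "a \<in> sol k" unfolding a[symmetric] by (simp add: tp_def sols_sol_fm)
  show "a \<notin> acl U C"
  proof
    assume "a \<in> acl U C"
    then obtain f where f: "f \<in> pfms C" "finite (sols U f)" "a \<in> sols U f" unfolding acl_def definable_over_def by blast
    then have "f \<in> gen k C" unfolding a[symmetric] by (simp add: tp_def)
    then have "finite ((sol k - sols U f) \<union> sols U f)" using f(2) by (simp add: gen_def)
    then show False using sol_minus_finite[of "(sol k - sols U f) \<union> sols U f" k] by blast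
  qed
qed

text \<open>As k < l, the p^k-th root of n b^(p^l) is still a p-th power, hence constant. So if a^(p^k) lies
  in S then a differs from an element of acl C by a constant, and a^(p^k+1) = a' lies in acl C.\<close>

lemma eigenvalue_not_combination:
  assumes kl: "k \<ge> 1" "k < l" and C: "C \<subseteq> carrier U" and a: "a \<in> sol k" "a \<notin> acl U C" and b: "b \<in> carrier U"
  shows "a [^] (p ^ k) \<notin> {s \<oplus> [n] \<cdot> (b [^] (p ^ l)) | s (n::nat). s \<in> acl U C}"
proof
  assume "a [^] (p ^ k) \<in> {s \<oplus> [n] \<cdot> (b [^] (p ^ l)) | s (n::nat). s \<in> acl U C}"
  then obtain s n where s: "s \<in> acl U C" "a [^] (p ^ k) = s \<oplus> [(n::nat)] \<cdot> (b [^] (p ^ l))" by blast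
  note A = dsubD[OF acl_dsub[OF C]] and aD = solD[OF a(1)]
  have sc: "s \<in> carrier U" by (rule A(2)[OF s(1)])
  define \<beta> where "\<beta> = b [^] (p ^ (l - k))"
  define e where "e = [n] \<cdot> \<one>"
  have eP: "e \<in> PF" unfolding e_def prime_field_elems by (rule rangeI)
  have ec: "e \<in> carrier U" "der U e = \<zero>" using prime_const[OF eP] cstD by auto
  have \<beta>c: "\<beta> \<in> carrier U" "der U \<beta> = \<zero>" using pow_const[OF b, of "l - k"] cstD kl unfolding \<beta>_def by auto
  define \<gamma> where "\<gamma> = e \<otimes> \<beta>"
  have \<gamma>c: "\<gamma> \<in> carrier U" "der U \<gamma> = \<zero>" using ec \<beta>c by (simp_all add: \<gamma>_def d_mult)
  have "\<beta> [^] (p ^ k) = b [^] (p ^ l)"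
    unfolding \<beta>_def using b kl by (simp add: nat_pow_pow power_add[symmetric])
  then have "\<gamma> [^] (p ^ k) = e \<otimes> b [^] (p ^ l)"
    unfolding \<gamma>_def using ec \<beta>c prime_frob_pow[OF eP] by (simp add: nat_pow_distrib)
  also have "\<dots> = [n] \<cdot> (b [^] (p ^ l))" using b by (simp add: e_def add_pow_ldistr)
  finally have \<gamma>: "\<gamma> [^] (p ^ k) = [n] \<cdot> (b [^] (p ^ l))" .
  define \<alpha> where "\<alpha> = a \<ominus> \<gamma>"
  have \<alpha>c: "\<alpha> \<in> carrier U" using aD(1) \<gamma>c(1) by (simp add: \<alpha>_def)
  have a\<alpha>: "a = \<alpha> \<oplus> \<gamma>" using aD(1) \<gamma>c(1) by (simp add: \<alpha>_def a_minus_def a_assoc l_neg)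
  have "\<alpha> [^] (p ^ k) \<oplus> \<gamma> [^] (p ^ k) = s \<oplus> \<gamma> [^] (p ^ k)"
    using s(2) frob_pow_add[OF \<alpha>c \<gamma>c(1), of k] unfolding a\<alpha>[symmetric] \<gamma> by simp
  then have "\<alpha> [^] (p ^ k) = s" using add.right_cancel[of "\<gamma> [^] (p ^ k)" "\<alpha> [^] (p ^ k)" s] \<alpha>c \<gamma>c(1) sc by simp
  then have \<alpha>A: "\<alpha> \<in> acl U C" using s(1) acl_root[OF \<alpha>c, of k C] by simp
  have "der U a = der U \<alpha>" unfolding arg_cong[OF a\<alpha>, of "der U"] using \<alpha>c \<gamma>c by (simp add: d_add)
  then have daA: "der U a \<in> acl U C" using A(10)[OF \<alpha>A] by simp
  define c where "c = a [^] (p ^ k)"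
  have c: "c \<in> carrier U" "der U c = \<zero>" using pow_const[OF aD(1) kl(1)] cstD unfolding c_def by auto
  have da: "der U a = c \<otimes> a" using aD(4) by (simp add: c_def)
  have dnz: "der U a \<noteq> \<zero>" unfolding da c_def using integral[of "a [^] (p ^ k)" a] nat_pow_nonzero[OF aD(1,2)] aD(1,2) by auto
  \<comment> \<open>As \<open>c\<close> is constant, differentiating
    \<open>der U a = c \<otimes> a\<close> once more exhibits \<open>c\<close> as a quotient of two
    elements of \<open>acl U C\<close>.\<close>
  have "der U (der U a) = c \<otimes> der U a" unfolding da using c aD(1) by (simp add: d_mult da)
  then have "der U (der U a) \<otimes> inv (der U a) = c \<otimes> (der U a \<otimes> inv (der U a))"
    using c inv_nonzero[OF d_closed[OF aD(1)] dnz] aD(1) by (simp add: m_assoc)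
  also have "\<dots> = c" using c inv_nonzero[OF d_closed[OF aD(1)] dnz] by simp
  finally have "c \<in> acl U C" using A(6)[OF A(10)[OF daA] A(9)[OF daA dnz]] by simp
  then show False using acl_root[OF aD(1)] a(2) unfolding c_def by blast
qed

text \<open>The field generated by \<open>b\<close> over \<open>acl U C\<close> is tame, and by
  \<open>eigenvalue_not_combination\<close> its monoid is avoided by the \<open>p^k\<close>-th power
  of every solution of the first equation outside \<open>acl U C\<close>. All these solutions thus
  have the same type over \<open>b\<close> and \<open>C\<close>. A formula in the type of
  \<open>a\<close> that failed at infinitely many solutions would fail at one of them, so the type
  of \<open>a\<close> consists of formulas true at almost all solutions and does not fork.\<close>

lemma gen_orthogonal:
  assumes kl: "k \<ge> 1" "k < l"
  shows "orthogonal_types \<kappa> U PF (gen k PF) (gen l PF)"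
  unfolding orthogonal_types_def
proof (intro allI impI, elim conjE)
  fix C a b
  assume C: "PF \<subseteq> C" "C \<subseteq> carrier U" "|C| <o \<kappa>" and ab: "a \<in> carrier U" "b \<in> carrier U"
    and "nonforking_extension U PF (gen k PF) C (tp U C a)" "nonforking_extension U PF (gen l PF) C (tp U C b)"
  have l: "l \<ge> 1" using kl by simp
  have "tp U C a = gen k C" "tp U C b = gen l C"
    using \<open>nonforking_extension U PF (gen k PF) C (tp U C a)\<close> \<open>nonforking_extension U PF (gen l PF) C (tp U C b)\<close>
    unfolding nonforking_iff[OF kl(1) C(1,2)] nonforking_iff[OF l C(1,2)] .
  then have a: "a \<in> sol k" "a \<notin> acl U C" and b: "b \<in> sol l" "b \<notin> acl U C"
    using gen_realization[OF kl(1) C(1,2)] gen_realization[OF l C(1,2)] by blast+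
  have bq: "b [^] (p ^ l) \<notin> acl U C" using acl_root[OF ab(2)] b(2) by blast
  note T = sol_ext(2)[OF acl_tame[OF C(2)] l b(1) bq]
  have bC: "insert b C \<subseteq> carrier U" using C(2) ab(2) by blast
  have R: "dring (PR (acl U C) b)"
    by (rule PR_dring[OF acl_dsub[OF C(2)] ab(2)]) (simp only: solD(3)[OF b(1)] PR_pow dsubD(4)[OF acl_dsub[OF C(2)]])
  show "independent_over U C a b" unfolding independent_over_def
  proof (rule cofinite_not_forking[OF kl(1)], rule ccontr)
    fix f assume f: "f \<in> tp U (insert b C) a" and inf: "infinite (sol k - sols U f)"
    have fC: "f \<in> pfms (insert b C)" and fa: "a \<in> sols U f" using f by (auto simp: tp_def)
    obtain a' where a': "a' \<in> sol k - sols U f" "a' \<notin> acl U (insert b C)"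
      using saturated_transcendental[OF saturated bC small_insert[OF saturated C(3)]
          definable_diff(1)[OF sol_definable pfms_definable[OF fC]] inf] by blast
    have a's: "a' \<in> sol k" "a' \<notin> acl U C" using a' acl_mono[of C "insert b C" U] by auto
    have "x \<in> Fr (PR (acl U C) b)" if "x \<in> set (snd f)" for x
      by (rule Fr_incl[OF R]) (use that fC acl_incl[OF C(2)] in \<open>auto simp: pfms_def intro: PR_var PR_K\<close>)
    then have "holds U (fst f) (a # snd f) \<longleftrightarrow> holds U (fst f) (a' # snd f)"
      by (intro tame_same_type[OF T kl(1) a(1) eigenvalue_not_combination[OF kl C(2) a ab(2)]
            a's(1) eigenvalue_not_combination[OF kl C(2) a's ab(2)]]) blast
    then show False using fa a'(1) solD(1)[OF a's(1)] by (simp add: sols_def)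
  qed
qed

lemma geometrically_trivial_sol:
  assumes k: "k \<ge> 1" shows "geometrically_trivial U PF (sol k)"
  unfolding geometrically_trivial_def
proof (intro conjI sol_definable allI impI)
  fix B assume B: "B \<subseteq> sol k" "B \<noteq> {}"
  have "acl U (PF \<union> {b}) \<inter> sol k = {b}" if "b \<in> B" for b using acl_trivial[OF k, of "{b}"] that B(1) by blast
  then show "acl U (PF \<union> B) \<inter> sol k = (\<Union>b\<in>B. acl U (PF \<union> {b}) \<inter> sol k)"
    unfolding acl_trivial[OF k B(1)] by simp
qed

lemma strictly_disintegrated_sol: "k \<ge> 1 \<Longrightarrow> strictly_disintegrated U PF (sol k)"
  unfolding strictly_disintegrated_def using sol_definable disintegrated_type by blast

lemma orthogonal_sol:
  assumes "k \<ge> 1" "k < l" shows "orthogonal_sets \<kappa> U PF (sol k) (sol l)"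
proof -
  have "l \<ge> 1" using assms by simp
  then show ?thesis unfolding orthogonal_sets_def
    using gen_isolated gen_stationary gen_orthogonal[OF assms] assms(1) by blast
qed

end

theorem theorem4p6:
  fixes p :: nat
    and DCF :: "fm set"
    and U :: "'u::infinite diff_ring"
    and \<kappa> :: "'k rel"
  assumes "prime p"
    and "model_companion DCF (differential_field p :: 'u diff_ring \<Rightarrow> bool)"
    and "is_model U DCF"
    and "sufficiently_saturated \<kappa> U"
  shows "(\<forall>k\<ge>1.
            strongly_minimal U (prime_subfield U) (nonzero_solutions p k U) \<and>
            strictly_disintegrated U (prime_subfield U) (nonzero_solutions p k U) \<and>
            geometrically_trivial U (prime_subfield U) (nonzero_solutions p k U)) \<and>
         (\<forall>k l. 1 \<le> k \<and> k < l \<longrightarrow>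
            orthogonal_sets \<kappa> U (prime_subfield U)
              (nonzero_solutions p k U) (nonzero_solutions p l U))"
proof -
  note M = assms(1-3)
  interpret dfield p U by (rule model_dfield[OF M])
  interpret saturated_dcf p U \<kappa>
    by unfold_locales (fact assms(4) model_root[OF M] model_infinite_solutions[OF M] model_elementary[OF M])+
  show ?thesis
    using strongly_minimal_sol strictly_disintegrated_sol geometrically_trivial_sol orthogonal_sol by blast
qed

end
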